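(* Let $\mathcal{Q}\in\{\mathbb{E}^2,\mathbb{S}^2,\mathbb{H}^2\}$ and let $f\in\mathcal{C}_{\mathcal{Q}}$. Then $f$ is $2$-invariant if and only if it is a discrete elastic curve in $\mathcal{Q}$. Moreover, $f$ is $3$-invariant if and only if it is a discrete constrained elastic curve in $\mathcal{Q}$.
   Context: **Matrices and models.** Let $\sigma_0=\begin{pmatrix}1&0\\0&1\end{pmatrix}$, $\sigma_1=\begin{pmatrix}0&1\\1&0\end{pmatrix}$, $\sigma_2=\begin{pmatrix}0&-i\\i&0\end{pmatrix}$, $\sigma_3=\begin{pmatrix}1&0\\0&-1\end{pmatrix}$ and $\mathbf 1=\sigma_0$, $\mathbf i=-i\sigma_1$, $\mathbf j=-i\sigma_2$, $\mathbf k=-i\sigma_3$. Quaternions are the elements of $\mathrm{span}_{\mathbb R}\{\mathbf 1,\mathbf i,\mathbf j,\mathbf k\}$; split-quaternions are the elements of $\mathrm{span}_{\mathbb R}\{\mathbf 1,\sigma_1,\sigma_2,\mathbf k\}$. For $F\in\mathbb C^{2\times2}$, $F^*$ is the adjugate matrix, $\langle F,G\rangle=\frac12\mathrm{tr}(FG^* )$, and $\vec M=\overrightarrow{M}=M-\frac12\mathrm{tr}(M)\mathbf 1$ is the trace-free part (applied coefficientwise to polynomials). Models: $\mathbb E^2=\mathrm{span}_{\mathbb R}\{\mathbf i,\mathbf j\}$, $\mathbb S^2=\{F\in\mathrm{span}_{\mathbb R}\{\mathbf i,\mathbf j,\mathbf k\}:\det F=1\}$, $\mathbb H^2=\{F\in\mathrm{span}_{\mathbb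 R}\{\sigma_1,\sigma_2,\mathbf k\}:\det F=1\}$ (a two-sheeted hyperboloid), with sectional curvature $\varepsilon=0,1,-1$ respectively. The distance of $F,G$ is $\sqrt{\langle G-F,G-F\rangle}$, $\arccos\langle F,G\rangle$, $\operatorname{arcosh}\langle F,G\rangle$ (same sheet), respectively. A point $f$ is represented by the matrix $F$; antipodal points in $\mathbb S^2,\mathbb H^2$ are $F,-F$. **Curves.** $\mathcal V=\mathbb Z$, edges join consecutive integers and are oriented in increasing direction. $f_{\bar1},f_0,f_1$ denote values at three consecutive vertices; subscripts $\bar10,01$ denote the edges between them; identities are understood at all vertices/edges. $\mathcal C_{\mathcal Q}$ is the set of $f:\mathcal V\to\mathcal Q$ with constant distance between consecutive points, any three consecutive points pairwise distinct, consecutive points not antipodal if $\mathcal Q=\mathbb S^2$, and all points on one sheet if $\mathcal Q=\mathbb H^2$; geodesic edges are oriented by the curve direction. Put $\eta>0$ with $\eta^2=\langle F_1-F_0,F_1-F_0\rangle$ for $\mathbb E^2$ and $\eta^2=2\varepsilon(1-\langle F_0,F_1\rangle)$ for $\mathbb S^2,\mathbb H^2$, and $\zeta=\eta\sqrt{1-\varepsilon\eta^2/4}$. Transport matrix: $u_{01}=F_1-F_0$ for $\mathbb E^2$, $u_{01}=F_1F_0^{-1}$ for $\mathbb S^2,\mathbb H^2$. Geodesic edges: $N_{01}=\frac1\eta\mathbf k u_{01}$ for $\mathbb E^2$, $N_{01}=\frac1\zeta\vec u_{01}$ for $\mathbb S^2,\mathbb H^2$. The geodesic curvature $\kappa_0$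 at $f_0$ is twice the geodesic curvature of the circle tangent to the two adjacent oriented geodesic edges at $f_{\bar1}$ and $f_1$; explicitly $\kappa_0=\dfrac{4\langle N_{\bar10},F_1-F_0\rangle}{\langle F_1-F_{\bar1},F_1-F_{\bar1}\rangle}$. **Elastic curves.** $f\in\mathcal C_{\mathcal Q}$ is constrained elastic if there are constants $\xi,\delta\in\mathbb R$ with $\kappa_{\bar1}+\kappa_1=\dfrac{\xi\kappa_0+\delta}{1+\frac{\zeta^2}{4}\kappa_0^2}$ at every vertex. It is elastic if $\delta=0$ and area-constrained elastic otherwise; by convention discrete circles (curves with constant non-vanishing curvature, for which $\xi,\delta$ are not unique) are counted as area-constrained elastic and not as elastic. **Bäcklund transformations.** A quad $(a,b,c,d)$ of points with $a\ne c$, $b\ne d$ (and neighbouring points not antipodal for $\mathbb S^2,\mathbb H^2$) is a $\mathcal Q$-Darboux butterfly if a reflection of $\mathcal Q$ in a geodesic interchanges $a\leftrightarrow c$ and $b\leftrightarrow d$. For $\mathbb S^2,\mathbb H^2$ reflections are the maps $F\mapsto -NFN^{-1}$ with $N$ trace-free, in the imaginary quaternions resp. trace-free split-quaternions, $\det N\neq0$ (in $\mathbb H^2$ those with $\det N>0$ interchange the sheets). Curves $f,\tilde f\in\mathcal C_{\mathcal Q}$ are related by a Bäcklund transformation if all quads $(f_0,f_1,\tilde f_1,\tilde f_0)$ are $\mathcal Q$-Darboux butterflies ($\tilde f=f$, the identity transformation, is allowed). For a sequence $f^{(0)},\dots,f^{(n)}$ put $v^{(i)}_0=F^{(i+1)}_0-F^{(i)}_0$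 ($\mathbb E^2$), $v^{(i)}_0=F^{(i+1)}_0(F^{(i)}_0)^{-1}$ ($\mathbb S^2,\mathbb H^2$). It is a sequence of Bäcklund transformations if consecutive curves are related by a Bäcklund transformation. **$n$-invariance.** $f\in\mathcal C_{\mathcal Q}$ is $n$-invariant if there is a regular sequence of $n$ Bäcklund transformations $f=f^{(0)},\dots,f^{(n)}=\tilde f$ such that $\tilde f$ is the image of $f$ under an isometry of $\mathcal Q$ which is orientation preserving if $n$ is odd and orientation reversing if $n$ is even. The isometry acts on the transport matrices of $f$ by $\tilde u_{01}=E^{-1}u_{01}E$, where: for $\mathbb E^2$, $0\neq E\in\mathrm{span}_{\mathbb R}\{\mathbf 1,\mathbf k\}$ (orientation preserving) or $0\ne E\in\mathrm{span}_{\mathbb R}\{\mathbf i,\mathbf j\}$ (orientation reversing); for $\mathbb S^2$ (resp. $\mathbb H^2$) $E$ is an invertible quaternion (resp. split-quaternion) with $\tilde F=E^{-1}FE$ (orientation preserving) or $\tilde F=-E^{-1}FE$ (orientation reversing). The sequence is regular if the polynomial $\mathcal P_0(\lambda)=E(\mathbf 1+\lambda v_0^{(n-1)})\cdots(\mathbf 1+\lambda v_0^{(0)})$ satisfies $\overrightarrow{\mathcal P}\ne0$. *)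

theory Defs
  imports "HOL-Analysis.Analysis"
begin

type_synonym cmat = "complex^2^2"

definition sigma1 :: cmat where
  "sigma1 = vector [vector [0, 1], vector [1, 0]]"

definition sigma2 :: cmat where
  "sigma2 = vector [vector [0, - \<i>], vector [\<i>, 0]]"

definition sigma3 :: cmat where
  "sigma3 = vector [vector [1, 0], vector [0, -1]]"

definition q1 :: cmat where "q1 = mat 1"
definition qi :: cmat where "qi = mat (- \<i>) ** sigma1"
definition qj :: cmat where "qj = mat (- \<i>) ** sigma2"
definition qk :: cmat where "qk = mat (- \<i>) ** sigma3"

(* "span" below is the library's real linear span. *)
definition quaternions :: "cmat set" where
  "quaternions = span {q1, qi, qj, qk}"

definition split_quaternions :: "cmat set" where
  "split_quaternions = span {q1, sigma1, sigma2, qk}"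

definition adjugate :: "cmat \<Rightarrow> cmat" where
  "adjugate F = vector [vector [F$2$2, - F$1$2], vector [- F$2$1, F$1$1]]"

definition mdot :: "cmat \<Rightarrow> cmat \<Rightarrow> complex" where
  "mdot F G = trace (F ** adjugate G) / 2"

(* On pairs of quaternions and on pairs of split-quaternions mdot takes real values. *)
definition rdot :: "cmat \<Rightarrow> cmat \<Rightarrow> real" where
  "rdot F G = Re (mdot F G)"

definition trace_free :: "cmat \<Rightarrow> cmat" where
  "trace_free M = M - mat (trace M / 2)"


datatype model = E2 | S2 | H2

fun points :: "model \<Rightarrow> cmat set" where
  "points E2 = span {qi, qj}"
| "points S2 = {F \<in> span {qi, qj, qk}. det F = 1}"
| "points H2 = {F \<in> span {sigma1, sigma2, qk}. det F = 1}"

fun curv :: "model \<Rightarrow> real" where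
  "curv E2 = 0"
| "curv S2 = 1"
| "curv H2 = -1"

fun mdist :: "model \<Rightarrow> cmat \<Rightarrow> cmat \<Rightarrow> real" where
  "mdist E2 F G = sqrt (rdot (G - F) (G - F))"
| "mdist S2 F G = arccos (rdot F G)"
| "mdist H2 F G = arcosh (rdot F G)"

(* A point a sigma1 + b sigma2 + c k of H2 satisfies c^2 = 1 + a^2 + b^2, and
   c = rdot F qk; the sign of c distinguishes the two sheets. *)
definition same_sheet :: "cmat \<Rightarrow> cmat \<Rightarrow> bool" where
  "same_sheet F G \<longleftrightarrow> sgn (rdot F qk) = sgn (rdot G qk)"


definition curves :: "model \<Rightarrow> (int \<Rightarrow> cmat) set" where
  "curves Q = {f. (\<forall>k. f k \<in> points Q)
     \<and> (\<exists>d. \<forall>k. mdist Q (f k) (f (k + 1)) = d)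
     \<and> (\<forall>k. distinct [f (k - 1), f k, f (k + 1)])
     \<and> (Q = S2 \<longrightarrow> (\<forall>k. f (k + 1) \<noteq> - f k))
     \<and> (Q = H2 \<longrightarrow> (\<forall>k l. same_sheet (f k) (f l)))}"

(* For a curve in "curves Q" the choice of the edge from 0 to 1 is immaterial. *)
definition eta :: "model \<Rightarrow> (int \<Rightarrow> cmat) \<Rightarrow> real" where
  "eta Q f = (if Q = E2 then sqrt (rdot (f 1 - f 0) (f 1 - f 0))
              else sqrt (2 * curv Q * (1 - rdot (f 0) (f 1))))"

definition zeta :: "model \<Rightarrow> (int \<Rightarrow> cmat) \<Rightarrow> real" where
  "zeta Q f = eta Q f * sqrt (1 - curv Q * (eta Q f)\<^sup>2 / 4)"

definition transport :: "model \<Rightarrow> cmat \<Rightarrow> cmat \<Rightarrow> cmat" where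
  "transport Q F G = (if Q = E2 then G - F else G ** matrix_inv F)"

(* The geodesic through the edge from k to k + 1. *)
definition edge_normal :: "model \<Rightarrow> (int \<Rightarrow> cmat) \<Rightarrow> int \<Rightarrow> cmat" where
  "edge_normal Q f k =
     (let u = transport Q (f k) (f (k + 1))
      in if Q = E2 then (1 / eta Q f) *\<^sub>R (qk ** u) else (1 / zeta Q f) *\<^sub>R trace_free u)"

definition geodesic_curvature :: "model \<Rightarrow> (int \<Rightarrow> cmat) \<Rightarrow> int \<Rightarrow> real" where
  "geodesic_curvature Q f k =
     4 * rdot (edge_normal Q f (k - 1)) (f (k + 1) - f k)
       / rdot (f (k + 1) - f (k - 1)) (f (k + 1) - f (k - 1))"


definition elastic_equation :: "model \<Rightarrow> (int \<Rightarrow> cmat) \<Rightarrow> real \<Rightarrow> real \<Rightarrow> bool" where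
  "elastic_equation Q f \<xi> \<delta> \<longleftrightarrow>
     (\<forall>k. geodesic_curvature Q f (k - 1) + geodesic_curvature Q f (k + 1) =
          (\<xi> * geodesic_curvature Q f k + \<delta>)
            / (1 + (zeta Q f)\<^sup>2 / 4 * (geodesic_curvature Q f k)\<^sup>2))"

definition constrained_elastic :: "model \<Rightarrow> (int \<Rightarrow> cmat) \<Rightarrow> bool" where
  "constrained_elastic Q f \<longleftrightarrow> f \<in> curves Q \<and> (\<exists>\<xi> \<delta>. elastic_equation Q f \<xi> \<delta>)"

definition discrete_circle :: "model \<Rightarrow> (int \<Rightarrow> cmat) \<Rightarrow> bool" where
  "discrete_circle Q f \<longleftrightarrow>
     f \<in> curves Q \<and> (\<exists>c. c \<noteq> 0 \<and> (\<forall>k. geodesic_curvature Q f k = c))"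

(* A discrete circle solves the equation for many pairs (xi, delta), among them one with
   delta = 0; by convention it is not called elastic. *)
definition elastic :: "model \<Rightarrow> (int \<Rightarrow> cmat) \<Rightarrow> bool" where
  "elastic Q f \<longleftrightarrow>
     f \<in> curves Q \<and> (\<exists>\<xi>. elastic_equation Q f \<xi> 0) \<and> \<not> discrete_circle Q f"


(* Reflections in geodesics. For H2, the matrices N with det N > 0, whose maps interchange
   the two sheets, are included. *)
fun reflections :: "model \<Rightarrow> (cmat \<Rightarrow> cmat) set" where
  "reflections E2 =
     {\<lambda>F. F - (2 * rdot (F - P) N / rdot N N) *\<^sub>R N | P N.
        P \<in> span {qi, qj} \<and> N \<in> span {qi, qj} \<and> N \<noteq> 0}"
| "reflections S2 =
     {\<lambda>F. - (N ** F ** matrix_inv N) | N. N \<in> span {qi, qj, qk} \<and> det N \<noteq> 0}"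
| "reflections H2 =
     {\<lambda>F. - (N ** F ** matrix_inv N) | N. N \<in> span {sigma1, sigma2, qk} \<and> det N \<noteq> 0}"

definition butterfly :: "model \<Rightarrow> cmat \<Rightarrow> cmat \<Rightarrow> cmat \<Rightarrow> cmat \<Rightarrow> bool" where
  "butterfly Q a b c d \<longleftrightarrow>
     {a, b, c, d} \<subseteq> points Q \<and> a \<noteq> c \<and> b \<noteq> d
     \<and> (Q \<noteq> E2 \<longrightarrow> a \<noteq> - b \<and> b \<noteq> - c \<and> c \<noteq> - d \<and> d \<noteq> - a)
     \<and> (\<exists>\<rho> \<in> reflections Q. \<rho> a = c \<and> \<rho> c = a \<and> \<rho> b = d \<and> \<rho> d = b)"

definition baecklund :: "model \<Rightarrow> (int \<Rightarrow> cmat) \<Rightarrow> (int \<Rightarrow> cmat) \<Rightarrow> bool" where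
  "baecklund Q f g \<longleftrightarrow> f \<in> curves Q \<and> g \<in> curves Q
     \<and> (\<forall>k. butterfly Q (f k) (f (k + 1)) (g (k + 1)) (g k))"

definition baecklund_sequence :: "model \<Rightarrow> nat \<Rightarrow> (nat \<Rightarrow> int \<Rightarrow> cmat) \<Rightarrow> bool" where
  "baecklund_sequence Q n fs \<longleftrightarrow> (\<forall>i<n. baecklund Q (fs i) (fs (Suc i)))"


(* "represents Q pres E \<phi>": the matrix E induces the isometry \<phi> of Q, which is orientation
   preserving if pres holds and orientation reversing otherwise. For E2 the matrix E determines
   only the linear part of \<phi>, whence the translation T. *)
fun represents :: "model \<Rightarrow> bool \<Rightarrow> cmat \<Rightarrow> (cmat \<Rightarrow> cmat) \<Rightarrow> bool" where
  "represents E2 pres E \<phi> \<longleftrightarrow>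
     E \<noteq> 0 \<and> E \<in> (if pres then span {q1, qk} else span {qi, qj})
     \<and> (\<exists>T \<in> span {qi, qj}. \<phi> = (\<lambda>F. matrix_inv E ** F ** E + T))"
| "represents S2 pres E \<phi> \<longleftrightarrow>
     E \<in> quaternions \<and> invertible E
     \<and> \<phi> = (\<lambda>F. (if pres then 1 else -1) *\<^sub>R (matrix_inv E ** F ** E))"
| "represents H2 pres E \<phi> \<longleftrightarrow>
     E \<in> split_quaternions \<and> invertible E
     \<and> \<phi> = (\<lambda>F. (if pres then 1 else -1) *\<^sub>R (matrix_inv E ** F ** E))"

(* Polynomials in lambda with matrix coefficients, as matrices of polynomials. *)
type_synonym pmat = "complex poly^2^2"

definition linear_factor :: "cmat \<Rightarrow> pmat" where
  "linear_factor v = map_matrix (\<lambda>c. [:c:]) (mat 1) + map_matrix (\<lambda>c. [:0, c:]) v"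

fun transport_product :: "model \<Rightarrow> (nat \<Rightarrow> int \<Rightarrow> cmat) \<Rightarrow> nat \<Rightarrow> int \<Rightarrow> pmat" where
  "transport_product Q fs 0 k = mat 1"
| "transport_product Q fs (Suc i) k =
     linear_factor (transport Q (fs i k) (fs (Suc i) k)) ** transport_product Q fs i k"

definition monodromy :: "model \<Rightarrow> cmat \<Rightarrow> nat \<Rightarrow> (nat \<Rightarrow> int \<Rightarrow> cmat) \<Rightarrow> int \<Rightarrow> pmat" where
  "monodromy Q E n fs k = map_matrix (\<lambda>c. [:c:]) E ** transport_product Q fs n k"

definition regular :: "model \<Rightarrow> cmat \<Rightarrow> nat \<Rightarrow> (nat \<Rightarrow> int \<Rightarrow> cmat) \<Rightarrow> bool" where
  "regular Q E n fs \<longleftrightarrow>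
     (\<forall>k. \<exists>d. trace_free (map_matrix (\<lambda>p. coeff p d) (monodromy Q E n fs k)) \<noteq> 0)"

definition n_invariant :: "model \<Rightarrow> nat \<Rightarrow> (int \<Rightarrow> cmat) \<Rightarrow> bool" where
  "n_invariant Q n f \<longleftrightarrow> f \<in> curves Q
     \<and> (\<exists>fs E \<phi>. fs 0 = f \<and> baecklund_sequence Q n fs
          \<and> represents Q (odd n) E \<phi> \<and> (\<forall>k. fs n k = \<phi> (f k))
          \<and> regular Q E n fs)"

end

theory Submission
  imports Defs
begin

text \<open>Each butterfly is an exchange relation
  \<open>(1 + \<lambda> v') (1 + \<lambda> u) = (1 + \<lambda> u') (1 + \<lambda> v)\<close> between transport matrices, so an invariant sequence makes the polynomial
  \<open>P = E (1 + \<lambda> v\<^sub>n\<^sub>-\<^sub>1) \<dots> (1 + \<lambda> v\<^sub>0)\<close> transform along the curve by conjugation with \<open>1 + \<lambda> u\<close>. Comparing coefficients gives a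
  linear difference system whose conserved quantities force an elastic equation on the curvature; regularity
  excludes the zero solution.

  Conversely, an elastic equation provides a solution of this system, that is, the trace-free part of some \<open>P\<close>.
  The traces of the coefficients are still free up to constants. When one of them is large, the determinant of \<open>P\<close> has
  sufficiently many real roots, and splitting off the corresponding linear factors one by one produces the sequence of
  Baecklund transformations.\<close>

section \<open>Quaternions and split-quaternions\<close>

text \<open>A factor \<open>1 + \<lambda> v\<close> has determinant
  \<open>1 + 2 x \<lambda> + \<lambda>^2\<close> on the sphere and the hyperbolic plane and
  \<open>1 + d \<lambda>^2\<close> in the Euclidean plane, where \<open>x\<close> or
  \<open>d\<close> measures the distance of corresponding points. A splitting therefore needs a
  determinant with real roots of this kind, and some values are forbidden: the edge length of the
  curve itself, for which opposite vertices of a butterfly coincide, and \<open>x = -1\<close>, for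
  which corresponding points are antipodal. For n = 2 the second condition amounts to
  \<open>P(1)\<close> being invertible. On a discrete circle \<open>P(1)\<close> vanishes, and this
  is why circles do not count as elastic. Geodesics solve the equation for every \<xi>, and only
  \<xi> = 2 leads to \<open>P(1) = 0\<close>, so another value can be taken. On the hyperbolic plane
  the determinant form is indefinite. Every division there rests on the definiteness of tangent
  planes or on an explicit positive expression. The Euclidean plane needs its own computation
  because its transport matrices are differences, not quotients. The coefficients of
  \<open>P\<close> are alternately diagonal and antidiagonal there, so each is a single complex
  number.\<close>

text \<open>The value of \<open>eps\<close> is the curvature: \<open>1\<close> yields the quaternions and \<open>-1\<close> the split-quaternions. The element \<open>GQ z w\<close>
  stands for the matrix with rows \<open>(z, w)\<close> and \<open>(- eps * cnj w, cnj z)\<close>.\<close>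

class signature =
  fixes eps :: "'a itself \<Rightarrow> real"
  assumes eps_cases: "eps x = 1 \<or> eps x = -1"

datatype plus = Plus
datatype minus = Minus

instantiation plus :: signature
begin
definition "eps_plus (x :: plus itself) = (1::real)"
instance by standard (simp add: eps_plus_def)
end

instantiation minus :: signature
begin
definition "eps_minus (x :: minus itself) = (-1::real)"
instance by standard (simp add: eps_minus_def)
end

text \<open>The phantom parameter carries the signature on the level of types. Both algebras thereby
  become instances of \<open>real_algebra_1\<close>, and one calculation serves sphere and
  hyperboloid.\<close>

datatype 's gq = GQ (gq1: complex) (gq2: complex)

abbreviation ep :: "'s::signature gq \<Rightarrow> complex" where
  "ep x \<equiv> of_real (eps TYPE('s))"

instantiation gq :: (signature) real_algebra_1
begin
definition "0 = GQ 0 0"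
definition "1 = GQ 1 0"
definition "x + y = GQ (gq1 x + gq1 y) (gq2 x + gq2 y)"
definition "x - y = GQ (gq1 x - gq1 y) (gq2 x - gq2 y)"
definition "- x = GQ (- gq1 x) (- gq2 x)"
definition "r *\<^sub>R x = GQ (r *\<^sub>R gq1 x) (r *\<^sub>R gq2 x)"
definition "x * y = GQ (gq1 x * gq1 y - ep x * gq2 x * cnj (gq2 y)) (gq1 x * gq2 y + gq2 x * cnj (gq1 y))"
instance
  by standard (auto simp: zero_gq_def one_gq_def plus_gq_def minus_gq_def uminus_gq_def scaleR_gq_def
     times_gq_def algebra_simps scaleR_conv_of_real)
end

lemma gq_sel [simp]:
  "gq1 0 = 0" "gq2 0 = 0" "gq1 1 = 1" "gq2 1 = 0"
  "gq1 (x + y) = gq1 x + gq1 y" "gq2 (x + y) = gq2 x + gq2 y"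
  "gq1 (x - y) = gq1 x - gq1 y" "gq2 (x - y) = gq2 x - gq2 y"
  "gq1 (- x) = - gq1 x" "gq2 (- x) = - gq2 x"
  "gq1 (r *\<^sub>R x) = of_real r * gq1 x" "gq2 (r *\<^sub>R x) = of_real r * gq2 x"
  "gq1 (x * y) = gq1 x * gq1 y - ep x * gq2 x * cnj (gq2 y)"
  "gq2 (x * y) = gq1 x * gq2 y + gq2 x * cnj (gq1 y)"
  for x y :: "'s::signature gq"
  by (simp_all add: zero_gq_def one_gq_def plus_gq_def minus_gq_def uminus_gq_def scaleR_gq_def times_gq_def scaleR_conv_of_real)

section \<open>Real part, conjugation and the determinant form\<close>

definition sc :: "'s::signature gq \<Rightarrow> real" where
  "sc x = Re (gq1 x)"
definition star :: "'s::signature gq \<Rightarrow> 's gq" where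
  "star x = GQ (cnj (gq1 x)) (- gq2 x)"
definition dot :: "'s::signature gq \<Rightarrow> 's gq \<Rightarrow> real" where
  "dot x y = sc (x * star y)"
abbreviation nrm :: "'s::signature gq \<Rightarrow> real" where
  "nrm x \<equiv> dot x x"

lemma star_sel [simp]: "gq1 (star x) = cnj (gq1 x)" "gq2 (star x) = - gq2 x"
  by (simp_all add: star_def)

lemma gq_eqI: "gq1 x = gq1 y \<Longrightarrow> gq2 x = gq2 y \<Longrightarrow> x = y"
  by (simp add: gq.expand)

lemma star_simps [simp]:
  "star (star x) = x" "star 0 = 0" "star 1 = 1" "star (x + y) = star x + star y"
  "star (x - y) = star x - star y" "star (- x) = - star x" "star (r *\<^sub>R x) = r *\<^sub>R star x"
  for x y :: "'s::signature gq"
  by (auto intro!: gq_eqI)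

lemma star_mult [simp]: "star (x * y) = star y * star (x::'s::signature gq)"
  by (auto intro!: gq_eqI simp: algebra_simps)

lemma sc_simps [simp]:
  "sc 0 = 0" "sc 1 = 1" "sc (x + y) = sc x + sc y" "sc (x - y) = sc x - sc y"
  "sc (- x) = - sc x" "sc (r *\<^sub>R x) = r * sc x" "sc (star x) = sc x"
  for x y :: "'s::signature gq"
  by (auto simp: sc_def)

lemma sc_commute: "sc (x * y) = sc (y * (x::'s::signature gq))"
  by (auto simp: sc_def algebra_simps)

lemma sc_cyclic: "sc (x * y * z) = sc (y * z * (x::'s::signature gq))"
  by (metis sc_commute mult.assoc)

lemma dot_commute: "dot x y = dot y (x::'s::signature gq)"
  by (auto simp: dot_def sc_def algebra_simps)

lemma dot_simps [simp]:
  "dot 0 y = 0" "dot y 0 = 0" "dot (x + y) z = dot x z + dot y z" "dot x (y + z) = dot x y + dot x z"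
  "dot (x - y) z = dot x z - dot y z" "dot x (y - z) = dot x y - dot x z"
  "dot (- x) y = - dot x y" "dot x (- y) = - dot x y"
  "dot (r *\<^sub>R x) y = r * dot x y" "dot x (r *\<^sub>R y) = r * dot x y"
  "dot 1 x = sc x" "dot x 1 = sc x" "dot (star x) (star y) = dot x y"
  for x y z :: "'s::signature gq"
  by (auto simp: dot_def sc_def algebra_simps)

lemma mult_star: "x * star x = nrm x *\<^sub>R 1" and star_mult_self: "star x * x = nrm x *\<^sub>R 1"
  for x :: "'s::signature gq"
  by (auto intro!: gq_eqI simp: dot_def sc_def complex_eq_iff algebra_simps)

lemma mult_star2 [simp]: "x * (star x * y) = nrm x *\<^sub>R y" and star_mult2 [simp]: "star x * (x * y) = nrm x *\<^sub>R y"
  for x :: "'s::signature gq"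
  by (simp_all add: mult.assoc[symmetric] mult_star star_mult_self)

lemma dot_mult_left: "dot (x * y) z = dot y (star x * z)"
  and dot_mult_right: "dot (x * y) z = dot x (z * star y)" for x y z :: "'s::signature gq"
  by (auto simp: dot_def mult.assoc sc_commute[of x])

lemma nrm_mult: "nrm (x * y) = nrm x * nrm (y::'s::signature gq)"
  by (simp add: dot_mult_left mult.assoc)

lemma dot_mult_mult [simp]: "dot (x * y) (x * z) = nrm x * dot y z" "dot (y * x) (z * x) = nrm x * dot y z"
  for x y z :: "'s::signature gq"
  by (simp add: dot_mult_left) (simp add: dot_mult_right mult.assoc mult_star)

lemma star_eq: "star x = (2 * sc x) *\<^sub>R 1 - x" for x :: "'s::signature gq"
  by (auto intro!: gq_eqI simp: sc_def complex_eq_iff)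

lemma star_vec: "sc x = 0 \<Longrightarrow> star x = - x" for x :: "'s::signature gq"
  by (simp add: star_eq)

lemma mult_anticommute: "sc x = 0 \<Longrightarrow> sc y = 0 \<Longrightarrow> x * y = - (y * x) - (2 * dot x y) *\<^sub>R 1"
  for x y :: "'s::signature gq"
  by (auto intro!: gq_eqI simp: sc_def dot_def complex_eq_iff algebra_simps)

lemma nrm_cancel_left: "nrm x \<noteq> 0 \<Longrightarrow> x * y = x * z \<Longrightarrow> y = z" for x y z :: "'s::signature gq"
  by (metis scaleR_cancel_left star_mult2)

lemma nrm_cancel_right: "nrm x \<noteq> 0 \<Longrightarrow> y * x = z * x \<Longrightarrow> y = z" for x y z :: "'s::signature gq"
  using nrm_cancel_left[of "star x" "star y" "star z"] by (metis star_mult star_simps(1) dot_simps(13))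

section \<open>Points and their tangent planes\<close>

definition pts :: "'s::signature gq set" where
  "pts = {x. sc x = 0 \<and> nrm x = 1}"

lemma pts_D: "x \<in> pts \<Longrightarrow> sc x = 0" "x \<in> pts \<Longrightarrow> nrm x = 1" "x \<in> pts \<Longrightarrow> star x = - x"
  "x \<in> pts \<Longrightarrow> x * x = - 1" "x \<in> pts \<Longrightarrow> x * (x * y) = - y" for x :: "'s::signature gq"
  using mult_star[of x] mult_star2[of x y]
  by (auto simp: pts_def star_vec neg_eq_iff_add_eq_0 eq_neg_iff_add_eq_0)

text \<open>The tangent plane at a point is definite in both signatures. For \<open>eps = -1\<close>
  this is the reversed Cauchy-Schwarz inequality at a timelike vector. It takes over the role of
  positivity: a nonzero tangent vector is invertible.\<close>

lemma plane_nrm: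
  fixes F X :: "'s::signature gq"
  assumes F: "F \<in> pts" and X: "sc X = 0" "dot X F = 0"
  shows "eps TYPE('s) * nrm X \<ge> 0" and "nrm X = 0 \<Longrightarrow> X = 0"
proof -
  define x w c f where "x = Im (gq1 X)" and "w = gq2 X" and "c = Im (gq1 F)" and "f = gq2 F"
  have nX: "nrm X = x\<^sup>2 + eps TYPE('s) * (cmod w)\<^sup>2"
    using X(1) by (simp add: dot_def sc_def x_def w_def cmod_power2) (simp add: power2_eq_square algebra_simps)
  have nF: "c\<^sup>2 + eps TYPE('s) * (cmod f)\<^sup>2 = 1"
    using F by (simp add: pts_def dot_def sc_def c_def f_def cmod_power2) (auto simp: power2_eq_square algebra_simps)
  have d: "x * c + eps TYPE('s) * Re (w * cnj f) = 0"
    using X F by (simp add: pts_def dot_def sc_def x_def w_def c_def f_def algebra_simps)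
  have X0: "X = 0" if "x = 0" "w = 0"
    using that X(1) by (auto intro!: gq_eqI simp: x_def w_def sc_def complex_eq_iff)
  have "eps TYPE('s) * nrm X \<ge> 0 \<and> (nrm X = 0 \<longrightarrow> X = 0)"
  proof (cases "eps TYPE('s) = 1")
    case True
    then show ?thesis
      using nX X0 by (simp add: sum_power2_ge_zero add_nonneg_eq_0_iff)
  next
    case False
    then have e: "eps TYPE('s) = -1"
      using eps_cases by blast
    have "\<bar>x * c\<bar> \<le> cmod w * cmod f"
      using d e abs_Re_le_cmod[of "w * cnj f"] by (simp add: norm_mult)
    then have "(x * c)\<^sup>2 \<le> (cmod w * cmod f)\<^sup>2"
      by (simp add: abs_le_square_iff[symmetric])
    moreover have "c\<^sup>2 = 1 + (cmod f)\<^sup>2"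
      using nF e by simp
    ultimately have le: "x\<^sup>2 * (1 + (cmod f)\<^sup>2) \<le> (cmod w)\<^sup>2 * (cmod f)\<^sup>2"
      by (simp only: power_mult_distrib)
    then have le2: "(cmod w)\<^sup>2 \<le> ((cmod w)\<^sup>2 - x\<^sup>2) * (1 + (cmod f)\<^sup>2)"
      by (simp add: algebra_simps)
    have "(cmod w)\<^sup>2 - x\<^sup>2 \<ge> 0"
    proof (rule ccontr)
      assume "\<not> (cmod w)\<^sup>2 - x\<^sup>2 \<ge> 0"
      then have "((cmod w)\<^sup>2 - x\<^sup>2) * (1 + (cmod f)\<^sup>2) < 0"
        by (simp add: mult_neg_pos add_pos_nonneg)
      with le2 show False
        by (smt (verit) zero_le_power2)
    qed
    moreover have "w = 0" if "(cmod w)\<^sup>2 - x\<^sup>2 = 0"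
    proof -
      have "(cmod w)\<^sup>2 \<le> 0"
        using le2 unfolding that by simp
      then show ?thesis
        by simp
    qed
    ultimately show ?thesis
      using nX e X0 by auto
  qed
  then show "eps TYPE('s) * nrm X \<ge> 0" and "nrm X = 0 \<Longrightarrow> X = 0"
    by auto
qed

text \<open>The component of \<open>G\<close> orthogonal to \<open>F\<close> has norm
  \<open>1 - (dot F G)^2\<close>, so the definiteness of the tangent plane applies to it.\<close>

lemma pts_dot:
  fixes F G :: "'s::signature gq"
  assumes "F \<in> pts" "G \<in> pts"
  shows "eps TYPE('s) * (1 - (dot F G)\<^sup>2) \<ge> 0" and "dot F G = 1 \<Longrightarrow> G = F" and "dot F G = -1 \<Longrightarrow> G = - F"
proof -
  define X where "X = G - dot F G *\<^sub>R F"
  have X: "sc X = 0" "dot X F = 0" "nrm X = 1 - (dot F G)\<^sup>2"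
    using assms by (simp_all add: X_def pts_def dot_commute[of G F] power2_eq_square)
  show "eps TYPE('s) * (1 - (dot F G)\<^sup>2) \<ge> 0"
    using plane_nrm(1)[OF assms(1) X(1,2)] X(3) by simp
  show "G = F" if "dot F G = 1"
    using plane_nrm(2)[OF assms(1) X(1,2)] X(3) that by (simp add: X_def)
  show "G = - F" if "dot F G = -1"
    using plane_nrm(2)[OF assms(1) X(1,2)] X(3) that unfolding X_def that by simp (metis minus_unique add.commute)
qed

text \<open>Being orthogonal to \<open>A\<close> and \<open>B\<close>, the vector \<open>Y\<close>
  anticommutes with both and so commutes with \<open>A * B\<close>. Orthogonality to
  \<open>A * B\<close> gives \<open>Y * (B * A) = A * B * Y\<close>. Hence \<open>Y\<close>
  annihilates the commutator, which is invertible; no positivity enters.\<close>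

lemma vec_basis:
  fixes Y A B :: "'s::signature gq"
  assumes "sc Y = 0" "sc A = 0" "sc B = 0" "dot Y A = 0" "dot Y B = 0" "dot Y (A * B) = 0"
    and n: "nrm (A * B - B * A) \<noteq> 0"
  shows "Y = 0"
proof -
  have c: "Y * A = - (A * Y)" "Y * B = - (B * Y)"
    using mult_anticommute[of Y A] mult_anticommute[of Y B] assms by auto
  have "star (Y * (B * A)) = - (Y * (B * A))"
    using assms(6) by (intro star_vec) (simp add: star_vec[OF assms(2)] star_vec[OF assms(3)] dot_def)
  moreover have "star (Y * (B * A)) = - (A * B * Y)"
    using assms by (simp add: star_vec)
  moreover have "A * B * Y = Y * (A * B)"
    by (simp add: mult.assoc[symmetric] c(1)) (simp add: mult.assoc c(2))
  ultimately have "Y * (A * B - B * A) = 0"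
    by (simp add: right_diff_distrib)
  then show ?thesis
    using nrm_cancel_right[OF n, of Y 0] by simp
qed

text \<open>The triple vector product in quaternionic form. It turns the commutator of
  \<open>a\<close> with a transport matrix into a combination of the two points.\<close>

lemma vec_commutator:
  fixes a A B :: "'s::signature gq"
  assumes "sc a = 0" "sc A = 0" "sc B = 0"
  shows "a * (A * B) - A * B * a = (2 * dot a B) *\<^sub>R A - (2 * dot a A) *\<^sub>R B"
proof -
  have "a * (A * B) = - (A * (a * B)) - (2 * dot a A) *\<^sub>R B"
    using mult_anticommute[OF assms(1,2)] by (simp add: mult.assoc[symmetric] left_diff_distrib)
  also have "a * B = - (B * a) - (2 * dot a B) *\<^sub>R 1"
    by (rule mult_anticommute[OF assms(1,3)])
  finally show ?thesis
    by (simp add: algebra_simps)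
qed

section \<open>Curves of constant edge length\<close>

text \<open>The bound \<open>c > -1\<close> excludes antipodal neighbours on the sphere and a change
  of sheet on the hyperboloid, where the absolute value of \<open>c\<close> is at least 1.\<close>

definition gcurve :: "real \<Rightarrow> (int \<Rightarrow> 's::signature gq) \<Rightarrow> bool" where
  "gcurve c F \<longleftrightarrow> (\<forall>k. F k \<in> pts) \<and> (\<forall>k. dot (F k) (F (k + 1)) = c) \<and> c > -1 \<and> c \<noteq> 1
     \<and> (\<forall>k. F (k + 1) \<noteq> F (k - 1))"

locale curve =
  fixes c :: real and F :: "int \<Rightarrow> 's::signature gq"
  assumes gcurve: "gcurve c F"
begin

lemma F [simp]: "F k \<in> pts" "sc (F k) = 0" "nrm (F k) = 1" "star (F k) = - F k"
  "F k * F k = - 1" "F k * (F k * x) = - x"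
  using gcurve pts_D(1-4)[of "F k"] pts_D(5)[of "F k" x] by (auto simp: gcurve_def)

lemma FF [simp]: "dot (F k) (F (k + 1)) = c" "dot (F (k + 1)) (F k) = c"
  "dot (F k) (F (k - 1)) = c" "dot (F (k - 1)) (F k) = c"
proof -
  show a: "dot (F k) (F (k + 1)) = c" for k
    using gcurve by (auto simp: gcurve_def)
  then show "dot (F (k + 1)) (F k) = c"
    by (simp add: dot_commute)
  show "dot (F (k - 1)) (F k) = c"
    using a[of "k - 1"] by simp
  then show "dot (F k) (F (k - 1)) = c"
    by (simp add: dot_commute)
qed

lemma c: "c > -1" "c \<noteq> 1" "1 + c \<noteq> 0" "1 - c \<noteq> 0" "1 - c\<^sup>2 \<noteq> 0" "eps TYPE('s) * (1 - c\<^sup>2) > 0"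
proof -
  show cc: "c > -1" "c \<noteq> 1"
    using gcurve by (auto simp: gcurve_def)
  then show "1 + c \<noteq> 0" "1 - c \<noteq> 0"
    by auto
  then have "(1 + c) * (1 - c) \<noteq> 0"
    by simp
  then show n: "1 - c\<^sup>2 \<noteq> 0"
    by (simp add: algebra_simps power2_eq_square)
  have "eps TYPE('s) \<noteq> 0"
    by (metis eps_cases one_neq_zero zero_neq_neg_one)
  then show "eps TYPE('s) * (1 - c\<^sup>2) > 0"
    using n pts_dot(1)[of "F 0" "F 1"] FF(1)[of 0] by (simp add: less_le)
qed

definition T :: "int \<Rightarrow> 's gq" where
  "T k = F (k + 1) - F (k - 1)"

text \<open>This is \<open>zeta / 2\<close> times the geodesic curvature. It is read off in the
  orthogonal frame \<open>F k\<close>, \<open>T k\<close>, \<open>F k * T k\<close> of a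
  vertex.\<close>

definition sg :: "int \<Rightarrow> real" where
  "sg k = dot (F (k + 1) + F (k - 1)) (F k * T k) / nrm (T k)"

lemma T [simp]: "sc (T k) = 0" "dot (F k) (T k) = 0" "dot (T k) (F k) = 0" "T k * F k = - (F k * T k)"
  "star (T k) = - T k"
  "sc (F k * T k) = 0" "dot (F k) (F k * T k) = 0" "dot (T k) (F k * T k) = 0" "nrm (F k * T k) = nrm (T k)"
  "dot (F k * T k) (F k) = 0" "dot (F k * T k) (T k) = 0"
proof -
  show a: "sc (T k) = 0" and b: "dot (F k) (T k) = 0"
    by (simp_all add: T_def)
  then show b': "dot (T k) (F k) = 0"
    by (simp add: dot_commute)
  show "star (T k) = - T k"
    by (rule star_vec[OF a])
  show "T k * F k = - (F k * T k)"
    using mult_anticommute[OF a, of "F k"] b' by simp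
  show e: "sc (F k * T k) = 0"
    using b \<open>star (T k) = - T k\<close> by (simp add: dot_def)
  show g: "dot (F k * T k) (F k) = 0"
    by (simp add: dot_mult_left a)
  then show "dot (F k) (F k * T k) = 0"
    by (simp add: dot_commute)
  show g': "dot (F k * T k) (T k) = 0"
    unfolding dot_mult_right mult_star by simp
  then show "dot (T k) (F k * T k) = 0"
    by (simp add: dot_commute)
  show "nrm (F k * T k) = nrm (T k)"
    by (simp add: nrm_mult)
qed

lemma nrm_T: "nrm (T k) \<noteq> 0"
  using plane_nrm(2)[of "F k" "T k"] gcurve by (auto simp: gcurve_def T_def[of k])

lemma vec_vertex_eqI:
  assumes "sc Y = 0" "sc Z = 0" "dot Y (F k) = dot Z (F k)" "dot Y (T k) = dot Z (T k)"
    "dot Y (F k * T k) = dot Z (F k * T k)"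
  shows "Y = Z"
proof -
  have "nrm (F k * T k - T k * F k) \<noteq> 0"
    using nrm_T[of k] by (simp add: algebra_simps)
  then have "Y - Z = 0"
    using assms by (intro vec_basis[of _ "F k" "T k"]) auto
  then show ?thesis
    by simp
qed

text \<open>A second frame, attached to an edge. Quantities known in the vertex frames of both
  endpoints are compared in it.\<close>

lemma vec_edge_eqI:
  assumes "sc Y = 0" "sc Z = 0" "dot Y (F k) = dot Z (F k)" "dot Y (F (k + 1)) = dot Z (F (k + 1))"
    "dot Y (F k * F (k + 1)) = dot Z (F k * F (k + 1))"
  shows "Y = Z"
proof -
  have "F (k + 1) * F k = - (F k * F (k + 1)) - (2 * c) *\<^sub>R 1"
    using mult_anticommute[of "F (k + 1)" "F k"] by simp
  moreover have "sc (F k * F (k + 1)) = - c"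
    using FF(1)[of k] by (simp add: dot_def del: FF)
  moreover have "nrm (F k * F (k + 1)) = 1"
    by (simp add: nrm_mult)
  moreover have "P - (- P - (2 * c) *\<^sub>R 1) = 2 *\<^sub>R (P + c *\<^sub>R 1)" for P :: "'s gq"
    by (simp add: algebra_simps scaleR_2)
  ultimately have "nrm (F k * F (k + 1) - F (k + 1) * F k) = nrm (2 *\<^sub>R (F k * F (k + 1) + c *\<^sub>R 1))"
    by simp
  also have "\<dots> = 4 * (1 - c\<^sup>2)"
    using \<open>sc (F k * F (k + 1)) = - c\<close> \<open>nrm (F k * F (k + 1)) = 1\<close>
    by (simp add: power2_eq_square right_diff_distrib)
  finally have "nrm (F k * F (k + 1) - F (k + 1) * F k) = 4 * (1 - c\<^sup>2)" .
  then have "Y - Z = 0"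
    using assms c by (intro vec_basis[of _ "F k" "F (k + 1)"]) auto
  then show ?thesis
    by simp
qed

lemma F_succ: "F (k + 1) = c *\<^sub>R F k + (1/2) *\<^sub>R T k + (sg k / 2) *\<^sub>R (F k * T k)"
  and F_pred: "F (k - 1) = c *\<^sub>R F k - (1/2) *\<^sub>R T k + (sg k / 2) *\<^sub>R (F k * T k)"
proof -
  have "F (k + 1) + F (k - 1) = (2 * c) *\<^sub>R F k + sg k *\<^sub>R (F k * T k)"
  proof (rule vec_vertex_eqI[of _ _ k])
    have "dot (F (k + 1) + F (k - 1)) (T k) = 0"
      by (simp add: T_def dot_commute[of "F (k - 1)" "F (k + 1)"])
    then show "dot (F (k + 1) + F (k - 1)) (T k) = dot ((2 * c) *\<^sub>R F k + sg k *\<^sub>R (F k * T k)) (T k)"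
      by simp
  qed (use nrm_T in \<open>auto simp: sg_def\<close>)
  moreover have "F (k + 1) - F (k - 1) = T k"
    by (simp add: T_def)
  moreover have "P = (1/2) *\<^sub>R ((P + Q) + (P - Q))" "Q = (1/2) *\<^sub>R ((P + Q) - (P - Q))" for P Q :: "'s gq"
    by (simp_all add: scaleR_2[symmetric])
  ultimately have "F (k + 1) = (1/2) *\<^sub>R ((2 * c) *\<^sub>R F k + sg k *\<^sub>R (F k * T k) + T k)"
    "F (k - 1) = (1/2) *\<^sub>R ((2 * c) *\<^sub>R F k + sg k *\<^sub>R (F k * T k) - T k)"
    by metis+
  then show "F (k + 1) = c *\<^sub>R F k + (1/2) *\<^sub>R T k + (sg k / 2) *\<^sub>R (F k * T k)"
    "F (k - 1) = c *\<^sub>R F k - (1/2) *\<^sub>R T k + (sg k / 2) *\<^sub>R (F k * T k)"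
    by (simp_all add: scaleR_add_right scaleR_diff_right)
qed

lemma dot_F:
  shows "dot Z (F (k + 1)) = c * dot Z (F k) + dot Z (T k) / 2 + sg k * dot Z (F k * T k) / 2"
    and "dot Z (F (k - 1)) = c * dot Z (F k) - dot Z (T k) / 2 + sg k * dot Z (F k * T k) / 2"
  by (subst F_succ F_pred, simp)+

text \<open>Up to its scalar part \<open>F k * F (k + 1)\<close> is the normal of the edge.
  Expanding it at either endpoint is what carries information from one vertex to the next.\<close>

lemma dot_edge:
  assumes "sc Z = 0"
  shows "dot Z (F k * F (k + 1)) = (dot Z (F k * T k) - sg k * dot Z (T k)) / 2"
    and "dot Z (F k * F (k + 1)) = (dot Z (F (k + 1) * T (k + 1)) + sg (k + 1) * dot Z (T (k + 1))) / 2"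
proof -
  have "F k * F (k + 1) = - (c *\<^sub>R 1) + (1/2) *\<^sub>R (F k * T k) - (sg k / 2) *\<^sub>R T k"
    by (subst F_succ) (simp add: algebra_simps)
  then show "dot Z (F k * F (k + 1)) = (dot Z (F k * T k) - sg k * dot Z (T k)) / 2"
    using assms by simp
  have "F (k + 1 - 1) * F (k + 1) = - (c *\<^sub>R 1) + (1/2) *\<^sub>R (F (k + 1) * T (k + 1)) + (sg (k + 1) / 2) *\<^sub>R T (k + 1)"
    by (subst F_pred) (simp add: algebra_simps)
  then show "dot Z (F k * F (k + 1)) = (dot Z (F (k + 1) * T (k + 1)) + sg (k + 1) * dot Z (T (k + 1))) / 2"
    using assms by simp
qed

text \<open>The norm of \<open>F_succ\<close>. The denominator of the elastic equation originates
  here.\<close>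

lemma nrm_T_sg: "nrm (T k) * (1 + (sg k)\<^sup>2) = 4 * (1 - c\<^sup>2)"
proof -
  have "1 = c\<^sup>2 + nrm (T k) * (1 + (sg k)\<^sup>2) / 4"
    using arg_cong[OF F_succ[of k], of "\<lambda>x. dot x x"] by (simp add: power2_eq_square field_simps)
  then show ?thesis
    by simp
qed

end

context curve
begin

lemma edge_commutator:
  assumes "sc a = 0"
  shows "a * (F (k + 1) * F k) - F (k + 1) * F k * a
    = (2 * dot a (F k)) *\<^sub>R F (k + 1) - (2 * dot a (F (k + 1))) *\<^sub>R F k"
  by (rule vec_commutator[OF assms]) simp_all

end

section \<open>Elastic equations from conserved quantities\<close>

text \<open>Here \<open>a\<close> is the trace-free part of \<open>E\<close>, and \<open>\<beta>\<close> is the trace-free part of the linear coefficient of \<open>P\<close> (plus \<open>a\<close> if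
  \<open>n = 3\<close>). The case \<open>l = 0\<close> is that of \<open>n = 2\<close>.\<close>

locale curve_data = curve c F for c :: real and F :: "int \<Rightarrow> 's::signature gq" +
  fixes a :: "'s gq" and \<beta> :: "int \<Rightarrow> 's gq" and l :: real
  assumes a: "sc a = 0" and sc_\<beta>: "sc (\<beta> k) = 0"
    and \<beta>_step: "\<beta> (k + 1) - \<beta> k = (2 * dot a (F k)) *\<^sub>R F (k + 1) - (2 * dot a (F (k + 1))) *\<^sub>R F k"
    and \<beta>_F: "dot (\<beta> k) (F k) = l"
begin

abbreviation h :: "int \<Rightarrow> real" where
  "h k \<equiv> dot a (F k)"

text \<open>The number \<open>2 * c\<close> is the trace of the transport matrix. With this
  coefficient \<open>X k\<close> has equal products with both neighbours of \<open>F k\<close>, so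
  it is orthogonal to the chord.\<close>

definition X :: "int \<Rightarrow> 's gq" where
  "X k = \<beta> k - (2 * c) *\<^sub>R a"

definition w :: "int \<Rightarrow> real" where
  "w k = dot (X k) (F k * T k)"

lemma dot_\<beta>_step: "dot (\<beta> (k + 1)) Z = dot (\<beta> k) Z + 2 * h k * dot (F (k + 1)) Z - 2 * h (k + 1) * dot (F k) Z"
  using arg_cong[OF \<beta>_step[of k], of "\<lambda>x. dot x Z"] by simp

lemma \<beta>_succ: "dot (\<beta> k) (F (k + 1)) = l + 2 * (c * h (k + 1) - h k)"
  using dot_\<beta>_step[of k "F (k + 1)"] by (simp add: \<beta>_F)

lemma \<beta>_pred: "dot (\<beta> k) (F (k - 1)) = l + 2 * (c * h (k - 1) - h k)"
  using dot_\<beta>_step[of "k - 1" "F (k - 1)"] by (simp add: \<beta>_F)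

lemma X [simp]: "sc (X k) = 0" "dot (X k) (F k) = l - 2 * c * h k" "dot (X k) (F (k + 1)) = l - 2 * h k"
    "dot (X k) (F (k - 1)) = l - 2 * h k" "dot (X k) (T k) = 0"
proof -
  show "sc (X k) = 0" "dot (X k) (F k) = l - 2 * c * h k"
    by (simp_all add: X_def sc_\<beta> a \<beta>_F)
  show p: "dot (X k) (F (k + 1)) = l - 2 * h k" "dot (X k) (F (k - 1)) = l - 2 * h k"
    by (simp_all add: X_def \<beta>_succ \<beta>_pred)
  show "dot (X k) (T k) = 0"
    by (simp add: T_def p)
qed

text \<open>The step of \<beta> lies in the span of the two endpoints, so the component of
  \<open>X\<close> along the edge normal is preserved. Since \<open>X\<close> is orthogonal to the
  chords, this component is \<open>w / 2\<close> seen from either end.\<close>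

lemma w_const: "w k = w 0"
proof -
  have "w (k + 1) = w k" for k
  proof -
    have "dot (F k) (F k * F (k + 1)) = 0" "dot (F (k + 1)) (F k * F (k + 1)) = 0"
      using dot_mult_left[of "F k" "F (k + 1)" "F k"] dot_mult_right[of "F k" "F (k + 1)" "F (k + 1)"]
      by (simp_all add: dot_commute[of _ "F k * F (k + 1)"] star_mult_self[of "F k", simplified])
    then have "dot (X (k + 1)) (F k * F (k + 1)) = dot (X k) (F k * F (k + 1))"
      by (simp add: X_def dot_\<beta>_step)
    then show ?thesis
      using dot_edge(1)[of "X k" k] dot_edge(2)[of "X (k + 1)" k] by (simp add: w_def)
  qed
  then show ?thesis
    by (induction k rule: int_induct[of _ 0]) (simp, metis, metis diff_add_cancel)
qed

lemma X_FT [simp]: "dot (X k) (F k * T k) = w 0"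
  using w_const[of k] by (simp only: w_def)

text \<open>Expand \<open>F (k + 1)\<close> in the vertex frame. If \<open>w\<close> does not
  vanish, the height of the curve in direction \<open>a\<close> is an affine function of the
  curvature, as for smooth elastic curves.\<close>

lemma w_sg: "w 0 * sg k = 2 * (1 - c) * (l - 2 * (1 + c) * h k)"
proof -
  have "l - 2 * h k = c * (l - 2 * c * h k) + sg k * w 0 / 2"
    using dot_F(1)[of "X k" k] by simp
  then show ?thesis
    by (simp add: algebra_simps)
qed

lemma X_eq: "X k = (l - 2 * c * h k) *\<^sub>R F k + (w 0 / nrm (T k)) *\<^sub>R (F k * T k)"
  by (rule vec_vertex_eqI[of _ _ k]) (use nrm_T[of k] in auto)

lemma a_\<beta>_const: "dot a (\<beta> k) = dot a (\<beta> 0)"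
proof -
  have "dot a (\<beta> (k + 1)) = dot a (\<beta> k)" for k
    using dot_\<beta>_step[of k a] by (simp add: dot_commute)
  then show ?thesis
    by (induction k rule: int_induct[of _ 0]) (simp, metis, metis diff_add_cancel)
qed

text \<open>Up to constants this is the quadratic coefficient of the determinant of
  \<open>P\<close>; \<open>a_\<beta>_const\<close> supplies the linear one.\<close>

lemma nrm_\<beta>_const: "nrm (\<beta> k) + 4 * l * h k - 4 * (h k)\<^sup>2 = nrm (\<beta> 0) + 4 * l * h 0 - 4 * (h 0)\<^sup>2"
proof -
  have "nrm (\<beta> (k + 1)) + 4 * l * h (k + 1) - 4 * (h (k + 1))\<^sup>2 = nrm (\<beta> k) + 4 * l * h k - 4 * (h k)\<^sup>2" for k
  proof -
    have "nrm (\<beta> (k + 1)) = dot (\<beta> k) (\<beta> (k + 1)) + 2 * h k * l - 2 * h (k + 1) * dot (F k) (\<beta> (k + 1))"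
      using dot_\<beta>_step[of k "\<beta> (k + 1)"] \<beta>_F[of "k + 1"] by (simp add: dot_commute)
    moreover have "dot (\<beta> k) (\<beta> (k + 1)) = nrm (\<beta> k) + 2 * h k * (l + 2 * (c * h (k + 1) - h k)) - 2 * h (k + 1) * l"
      using dot_\<beta>_step[of k "\<beta> k"] \<beta>_F[of k] \<beta>_succ[of k] by (simp add: dot_commute)
    moreover have "dot (F k) (\<beta> (k + 1)) = l + 2 * (c * h k - h (k + 1))"
      using \<beta>_pred[of "k + 1"] by (simp add: dot_commute)
    ultimately show ?thesis
      by algebra
  qed
  then show ?thesis
    by (induction k rule: int_induct[of _ 0]) (simp, metis, metis diff_add_cancel)
qed

lemma h_second_difference: "h (k + 1) + h (k - 1) - 2 * c * h k = sg k * dot a (F k * T k)"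
  using dot_F[of a k] by (simp add: field_simps)

text \<open>Pairing the frame expansion of \<open>X\<close> with \<open>a\<close> expresses
  \<open>dot a (F k * T k)\<close> by the height, since \<open>dot a (\<beta> k)\<close> is
  conserved. The second difference of the height is then a function of the height alone, and the
  height is affine in \<open>sg\<close>.\<close>

lemma elastic_of_w:
  assumes w: "w 0 \<noteq> 0"
  obtains \<xi> where "\<And>k. (1 + (sg k)\<^sup>2) * (sg (k + 1) + sg (k - 1)) = \<xi> * sg k + 4 * (1 - c)\<^sup>2 * l / w 0"
proof -
  define m where "m = dot a (\<beta> 0) - 2 * c * nrm a"
  define K L W where "K = 4 * (1 - c\<^sup>2)" and "L = 2 * (1 - c) * l" and "W = w 0"
  have h: "K * h k = L - W * sg k" for k
    using w_sg[of k] by (simp add: K_def L_def W_def power2_eq_square algebra_simps)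
  \<comment> \<open>This relation cancels the terms quadratic in \<open>sg\<close>; the cubic ones
    cancel by themselves, and an affine right-hand side remains.\<close>
  have lK: "l * K = 2 * (1 + c) * L"
    by (simp add: K_def L_def power2_eq_square algebra_simps)
  have eq: "W\<^sup>2 * ((1 + (sg k)\<^sup>2) * (sg (k + 1) + sg (k - 1)))
      = 2 * L * (1 - c) * W + sg k * (2 * c * W\<^sup>2 - K\<^sup>2 * m + l * K * L - 2 * c * L\<^sup>2)" for k
  proof -
    define \<rho> where "\<rho> = dot a (F k * T k)"
    have m: "m = (l - 2 * c * h k) * h k + W / nrm (T k) * \<rho>"
      using arg_cong[OF X_eq[of k], of "dot a"] a_\<beta>_const[of k]
      by (simp add: X_def m_def W_def \<rho>_def)
    have N: "nrm (T k) * (1 + (sg k)\<^sup>2) = K"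
      by (simp add: K_def nrm_T_sg)
    have "W * \<rho> = nrm (T k) * (m - (l - 2 * c * h k) * h k)"
      using nrm_T[of k] by (simp add: m)
    then have "W * \<rho> * (1 + (sg k)\<^sup>2) = nrm (T k) * (1 + (sg k)\<^sup>2) * (m - (l - 2 * c * h k) * h k)"
      by simp
    then have "W * \<rho> * (1 + (sg k)\<^sup>2) = K * (m - (l - 2 * c * h k) * h k)"
      unfolding N .
    moreover have "h (k + 1) + h (k - 1) - 2 * c * h k = sg k * \<rho>"
      by (simp add: h_second_difference \<rho>_def)
    ultimately have "K * (W * (h (k + 1) + h (k - 1) - 2 * c * h k) * (1 + (sg k)\<^sup>2))
        = sg k * (K\<^sup>2 * m - l * K * (K * h k) + 2 * c * (K * h k)\<^sup>2)"
      by algebra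
    then have "W * (K * h (k + 1) + K * h (k - 1) - 2 * c * (K * h k)) * (1 + (sg k)\<^sup>2)
        = sg k * (K\<^sup>2 * m - l * K * (K * h k) + 2 * c * (K * h k)\<^sup>2)"
      by (simp add: algebra_simps)
    then show ?thesis
      unfolding h lK by algebra
  qed
  have "(1 + (sg k)\<^sup>2) * (sg (k + 1) + sg (k - 1))
      = (2 * c * W\<^sup>2 - K\<^sup>2 * m + l * K * L - 2 * c * L\<^sup>2) / W\<^sup>2 * sg k + 4 * (1 - c)\<^sup>2 * l / W" for k
  proof -
    have "4 * (1 - c)\<^sup>2 * l / W = 2 * L * (1 - c) * W / W\<^sup>2"
      using w by (simp add: W_def L_def power2_eq_square)
    moreover have "(1 + (sg k)\<^sup>2) * (sg (k + 1) + sg (k - 1)) = W\<^sup>2 * ((1 + (sg k)\<^sup>2) * (sg (k + 1) + sg (k - 1))) / W\<^sup>2"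
      using w by (simp add: W_def)
    ultimately show ?thesis
      unfolding eq by (simp add: add_divide_distrib)
  qed
  then show thesis
    using that unfolding W_def by blast
qed

text \<open>Now the height is constant, so \<open>a\<close> has no component along the chords and a
  constant one along \<open>F * T\<close>. The second difference of the height then determines
  \<open>sg\<close>, unless that component vanishes, which would make both \<open>a\<close> and
  \<open>X\<close> zero.\<close>

lemma sg_const_of_w:
  assumes w: "w 0 = 0" and ne: "a \<noteq> 0 \<or> \<beta> k0 \<noteq> 0"
  shows "sg k = sg 0" and "l = 0 \<Longrightarrow> sg k = 0"
proof -
  define e where "e = l / (2 * (1 + c))"
  have h: "h k = e" for k
  proof -
    have "l - 2 * (1 + c) * h k = 0"
      using w_sg[of k] c by (simp add: w)
    then show ?thesis
      using c by (simp add: e_def field_simps)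
  qed
  define \<rho> where "\<rho> = (\<lambda>k. dot a (F k * T k))"
  have aT: "dot a (T k) = 0" for k
    by (simp add: T_def h)
  have "\<rho> (k + 1) = \<rho> k" for k
    using dot_edge[OF a, of k] by (simp add: aT \<rho>_def)
  then have \<rho>: "\<rho> k = \<rho> 0" for k
    by (induction k rule: int_induct[of _ 0]) (simp, metis, metis diff_add_cancel)
  have s: "sg k * \<rho> 0 = 2 * (1 - c) * e" for k
    using h_second_difference[of k] \<rho>[of k] by (simp add: \<rho>_def h algebra_simps)
  have \<rho>0: "\<rho> 0 \<noteq> 0"
  proof
    assume z: "\<rho> 0 = 0"
    then have e0: "e = 0"
      using s[of 0] c by simp
    then have l: "l = 0"
      using c by (simp add: e_def)
    then have "a = 0"
      using z by (intro vec_vertex_eqI[of _ _ 0]) (auto simp: aT h e0 a \<rho>_def)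
    moreover have "X k0 = 0"
      using X_eq[of k0] w l h e0 by simp
    ultimately show False
      using ne unfolding X_def by simp
  qed
  show "sg k = sg 0"
    using s[of k] s[of 0] \<rho>0 by (metis mult_right_cancel)
  show "l = 0 \<Longrightarrow> sg k = 0"
    using s[of k] \<rho>0 by (simp add: e_def)
qed

text \<open>For n = 2 the vector is \<open>P\<close> at \<lambda> = 1. It has no component along
  \<open>F\<close> and \<open>T\<close> for general reasons, and the conserved quantities remove the
  third one.\<close>

lemma circle_degenerate:
  assumes l: "l = 0" and w: "w 0 \<noteq> 0" and s: "\<And>k. sg k = s" "s \<noteq> 0"
  shows "2 *\<^sub>R a - (2 * h k) *\<^sub>R F k + \<beta> k = 0"
proof -
  have h: "h k = - (w 0 * s) / (4 * (1 - c\<^sup>2))" for k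
    using w_sg[of k] c by (simp add: l s field_simps power2_eq_square)
  have h': "h k = h 0" for k
    unfolding h ..
  have \<beta>: "\<beta> k = X k + (2 * c) *\<^sub>R a"
    by (simp add: X_def)
  show ?thesis
  proof (rule vec_vertex_eqI[of _ _ k])
    show "dot (2 *\<^sub>R a - (2 * h k) *\<^sub>R F k + \<beta> k) (T k) = dot 0 (T k)"
      unfolding \<beta> by (simp add: T_def[of k] h'[of "k + 1"] h'[of "k - 1"])
    have "s * dot a (F k * T k) = h (k + 1) + h (k - 1) - 2 * c * h k"
      by (simp only: h_second_difference s)
    also have "\<dots> = 2 * (1 - c) * h 0"
      by (simp only: h'[of "k + 1"] h'[of "k - 1"] h'[of k]) (simp add: algebra_simps)
    finally have "s * dot a (F k * T k) = 2 * (1 - c) * h 0" .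
    moreover have "w 0 * s = - (4 * (1 - c\<^sup>2)) * h 0"
      using h[of 0] c by (simp add: field_simps)
    moreover have "s * (w 0 + 2 * (1 + c) * d) = w 0 * s + 2 * (1 + c) * (s * d)" for d
      by (simp add: algebra_simps)
    ultimately have "s * (w 0 + 2 * (1 + c) * dot a (F k * T k)) = 0"
      by (simp only:) (simp add: power2_eq_square algebra_simps)
    then have "w 0 + 2 * (1 + c) * dot a (F k * T k) = 0"
      using s(2) by simp
    then show "dot (2 *\<^sub>R a - (2 * h k) *\<^sub>R F k + \<beta> k) (F k * T k) = dot 0 (F k * T k)"
      unfolding \<beta> by (simp add: algebra_simps)
  qed (simp_all add: a sc_\<beta> \<beta>_F l)
qed

end

context curve
begin

text \<open>The derivation of the elastic equation read backwards. With
  \<open>w = - 4 (1 - c^2)\<close> the relation \<open>w_sg\<close> becomes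
  \<open>h = sg + hs\<close>, and \<delta> determines \<open>hs\<close> and \<open>l\<close>. This
  prescribes the components of \<open>a\<close> in every vertex frame; the elastic equation says
  that they belong to one fixed vector. The last clause finds the solutions with
  \<open>P(1) = 0\<close>.\<close>

lemma elastic_data:
  assumes eq: "\<And>k. (1 + (sg k)\<^sup>2) * (sg (k + 1) + sg (k - 1)) = \<xi> * sg k + \<delta>"
  obtains a \<beta> l where "curve_data c F a \<beta> l" "curve_data.w c F a \<beta> 0 \<noteq> 0" "\<delta> = 0 \<Longrightarrow> l = 0"
    "(\<And>k. 2 *\<^sub>R a - (2 * dot a (F k)) *\<^sub>R F k + \<beta> k = 0) \<Longrightarrow> \<delta> = 0 \<Longrightarrow> (\<forall>k. sg k = sg 0) \<and> (sg 0 = 0 \<longrightarrow> \<xi> = 2)"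
proof -
  define w where "w = - (4 * (1 - c\<^sup>2))"
  define hs where "hs = - \<delta> / (2 * (1 - c))"
  define h where "h k = sg k + hs" for k
  define l where "l = 2 * (1 + c) * hs"
  \<comment> \<open>Where \<open>sg k\<close> does not vanish, this value is forced by
    \<open>h_second_difference\<close>; the formula extends it to the other vertices.\<close>
  define \<rho> where "\<rho> k = - (2 * c - \<xi> + 2 * c * (sg k)\<^sup>2 + \<delta> * sg k) / (1 + (sg k)\<^sup>2)" for k
  define A where "A k = h k *\<^sub>R F k + ((h (k + 1) - h (k - 1)) / nrm (T k)) *\<^sub>R T k
      + (\<rho> k / nrm (T k)) *\<^sub>R (F k * T k)" for k
  have pos: "1 + (sg k)\<^sup>2 \<noteq> 0" for k
    by (smt (verit) zero_le_power2)
  have \<rho>: "(1 + (sg k)\<^sup>2) * \<rho> k = - (2 * c - \<xi> + 2 * c * (sg k)\<^sup>2 + \<delta> * sg k)" for k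
    using pos[of k] by (simp add: \<rho>_def)
  have hs: "2 * (1 - c) * hs = - \<delta>"
    using c by (simp add: hs_def field_simps)
  have A [simp]: "sc (A k) = 0" "dot (A k) (F k) = h k" "dot (A k) (T k) = h (k + 1) - h (k - 1)"
    "dot (A k) (F k * T k) = \<rho> k" for k
    using nrm_T[of k] by (simp_all add: A_def)
  have second: "h (k + 1) + h (k - 1) - 2 * c * h k = sg k * \<rho> k" for k
  proof -
    have "(1 + (sg k)\<^sup>2) * (h (k + 1) + h (k - 1) - 2 * c * h k)
        = (1 + (sg k)\<^sup>2) * (sg (k + 1) + sg (k - 1)) + (1 + (sg k)\<^sup>2) * (2 * (1 - c) * hs - 2 * c * sg k)"
      by (simp add: h_def algebra_simps)
    also have "\<dots> = sg k * (- (2 * c - \<xi> + 2 * c * (sg k)\<^sup>2 + \<delta> * sg k))"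
      unfolding eq hs by (simp add: power2_eq_square algebra_simps)
    also have "\<dots> = (1 + (sg k)\<^sup>2) * (sg k * \<rho> k)"
      unfolding \<rho>[symmetric] by simp
    finally show ?thesis
      using pos[of k] by simp
  qed
  have A_F: "dot (A k) (F (k + 1)) = h (k + 1)" "dot (A k) (F (k - 1)) = h (k - 1)" for k
    using second[of k] dot_F[of "A k" k] by (simp_all add: field_simps)
  \<comment> \<open>Twice the components of \<open>A k\<close> along the two adjacent edge normals.
    The right-hand sides are symmetric in the ends of the edge, so neighbouring vertices yield the
    same vector.\<close>
  have edge: "\<rho> k - sg k * (h (k + 1) - h (k - 1)) = \<xi> - 2 * c - 2 * sg k * sg (k + 1)"
    "\<rho> k + sg k * (h (k + 1) - h (k - 1)) = \<xi> - 2 * c - 2 * sg k * sg (k - 1)" for k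
  proof -
    have "(1 + (sg k)\<^sup>2) * (\<rho> k - sg k * (h (k + 1) - h (k - 1)) - (\<xi> - 2 * c - 2 * sg k * sg (k + 1)))
      = (1 + (sg k)\<^sup>2) * \<rho> k + sg k * ((1 + (sg k)\<^sup>2) * (sg (k + 1) + sg (k - 1))) - (1 + (sg k)\<^sup>2) * (\<xi> - 2 * c)"
      by (simp add: h_def algebra_simps)
    also have "\<dots> = 0"
      unfolding eq \<rho> by (simp add: power2_eq_square algebra_simps)
    finally show "\<rho> k - sg k * (h (k + 1) - h (k - 1)) = \<xi> - 2 * c - 2 * sg k * sg (k + 1)"
      using pos[of k] by simp
    have "(1 + (sg k)\<^sup>2) * (\<rho> k + sg k * (h (k + 1) - h (k - 1)) - (\<xi> - 2 * c - 2 * sg k * sg (k - 1)))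
      = (1 + (sg k)\<^sup>2) * \<rho> k + sg k * ((1 + (sg k)\<^sup>2) * (sg (k + 1) + sg (k - 1))) - (1 + (sg k)\<^sup>2) * (\<xi> - 2 * c)"
      by (simp add: h_def algebra_simps)
    also have "\<dots> = 0"
      unfolding eq \<rho> by (simp add: power2_eq_square algebra_simps)
    finally show "\<rho> k + sg k * (h (k + 1) - h (k - 1)) = \<xi> - 2 * c - 2 * sg k * sg (k - 1)"
      using pos[of k] by simp
  qed
  have "A (k + 1) = A k" for k
  proof (rule vec_edge_eqI[of _ _ k])
    show "dot (A (k + 1)) (F k) = dot (A k) (F k)"
      using A_F(2)[of "k + 1"] by simp
    show "dot (A (k + 1)) (F (k + 1)) = dot (A k) (F (k + 1))"
      by (simp add: A_F)
    show "dot (A (k + 1)) (F k * F (k + 1)) = dot (A k) (F k * F (k + 1))"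
      using edge(1)[of k] edge(2)[of "k + 1"] dot_edge(1)[of "A k" k] dot_edge(2)[of "A (k + 1)" k]
      by (simp add: mult.assoc mult.commute[of "sg k" "sg (k + 1)"])
  qed simp_all
  then have A0: "A k = A 0" for k
    by (induction k rule: int_induct[of _ 0]) (simp, metis, metis diff_add_cancel)
  define a where "a = A 0"
  have a [simp]: "sc a = 0" "dot a (F k) = h k" "dot a (T k) = h (k + 1) - h (k - 1)"
    "dot a (F k * T k) = \<rho> k" for k
    using A[of k] A0[of k] by (simp_all add: a_def)
  define X where "X k = (l - 2 * c * h k) *\<^sub>R F k + (w / nrm (T k)) *\<^sub>R (F k * T k)" for k
  have X [simp]: "sc (X k) = 0" "dot (X k) (F k) = l - 2 * c * h k" "dot (X k) (T k) = 0" "dot (X k) (F k * T k) = w" for k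
    using nrm_T[of k] by (simp_all add: X_def)
  have "c * (l - 2 * c * h k) + sg k * w / 2 = l - 2 * h k" for k
    by (simp add: l_def w_def h_def power2_eq_square field_simps)
  then have X_F: "dot (X k) (F (k + 1)) = l - 2 * h k" "dot (X k) (F (k - 1)) = l - 2 * h k" for k
    by (simp_all add: dot_F)
  define \<beta> where "\<beta> k = X k + (2 * c) *\<^sub>R a" for k
  have step: "\<beta> (k + 1) - \<beta> k = (2 * dot a (F k)) *\<^sub>R F (k + 1) - (2 * dot a (F (k + 1))) *\<^sub>R F k" (is "_ = ?R") for k
  proof (rule vec_edge_eqI[of _ _ k])
    have "dot (F k) (F k * F (k + 1)) = 0" "dot (F (k + 1)) (F k * F (k + 1)) = 0"
      using dot_mult_left[of "F k" "F (k + 1)" "F k"] dot_mult_right[of "F k" "F (k + 1)" "F (k + 1)"]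
      by (simp_all add: dot_commute[of _ "F k * F (k + 1)"] star_mult_self[of "F k", simplified])
    then show "dot (\<beta> (k + 1) - \<beta> k) (F k * F (k + 1)) = dot ?R (F k * F (k + 1))"
      using dot_edge(1)[of "X k" k] dot_edge(2)[of "X (k + 1)" k] by (simp add: \<beta>_def)
    show "dot (\<beta> (k + 1) - \<beta> k) (F k) = dot ?R (F k)"
      using X_F(2)[of "k + 1"] by (simp add: \<beta>_def)
    show "dot (\<beta> (k + 1) - \<beta> k) (F (k + 1)) = dot ?R (F (k + 1))"
      by (simp add: \<beta>_def X_F)
  qed (simp_all add: \<beta>_def)
  have data: "curve_data c F a \<beta> l"
    by unfold_locales (simp_all only: step, simp_all add: \<beta>_def)
  have w: "curve_data.w c F a \<beta> 0 = w"
    unfolding curve_data.w_def[OF data] curve_data.X_def[OF data] \<beta>_def by simp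
  show thesis
  proof (rule that[OF data])
    show "curve_data.w c F a \<beta> 0 \<noteq> 0"
      using c unfolding w by (simp add: w_def)
    show "\<delta> = 0 \<Longrightarrow> l = 0"
      by (simp add: l_def hs_def)
    assume z: "\<And>k. 2 *\<^sub>R a - (2 * dot a (F k)) *\<^sub>R F k + \<beta> k = 0" and \<delta>: "\<delta> = 0"
    then have 0: "hs = 0" "l = 0"
      by (simp_all add: hs_def l_def)
    have s: "sg (k + 1) = sg k" for k
    proof -
      have "2 * h (k + 1) - 2 * h k * c + (- (2 * h k) + 2 * c * h (k + 1)) = 0"
        using arg_cong[OF z[of k], of "\<lambda>x. dot x (F (k + 1))"] by (simp add: \<beta>_def X_F 0)
      then have "(1 + c) * (h (k + 1) - h k) = 0"
        by (simp add: algebra_simps)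
      then show ?thesis
        using c by (simp add: h_def)
    qed
    then have s: "sg k = sg 0" for k
      by (induction k rule: int_induct[of _ 0]) (simp, metis, metis diff_add_cancel)
    moreover have "\<xi> = 2" if "sg 0 = 0"
    proof -
      have "2 * \<rho> 0 + (w + 2 * c * \<rho> 0) = 0"
        using arg_cong[OF z[of 0], of "\<lambda>x. dot x (F 0 * T 0)"] by (simp add: \<beta>_def)
      then have "(1 + c) * (\<xi> - 2) = 0"
        using that by (simp add: \<rho>_def w_def power2_eq_square algebra_simps)
      then show ?thesis
        using c by simp
    qed
    ultimately show "(\<forall>k. sg k = sg 0) \<and> (sg 0 = 0 \<longrightarrow> \<xi> = 2)"
      by blast
  qed
qed

end

section \<open>Splitting off linear factors\<close>

text \<open>Let \<open>1 + t \<lambda> + d \<lambda>^2\<close> be the determinant of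
  \<open>1 + \<lambda> v\<close>. A polynomial with remainder \<open>R0 + \<lambda> R1\<close>
  modulo it is right divisible by \<open>1 + \<lambda> v\<close> because \<open>R1 = R0 * v\<close>.
  The hypotheses \<open>e1\<close> and \<open>e2\<close> are the relation
  \<open>P' (1 + \<lambda> u) = (1 + \<lambda> w) P\<close> modulo the same determinant, and the
  conclusion is the exchange relation between \<open>u\<close>, \<open>v\<close> and
  \<open>v'\<close>.\<close>

lemma factor_step:
  fixes u w v v' R0 R1 R0' R1' :: "'s::signature gq"
  assumes v: "v * v = t *\<^sub>R v - d *\<^sub>R 1" and d: "d \<noteq> 0" and n: "nrm R0' \<noteq> 0" "nrm v \<noteq> 0"
    and R: "R0 * v = R1" "R0' * v' = R1'"
    and e1: "d *\<^sub>R R0' - R1' * u = d *\<^sub>R R0 - w * R1"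
    and e2: "d *\<^sub>R (R1' + R0' * u) - t *\<^sub>R (R1' * u) = d *\<^sub>R (R1 + w * R0) - t *\<^sub>R (w * R1)"
  shows "v' * (v - u) = (v - u) * v"
proof -
  have vv: "x * (v * v) = t *\<^sub>R (x * v) - d *\<^sub>R x" for x
    unfolding v by (simp add: right_diff_distrib)
  have "(d *\<^sub>R R0' - R1' * u) * v = d *\<^sub>R (R1 + w * R0) - t *\<^sub>R (w * R1)"
    unfolding e1 R(1)[symmetric] by (simp add: left_diff_distrib mult.assoc vv v) (simp add: algebra_simps)
  then have "R0' * (d *\<^sub>R v - v' * u * v) = R0' * (d *\<^sub>R v' + d *\<^sub>R u - t *\<^sub>R (v' * u))"
    unfolding e2[symmetric] R(2)[symmetric] by (simp add: algebra_simps)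
  then have "d *\<^sub>R v - v' * u * v = d *\<^sub>R v' + d *\<^sub>R u - t *\<^sub>R (v' * u)"
    by (rule nrm_cancel_left[OF n(1)])
  then have "(d *\<^sub>R v - v' * u * v) * v = (d *\<^sub>R v' + d *\<^sub>R u - t *\<^sub>R (v' * u)) * v"
    by simp
  then have "d *\<^sub>R ((v - u - v') * v) = (v' * u * v - t *\<^sub>R (v' * u)) * v"
    by (simp add: algebra_simps)
  also have "\<dots> = d *\<^sub>R (- (v' * u))"
    by (simp add: left_diff_distrib mult.assoc vv v) (simp add: algebra_simps)
  finally have "(v - u - v') * v = - (v' * u)"
    using d by (metis scaleR_cancel_left)
  then show ?thesis
    by (simp add: algebra_simps)
qed

text \<open>The linear coefficient of the exchange relation between the four transport matrices; the
  quadratic one holds automatically. Equivalently, the reflection in \<open>b - d\<close>, which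
  swaps the points \<open>b\<close> and \<open>d\<close>, also maps \<open>a\<close> to
  \<open>c\<close>.\<close>

definition bfly :: "'s::signature gq \<Rightarrow> 's gq \<Rightarrow> 's gq \<Rightarrow> 's gq \<Rightarrow> bool" where
  "bfly a b c d \<longleftrightarrow> c * (d - b) = (b - d) * a"

section \<open>Butterflies and the curves they generate\<close>

lemma pts_nrm_diff: "a \<in> pts \<Longrightarrow> b \<in> pts \<Longrightarrow> a \<noteq> b \<Longrightarrow> nrm (a - b) \<noteq> 0" for a b :: "'s::signature gq"
  using pts_dot(2)[of a b] by (auto simp: pts_def dot_commute[of b a])

lemma pts_swap:
  fixes a b :: "'s::signature gq"
  assumes "a \<in> pts" "b \<in> pts"
  shows "a * (a - b) = - ((a - b) * b)" "b * (a - b) = - ((a - b) * a)"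
  using pts_D(4)[OF assms(1)] pts_D(4)[OF assms(2)] by (simp_all add: algebra_simps)

lemma bfly_dot:
  fixes a b c d :: "'s::signature gq"
  assumes p: "a \<in> pts" "b \<in> pts" "c \<in> pts" "d \<in> pts" and "b \<noteq> d" and "bfly a b c d"
  shows "dot c d = dot a b" "dot c b = dot d a" "dot a b \<noteq> dot a d \<Longrightarrow> c \<noteq> a"
proof -
  have n: "nrm (b - d) \<noteq> 0"
    using assms pts_nrm_diff by blast
  have c: "c * (b - d) = - ((b - d) * a)"
    using assms(6) by (simp add: bfly_def algebra_simps)
  have "nrm (b - d) * dot c d = dot (c * (b - d)) (d * (b - d))"
    by (simp only: dot_mult_mult)
  also have "\<dots> = nrm (b - d) * dot a b"
    unfolding c pts_swap(2)[OF p(2,4)] by (simp only: dot_mult_mult dot_simps minus_minus)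
  finally show "dot c d = dot a b"
    using n by simp
  have "nrm (b - d) * dot c b = dot (c * (b - d)) (b * (b - d))"
    by (simp only: dot_mult_mult)
  also have "\<dots> = nrm (b - d) * dot a d"
    unfolding c pts_swap(1)[OF p(2,4)] by (simp only: dot_mult_mult dot_simps minus_minus)
  finally show "dot c b = dot d a"
    using n by (simp add: dot_commute)
  show "c \<noteq> a" if "dot a b \<noteq> dot a d"
  proof
    assume "c = a"
    then have "a * (b - d) = - ((b - d) * a)"
      using c by simp
    moreover have "a * (b - d) = - ((b - d) * a) - (2 * dot a (b - d)) *\<^sub>R 1"
      using p by (intro mult_anticommute) (auto simp: pts_def)
    ultimately have "dot a (b - d) = 0"
      by simp
    with that show False
      by simp
  qed
qed

text \<open>The same butterfly seen from its other pair of opposite vertices: the reflection in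
  \<open>f0 - g1\<close> takes \<open>g0\<close> to \<open>f1\<close>.\<close>

lemma bfly_turn:
  fixes f0 f1 g0 g1 :: "'s::signature gq"
  assumes p: "f0 \<in> pts" "f1 \<in> pts" "g0 \<in> pts" "g1 \<in> pts" and x: "dot g0 f0 = x" "dot g1 f1 = x"
    and b: "bfly f0 f1 g1 g0"
  shows "f1 * (f0 - g1) = - ((f0 - g1) * g0)" "f0 * (f1 - g0) = - ((f1 - g0) * g1)"
proof -
  have "f1 * f0 = g1 * g0 + g0 * f0 - g1 * f1"
    using b by (simp add: bfly_def algebra_simps)
  moreover have "f0 * g0 = - (g0 * f0) - (2 * x) *\<^sub>R 1" "f1 * g1 = - (g1 * f1) - (2 * x) *\<^sub>R 1"
    using mult_anticommute[of f0 g0] mult_anticommute[of f1 g1] p x by (auto simp: pts_def dot_commute)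
  ultimately show "f1 * (f0 - g1) = - ((f0 - g1) * g0)"
    by (simp add: right_diff_distrib left_diff_distrib)
  have "star (g1 * (g0 - f1)) = star ((f1 - g0) * f0)"
    using b by (simp add: bfly_def)
  then show "f0 * (f1 - g0) = - ((f1 - g0) * g1)"
    using p by (simp add: pts_D algebra_simps)
qed

locale transform = curve c F for c :: real and F :: "int \<Rightarrow> 's::signature gq" +
  fixes G :: "int \<Rightarrow> 's gq" and x :: real
  assumes G: "G k \<in> pts" and GF: "dot (G k) (F k) = x" and b: "bfly (F k) (F (k + 1)) (G (k + 1)) (G k)"
    and x: "x \<noteq> c"
begin

lemma ne: "F (k + 1) \<noteq> G k" "G (k + 1) \<noteq> F k"
proof -
  show "F (k + 1) \<noteq> G k"
    using x GF[of k] FF(2)[of k] by metis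
  show "G (k + 1) \<noteq> F k"
    using x GF[of "k + 1"] FF(1)[of k] by metis
qed

lemma gcurve_G: "gcurve c G"
  unfolding gcurve_def
proof (intro conjI allI)
  show "G k \<in> pts" for k
    by (rule G)
  show "dot (G k) (G (k + 1)) = c" for k
    using bfly_dot(1)[OF F(1) F(1) G G ne(1) b, of k] by (simp add: dot_commute)
  show "c > -1" "c \<noteq> 1"
    using c by auto
  show "G (k + 1) \<noteq> G (k - 1)" for k
  proof
    assume eq: "G (k + 1) = G (k - 1)"
    \<comment> \<open>Under the assumption one and the same reflection takes \<open>G k\<close> to
      \<open>F (k + 1)\<close> and to \<open>F (k - 1)\<close>.\<close>
    have "F (k + 1) * (F k - G (k + 1)) = - ((F k - G (k + 1)) * G k)"
      by (rule bfly_turn(1)[OF _ _ G G GF GF b]) simp_all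
    moreover have "F (k - 1) * (F (k - 1 + 1) - G (k - 1)) = - ((F (k - 1 + 1) - G (k - 1)) * G (k - 1 + 1))"
      by (rule bfly_turn(2)[OF _ _ G G GF GF b]) simp_all
    ultimately have "F (k + 1) * (F k - G (k + 1)) = F (k - 1) * (F k - G (k + 1))"
      unfolding eq by simp
    moreover have "nrm (F k - G (k + 1)) \<noteq> 0"
      using pts_nrm_diff[OF F(1) G] ne(2) by metis
    ultimately have "F (k + 1) = F (k - 1)"
      using nrm_cancel_right by blast
    then show False
      using gcurve by (simp add: gcurve_def)
  qed
qed

end

text \<open>The polynomial is \<open>E + \<lambda> A1 - \<lambda>^2 (fh * E * f)\<close>, and
  \<open>c1\<close>, \<open>c2\<close> say that its determinant is \<open>n0 (1 + 2 x \<lambda> +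
  \<lambda>^2) (1 + 2 y \<lambda> + \<lambda>^2)\<close>. Modulo the first factor the remainder is
  \<open>R + \<lambda> S\<close>, so the transport matrix to be split off is the quotient of
  \<open>S\<close> by \<open>R\<close>.\<close>

lemma quadratic_factor:
  fixes f fh E A1 :: "'s::signature gq"
  assumes p: "f \<in> pts" "fh \<in> pts" and E: "nrm E = n0" and sym: "fh * A1 = A1 * f"
    and c1: "dot E A1 = n0 * (x + y)" and c2: "nrm A1 - 2 * dot E (fh * E * f) = n0 * (2 + 4 * x * y)"
    and R0: "nrm (E + fh * E * f) \<noteq> 0"
  obtains g where "g \<in> pts" "dot g f = x" "A1 = - (E * g * f) - fh * E * g"
    "(E + fh * E * f) * - (g * f) = A1 + (2 * x) *\<^sub>R (fh * E * f)"
proof -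
  note [simp] = pts_D[OF p(1)] pts_D[OF p(2)]
  define A2 where "A2 = fh * E * f"
  define R where "R = E + A2"
  define S where "S = A1 + (2 * x) *\<^sub>R A2"
  define v where "v = (1 / nrm R) *\<^sub>R (star R * S)"
  define g where "g = v * f"
  have R0: "nrm R \<noteq> 0"
    using R0 by (simp add: R_def A2_def)
  have Rv: "R * v = S"
    using R0 by (simp add: v_def)
  \<comment> \<open>The map taking \<open>z\<close> to \<open>- (fh * z * f)\<close> is an isometry
    that exchanges the outer coefficients and fixes the middle one. This makes the determinant
    palindromic.\<close>
  have A1: "A1 = - (fh * A1 * f)"
    by (simp add: sym mult.assoc)
  have "dot A1 A2 = dot (- (fh * A1 * f)) (fh * E * f)"
    using A1 by (simp add: A2_def)
  also have "\<dots> = - dot A1 E"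
    by simp
  finally have A12: "dot A1 A2 = - (n0 * (x + y))"
    using c1 by (simp add: dot_commute)
  have A22: "nrm A2 = n0"
    by (simp add: A2_def nrm_mult E)
  have nR: "nrm R = 2 * n0 + 2 * dot E A2"
    by (simp add: R_def E A22 dot_commute[of A2 E])
  have "nrm S = nrm A1 + 4 * x * dot A1 A2 + 4 * x\<^sup>2 * n0"
    by (simp add: S_def A22 dot_commute[of A2 A1] power2_eq_square algebra_simps)
  then have nS: "nrm S = nrm R"
    using c2 unfolding A12 nR A2_def[symmetric] by (simp add: algebra_simps power2_eq_square)
  have "dot R S = dot E A1 + 2 * x * dot E A2 + dot A1 A2 + 2 * x * n0"
    by (simp add: R_def S_def A22 dot_commute[of A2 A1] algebra_simps)
  then have RS: "dot R S = x * nrm R"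
    unfolding A12 c1 nR by (simp add: algebra_simps)
  have v: "nrm v = 1" "sc v = x"
  proof -
    show "nrm v = 1"
      using R0 nS by (simp add: v_def nrm_mult)
    have "nrm R * sc v = dot (R * 1) (R * v)"
      by (simp only: dot_mult_mult dot_simps)
    then show "sc v = x"
      using RS R0 by (simp add: Rv)
  qed
  have "nrm R * sc g = dot (R * 1) (R * (v * f))"
    by (simp only: dot_mult_mult dot_simps g_def)
  also have "\<dots> = dot R (S * f)"
    by (simp add: Rv mult.assoc[symmetric])
  also have "\<dots> = 0"
  proof -
    have "dot A1 (E * f) = dot (- (fh * A1 * f)) (E * f)"
      using A1 by simp
    also have "\<dots> = - dot (fh * A1) E"
      by simp
    also have "\<dots> = dot A1 (fh * E)"
      by (simp only: dot_mult_left) simp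
    finally have "dot A1 (E * f) = dot A1 (fh * E)" .
    moreover have "dot E (A1 * f) = - dot A1 (E * f)"
      using dot_mult_right[of A1 f E] by (simp add: dot_commute)
    moreover have "dot A2 (A1 * f) = dot (fh * E) A1"
      unfolding A2_def dot_mult_mult by simp
    moreover have "dot E (fh * E) = 0"
      using dot_mult_mult(2)[of 1 E fh] by simp
    moreover have "dot (fh * E * f) (fh * E) = 0"
      using dot_mult_mult(1)[of "fh * E" f 1] by simp
    ultimately show ?thesis
      by (simp add: R_def S_def distrib_right dot_commute[of "fh * E" A1]) (simp add: A2_def mult.assoc)
  qed
  finally have g0: "sc g = 0"
    using R0 by simp
  have gp: "g \<in> pts"
    using g0 v by (simp add: pts_def g_def nrm_mult)
  have vg: "v = - (g * f)"
    by (simp add: g_def mult.assoc)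
  show thesis
  proof (rule that[OF gp])
    show "dot g f = x"
      by (simp add: g_def dot_mult_right v)
    show "(E + fh * E * f) * - (g * f) = A1 + (2 * x) *\<^sub>R (fh * E * f)"
      using Rv by (simp add: R_def S_def A2_def vg)
    have "star v = (2 * x) *\<^sub>R 1 - v"
      using star_eq[of v] v by simp
    moreover have "star v = - (f * g)"
      using gp by (simp add: vg pts_D)
    ultimately have "(2 * x) *\<^sub>R 1 = v - f * g"
      by (simp add: algebra_simps)
    then have "A2 * (2 * x) *\<^sub>R 1 = A2 * (v - f * g)"
      by simp
    then have "(2 * x) *\<^sub>R A2 = A2 * v - A2 * (f * g)"
      by (simp add: right_diff_distrib)
    moreover have "A1 = E * v + A2 * v - (2 * x) *\<^sub>R A2"
      using Rv by (simp add: R_def S_def algebra_simps)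
    ultimately have "A1 = E * v + A2 * (f * g)"
      by simp
    then show "A1 = - (E * g * f) - fh * E * g"
      by (simp add: vg A2_def mult.assoc)
  qed
qed

lemma bfly_of_factor:
  fixes f0 f1 g0 g1 :: "'s::signature gq"
  assumes p: "f0 \<in> pts" "f1 \<in> pts" "g0 \<in> pts" "g1 \<in> pts"
    and v: "- (g1 * f1) * (- (g0 * f0) + f1 * f0) = (- (g0 * f0) + f1 * f0) * - (g0 * f0)"
  shows "bfly f0 f1 g1 g0"
proof -
  have "g1 * (f1 * (f1 - g0)) * f0 = (f1 - g0) * (f0 * g0) * f0"
    using v by (simp add: algebra_simps)
  then have "g1 * (f1 * (f1 - g0)) = (f1 - g0) * (f0 * g0)"
    using nrm_cancel_right[of f0] pts_D(2)[OF p(1)] by fastforce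
  then have "g1 * (g0 - f1) * g0 = (f1 - g0) * f0 * g0"
    unfolding pts_swap(1)[OF p(2,3)] by (simp add: algebra_simps)
  then show ?thesis
    unfolding bfly_def using nrm_cancel_right[of g0] pts_D(2)[OF p(3)] by fastforce
qed

text \<open>Cayley-Hamilton for a transport matrix of trace \<open>2 * x\<close> and determinant
  1.\<close>

lemma sq_of_dot:
  fixes f g :: "'s::signature gq"
  assumes p: "f \<in> pts" "g \<in> pts" and "dot g f = x"
  shows "- (g * f) * - (g * f) = (2 * x) *\<^sub>R - (g * f) - 1 *\<^sub>R 1"
proof -
  have "f * g = - (g * f) - (2 * x) *\<^sub>R 1"
    using mult_anticommute[of f g] assms by (auto simp: pts_def dot_commute)
  then have "g * (f * g) * f = g * (- (g * f) - (2 * x) *\<^sub>R 1) * f"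
    by simp
  also have "\<dots> = (2 * x) *\<^sub>R - (g * f) - 1"
    using p by (simp add: left_diff_distrib right_diff_distrib mult.assoc pts_D)
  finally show ?thesis
    by (simp add: mult.assoc)
qed

lemma quadratic_bfly:
  fixes f0 f1 h0 h1 E A A' g0 g1 :: "'s::signature gq"
  assumes p: "f0 \<in> pts" "f1 \<in> pts" "h0 \<in> pts" "h1 \<in> pts" "g0 \<in> pts" "g1 \<in> pts"
    and sym: "h0 * A = A * f0" "h1 * A' = A' * f1"
    and step: "A' - A = E * (f1 * f0) - h1 * h0 * E"
    and x: "dot g0 f0 = x" and n: "nrm (E + h1 * E * f1) \<noteq> 0"
    and R: "(E + h0 * E * f0) * - (g0 * f0) = A + (2 * x) *\<^sub>R (h0 * E * f0)"
      "(E + h1 * E * f1) * - (g1 * f1) = A' + (2 * x) *\<^sub>R (h1 * E * f1)"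
  shows "bfly f0 f1 g1 g0"
proof (rule bfly_of_factor)
  note [simp] = pts_D[OF p(1)] pts_D[OF p(2)] pts_D[OF p(3)] pts_D[OF p(4)]
  have s1: "h1 * (A' * z) = A' * (f1 * z)" "h0 * (A * z) = A * (f0 * z)" for z
    using sym by (simp_all add: mult.assoc[symmetric])
  have A': "A' = A + E * (f1 * f0) - h1 * h0 * E"
    using step by (simp add: algebra_simps)
  \<comment> \<open>The coefficient of \<open>\<lambda>^2\<close> in the intertwining relation,
    obtained from \<open>step\<close> by the symmetry. That of \<open>\<lambda>^3\<close> holds
    since points square to \<open>-1\<close>.\<close>
  have L2: "- (h1 * E * f1) - A' * (f1 * f0) = - (h0 * E * f0) - h1 * h0 * A"
  proof -
    have "A' * (f1 * f0) = h1 * (A' * f0)"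
      by (simp add: s1)
    also have "\<dots> = h1 * (A * f0) + h1 * (E * (f1 * f0)) * f0 - h1 * (h1 * h0 * E) * f0"
      unfolding A' by (simp add: algebra_simps)
    finally show ?thesis
      using sym(1) by (simp add: mult.assoc)
  qed
  have "- (g1 * f1) * (- (g0 * f0) - (- (f1 * f0))) = (- (g0 * f0) - (- (f1 * f0))) * - (g0 * f0)"
  proof (rule factor_step[OF sq_of_dot[OF p(1,5) x] _ n _ R])
    show "nrm (- (g0 * f0)) \<noteq> 0"
      using p by (simp add: nrm_mult pts_D)
    show "1 *\<^sub>R (E + h1 * E * f1) - (A' + (2 * x) *\<^sub>R (h1 * E * f1)) * - (f1 * f0)
        = 1 *\<^sub>R (E + h0 * E * f0) - - (h1 * h0) * (A + (2 * x) *\<^sub>R (h0 * E * f0))"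
      using L2 by (simp add: algebra_simps)
    have "A' + E * - (f1 * f0) = A + - (h1 * h0) * E"
      using A' by simp
    then show "1 *\<^sub>R (A' + (2 * x) *\<^sub>R (h1 * E * f1) + (E + h1 * E * f1) * - (f1 * f0))
        - (2 * x) *\<^sub>R ((A' + (2 * x) *\<^sub>R (h1 * E * f1)) * - (f1 * f0))
      = 1 *\<^sub>R (A + (2 * x) *\<^sub>R (h0 * E * f0) + - (h1 * h0) * (E + h0 * E * f0))
        - (2 * x) *\<^sub>R (- (h1 * h0) * (A + (2 * x) *\<^sub>R (h0 * E * f0)))"
      using arg_cong[OF L2, of "\<lambda>z. (2 * x) *\<^sub>R z"] by (simp add: algebra_simps)
  qed simp
  then show "- (g1 * f1) * (- (g0 * f0) + f1 * f0) = (- (g0 * f0) + f1 * f0) * - (g0 * f0)"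
    by simp
qed (use p in auto)

text \<open>The polynomial is \<open>E + \<lambda> A - \<lambda>^2 (f * A * f) - \<lambda>^3 (f * E
  * f)\<close>. Its remainder modulo \<open>1 + 2 x \<lambda> + \<lambda>^2\<close> has constant
  term \<open>R = s + t f + Y\<close> with \<open>Y\<close> tangent at \<open>f\<close>, and
  \<open>root\<close> says that the modulus divides the determinant. The last conclusion concerns
  the linear coefficient of the quotient and is the symmetry required for the next
  splitting.\<close>

lemma cubic_factor:
  fixes f a \<beta> :: "'s::signature gq" and e b l x :: real
  defines "E \<equiv> e *\<^sub>R 1 + a" and "A \<equiv> b *\<^sub>R 1 + \<beta> - a"
    and "s \<equiv> e * (1 + 2 * x) - b" and "t \<equiv> 2 * dot a f * (1 + x) - l"
    and "Y \<equiv> \<beta> - l *\<^sub>R f - (2 * x) *\<^sub>R (a - dot a f *\<^sub>R f)"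
  assumes p: "f \<in> pts" and a: "sc a = 0" and \<beta>: "sc \<beta> = 0" "dot \<beta> f = l"
    and root: "(1 - x) * (s\<^sup>2 + t\<^sup>2) = (1 + x) * nrm Y" and s: "s \<noteq> 0" and x: "x \<noteq> -1"
  obtains g where "g \<in> pts" "dot g f = x" "nrm (E + f * A * f - (2 * x) *\<^sub>R (f * E * f)) \<noteq> 0"
    "(E + f * A * f - (2 * x) *\<^sub>R (f * E * f)) * - (g * f)
      = A + (2 * x) *\<^sub>R (f * A * f) + (1 - 4 * x\<^sup>2) *\<^sub>R (f * E * f)"
    "f * (A + E * g * f) = (A + E * g * f) * g"
proof -
  note [simp] = pts_D[OF p]
  define R where "R = E + f * A * f - (2 * x) *\<^sub>R (f * E * f)"
  define S where "S = A + (2 * x) *\<^sub>R (f * A * f) + (1 - 4 * x\<^sup>2) *\<^sub>R (f * E * f)"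
  have anti: "z * f = - (f * z) - (2 * dot z f) *\<^sub>R 1" if "sc z = 0" for z
    using mult_anticommute[OF that, of f] by simp
  have fzf: "f * z * f = z - (2 * dot z f) *\<^sub>R f" if "sc z = 0" for z
    using anti[OF that] by (simp add: mult.assoc right_diff_distrib)
  have Y: "sc Y = 0" "dot Y f = 0"
    by (simp_all add: Y_def a \<beta>)
  have R: "R = s *\<^sub>R 1 + t *\<^sub>R f + Y"
  proof -
    have "f * A * f = (- b) *\<^sub>R 1 + f * \<beta> * f - f * a * f" "f * E * f = (- e) *\<^sub>R 1 + f * a * f"
      by (simp_all add: A_def E_def algebra_simps)
    then have "f * A * f = (- b) *\<^sub>R 1 + (\<beta> - (l *\<^sub>R f + l *\<^sub>R f)) - (a - (dot a f *\<^sub>R f + dot a f *\<^sub>R f))"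
      and fEf: "f * E * f = (- e) *\<^sub>R 1 + (a - (dot a f *\<^sub>R f + dot a f *\<^sub>R f))"
      by (simp_all only: fzf[OF a] fzf[OF \<beta>(1)] \<beta>(2) mult_2 scaleR_add_left)
    moreover define x2 where "x2 = 2 * x"
    have st: "s *\<^sub>R 1 = e *\<^sub>R 1 + (e * x2) *\<^sub>R 1 - b *\<^sub>R (1 :: 's gq)"
      "t *\<^sub>R f = dot a f *\<^sub>R f + dot a f *\<^sub>R f + (dot a f * x2) *\<^sub>R f - l *\<^sub>R f"
      unfolding scaleR_add_left[symmetric] scaleR_diff_left[symmetric]
      by (simp_all add: s_def t_def x2_def algebra_simps)
    ultimately show ?thesis
      unfolding R_def x2_def[symmetric] Y_def fEf st by (simp add: E_def algebra_simps)
  qed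
  have fY: "Y * f = - (f * Y)"
    using anti[OF Y(1)] Y(2) by simp
  have Yf: "dot f Y = 0" "dot f (f * Y) = 0" "dot (f * Y) f = 0"
    using Y dot_mult_mult(1)[of f 1 Y] dot_mult_mult(1)[of f Y 1] by (simp_all add: dot_commute[of f Y])
  have nfY: "nrm (f * Y) = nrm Y" "sc (f * Y) = 0"
    using Yf(1) Y(1) by (simp_all add: nrm_mult[of f Y] dot_def[of f Y] star_vec)
  have nR: "nrm R = s\<^sup>2 + t\<^sup>2 + nrm Y"
    unfolding R by (simp add: Y Yf power2_eq_square)
  \<comment> \<open>This keeps \<open>R\<close> invertible in the indefinite case too; here
    \<open>s\<close> must not vanish.\<close>
  have "(1 + x) * nrm R = 2 * (s\<^sup>2 + t\<^sup>2)"
    using root unfolding nR by algebra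
  moreover have "s\<^sup>2 + t\<^sup>2 \<noteq> 0"
    using s by (simp add: sum_power2_eq_zero_iff)
  ultimately have nR0: "nrm R \<noteq> 0"
    by (metis mult_eq_0_iff zero_neq_numeral)
  \<comment> \<open>Since \<open>S = f * R * f + 2 x R\<close>, the quotient of \<open>S\<close> by
    \<open>R\<close> only involves the conjugate \<open>z\<close> of \<open>f\<close> by
    \<open>R\<close>.\<close>
  define z where "z = (1 / nrm R) *\<^sub>R (star R * (f * R))"
  have Rz: "R * z = f * R"
    using nR0 by (simp add: z_def)
  have "z * z = (1 / nrm R) *\<^sub>R (star R * f * (R * z))"
    by (simp add: z_def mult.assoc)
  also have "\<dots> = - 1"
    using nR0 unfolding Rz by (simp add: mult.assoc star_mult_self)
  finally have zz: "z * z = - 1" .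
  have "sc (star R * (f * R)) = sc (f * (R * star R))"
    by (metis sc_cyclic mult.assoc)
  then have scz: "sc z = 0"
    by (simp add: z_def mult_star)
  have nz: "nrm z = 1"
    using zz mult_star[of z] by (simp add: star_vec[OF scz]) (metis scaleR_cancel_right scaleR_one zero_neq_one)
  have "nrm R * dot z f = dot (R * z) (R * f)"
    by (simp only: dot_mult_mult)
  also have "\<dots> = dot (f * R) (R * f)"
    by (simp add: Rz)
  also have "f * R = s *\<^sub>R f - t *\<^sub>R 1 + f * Y"
    by (simp add: R algebra_simps)
  also have "R * f = s *\<^sub>R f - t *\<^sub>R 1 - f * Y"
    by (simp add: R algebra_simps fY)
  finally have "nrm R * dot z f = s\<^sup>2 + t\<^sup>2 - nrm Y"
    by (simp add: Yf nfY power2_eq_square)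
  also have "\<dots> = x * nrm R"
    using root unfolding nR by algebra
  finally have zf: "dot z f = x"
    using nR0 by simp
  \<comment> \<open>The mirror image of \<open>z\<close> with respect to the axis \<open>f\<close>;
    then \<open>- (g * f)\<close> equals \<open>z * f + 2 x\<close>, the required quotient.\<close>
  define g where "g = - (f * z * f)"
  have g: "g = (2 * x) *\<^sub>R f - z"
    unfolding g_def fzf[OF scz] zf by simp
  have gp: "g \<in> pts"
    by (simp add: pts_def g scz nz zf dot_commute[of f z])
  have vg: "- (g * f) = - (f * z)"
    by (simp add: g_def mult.assoc)
  have fz: "- (f * z) = z * f + (2 * x) *\<^sub>R 1"
    using anti[OF scz] zf by simp
  have Rv: "R * - (g * f) = S"
  proof -
    have "R * - (g * f) = f * R * f + (2 * x) *\<^sub>R R"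
      unfolding vg fz by (simp add: distrib_left mult.assoc[symmetric] Rz)
    also have "\<dots> = S"
      by (simp add: R_def S_def algebra_simps power2_eq_square)
    finally show ?thesis .
  qed
  show thesis
  proof (rule that[OF gp])
    show "dot g f = x"
      by (simp add: g zf)
    show "nrm (E + f * A * f - (2 * x) *\<^sub>R (f * E * f)) \<noteq> 0"
      using nR0 by (simp add: R_def)
    show "(E + f * A * f - (2 * x) *\<^sub>R (f * E * f)) * - (g * f)
      = A + (2 * x) *\<^sub>R (f * A * f) + (1 - 4 * x\<^sup>2) *\<^sub>R (f * E * f)"
      using Rv by (simp add: R_def S_def)
    have gg: "g * g = -1" "g * (g * y) = - y" for y
      using gp by (simp_all add: pts_D)
    have fg: "f * g = - (g * f) - (2 * x) *\<^sub>R 1"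
    proof -
      have "sc g = 0" "dot g f = x"
        by (simp_all add: g zf scz)
      then show ?thesis
        using anti[of g] by simp
    qed
    have fg': "f * (g * y) = - (g * (f * y)) - (2 * x) *\<^sub>R y" for y
      using arg_cong[OF fg, of "\<lambda>z. z * y"] by (simp add: mult.assoc left_diff_distrib)
    have "f * ((A + E * g * f) * g - f * (A + E * g * f)) = S - R * - (g * f)"
      by (simp add: R_def S_def algebra_simps power2_eq_square fg fg' gg)
    also have "\<dots> = f * 0"
      unfolding Rv by simp
    finally have "(A + E * g * f) * g - f * (A + E * g * f) = 0"
      by (rule nrm_cancel_left[rotated]) simp
    then show "f * (A + E * g * f) = (A + E * g * f) * g"
      by simp
  qed
qed

text \<open>The coefficient of \<open>\<lambda>^2\<close> in the intertwining relation. It depends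
  on the sum \<open>E + A\<close> having the same scalar part \<open>r\<close> and the same
  component \<open>l\<close> along the point at both vertices.\<close>

lemma cubic_L2:
  fixes f0 f1 E A A' \<beta> \<beta>' :: "'s::signature gq"
  assumes p: "f0 \<in> pts" "f1 \<in> pts" and C: "E + A = r *\<^sub>R 1 + \<beta>" "E + A' = r *\<^sub>R 1 + \<beta>'"
    and \<beta>: "sc \<beta> = 0" "sc \<beta>' = 0" "dot \<beta> f0 = l" "dot \<beta>' f1 = l"
    and step: "A' - A = E * (f1 * f0) - f1 * f0 * E"
  shows "- (f1 * A' * f1) - A' * (f1 * f0) = - (f0 * A * f0) - f1 * f0 * A"
proof -
  note [simp] = pts_D[OF p(1)] pts_D[OF p(2)]
  have A: "A = r *\<^sub>R 1 + \<beta> - E" "A' = r *\<^sub>R 1 + \<beta>' - E"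
    using C by (simp_all add: algebra_simps)
  have a: "\<beta> * f0 = - (f0 * \<beta>) - (2 * l) *\<^sub>R 1" "\<beta>' * f1 = - (f1 * \<beta>') - (2 * l) *\<^sub>R 1"
    using mult_anticommute[OF \<beta>(1), of f0] mult_anticommute[OF \<beta>(2), of f1] \<beta> by simp_all
  have a': "\<beta> * (f0 * z) = - (f0 * (\<beta> * z)) - (2 * l) *\<^sub>R z" "\<beta>' * (f1 * z) = - (f1 * (\<beta>' * z)) - (2 * l) *\<^sub>R z" for z
    using arg_cong[OF a(1), of "\<lambda>y. y * z"] arg_cong[OF a(2), of "\<lambda>y. y * z"]
    by (simp_all add: mult.assoc left_diff_distrib)
  have \<beta>': "\<beta>' = \<beta> + E * (f1 * f0) - f1 * f0 * E"
    using step unfolding A by (simp add: algebra_simps)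
  have "f1 * (\<beta>' * f0) = f1 * ((\<beta> + E * (f1 * f0) - f1 * f0 * E) * f0)"
    by (subst \<beta>') simp
  then have e: "f1 * (\<beta>' * f0) = f1 * (\<beta> * f0) - f1 * E * f1 + f0 * E * f0"
    by (simp add: algebra_simps)
  have "- (f1 * A' * f1) - A' * (f1 * f0) + f0 * A * f0 + f1 * f0 * A = 0"
    unfolding A by (simp add: algebra_simps a a' e) (simp add: \<beta>' algebra_simps)
  then show ?thesis
    by (simp add: algebra_simps)
qed

lemma cubic_bfly:
  fixes f0 f1 E A A' g0 g1 :: "'s::signature gq"
  assumes p: "f0 \<in> pts" "f1 \<in> pts" "g0 \<in> pts" "g1 \<in> pts"
    and step: "A' - A = E * (f1 * f0) - f1 * f0 * E"
    and L2: "- (f1 * A' * f1) - A' * (f1 * f0) = - (f0 * A * f0) - f1 * f0 * A"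
    and x: "dot g0 f0 = x" and n: "nrm (E + f1 * A' * f1 - (2 * x) *\<^sub>R (f1 * E * f1)) \<noteq> 0"
    and R: "(E + f0 * A * f0 - (2 * x) *\<^sub>R (f0 * E * f0)) * - (g0 * f0)
        = A + (2 * x) *\<^sub>R (f0 * A * f0) + (1 - 4 * x\<^sup>2) *\<^sub>R (f0 * E * f0)"
      "(E + f1 * A' * f1 - (2 * x) *\<^sub>R (f1 * E * f1)) * - (g1 * f1)
        = A' + (2 * x) *\<^sub>R (f1 * A' * f1) + (1 - 4 * x\<^sup>2) *\<^sub>R (f1 * E * f1)"
  shows "bfly f0 f1 g1 g0"
proof (rule bfly_of_factor)
  note [simp] = pts_D[OF p(1)] pts_D[OF p(2)]
  define u where "u = - (f1 * f0)"
  define a2 a3 a2' a3' where "a2 = - (f0 * A * f0)" and "a3 = - (f0 * E * f0)"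
    and "a2' = - (f1 * A' * f1)" and "a3' = - (f1 * E * f1)"
  have l1: "A' = A + u * E - E * u"
    using step by (simp add: u_def algebra_simps)
  have l2: "a2' = a2 + u * A - A' * u"
    using L2 by (simp add: u_def a2_def a2'_def algebra_simps)
  \<comment> \<open>Multiplying the linear relation by the points from both sides yields the cubic
    one; the relation of degree four follows from \<open>f * f = -1\<close>.\<close>
  have "f1 * (A' * f0) = f1 * (A * f0) + f0 * E * f0 - f1 * E * f1"
    unfolding l1 u_def by (simp add: algebra_simps)
  then have l3: "a3' = a3 + u * a2 - a2' * u"
    by (simp add: u_def a2_def a2'_def a3_def a3'_def algebra_simps)
  have l4: "a3' * u = u * a3"
    by (simp add: u_def a3_def a3'_def algebra_simps)
  have "- (g1 * f1) * (- (g0 * f0) - u) = (- (g0 * f0) - u) * - (g0 * f0)"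
  proof (rule factor_step[OF sq_of_dot[OF p(1,3) x] _ n _ R])
    show "nrm (- (g0 * f0)) \<noteq> 0"
      using p by (simp add: nrm_mult pts_D)
    define y where "y = 2 * x"
    have yy: "1 - 4 * x\<^sup>2 = 1 - y * y"
      by (simp add: y_def power2_eq_square)
    have R': "E + f1 * A' * f1 - (2 * x) *\<^sub>R (f1 * E * f1) = E - a2' + y *\<^sub>R a3'"
      "E + f0 * A * f0 - (2 * x) *\<^sub>R (f0 * E * f0) = E - a2 + y *\<^sub>R a3"
      "A + (2 * x) *\<^sub>R (f0 * A * f0) + (1 - 4 * x\<^sup>2) *\<^sub>R (f0 * E * f0) = A - y *\<^sub>R a2 + (y * y - 1) *\<^sub>R a3"
      "A' + (2 * x) *\<^sub>R (f1 * A' * f1) + (1 - 4 * x\<^sup>2) *\<^sub>R (f1 * E * f1) = A' - y *\<^sub>R a2' + (y * y - 1) *\<^sub>R a3'"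
      unfolding y_def[symmetric] yy by (simp_all add: a2_def a2'_def a3_def a3'_def algebra_simps)
    have e0: "A' + E * u = A + u * E"
      using l1 by simp
    have e: "a2' + A' * u = a2 + u * A" "a3' + a2' * u = a3 + u * a2"
      using l2 l3 by simp_all
    show "1 *\<^sub>R (E + f1 * A' * f1 - (2 * x) *\<^sub>R (f1 * E * f1))
        - (A' + (2 * x) *\<^sub>R (f1 * A' * f1) + (1 - 4 * x\<^sup>2) *\<^sub>R (f1 * E * f1)) * u
      = 1 *\<^sub>R (E + f0 * A * f0 - (2 * x) *\<^sub>R (f0 * E * f0))
        - u * (A + (2 * x) *\<^sub>R (f0 * A * f0) + (1 - 4 * x\<^sup>2) *\<^sub>R (f0 * E * f0))"
    proof -
      have "E - a2' + y *\<^sub>R a3' - (A' - y *\<^sub>R a2' + (y * y - 1) *\<^sub>R a3') * u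
        = E - (a2' + A' * u) + y *\<^sub>R (a3' + a2' * u) - (y * y - 1) *\<^sub>R (a3' * u)"
        by (simp add: algebra_simps)
      also have "\<dots> = E - a2 + y *\<^sub>R a3 - u * (A - y *\<^sub>R a2 + (y * y - 1) *\<^sub>R a3)"
        unfolding e l4 by (simp add: algebra_simps)
      finally show ?thesis
        unfolding R' by simp
    qed
    show "1 *\<^sub>R (A' + (2 * x) *\<^sub>R (f1 * A' * f1) + (1 - 4 * x\<^sup>2) *\<^sub>R (f1 * E * f1)
          + (E + f1 * A' * f1 - (2 * x) *\<^sub>R (f1 * E * f1)) * u)
        - (2 * x) *\<^sub>R ((A' + (2 * x) *\<^sub>R (f1 * A' * f1) + (1 - 4 * x\<^sup>2) *\<^sub>R (f1 * E * f1)) * u)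
      = 1 *\<^sub>R (A + (2 * x) *\<^sub>R (f0 * A * f0) + (1 - 4 * x\<^sup>2) *\<^sub>R (f0 * E * f0)
          + u * (E + f0 * A * f0 - (2 * x) *\<^sub>R (f0 * E * f0)))
        - (2 * x) *\<^sub>R (u * (A + (2 * x) *\<^sub>R (f0 * A * f0) + (1 - 4 * x\<^sup>2) *\<^sub>R (f0 * E * f0)))"
    proof -
      have "A' - y *\<^sub>R a2' + (y * y - 1) *\<^sub>R a3' + (E - a2' + y *\<^sub>R a3') * u
          - y *\<^sub>R ((A' - y *\<^sub>R a2' + (y * y - 1) *\<^sub>R a3') * u)
        = A' + E * u - y *\<^sub>R (a2' + A' * u) + (y * y - 1) *\<^sub>R (a3' + a2' * u)
          + (y *\<^sub>R (a3' * u) + y *\<^sub>R (a3' * u) - (y * (y * y)) *\<^sub>R (a3' * u))"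
        by (simp add: algebra_simps)
      also have "\<dots> = A - y *\<^sub>R a2 + (y * y - 1) *\<^sub>R a3 + u * (E - a2 + y *\<^sub>R a3)
          - y *\<^sub>R (u * (A - y *\<^sub>R a2 + (y * y - 1) *\<^sub>R a3))"
        unfolding e e0 l4 by (simp add: algebra_simps)
      finally show ?thesis
        unfolding R' unfolding y_def[symmetric] by simp
    qed
  qed simp
  then show "- (g1 * f1) * (- (g0 * f0) + f1 * f0) = (- (g0 * f0) + f1 * f0) * - (g0 * f0)"
    by (simp add: u_def)
qed (use p in auto)

section \<open>Real roots for large parameters\<close>

lemma eventually_quadratic_pos: "K > 0 \<Longrightarrow> \<forall>\<^sub>F e in at_top. K * e\<^sup>2 + L > (0::real)"
proof -
  assume K: "K > 0"
  have "K * e\<^sup>2 + L > 0" if e: "e > max 1 (\<bar>L\<bar> / K)" for e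
  proof -
    have "\<bar>L\<bar> < K * e"
      using e K by (simp add: field_simps)
    also have "K * e \<le> K * e\<^sup>2"
      using e K by (simp add: power2_eq_square)
    finally show ?thesis
      by linarith
  qed
  then show ?thesis
    by (rule eventually_mono[OF eventually_gt_at_top])
qed

lemma eventually_quadratic_nonzero: "K \<noteq> 0 \<Longrightarrow> \<forall>\<^sub>F e in at_top. K * e\<^sup>2 + L \<noteq> (0::real)"
  using eventually_quadratic_pos[of K L] eventually_quadratic_pos[of "- K" "- L"]
  by (cases "K > 0") (auto elim!: eventually_mono)

lemma cubic_pos_at_top:
  fixes p3 :: real
  assumes "p3 > 0"
  obtains z where "z > M" "p3 * z^3 + p2 * z\<^sup>2 + p1 * z + p0 > 0"
proof -
  define S where "S = \<bar>p2\<bar> + \<bar>p1\<bar> + \<bar>p0\<bar>"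
  define z where "z = 1 + \<bar>M\<bar> + S / p3"
  have z1: "z \<ge> 1" "z > M"
  proof -
    have "S / p3 \<ge> 0"
      using assms by (simp add: S_def)
    then show "z \<ge> 1" "z > M"
      unfolding z_def by linarith+
  qed
  then have zz: "1 \<le> z\<^sup>2" "z \<le> z\<^sup>2"
    by (simp_all add: power2_eq_square mult_ge1_I)
  have "p3 * z = p3 + p3 * \<bar>M\<bar> + S"
    using assms by (simp add: z_def field_simps)
  moreover have "p3 * \<bar>M\<bar> \<ge> 0"
    using assms by simp
  ultimately have "S < p3 * z"
    using assms by linarith
  then have "S * z\<^sup>2 < p3 * z * z\<^sup>2"
    using z1 by simp
  moreover have "- (S * z\<^sup>2) \<le> p2 * z\<^sup>2 + p1 * z + p0"
  proof -
    have "- (\<bar>p2\<bar> * z\<^sup>2) \<le> p2 * z\<^sup>2"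
      using mult_right_mono[of "- p2" "\<bar>p2\<bar>" "z\<^sup>2"] abs_ge_minus_self[of p2] by simp
    moreover have "- (\<bar>p1\<bar> * z\<^sup>2) \<le> p1 * z"
    proof -
      have "- (p1 * z) \<le> \<bar>p1\<bar> * z"
        using mult_right_mono[of "- p1" "\<bar>p1\<bar>" z] abs_ge_minus_self[of p1] z1 by simp
      also have "\<dots> \<le> \<bar>p1\<bar> * z\<^sup>2"
        using zz by (intro mult_left_mono) auto
      finally show ?thesis
        by simp
    qed
    moreover have "- (\<bar>p0\<bar> * z\<^sup>2) \<le> p0"
    proof -
      have "\<bar>p0\<bar> * 1 \<le> \<bar>p0\<bar> * z\<^sup>2"
        using zz by (intro mult_left_mono) auto
      then show ?thesis
        by simp
    qed
    ultimately show ?thesis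
      by (simp add: S_def algebra_simps)
  qed
  ultimately have "p3 * z^3 + p2 * z\<^sup>2 + p1 * z + p0 > 0"
    by (simp add: power3_eq_cube power2_eq_square algebra_simps)
  then show thesis
    using that z1 by blast
qed

text \<open>The relations of Vieta, derived from divided differences at the three distinct
  roots.\<close>

lemma cubic_split:
  fixes p3 :: real
  assumes r: "\<And>z. z \<in> {r1, r2, r3} \<Longrightarrow> p3 * z^3 + p2 * z\<^sup>2 + p1 * z + p0 = 0"
    and d: "r1 \<noteq> r2" "r1 \<noteq> r3" "r2 \<noteq> r3"
  shows "p2 = - p3 * (r1 + r2 + r3)" "p1 = p3 * (r1 * r2 + r1 * r3 + r2 * r3)" "p0 = - p3 * (r1 * r2 * r3)"
proof -
  have "(r1 - r2) * (p3 * (r1\<^sup>2 + r1 * r2 + r2\<^sup>2) + p2 * (r1 + r2) + p1) = 0"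
    using r[of r1] r[of r2] by (simp add: algebra_simps power2_eq_square power3_eq_cube)
  then have e12: "p3 * (r1\<^sup>2 + r1 * r2 + r2\<^sup>2) + p2 * (r1 + r2) + p1 = 0"
    using d by simp
  have "(r1 - r3) * (p3 * (r1\<^sup>2 + r1 * r3 + r3\<^sup>2) + p2 * (r1 + r3) + p1) = 0"
    using r[of r1] r[of r3] by (simp add: algebra_simps power2_eq_square power3_eq_cube)
  then have "p3 * (r1\<^sup>2 + r1 * r3 + r3\<^sup>2) + p2 * (r1 + r3) + p1 = 0"
    using d by simp
  with e12 have "(r2 - r3) * (p3 * (r1 + r2 + r3) + p2) = 0"
    by (simp add: algebra_simps power2_eq_square)
  then show 2: "p2 = - p3 * (r1 + r2 + r3)"
    using d by simp
  have "p1 = - p3 * (r1\<^sup>2 + r1 * r2 + r2\<^sup>2) - p2 * (r1 + r2)"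
    using e12 by simp
  then show 1: "p1 = p3 * (r1 * r2 + r1 * r3 + r2 * r3)"
    unfolding 2 by (simp add: algebra_simps power2_eq_square)
  have "p0 = - (p3 * r1^3 + p2 * r1\<^sup>2 + p1 * r1)"
    using r[of r1] by simp
  then show "p0 = - p3 * (r1 * r2 * r3)"
    unfolding 2 1 by (simp add: algebra_simps power2_eq_square power3_eq_cube)
qed

lemma IVT_strict:
  fixes f :: "real \<Rightarrow> real"
  assumes "a < b" "f a * f b < 0" "continuous_on UNIV f"
  obtains z where "a < z" "z < b" "f z = 0"
proof -
  have c: "continuous_on {a..b} f"
    using assms(3) continuous_on_subset by blast
  consider "f a < 0" "0 < f b" | "f b < 0" "0 < f a"
    using assms(2) by (auto simp: mult_less_0_iff)
  then obtain z where "a \<le> z" "z \<le> b" "f z = 0"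
    using IVT'[of f a 0 b] IVT2'[of f b 0 a] c assms(1) by (metis less_imp_le)
  moreover have "z \<noteq> a" "z \<noteq> b"
    using assms(2) calculation(3) by auto
  ultimately show thesis
    using that by (metis less_le)
qed

lemma cubic_three_roots:
  fixes p3 p2 p1 p0 :: real
  defines "D \<equiv> \<lambda>z. p3 * z^3 + p2 * z\<^sup>2 + p1 * z + p0"
  assumes p3: "p3 > 0" and uv: "u < v" "D u > 0" "D v < 0"
  obtains r1 r2 r3 where "r1 < r2" "r2 < r3" "D r1 = 0" "D r2 = 0" "D r3 = 0"
proof -
  obtain z where z: "z > v" "D z > 0"
    using cubic_pos_at_top[OF p3] unfolding D_def by blast
  obtain y where y: "y > - u" "p3 * y^3 + (- p2) * y\<^sup>2 + p1 * y + (- p0) > 0"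
    by (rule cubic_pos_at_top[OF p3])
  then have y': "- y < u" "D (- y) < 0"
    by (simp_all add: D_def)
  have c: "continuous_on UNIV D"
    unfolding D_def by (intro continuous_intros)
  obtain r1 where r1: "- y < r1" "r1 < u" "D r1 = 0"
    using IVT_strict[OF y'(1) _ c] y' uv by (auto simp: mult_neg_pos)
  obtain r2 where r2: "u < r2" "r2 < v" "D r2 = 0"
    using IVT_strict[OF uv(1) _ c] uv by (auto simp: mult_pos_neg)
  obtain r3 where r3: "v < r3" "r3 < z" "D r3 = 0"
    using IVT_strict[OF z(1) _ c] z uv by (auto simp: mult_neg_pos)
  show thesis
    using that[of r1 r2 r3] r1 r2 r3 by simp
qed

text \<open>For large \<open>e\<close> the dominant term \<open>e\<^sup>2 (z - w) (z - z0)\<^sup>2\<close> has a double root, which the condition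
  on \<open>q\<close> splits into two real ones.\<close>

lemma perturbed_cubic_roots:
  fixes q3 q2 q1 q0 z0 w cc :: real
  defines "q \<equiv> \<lambda>z. q3 * z^3 + q2 * z\<^sup>2 + q1 * z + q0"
  assumes z0: "(z0 - w) * q z0 < 0" and cc: "cc \<noteq> w"
  obtains e r1 r2 r3 where "e > 0" "e\<^sup>2 + q3 > 0" "r1 < r2" "r2 < r3"
    "\<And>z. e\<^sup>2 * (z - w) * (z - z0)\<^sup>2 + q z = (e\<^sup>2 + q3) * (z - r1) * (z - r2) * (z - r3)"
    "e\<^sup>2 * (cc - w) * (cc - z0)\<^sup>2 + q cc \<noteq> 0"
proof -
  \<comment> \<open>Halfway between \<open>z0\<close> and \<open>w\<close> the dominant term has the
    sign of \<open>z0 - w\<close>. At \<open>z0\<close> it vanishes, and there the value of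
    \<open>q\<close> has the opposite sign.\<close>
  define zm where "zm = (z0 + w) / 2"
  have zm: "zm - w = (z0 - w) / 2" "(zm - z0)\<^sup>2 = ((z0 - w) / 2)\<^sup>2"
    by (simp_all add: zm_def field_simps power2_eq_square)
  have z0w: "z0 \<noteq> w"
    using z0 by auto
  have "\<forall>\<^sub>F e in at_top. e > 0 \<and> 1 * e\<^sup>2 + q3 > 0 \<and> (z0 - w)^4 / 8 * e\<^sup>2 + (z0 - w) * q zm > 0
      \<and> e\<^sup>2 * (cc - w) * (cc - z0)\<^sup>2 + q cc \<noteq> 0"
  proof (intro eventually_conj)
    \<comment> \<open>In the applications \<open>cc\<close> is the value belonging to the edge
      length of the curve, which must not become a root.\<close>
    show "\<forall>\<^sub>F e in at_top. e\<^sup>2 * (cc - w) * (cc - z0)\<^sup>2 + q cc \<noteq> 0"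
    proof (cases "cc = z0")
      case True
      then show ?thesis
        using z0 by auto
    next
      case False
      then have "\<forall>\<^sub>F e in at_top. ((cc - w) * (cc - z0)\<^sup>2) * e\<^sup>2 + q cc \<noteq> 0"
        using cc by (intro eventually_quadratic_nonzero) auto
      then show ?thesis
        by (simp add: mult_ac)
    qed
    show "\<forall>\<^sub>F e in at_top. (z0 - w)^4 / 8 * e\<^sup>2 + (z0 - w) * q zm > 0"
      using z0w by (intro eventually_quadratic_pos) (simp add: zero_less_power_eq)
    show "\<forall>\<^sub>F e in at_top. 1 * e\<^sup>2 + q3 > 0"
      by (rule eventually_quadratic_pos) simp
  qed (rule eventually_gt_at_top)
  then obtain e where e: "e > 0" "e\<^sup>2 + q3 > 0" "(z0 - w)^4 / 8 * e\<^sup>2 + (z0 - w) * q zm > 0"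
      and ecc: "e\<^sup>2 * (cc - w) * (cc - z0)\<^sup>2 + q cc \<noteq> 0"
    using eventually_happens by force
  define p2 p1 p0 where "p2 = q2 - e\<^sup>2 * (w + 2 * z0)" and "p1 = q1 + e\<^sup>2 * (z0\<^sup>2 + 2 * z0 * w)"
    and "p0 = q0 - e\<^sup>2 * w * z0\<^sup>2"
  define D where "D z = (e\<^sup>2 + q3) * z^3 + p2 * z\<^sup>2 + p1 * z + p0" for z
  have D: "D z = e\<^sup>2 * (z - w) * (z - z0)\<^sup>2 + q z" for z
    by (simp add: D_def q_def p2_def p1_def p0_def algebra_simps power2_eq_square power3_eq_cube)
  have "(z0 - w) * D z0 < 0"
    using z0 by (simp add: D)
  moreover have "(z0 - w) * D zm > 0"
  proof -
    have "(z0 - w) * D zm = (z0 - w)^4 / 8 * e\<^sup>2 + (z0 - w) * q zm"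
      unfolding D zm by (simp add: field_simps power2_eq_square power4_eq_xxxx)
    then show ?thesis
      using e(3) by simp
  qed
  moreover have "zm < z0" if "z0 > w"
    using that by (simp add: zm_def)
  moreover have "z0 < zm" if "z0 < w"
    using that by (simp add: zm_def)
  ultimately obtain u v where "u < v" "D u > 0" "D v < 0"
    using z0w by (cases "z0 > w") (auto simp: mult_less_0_iff zero_less_mult_iff)
  then obtain r1 r2 r3 where r: "r1 < r2" "r2 < r3" "D r1 = 0" "D r2 = 0" "D r3 = 0"
    using cubic_three_roots[OF e(2), of u v p2 p1 p0] unfolding D_def by blast
  have V: "p2 = - (e\<^sup>2 + q3) * (r1 + r2 + r3)" "p1 = (e\<^sup>2 + q3) * (r1 * r2 + r1 * r3 + r2 * r3)"
    "p0 = - (e\<^sup>2 + q3) * (r1 * r2 * r3)"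
    using r by (intro cubic_split; auto simp: D_def)+
  show thesis
  proof (rule that[OF e(1,2) r(1,2) _ ecc])
    show "e\<^sup>2 * (z - w) * (z - z0)\<^sup>2 + q z = (e\<^sup>2 + q3) * (z - r1) * (z - r2) * (z - r3)" for z
      unfolding D[symmetric] D_def V by (simp add: algebra_simps power2_eq_square power3_eq_cube)
  qed
qed

lemma quadratic_neg_value:
  fixes A B C :: real
  assumes "B\<^sup>2 - 4 * A * C > 0"
  obtains z where "A * z\<^sup>2 + B * z + C < 0"
proof (cases "A > 0")
  case True
  have "A * (- B / (2 * A))\<^sup>2 + B * (- B / (2 * A)) + C = - (B\<^sup>2 - 4 * A * C) / (4 * A)"
    using True by (simp add: field_simps power2_eq_square)
  also have "\<dots> < 0"
    using True assms by (simp add: divide_neg_pos)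
  finally show thesis
    by (rule that)
next
  case False
  show thesis
  proof (cases "B = 0")
    case B: True
    then have "A < 0"
      using False assms by (cases "A = 0") auto
    then have "\<forall>\<^sub>F z in at_top. (- A) * z\<^sup>2 + (- C) > 0"
      by (intro eventually_quadratic_pos) simp
    then obtain z where "(- A) * z\<^sup>2 + (- C) > 0"
      using eventually_happens by force
    then show thesis
      using that[of z] B by simp
  next
    case B: False
    \<comment> \<open>As \<open>A \<le> 0\<close>, the quadratic term cannot hurt and the linear
      term alone outweighs \<open>C\<close>.\<close>
    define z where "z = - (\<bar>C\<bar> + 1) / B"
    have "A * z\<^sup>2 \<le> 0"
      using False by (simp add: mult_nonpos_nonneg)
    moreover have "B * z = - (\<bar>C\<bar> + 1)"
      using B by (simp add: z_def)
    ultimately show thesis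
      using that[of z] by linarith
  qed
qed

text \<open>For large \<open>e\<close> the product \<open>x * y\<close> becomes negative, so both
  roots are real. They avoid \<open>c\<close> because the value of the polynomial at
  \<open>c\<close> is quadratic in \<open>e\<close> with a nonzero leading coefficient.\<close>

lemma quadratic_split_large:
  fixes N m j c :: real
  assumes c: "1 - c\<^sup>2 \<noteq> 0"
  obtains e x y where "e > 0" "e\<^sup>2 + N > 0" "m = (e\<^sup>2 + N) * (x + y)" "j - 4 * e\<^sup>2 = 4 * (e\<^sup>2 + N) * (x * y)"
    "x \<noteq> c" "y \<noteq> c"
proof -
  have "\<forall>\<^sub>F e in at_top. e > 0 \<and> 1 * e\<^sup>2 + N > 0 \<and> 4 * e\<^sup>2 + (- j) > 0
      \<and> (- (4 * (1 - c\<^sup>2))) * e\<^sup>2 + (4 * N * c\<^sup>2 - 4 * m * c + j) \<noteq> 0"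
    using c by (intro eventually_conj eventually_quadratic_pos eventually_quadratic_nonzero eventually_gt_at_top) auto
  then obtain e where e: "e > 0" "e\<^sup>2 + N > 0" "4 * e\<^sup>2 - j > 0"
      "- (4 * (1 - c\<^sup>2)) * e\<^sup>2 + (4 * N * c\<^sup>2 - 4 * m * c + j) \<noteq> 0"
    using eventually_happens by force
  define n where "n = e\<^sup>2 + N"
  have n: "n > 0"
    using e by (simp add: n_def)
  define R where "R = sqrt (m\<^sup>2 + n * (4 * e\<^sup>2 - j))"
  have R: "R\<^sup>2 = m\<^sup>2 + n * (4 * e\<^sup>2 - j)"
    using e n by (simp add: R_def)
  define x y where "x = (m + R) / (2 * n)" and "y = (m - R) / (2 * n)"
  have m: "m = n * (x + y)" and j: "j - 4 * e\<^sup>2 = 4 * n * (x * y)"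
  proof -
    show "m = n * (x + y)"
      using n by (simp add: x_def y_def field_simps)
    have "4 * n * (n * (x * y)) = m\<^sup>2 - R\<^sup>2"
      using n by (simp add: x_def y_def field_simps power2_eq_square)
    then have "n * (4 * n * (x * y)) = n * (j - 4 * e\<^sup>2)"
      unfolding R by (simp add: algebra_simps)
    then show "j - 4 * e\<^sup>2 = 4 * n * (x * y)"
      using n by simp
  qed
  have "- (4 * (1 - c\<^sup>2)) * e\<^sup>2 + (4 * N * c\<^sup>2 - 4 * m * c + j) = 4 * n * c\<^sup>2 - 4 * c * m + (j - 4 * e\<^sup>2)"
    by (simp add: n_def algebra_simps)
  also have "\<dots> = 4 * n * ((c - x) * (c - y))"
    unfolding m j by (simp add: algebra_simps power2_eq_square)
  finally have "x \<noteq> c" "y \<noteq> c"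
    using e(4) by auto
  then show thesis
    using that e m j unfolding n_def by blast
qed

section \<open>Construction of invariant sequences\<close>

text \<open>The identity transformation is the case \<open>x = 1\<close>. The value \<open>c\<close>
  is excluded since opposite vertices would coincide, \<open>-1\<close> since corresponding points
  would be antipodal.\<close>

definition gback :: "real \<Rightarrow> (int \<Rightarrow> 's::signature gq) \<Rightarrow> (int \<Rightarrow> 's gq) \<Rightarrow> bool" where
  "gback c F G \<longleftrightarrow> gcurve c F \<and> (\<forall>k. G k \<in> pts \<and> bfly (F k) (F (k + 1)) (G (k + 1)) (G k))
     \<and> (\<exists>x. x \<noteq> c \<and> x \<noteq> -1 \<and> (\<forall>k. dot (G k) (F k) = x))"

lemma gback_gcurve: "gback c F G \<Longrightarrow> gcurve c G"
  using transform.gcurve_G[of c F G]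
  unfolding gback_def transform_def transform_axioms_def curve_def by blast

text \<open>The linear coefficients of the two exchange relations add up to \<open>step\<close>.
  Once the first butterfly is known, subtracting it leaves the second.\<close>

lemma quadratic_second:
  fixes f0 f1 h0 h1 E A A' g0 g1 k0 k1 :: "'s::signature gq"
  assumes E: "nrm E \<noteq> 0" and k: "E * k0 = h0 * E" "E * k1 = h1 * E"
    and A: "A = - (E * g0 * f0) - h0 * E * g0" "A' = - (E * g1 * f1) - h1 * E * g1"
    and step: "A' - A = E * (f1 * f0) - h1 * h0 * E" and b: "bfly f0 f1 g1 g0"
  shows "bfly g0 g1 k1 k0"
proof -
  have k': "E * (k0 * z) = h0 * (E * z)" "E * (k1 * z) = h1 * (E * z)" for z
    using k by (simp_all add: mult.assoc[symmetric])
  have "E * (g1 * g0) - E * (g1 * f1) - E * (f1 * f0) + E * (g0 * f0) = E * (g1 * (g0 - f1) - (f1 - g0) * f0)"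
    by (simp add: algebra_simps)
  also have "\<dots> = 0"
    using b by (simp add: bfly_def)
  finally have e1: "E * (g1 * g0) - E * (g1 * f1) - E * (f1 * f0) + E * (g0 * f0) = 0" .
  have e2: "E * (f1 * f0) = - (E * (g1 * f1)) - h1 * (E * g1) + E * (g0 * f0) + h0 * (E * g0) + h1 * (h0 * E)"
    using step unfolding A by (simp add: algebra_simps)
  have "E * (k1 * (k0 - g1)) = E * ((g1 - k0) * g0)"
    using e1 unfolding e2 by (simp add: algebra_simps k k')
  then show ?thesis
    unfolding bfly_def using nrm_cancel_left[OF E] by blast
qed

text \<open>The points \<open>Fh\<close> are the conjugates of the final curve \<open>H\<close> by
  \<open>E\<close>. For n = 2 they are \<open>- F\<close>; in the second stage of n = 3 they are the
  points of the curve before the first splitting.\<close>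

lemma two_step:
  fixes F Fh A :: "int \<Rightarrow> 's::signature gq" and E :: "'s gq"
  assumes FC: "gcurve c F" and Fh: "\<And>k. Fh k \<in> pts" and E: "nrm E = n0" "n0 \<noteq> 0"
    and sym: "\<And>k. Fh k * A k = A k * F k"
    and step: "\<And>k. A (k + 1) - A k = E * (F (k + 1) * F k) - Fh (k + 1) * Fh k * E"
    and c1: "\<And>k. dot E (A k) = n0 * (x + y)"
    and c2: "\<And>k. nrm (A k) - 2 * dot E (Fh k * E * F k) = n0 * (2 + 4 * x * y)"
    and R: "\<And>k. nrm (E + Fh k * E * F k) \<noteq> 0" and xy: "x \<noteq> c" "x \<noteq> -1" "y \<noteq> c" "y \<noteq> -1"
    and H: "\<And>k. H k \<in> pts" "\<And>k. E * H k = Fh k * E"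
  obtains G where "gback c F G" "gback c G H" "\<And>k. A k = - (E * G k * F k) - Fh k * E * G k"
proof -
  interpret curve c F
    by (rule curve.intro[OF FC])
  have "\<exists>g. g \<in> pts \<and> dot g (F k) = x \<and> A k = - (E * g * F k) - Fh k * E * g \<and>
      (E + Fh k * E * F k) * - (g * F k) = A k + (2 * x) *\<^sub>R (Fh k * E * F k)" for k
    using quadratic_factor[OF F(1)[of k] Fh[of k] E(1) sym c1 c2 R] by blast
  then obtain G where G: "\<And>k. G k \<in> pts" "\<And>k. dot (G k) (F k) = x"
      and A: "\<And>k. A k = - (E * G k * F k) - Fh k * E * G k"
      and v: "\<And>k. (E + Fh k * E * F k) * - (G k * F k) = A k + (2 * x) *\<^sub>R (Fh k * E * F k)"
    by metis
  have b: "bfly (F k) (F (k + 1)) (G (k + 1)) (G k)" for k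
    by (rule quadratic_bfly[OF F(1) F(1) Fh Fh G(1) G(1) sym sym step G(2) R v v])
  have FG: "gback c F G"
    unfolding gback_def using FC G b xy by blast
  have "dot (H k) (G k) = y" for k
  proof -
    have EH: "Fh k * E * G k = E * (H k * G k)"
      using H(2)[of k] by (simp add: mult.assoc[symmetric])
    have neg: "sc (p * q) = - dot p q" if "q \<in> pts" for p q :: "'s gq"
      using that by (simp add: dot_def pts_D)
    have "dot E (E * z) = n0 * sc z" for z
      using dot_mult_mult(1)[of E 1 z] E by simp
    then have "n0 * (x + y) = n0 * x + n0 * dot (H k) (G k)"
      using c1[of k] G(2)[of k] unfolding A EH by (simp add: mult.assoc neg G(1))
    then show ?thesis
      using E(2) by (simp add: distrib_left)
  qed
  moreover have "bfly (G k) (G (k + 1)) (H (k + 1)) (H k)" for k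
    by (rule quadratic_second[OF _ H(2) H(2) A A step b]) (use E in simp)
  ultimately have "gback c G H"
    unfolding gback_def using gback_gcurve[OF FG] H(1) xy by blast
  then show thesis
    using that FG A by blast
qed

context curve_data
begin

lemma scaled_pts:
  assumes E: "nrm E \<noteq> 0" and P: "P \<in> pts"
  obtains H where "H \<in> pts" "E * H = P * E"
proof (rule that)
  let ?H = "(1 / nrm E) *\<^sub>R (star E * (P * E))"
  show "E * ?H = P * E"
    using E by simp
  have "sc (star E * (P * E)) = 0"
    using sc_cyclic[of "star E" P E] sc_cyclic[of P E "star E"] P by (simp add: mult.assoc mult_star pts_D)
  moreover have "nrm (star E) = nrm E"
    by simp
  ultimately show "?H \<in> pts"
    using E P by (simp add: pts_def nrm_mult)
qed

text \<open>The trace-free data \<open>a\<close> and \<beta> are fixed and only the scalar part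
  \<open>e\<close> of \<open>E\<close> is free. It enters the determinant through
  \<open>e^2\<close>, and a large value makes both quadratic factors real.\<close>

lemma exists_two:
  assumes l: "l = 0" and ne: "2 *\<^sub>R a - (2 * h k0) *\<^sub>R F k0 + \<beta> k0 \<noteq> 0"
  obtains e G H where "nrm (e *\<^sub>R 1 + a) \<noteq> 0" "gback c F G" "gback c G H"
    "\<And>k. (e *\<^sub>R 1 + a) * H k = - (F k * (e *\<^sub>R 1 + a))"
    "\<And>k. \<beta> k = - ((e *\<^sub>R 1 + a) * G k * F k) - (e *\<^sub>R 1 + a) * H k * G k"
proof -
  define m j where "m = dot a (\<beta> 0)" and "j = nrm (\<beta> 0) - 4 * (h 0)\<^sup>2"
  have m: "dot a (\<beta> k) = m" and j: "nrm (\<beta> k) = j + 4 * (h k)\<^sup>2" for k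
    using a_\<beta>_const[of k] nrm_\<beta>_const[of k] by (simp_all add: l m_def j_def)
  obtain e x y where e: "e > 0" "e\<^sup>2 + nrm a > 0" and xy: "m = (e\<^sup>2 + nrm a) * (x + y)"
      "j - 4 * e\<^sup>2 = 4 * (e\<^sup>2 + nrm a) * (x * y)" "x \<noteq> c" "y \<noteq> c"
    by (rule quadratic_split_large[OF c(5)])
  define n where "n = e\<^sup>2 + nrm a"
  define E where "E = e *\<^sub>R 1 + a"
  have E: "nrm E = n"
    by (simp add: E_def n_def a power2_eq_square)
  have n: "n \<noteq> 0"
    using e by (simp add: n_def)
  have FEF: "F k * E * F k = (- e) *\<^sub>R 1 + a - (2 * h k) *\<^sub>R F k" for k
  proof -
    have "a * F k = - (F k * a) - (2 * h k) *\<^sub>R 1"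
      using mult_anticommute[OF a, of "F k"] by simp
    then show ?thesis
      by (simp add: E_def distrib_left distrib_right mult.assoc right_diff_distrib)
  qed
  have EFEF: "dot E (F k * E * F k) = - e\<^sup>2 + nrm a - 2 * (h k)\<^sup>2" for k
    unfolding FEF by (simp add: E_def a power2_eq_square)
  \<comment> \<open>At \<lambda> = 1 the polynomial equals \<open>Z\<close>, and its determinant is
    the product of \<open>n\<close> and the two values \<open>2 * (1 + x)\<close>,
    \<open>2 * (1 + y)\<close>. As \<open>Z\<close> is tangent, it has nonzero norm.\<close>
  have x1: "x \<noteq> -1 \<and> y \<noteq> -1"
  proof -
    define Z where "Z = 2 *\<^sub>R a - (2 * h k0) *\<^sub>R F k0 + \<beta> k0"
    have "nrm Z \<noteq> 0"
      using plane_nrm(2)[OF F(1), of Z k0] ne by (auto simp: Z_def a sc_\<beta> \<beta>_F l)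
    moreover have "nrm Z = 4 * nrm a - 8 * (h k0)\<^sup>2 + 4 * (h k0)\<^sup>2 + nrm (\<beta> k0) + 4 * m"
      using m[of k0] \<beta>_F[of k0] l
      by (simp add: Z_def dot_commute[of "\<beta> k0" a] dot_commute[of "F k0" a] dot_commute[of "F k0" "\<beta> k0"]
          power2_eq_square algebra_simps)
    ultimately have "4 * nrm a + 4 * m + j \<noteq> 0"
      unfolding j by simp
    moreover have "4 * nrm a + 4 * m + j = 4 * n * ((1 + x) * (1 + y))"
      using xy(1,2) unfolding n_def[symmetric] by (simp add: n_def algebra_simps)
    ultimately show ?thesis
      by auto
  qed
  have "\<exists>H. H \<in> pts \<and> E * H = - F k * E" for k
  proof -
    have "- F k \<in> pts"
      by (simp add: pts_def)
    then show ?thesis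
      using scaled_pts[of E "- F k"] n E by metis
  qed
  then obtain H where H: "\<And>k. H k \<in> pts" "\<And>k. E * H k = - F k * E"
    by metis
  obtain G where G: "gback c F G" "gback c G H" "\<And>k. \<beta> k = - (E * G k * F k) - - F k * E * G k"
  proof (rule two_step[OF gcurve, of "\<lambda>k. - F k" E n \<beta> x y H])
    show "- F k \<in> pts" for k
      by (simp add: pts_def)
    show "- F k * \<beta> k = \<beta> k * F k" for k
      using mult_anticommute[OF sc_\<beta>, of "F k" k] \<beta>_F[of k] by (simp add: l)
    show "\<beta> (k + 1) - \<beta> k = E * (F (k + 1) * F k) - - F (k + 1) * - F k * E" for k
      unfolding \<beta>_step edge_commutator[OF a, symmetric] by (simp add: E_def distrib_left distrib_right mult.assoc)
    show "dot E (\<beta> k) = n * (x + y)" for k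
      using m[of k] xy(1) by (simp add: E_def sc_\<beta> n_def)
    show "nrm (\<beta> k) - 2 * dot E (- F k * E * F k) = n * (2 + 4 * x * y)" for k
      using xy(2) EFEF[of k] unfolding j by (simp add: n_def algebra_simps)
    show "nrm (E + - F k * E * F k) \<noteq> 0" for k
    proof -
      have "nrm (E + - F k * E * F k) = 2 * n - 2 * dot E (F k * E * F k)"
        by (simp add: E nrm_mult dot_commute[of "F k * E * F k" E])
      also have "\<dots> = 4 * (e\<^sup>2 + (h k)\<^sup>2)"
        unfolding EFEF by (simp add: n_def)
      also have "\<dots> > 0"
        using e by (simp add: add_pos_nonneg)
      finally show ?thesis
        by simp
    qed
  qed (use E n xy x1 H in auto)
  show thesis
    by (rule that[of e G H]) (use E n G H in \<open>auto simp: E_def[symmetric]\<close>)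
qed

end

section \<open>Quotients of the cubic polynomial\<close>

lemma cubic_quotient_coeff:
  fixes f g E A :: "'s::signature gq"
  assumes p: "f \<in> pts" "g \<in> pts" "dot g f = x" and E: "nrm E = n"
    and sym: "f * (A + E * g * f) = (A + E * g * f) * g"
  shows "dot E (A + E * g * f) = dot E A - n * x"
    "nrm A - 2 * dot E (f * A * f)
      = nrm (A + E * g * f) - 2 * dot E (f * E * g) + n + 4 * x * dot E (A + E * g * f)"
proof -
  note [simp] = pts_D[OF p(1)] pts_D[OF p(2)]
  define B where "B = A + E * g * f"
  have A: "A = B - E * (g * f)"
    by (simp add: B_def mult.assoc)
  have EE: "dot E (E * z) = n * sc z" for z
    using dot_mult_mult(1)[of E 1 z] E by simp
  have "sc (g * f) = - x"
    using p(3) by (simp add: dot_def)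
  then show "dot E (A + E * g * f) = dot E A - n * x"
    by (simp add: mult.assoc EE)
  have anti: "f * g = - (g * f) - (2 * x) *\<^sub>R 1"
    using mult_anticommute[of f g] p(3) by (simp add: dot_commute[of f g])
  have "f * A * f = (f * B) * f + f * E * g"
    unfolding A by (simp add: algebra_simps)
  also have "f * B = B * g"
    using sym by (simp add: B_def)
  finally have fAf: "f * A * f = B * (g * f) + f * E * g"
    by (simp add: mult.assoc)
  have "dot E (B * (g * f)) = dot B (E * (f * g))"
    by (simp add: dot_commute[of E "B * (g * f)"] dot_mult_right)
  also have "\<dots> = - dot B (E * (g * f)) - 2 * x * dot B E"
    unfolding anti by (simp add: right_diff_distrib)
  finally have 1: "dot E (B * (g * f)) = - dot B (E * (g * f)) - 2 * x * dot B E" .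
  have "nrm A = nrm B - 2 * dot B (E * (g * f)) + n"
    unfolding A by (simp add: nrm_mult E dot_commute[of "E * (g * f)" B])
  then show "nrm A - 2 * dot E (f * A * f)
      = nrm (A + E * g * f) - 2 * dot E (f * E * g) + n + 4 * x * dot E (A + E * g * f)"
    unfolding fAf B_def[symmetric] using 1 by (simp add: dot_commute[of B E])
qed

text \<open>If the matrix were singular, the conjugate of \<open>f\<close> by \<open>E\<close> would
  be \<open>g\<close>. Then the middle coefficient divided by \<open>E\<close> commutes with
  \<open>g\<close>, so its vector part is a multiple of \<open>g\<close> and has nonnegative norm
  even in the indefinite case. This forces \<open>(y + z)^2 \<le> 4 * y * z\<close>, impossible for
  distinct roots.\<close>

lemma distinct_roots_nonparallel:
  fixes f g E B :: "'s::signature gq"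
  assumes p: "f \<in> pts" "g \<in> pts" and E: "nrm E = n" "n > 0" and sym: "f * B = B * g"
    and c1: "dot E B = n * (y + z)" and c2: "nrm B - 2 * dot E (f * E * g) = n * (2 + 4 * y * z)" and ne: "y \<noteq> z"
  shows "nrm (E + f * E * g) \<noteq> 0"
proof
  note [simp] = pts_D[OF p(1)] pts_D[OF p(2)]
  assume 0: "nrm (E + f * E * g) = 0"
  have EE: "dot (E * p) (E * q) = n * dot p q" for p q
    using E by simp
  define h where "h = (1 / n) *\<^sub>R (star E * (f * E))"
  have Eh: "E * h = f * E"
    using E by (simp add: h_def)
  have "sc (star E * (f * E)) = 0"
    using sc_cyclic[of "star E" f E] sc_cyclic[of f E "star E"] by (simp add: mult.assoc mult_star)
  moreover have "nrm (star E) = n"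
    using E by simp
  ultimately have hp: "h \<in> pts"
    using E by (simp add: pts_def h_def nrm_mult)
  have "E + f * E * g = E * (1 + h * g)"
    by (simp add: distrib_left mult.assoc[symmetric] Eh)
  also have "\<dots> = E * ((g - h) * - g)"
    by (simp add: left_diff_distrib algebra_simps)
  finally have "nrm (E + f * E * g) = n * nrm (g - h)"
    using E by (simp add: nrm_mult)
  then have "nrm (g - h) = 0"
    using 0 E by simp
  then have hg: "h = g"
    using pts_nrm_diff[OF p(2) hp] by metis
  define \<kappa> where "\<kappa> = (1 / n) *\<^sub>R (star E * B)"
  have E\<kappa>: "E * \<kappa> = B"
    using E by (simp add: \<kappa>_def)
  have "E * (g * \<kappa>) = E * (\<kappa> * g)"
    using sym Eh unfolding hg E\<kappa>[symmetric] by (simp add: mult.assoc[symmetric])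
  then have comm: "g * \<kappa> = \<kappa> * g"
    using nrm_cancel_left[of E] E by auto
  define v where "v = \<kappa> - sc \<kappa> *\<^sub>R 1"
  have v: "sc v = 0" "v * g = g * v"
    using comm by (simp_all add: v_def left_diff_distrib right_diff_distrib)
  then have "v * g = - (v * g) - (2 * dot v g) *\<^sub>R 1"
    using mult_anticommute[of v g] by simp
  then have "v * g + v * g = v * g + (- (v * g) - (2 * dot v g) *\<^sub>R 1)"
    by (rule arg_cong)
  then have "2 *\<^sub>R (v * g) = 2 *\<^sub>R (- dot v g *\<^sub>R 1)"
    by (simp add: scaleR_2[symmetric])
  then have "v * g = - dot v g *\<^sub>R 1"
    by (metis scaleR_cancel_left zero_neq_numeral)
  then have "nrm v * nrm g = (dot v g)\<^sup>2"
    using nrm_mult[of v g] by (simp add: power2_eq_square)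
  then have nv: "nrm v \<ge> 0"
    by simp
  have "\<kappa> = sc \<kappa> *\<^sub>R 1 + v"
    by (simp add: v_def)
  then have nk: "nrm \<kappa> = (sc \<kappa>)\<^sup>2 + nrm v"
    by (metis add.commute add.left_commute add_cancel_left_right dot_simps(11,12,3,4,9,10) mult_zero_right power2_eq_square sc_simps(2) v(1) mult.right_neutral)
  have "sc \<kappa> = y + z"
    using c1 EE[of 1 \<kappa>] E by (simp add: E\<kappa>)
  moreover have "nrm \<kappa> = 4 * y * z"
  proof -
    have "f * E * g = - E"
      using Eh unfolding hg by (metis mult.assoc mult_minus_right pts_D(4)[OF p(2)] mult.right_neutral)
    then have "n * nrm \<kappa> + 2 * n = n * (2 + 4 * y * z)"
      using c2 EE[of \<kappa> \<kappa>] E by (simp add: E\<kappa>)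
    then have "n * nrm \<kappa> = n * (4 * y * z)"
      by (simp add: algebra_simps)
    then show ?thesis
      using E by simp
  qed
  ultimately have "(y + z)\<^sup>2 \<le> 4 * y * z"
    using nk nv by simp
  then have "(y - z)\<^sup>2 \<le> 0"
    by (simp add: power2_eq_square algebra_simps)
  then show False
    using ne by simp
qed

context curve_data
begin

text \<open>The vector \<open>Y\<close> of \<open>cubic_factor\<close> at
  \<open>x = 1\<close>.\<close>

definition Z :: "int \<Rightarrow> 's gq" where
  "Z k = \<beta> k - l *\<^sub>R F k - 2 *\<^sub>R (a - h k *\<^sub>R F k)"

text \<open>If \<open>a\<close> were a multiple of \<open>F k\<close>, the equal heights at
  \<open>k\<close> and \<open>k + 2\<close> would make these points coincide, or else
  \<open>a\<close> and \<open>l\<close> would vanish, against \<open>w 0 \<noteq> 0\<close>.\<close>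

lemma Z_zero:
  assumes w: "w 0 \<noteq> 0" and Z: "\<And>k. Z k = 0"
  shows "l = 2 * (h k + h (k + 1))" "a \<noteq> h k *\<^sub>R F k"
proof -
  have hh: "l = 2 * (h k + h (k + 1))" for k
  proof -
    have "l + 2 * (c * h (k + 1) - h k) - l * c - 2 * (h (k + 1) - h k * c) = 0"
      using arg_cong[OF Z[of k], of "\<lambda>z. dot z (F (k + 1))"] by (simp add: Z_def \<beta>_succ)
    then have "(1 - c) * (l - 2 * (h k + h (k + 1))) = 0"
      by (simp add: algebra_simps)
    then show ?thesis
      using c by simp
  qed
  then show "l = 2 * (h k + h (k + 1))" .
  show "a \<noteq> h k *\<^sub>R F k"
  proof
    assume eq: "a = h k *\<^sub>R F k"
    have h2: "h (k + 1 + 1) = h k"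
      using hh[of k] hh[of "k + 1"] by simp
    have hF: "h i = h k * dot (F k) (F i)" for i
      using arg_cong[OF eq, of "\<lambda>z. dot z (F i)"] by simp
    have h0: "h k = 0"
    proof (rule ccontr)
      assume "h k \<noteq> 0"
      then have "dot (F k) (F (k + 1 + 1)) = 1"
        using h2 hF[of "k + 1 + 1"] by simp
      then have "F (k + 1 + 1) = F (k + 1 - 1)"
        using pts_dot(2)[OF F(1) F(1), of k "k + 1 + 1"] by simp
      then show False
        using gcurve unfolding gcurve_def by blast
    qed
    then have "a = 0"
      using eq by simp
    moreover have "l = 0"
      using hh[of k] hF[of "k + 1"] h0 by simp
    ultimately have "X 0 = 0"
      using Z[of 0] unfolding Z_def X_def by simp
    then show False
      using X_FT[of 0] w by simp
  qed
qed

text \<open>With \<open>z = - 2 * x\<close> and \<open>b = e * (1 - z0)\<close> the condition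
  \<open>root\<close> of \<open>cubic_factor\<close> becomes
  \<open>e^2 (z + 2) (z - z0)^2 + q z = 0\<close>, where \<open>q\<close> involves only conserved
  quantities. The scalar parts of \<open>E\<close> and of the linear coefficient are thus encoded by
  \<open>e\<close> and \<open>z0\<close>.\<close>

lemma exists_three:
  assumes w: "w 0 \<noteq> 0"
  obtains e b G M H where "nrm (e *\<^sub>R 1 + a) \<noteq> 0" "gback c F G" "gback c G M" "gback c M H"
    "\<And>k. (e *\<^sub>R 1 + a) * H k = F k * (e *\<^sub>R 1 + a)"
    "\<And>k. b *\<^sub>R 1 + \<beta> k - a = - ((e *\<^sub>R 1 + a) * G k * F k) - (e *\<^sub>R 1 + a) * M k * G k
      - (e *\<^sub>R 1 + a) * H k * M k"
proof -
  define N m j where "N = nrm a" and "m = dot a (\<beta> 0)" and "j = nrm (\<beta> 0) + 4 * l * h 0 - 4 * (h 0)\<^sup>2"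
  have m: "dot a (\<beta> k) = m" and j: "nrm (\<beta> k) = j - 4 * l * h k + 4 * (h k)\<^sup>2" for k
    using a_\<beta>_const[of k] nrm_\<beta>_const[of k] by (simp_all add: m_def j_def)
  define q where "q z = N * z^3 + (2 * m - 2 * N) * z\<^sup>2 + (j - 4 * m) * z + (4 * l\<^sup>2 - 2 * j)" for z
  have q2: "q 2 = 4 * l\<^sup>2"
    by (simp add: q_def)
  have qZ: "q (- 2) = - 4 * nrm (Z k)" for k
  proof -
    have "nrm (Z k) = j - 4 * l * h k + 4 * (h k)\<^sup>2 - l\<^sup>2 + 4 * (N - (h k)\<^sup>2) - 4 * (m - h k * l)"
      using m[of k] j[of k] \<beta>_F[of k]
      by (simp add: Z_def N_def dot_commute[of "\<beta> k" a] dot_commute[of "F k" a] dot_commute[of "F k" "\<beta> k"]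
          power2_eq_square algebra_simps)
    then show ?thesis
      by (simp add: q_def algebra_simps)
  qed
  \<comment> \<open>If \<open>q (- 2)\<close> does not vanish, a point next to \<open>- 2\<close> on
    the appropriate side will do. Otherwise every \<open>Z k\<close> is zero, \<open>q\<close>
    contains the factor \<open>z + 2\<close>, and the remaining quadratic must take a negative
    value.\<close>
  obtain z0 where z0: "(z0 - (- 2)) * q z0 < 0"
  proof (cases "q (- 2) = 0")
    case False
    have "isCont q (- 2)"
      unfolding q_def by (intro continuous_intros)
    then obtain d where d: "d > 0" "\<And>z. dist z (- 2) < d \<Longrightarrow> dist (q z) (q (- 2)) < \<bar>q (- 2)\<bar>"
      using False unfolding continuous_at_eps_delta by (metis zero_less_abs_iff dist_commute)
    show thesis
    proof (cases "q (- 2) > 0")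
      case True
      then have "q (- 2 - d / 2) > 0"
        using d(1) d(2)[of "- 2 - d / 2"] by (simp add: dist_real_def)
      then show thesis
        using d(1) that[of "- 2 - d / 2"] by (simp add: mult_neg_pos)
    next
      case F: False
      then have "q (- 2 + d / 2) < 0"
        using d(1) d(2)[of "- 2 + d / 2"] False by (simp add: dist_real_def)
      then show thesis
        using d(1) that[of "- 2 + d / 2"] by (simp add: mult_pos_neg)
    qed
  next
    case True
    have Z0: "Z k = 0" for k
    proof -
      have "nrm (Z k) = 0"
        using qZ[of k] True by simp
      then show ?thesis
        by (intro plane_nrm(2)[OF F(1)[of k]]) (simp_all add: Z_def sc_\<beta> a \<beta>_F)
    qed
    note Z = Z_zero[OF w Z0]
    define s t where "s = h 0" and "t = h 1"
    have l: "l = 2 * (s + t)"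
      using Z(1)[of 0] by (simp add: s_def t_def)
    have \<beta>0: "\<beta> 0 = l *\<^sub>R F 0 + 2 *\<^sub>R (a - s *\<^sub>R F 0)"
      using Z0[of 0] by (simp add: Z_def s_def algebra_simps)
    have m': "m = l * s + 2 * (N - s\<^sup>2)"
      unfolding m_def \<beta>0 by (simp add: N_def s_def power2_eq_square)
    have "nrm (\<beta> 0) = l\<^sup>2 + 4 * (N - s\<^sup>2)"
      unfolding \<beta>0 by (simp add: N_def s_def power2_eq_square dot_commute[of "F 0" a] algebra_simps)
    then have j': "j = l\<^sup>2 + 4 * (N - s\<^sup>2) + 4 * l * s - 4 * s\<^sup>2"
      by (simp add: j_def s_def)
    have pos: "eps TYPE('s) * (N - (h k)\<^sup>2) > 0" for k
    proof -
      define y where "y = a - h k *\<^sub>R F k"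
      have y: "sc y = 0" "dot y (F k) = 0" "nrm y = N - (h k)\<^sup>2"
        by (simp_all add: y_def a N_def dot_commute[of "F k" a] power2_eq_square)
      have "y \<noteq> 0"
        using Z(2)[of k] by (simp add: y_def)
      then have "nrm y \<noteq> 0"
        using plane_nrm(2)[OF F(1) y(1,2)] by blast
      moreover have "eps TYPE('s) * nrm y \<ge> 0"
        by (rule plane_nrm(1)[OF F(1) y(1,2)])
      moreover have "eps TYPE('s) \<noteq> 0"
        by (metis eps_cases one_neq_zero zero_neq_neg_one)
      ultimately show ?thesis
        unfolding y(3) by (simp add: less_le)
    qed
    \<comment> \<open>Sixteen times this product is the discriminant of the remaining
      quadratic.\<close>
    have "(N - s\<^sup>2) * (N - t\<^sup>2) > 0"
      using pos[of 0] pos[of 1] by (auto simp: s_def t_def zero_less_mult_iff)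
    then have "(4 * s * t)\<^sup>2 - 4 * N * (4 * (s\<^sup>2 + t\<^sup>2 - N)) > 0"
      by (simp add: algebra_simps power2_eq_square)
    then obtain z where z: "N * z\<^sup>2 + 4 * s * t * z + 4 * (s\<^sup>2 + t\<^sup>2 - N) < 0"
      by (rule quadratic_neg_value)
    have "z \<noteq> - 2"
    proof
      assume "z = - 2"
      with z have "(s - t)\<^sup>2 < 0"
        by (simp add: power2_eq_square algebra_simps)
      then show False
        by simp
    qed
    then have "(z + 2)\<^sup>2 * (N * z\<^sup>2 + 4 * s * t * z + 4 * (s\<^sup>2 + t\<^sup>2 - N)) < 0"
      using z by (intro mult_pos_neg) (auto simp: add_eq_0_iff2)
    also have "(z + 2)\<^sup>2 * (N * z\<^sup>2 + 4 * s * t * z + 4 * (s\<^sup>2 + t\<^sup>2 - N)) = (z - (- 2)) * q z"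
      unfolding q_def m' j' l by (simp add: algebra_simps power2_eq_square power3_eq_cube)
    finally show thesis
      by (rule that)
  qed
  \<comment> \<open>The left-hand side corresponds to \<open>x = c\<close>, the right-hand side to
    the simple root of the dominant term.\<close>
  have "- 2 * c \<noteq> - 2"
    using c by simp
  then obtain e r1 r2 r3 where e: "e > 0" "e\<^sup>2 + N > 0" "r1 < r2" "r2 < r3"
      and D: "\<And>z. e\<^sup>2 * (z - (- 2)) * (z - z0)\<^sup>2 + q z = (e\<^sup>2 + N) * (z - r1) * (z - r2) * (z - r3)"
      and Dc: "e\<^sup>2 * (- 2 * c - (- 2)) * (- 2 * c - z0)\<^sup>2 + q (- 2 * c) \<noteq> 0"
    using perturbed_cubic_roots[of z0 "- 2" N "2 * m - 2 * N" "j - 4 * m" "4 * l\<^sup>2 - 2 * j" "- 2 * c"] z0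
    unfolding q_def by blast
  define n where "n = e\<^sup>2 + N"
  define b where "b = e * (1 - z0)"
  define x y z where "x = - r1 / 2" and "y = - r2 / 2" and "z = - r3 / 2"
  have r: "r1 = - 2 * x" "r2 = - 2 * y" "r3 = - 2 * z"
    by (simp_all add: x_def y_def z_def)
  have D: "e\<^sup>2 * (s + 2) * (s - z0)\<^sup>2 + q s = n * (s + 2 * x) * (s + 2 * y) * (s + 2 * z)" for s
    using D[of s] unfolding r n_def by simp
  have ne: "x \<noteq> c" "y \<noteq> c" "z \<noteq> c"
    using Dc D[of "- 2 * c"] by auto
  \<comment> \<open>The value 2 corresponds to the forbidden \<open>x = -1\<close>. There the
    perturbed polynomial is strictly positive.\<close>
  have "z0 \<noteq> 2"
    using z0 q2 by auto
  then have "e\<^sup>2 * (2 + 2) * (2 - z0)\<^sup>2 > 0"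
    using e by simp
  then have "e\<^sup>2 * (2 + 2) * (2 - z0)\<^sup>2 + q 2 > 0"
    unfolding q2 by (intro add_pos_nonneg) auto
  then have ne1: "x \<noteq> -1" "y \<noteq> -1" "z \<noteq> -1"
    unfolding D by auto
  \<comment> \<open>The coefficients of the determinant are recovered from its values at three
    points.\<close>
  have V2: "e\<^sup>2 * (2 - 2 * z0) + 2 * m - 2 * N = 2 * n * (x + y + z)"
    using D[of 1] D[of "-1"] D[of 0] unfolding q_def
    by (simp add: n_def power2_eq_square algebra_simps)
  have V1: "e\<^sup>2 * (z0\<^sup>2 - 4 * z0) + j - 4 * m = 4 * n * (x * y + x * z + y * z)"
  proof -
    have 1: "D1 - D2 = 2 * (e\<^sup>2 + N) + 2 * (e\<^sup>2 * (z0\<^sup>2 - 4 * z0) + j - 4 * m)"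
      if "D1 = e\<^sup>2 * (1 + 2) * (1 - z0)\<^sup>2 + q 1" "D2 = e\<^sup>2 * (-1 + 2) * (-1 - z0)\<^sup>2 + q (-1)" for D1 D2
      unfolding that q_def by (simp add: power2_eq_square algebra_simps)
    show ?thesis
      using 1[OF D[of 1, symmetric] D[of "-1", symmetric]] by (simp add: n_def algebra_simps)
  qed
  have n: "n > 0"
    using e by (simp add: n_def)
  define E where "E = e *\<^sub>R 1 + a"
  define A where "A k = b *\<^sub>R 1 + \<beta> k - a" for k
  have E: "nrm E = n"
    by (simp add: E_def n_def N_def a power2_eq_square)
  have root: "(1 - x) * ((e * (1 + 2 * x) - b)\<^sup>2 + (2 * h k * (1 + x) - l)\<^sup>2)
      = (1 + x) * nrm (\<beta> k - l *\<^sub>R F k - (2 * x) *\<^sub>R (a - h k *\<^sub>R F k))" for k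
  proof -
    have Y: "nrm (\<beta> k - l *\<^sub>R F k - (2 * x) *\<^sub>R (a - h k *\<^sub>R F k))
        = nrm (\<beta> k) - l\<^sup>2 + 4 * x\<^sup>2 * (N - (h k)\<^sup>2) - 4 * x * (m - h k * l)"
      using m[of k] \<beta>_F[of k]
      by (simp add: N_def dot_commute[of "\<beta> k" a] dot_commute[of "F k" a] dot_commute[of "F k" "\<beta> k"]
          power2_eq_square algebra_simps)
    have "e\<^sup>2 * (- 2 * x + 2) * (- 2 * x - z0)\<^sup>2 + q (- 2 * x) = 0"
      unfolding D by simp
    then show ?thesis
      unfolding Y j by (simp add: q_def b_def power2_eq_square power3_eq_cube algebra_simps)
  qed
  have s: "e * (1 + 2 * x) - b \<noteq> 0"
  proof
    assume "e * (1 + 2 * x) - b = 0"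
    then have "e * (2 * x + z0) = 0"
      by (simp add: b_def algebra_simps)
    then have "z0 = - 2 * x"
      using e by simp
    then show False
      using D[of z0] z0 by simp
  qed
  have "\<exists>g. g \<in> pts \<and> dot g (F k) = x \<and> nrm (E + F k * A k * F k - (2 * x) *\<^sub>R (F k * E * F k)) \<noteq> 0 \<and>
      (E + F k * A k * F k - (2 * x) *\<^sub>R (F k * E * F k)) * - (g * F k)
        = A k + (2 * x) *\<^sub>R (F k * A k * F k) + (1 - 4 * x\<^sup>2) *\<^sub>R (F k * E * F k) \<and>
      F k * (A k + E * g * F k) = (A k + E * g * F k) * g" for k
    using cubic_factor[OF F(1)[of k] a sc_\<beta>[of k] \<beta>_F[of k] root[of k] s ne1(1)] unfolding E_def A_def by blast
  then obtain G where G: "\<And>k. G k \<in> pts" "\<And>k. dot (G k) (F k) = x"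
    "\<And>k. nrm (E + F k * A k * F k - (2 * x) *\<^sub>R (F k * E * F k)) \<noteq> 0"
    "\<And>k. (E + F k * A k * F k - (2 * x) *\<^sub>R (F k * E * F k)) * - (G k * F k)
        = A k + (2 * x) *\<^sub>R (F k * A k * F k) + (1 - 4 * x\<^sup>2) *\<^sub>R (F k * E * F k)"
    and sym: "\<And>k. F k * (A k + E * G k * F k) = (A k + E * G k * F k) * G k"
    by metis
  have step: "A (k + 1) - A k = E * (F (k + 1) * F k) - F (k + 1) * F k * E" for k
  proof -
    have "A (k + 1) - A k = \<beta> (k + 1) - \<beta> k"
      by (simp add: A_def)
    then show ?thesis
      unfolding \<beta>_step edge_commutator[OF a, symmetric] by (simp add: E_def distrib_left distrib_right mult.assoc)
  qed
  have L2: "- (F (k + 1) * A (k + 1) * F (k + 1)) - A (k + 1) * (F (k + 1) * F k)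
      = - (F k * A k * F k) - F (k + 1) * F k * A k" for k
    by (rule cubic_L2[OF F(1) F(1) _ _ sc_\<beta> sc_\<beta> \<beta>_F \<beta>_F step, of _ "e + b"])
       (simp_all add: A_def E_def scaleR_add_left)
  have bf: "bfly (F k) (F (k + 1)) (G (k + 1)) (G k)" for k
    by (rule cubic_bfly[OF F(1) F(1) G(1) G(1) step L2 G(2) G(3) G(4) G(4)])
  have FG: "gback c F G"
    unfolding gback_def using gcurve G bf ne ne1 by blast
  define B where "B k = A k + E * G k * F k" for k
  have "dot E (A k) = n * (x + y + z)" for k
    using V2 m[of k] by (simp add: E_def A_def b_def a sc_\<beta> N_def power2_eq_square algebra_simps)
  then have c1: "dot E (B k) = n * (y + z)" for k
    using cubic_quotient_coeff(1)[OF F(1) G(1) G(2) E sym, of k] by (simp add: B_def algebra_simps)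
  have c2: "nrm (B k) - 2 * dot E (F k * E * G k) = n * (2 + 4 * y * z)" for k
  proof -
    have anti: "u * F k = - (F k * u) - (2 * dot u (F k)) *\<^sub>R 1" if "sc u = 0" for u
      using mult_anticommute[OF that, of "F k"] by simp
    have "F k * A k * F k = (- b) *\<^sub>R 1 + (\<beta> k - (2 * l) *\<^sub>R F k) - (a - (2 * h k) *\<^sub>R F k)"
      by (simp add: A_def distrib_left left_diff_distrib distrib_right right_diff_distrib mult.assoc
          anti[OF a] anti[OF sc_\<beta>] \<beta>_F)
    then have "dot E (F k * A k * F k) = - (e * b) + (m - 2 * l * h k) - (N - 2 * (h k)\<^sup>2)"
      using m[of k] by (simp add: E_def a sc_\<beta> N_def power2_eq_square)
    moreover have "nrm (A k) = b\<^sup>2 + nrm (\<beta> k) - 2 * m + N"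
      using m[of k] by (simp add: A_def a sc_\<beta> N_def dot_commute[of "\<beta> k" a] power2_eq_square)
    ultimately have "nrm (A k) - 2 * dot E (F k * A k * F k) = b\<^sup>2 + 2 * e * b + j - 4 * m + 3 * N"
      unfolding j by (simp add: power2_eq_square algebra_simps)
    also have "\<dots> = 3 * n + (e\<^sup>2 * (z0\<^sup>2 - 4 * z0) + j - 4 * m)"
      by (simp add: b_def n_def power2_eq_square algebra_simps)
    also have "\<dots> = n * (3 + 4 * (x * y + x * z + y * z))"
      unfolding V1 by (simp add: algebra_simps)
    finally show ?thesis
      using cubic_quotient_coeff(2)[OF F(1) G(1) G(2) E sym, of k] c1[of k]
      unfolding B_def[symmetric] by (simp add: algebra_simps)
  qed
  have "\<exists>H. H \<in> pts \<and> E * H = F k * E" for k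
    using scaled_pts[of E "F k"] n E by (metis F(1) less_irrefl)
  then obtain H where H: "\<And>k. H k \<in> pts" "\<And>k. E * H k = F k * E"
    by metis
  obtain M where M: "gback c G M" "gback c M H" "\<And>k. B k = - (E * M k * G k) - F k * E * M k"
  proof (rule two_step[OF gback_gcurve[OF FG], of F E n B y z H])
    show "F k * B k = B k * G k" for k
      using sym by (simp add: B_def)
    show "B (k + 1) - B k = E * (G (k + 1) * G k) - F (k + 1) * F k * E" for k
    proof -
      have "E * (G (k + 1) * (G k - F (k + 1))) = E * ((F (k + 1) - G k) * F k)"
        using bf[of k] by (simp add: bfly_def)
      then have "E * (G (k + 1) * G k) - E * (G (k + 1) * F (k + 1)) = E * (F (k + 1) * F k) - E * (G k * F k)"
        by (simp add: right_diff_distrib left_diff_distrib)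
      then have GG: "E * (G (k + 1) * G k) = E * (F (k + 1) * F k) - E * (G k * F k) + E * (G (k + 1) * F (k + 1))"
        by (simp only: diff_eq_eq)
      have "B (k + 1) - B k = (A (k + 1) - A k) + E * (G (k + 1) * F (k + 1)) - E * (G k * F k)"
        by (simp add: B_def mult.assoc)
      then show ?thesis
        unfolding step GG by simp
    qed
    show "nrm (E + F k * E * G k) \<noteq> 0" for k
      by (rule distinct_roots_nonparallel[OF F(1) G(1) E n _ c1 c2])
         (use sym e in \<open>auto simp: B_def y_def z_def\<close>)
  qed (use E n ne ne1 c1 c2 H in auto)
  show thesis
  proof (rule that[of e G M H b])
    show "b *\<^sub>R 1 + \<beta> k - a = - ((e *\<^sub>R 1 + a) * G k * F k) - (e *\<^sub>R 1 + a) * M k * G k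
      - (e *\<^sub>R 1 + a) * H k * M k" for k
      using M(3)[of k] unfolding H(2)[symmetric] B_def A_def E_def[symmetric] by (simp add: algebra_simps)
  qed (use FG M H E n in \<open>auto simp: E_def[symmetric]\<close>)
qed

end

section \<open>Elasticity of invariant curves\<close>

lemma gback_D:
  assumes "gback c F G"
  shows "curve c F" "curve c G" "F k \<in> pts" "G k \<in> pts" "bfly (F k) (F (k + 1)) (G (k + 1)) (G k)"
    "nrm (1 - G k * F k) \<noteq> 0"
proof -
  show F: "curve c F" and G: "curve c G"
    using assms gback_gcurve[OF assms] by (auto simp: gback_def curve_def)
  show p: "F k \<in> pts" and q: "G k \<in> pts"
    using curve.F(1)[OF F] curve.F(1)[OF G] by auto
  show "bfly (F k) (F (k + 1)) (G (k + 1)) (G k)"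
    using assms by (simp add: gback_def)
  obtain x where x: "x \<noteq> -1" "dot (G k) (F k) = x"
    using assms by (auto simp: gback_def)
  have "sc (G k * F k) = - x"
    using x(2) p by (simp add: dot_def pts_D)
  moreover have "nrm (G k * F k) = 1"
    using p q by (simp add: nrm_mult pts_D)
  ultimately have "nrm (1 - G k * F k) = 2 * (1 + x)"
    by simp
  then show "nrm (1 - G k * F k) \<noteq> 0"
    using x(1) by simp
qed

lemma bfly_sum: "bfly f0 f1 g1 g0 \<Longrightarrow> g1 * f1 - g0 * f0 = g1 * g0 - f1 * f0"
  for f0 f1 g0 g1 :: "'s::signature gq"
  by (simp add: bfly_def algebra_simps)

text \<open>The exchange relation of the four transport matrices at \<lambda> = 1.\<close>

lemma bfly_lax:
  fixes f0 f1 g0 g1 :: "'s::signature gq"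
  assumes "bfly f0 f1 g1 g0" "f1 \<in> pts" "g0 \<in> pts"
  shows "(1 - g1 * f1) * (1 - f1 * f0) = (1 - g1 * g0) * (1 - g0 * f0)"
proof -
  have "g1 * f1 + f1 * f0 = g1 * g0 + g0 * f0"
    using bfly_sum[OF assms(1)] by (simp add: algebra_simps)
  then have "1 - (g1 * f1 + f1 * f0) - g1 * f0 = 1 - (g1 * g0 + g0 * f0) - g1 * f0"
    by simp
  then show ?thesis
    using assms by (simp add: algebra_simps pts_D)
qed

lemma conj_product:
  fixes E h0 h1 f0 f1 :: "'s::signature gq"
  assumes "E * h0 = s *\<^sub>R (f0 * E)" "E * h1 = s *\<^sub>R (f1 * E)" "s * s = 1"
  shows "E * (h1 * h0) = f1 * f0 * E"
proof -
  have "E * (h1 * h0) = s *\<^sub>R (f1 * (E * h0))"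
    using assms(2) by (simp add: mult.assoc[symmetric])
  then show ?thesis
    using assms by (simp add: mult.assoc)
qed

text \<open>Because \<open>E * H k = - (F k * E)\<close>, the linear coefficient of \<open>P\<close>
  is a commutator with \<open>F k\<close>. It is therefore trace-free and orthogonal to
  \<open>F k\<close>, which explains \<open>l = 0\<close>.\<close>

lemma two_invariant_data:
  fixes F G H :: "int \<Rightarrow> 's::signature gq"
  assumes FG: "gback c F G" and GH: "gback c G H" and EH: "\<And>k. E * H k = - (F k * E)"
  shows "curve_data c F (E - sc E *\<^sub>R 1) (\<lambda>k. - (E * G k * F k) - E * H k * G k) 0"
proof -
  interpret F: curve c F
    by (rule gback_D[OF FG])
  interpret G: curve c G
    by (rule gback_D[OF GH])
  have b: "- (E * G k * F k) - E * H k * G k = F k * (E * G k) - E * G k * F k" for k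
    by (simp add: EH mult.assoc)
  have a: "sc (E - sc E *\<^sub>R 1) = 0"
    by simp
  show ?thesis
  proof (unfold_locales)
    show "sc (E - sc E *\<^sub>R 1) = 0"
      by (rule a)
    show "sc (- (E * G k * F k) - E * H k * G k) = 0" for k
      unfolding b using sc_commute[of "F k" "E * G k"] by simp
    show "dot (- (E * G k * F k) - E * H k * G k) (F k) = 0" for k
      unfolding b using sc_commute[of "F k" "E * G k * F k"] by (simp add: dot_def right_diff_distrib left_diff_distrib mult.assoc)
    fix k
    have s1: "G (k + 1) * F (k + 1) - G k * F k = G (k + 1) * G k - F (k + 1) * F k"
      by (rule bfly_sum[OF gback_D(5)[OF FG]])
    have s2: "H (k + 1) * G (k + 1) - H k * G k = H (k + 1) * H k - G (k + 1) * G k"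
      by (rule bfly_sum[OF gback_D(5)[OF GH]])
    have "E * (H (k + 1) * H k) = F (k + 1) * F k * E"
      by (rule conj_product[where s = "-1"]) (simp_all add: EH)
    moreover have "(- (E * G (k + 1) * F (k + 1)) - E * H (k + 1) * G (k + 1)) - (- (E * G k * F k) - E * H k * G k)
       = - (E * (G (k + 1) * F (k + 1) - G k * F k)) - E * (H (k + 1) * G (k + 1) - H k * G k)"
      by (simp add: right_diff_distrib mult.assoc)
    ultimately have "(- (E * G (k + 1) * F (k + 1)) - E * H (k + 1) * G (k + 1)) - (- (E * G k * F k) - E * H k * G k)
       = E * (F (k + 1) * F k) - F (k + 1) * F k * E"
      unfolding s1 s2 by (simp add: right_diff_distrib)
    also have "\<dots> = (E - sc E *\<^sub>R 1) * (F (k + 1) * F k) - F (k + 1) * F k * (E - sc E *\<^sub>R 1)"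
      by (simp add: left_diff_distrib right_diff_distrib)
    also have "\<dots> = (2 * dot (E - sc E *\<^sub>R 1) (F k)) *\<^sub>R F (k + 1) - (2 * dot (E - sc E *\<^sub>R 1) (F (k + 1))) *\<^sub>R F k"
      by (rule F.edge_commutator[OF a])
    finally show "(- (E * G (k + 1) * F (k + 1)) - E * H (k + 1) * G (k + 1)) - (- (E * G k * F k) - E * H k * G k)
       = (2 * dot (E - sc E *\<^sub>R 1) (F k)) *\<^sub>R F (k + 1) - (2 * dot (E - sc E *\<^sub>R 1) (F (k + 1))) *\<^sub>R F k" .
  qed
qed

lemma two_invariant_elastic:
  fixes F G H :: "int \<Rightarrow> 's::signature gq"
  assumes FG: "gback c F G" and GH: "gback c G H" and E: "nrm E \<noteq> 0" and EH: "\<And>k. E * H k = - (F k * E)"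
    and reg: "E - sc E *\<^sub>R 1 \<noteq> 0 \<or> - (E * G k0 * F k0) - E * H k0 * G k0 \<noteq> 0"
  shows "\<exists>\<xi>. \<forall>k. (1 + (curve.sg F k)\<^sup>2) * (curve.sg F (k + 1) + curve.sg F (k - 1)) = \<xi> * curve.sg F k"
    and "(\<And>k. curve.sg F k = s) \<Longrightarrow> s = 0"
proof -
  define a where "a = E - sc E *\<^sub>R 1"
  define \<beta> where "\<beta> k = - (E * G k * F k) - E * H k * G k" for k
  interpret curve_data c F a \<beta> 0
    unfolding a_def \<beta>_def by (rule two_invariant_data[OF FG GH EH])
  have ne: "a \<noteq> 0 \<or> \<beta> k0 \<noteq> 0"
    using reg by (simp add: a_def \<beta>_def)
  show "\<exists>\<xi>. \<forall>k. (1 + (sg k)\<^sup>2) * (sg (k + 1) + sg (k - 1)) = \<xi> * sg k"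
  proof (cases "w 0 = 0")
    case True
    have "sg k = 0" for k
      by (rule sg_const_of_w(2)[OF True ne refl])
    then show ?thesis
      by simp
  next
    case False
    then show ?thesis
      using elastic_of_w[OF False] by (metis add.right_neutral mult_zero_right divide_eq_0_iff)
  qed
  show "s = 0" if s: "\<And>k. sg k = s"
  proof (rule ccontr)
    assume s0: "s \<noteq> 0"
    have w: "w 0 \<noteq> 0"
      using sg_const_of_w(2)[OF _ ne refl, of 0] s s0 by metis
    have 0: "2 *\<^sub>R a - (2 * h 0) *\<^sub>R F 0 + \<beta> 0 = 0"
      by (rule circle_degenerate[OF refl w s s0])
    define e where "e = sc E"
    have E': "E = e *\<^sub>R 1 + a"
      by (simp add: a_def e_def)
    have "a * F 0 = - (F 0 * a) - (2 * h 0) *\<^sub>R 1"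
      using mult_anticommute[OF a, of "F 0"] by simp
    then have "F 0 * E * F 0 = - (e *\<^sub>R 1) + a - (2 * h 0) *\<^sub>R F 0"
      unfolding E' by (simp add: distrib_left distrib_right mult.assoc right_diff_distrib)
    \<comment> \<open>This is \<open>P\<close> at \<lambda> = 1, a product of invertible factors. On
      a circle it would have to be zero.\<close>
    moreover have "E * ((1 - H 0 * G 0) * (1 - G 0 * F 0)) = E + \<beta> 0 + F 0 * E * F 0"
    proof -
      have "E * ((1 - H 0 * G 0) * (1 - G 0 * F 0)) = E + \<beta> 0 + E * (H 0 * (G 0 * (G 0 * F 0)))"
        by (simp add: \<beta>_def algebra_simps)
      also have "E * (H 0 * (G 0 * (G 0 * F 0))) = - (E * H 0 * F 0)"
        using gback_D(4)[OF FG, of 0] by (simp add: pts_D mult.assoc)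
      finally show ?thesis
        by (simp add: EH mult.assoc)
    qed
    ultimately have "E * ((1 - H 0 * G 0) * (1 - G 0 * F 0)) = 2 *\<^sub>R a - (2 * h 0) *\<^sub>R F 0 + \<beta> 0"
      unfolding E' by (simp add: scaleR_2)
    then have "nrm (E * ((1 - H 0 * G 0) * (1 - G 0 * F 0))) = 0"
      unfolding 0 by simp
    then show False
      using E gback_D(6)[OF FG, of 0] gback_D(6)[OF GH, of 0] by (simp add: nrm_mult del: dot_simps)
  qed
qed

text \<open>The matrix \<open>C\<close> is the sum of the constant and the linear coefficient of
  \<open>P\<close>. The symmetry under conjugation by points gives
  \<open>P(1) = C - F * C * F\<close>, so \<open>P(1)\<close> records exactly the scalar part of
  \<open>C\<close> and its component along \<open>F\<close>.\<close>

lemma three_invariant_elastic: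
  fixes F G M H :: "int \<Rightarrow> 's::signature gq"
  assumes FG: "gback c F G" and GM: "gback c G M" and MH: "gback c M H" and EH: "\<And>k. E * H k = F k * E"
    and reg: "E - sc E *\<^sub>R 1 \<noteq> 0 \<or> K - sc K *\<^sub>R 1 \<noteq> 0" and K: "K = - (E * G k0 * F k0) - E * M k0 * G k0 - E * H k0 * M k0"
  shows "\<exists>\<xi> \<delta>. \<forall>k. (1 + (curve.sg F k)\<^sup>2) * (curve.sg F (k + 1) + curve.sg F (k - 1)) = \<xi> * curve.sg F k + \<delta>"
proof -
  interpret F: curve c F
    by (rule gback_D[OF FG])
  define a where "a = E - sc E *\<^sub>R 1"
  have a: "sc a = 0"
    by (simp add: a_def)
  define C where "C k = E - E * G k * F k - E * M k * G k - E * H k * M k" for k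
  have step: "C (k + 1) - C k = a * (F (k + 1) * F k) - F (k + 1) * F k * a" for k
  proof -
    have HH: "E * (H (k + 1) * H k) = F (k + 1) * F k * E"
      by (rule conj_product[where s = 1]) (simp_all add: EH)
    have "C (k + 1) - C k = - (E * (G (k + 1) * F (k + 1) - G k * F k)) - E * (M (k + 1) * G (k + 1) - M k * G k)
       - E * (H (k + 1) * M (k + 1) - H k * M k)"
      by (simp add: C_def right_diff_distrib mult.assoc)
    also have "\<dots> = E * (F (k + 1) * F k) - F (k + 1) * F k * E"
      unfolding bfly_sum[OF gback_D(5)[OF FG]] bfly_sum[OF gback_D(5)[OF GM]] bfly_sum[OF gback_D(5)[OF MH]]
        HH[symmetric] by (simp add: right_diff_distrib)
    also have "\<dots> = a * (F (k + 1) * F k) - F (k + 1) * F k * a"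
      by (simp add: a_def left_diff_distrib right_diff_distrib)
    finally show ?thesis .
  qed
  have sC: "sc (C (k + 1)) = sc (C k)" for k
  proof -
    have "sc (C (k + 1) - C k) = 0"
      unfolding step sc_simps using sc_commute[of a "F (k + 1) * F k"] by simp
    then show ?thesis
      by simp
  qed
  define \<beta> where "\<beta> k = C k - sc (C k) *\<^sub>R 1" for k
  have lax: "E * (1 - H (k + 1) * M (k + 1)) * (1 - M (k + 1) * G (k + 1)) * (1 - G (k + 1) * F (k + 1)) * (1 - F (k + 1) * F k)
      = (1 - F (k + 1) * F k) * (E * (1 - H k * M k) * (1 - M k * G k) * (1 - G k * F k))" for k
  proof -
    have HH: "E * (H (k + 1) * H k) = F (k + 1) * F k * E"
      by (rule conj_product[where s = 1]) (simp_all add: EH)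
    note l = bfly_lax[OF gback_D(5)[OF FG] gback_D(3)[OF FG] gback_D(4)[OF FG], of k]
      bfly_lax[OF gback_D(5)[OF GM] gback_D(3)[OF GM] gback_D(4)[OF GM], of k]
      bfly_lax[OF gback_D(5)[OF MH] gback_D(3)[OF MH] gback_D(4)[OF MH], of k]
    have "E * (1 - H (k + 1) * M (k + 1)) * (1 - M (k + 1) * G (k + 1)) * (1 - G (k + 1) * F (k + 1)) * (1 - F (k + 1) * F k)
      = E * ((1 - H (k + 1) * M (k + 1)) * ((1 - M (k + 1) * G (k + 1)) * ((1 - G (k + 1) * F (k + 1)) * (1 - F (k + 1) * F k))))"
      by (simp only: mult.assoc)
    also have "\<dots> = E * ((1 - H (k + 1) * M (k + 1)) * (((1 - M (k + 1) * G (k + 1)) * (1 - G (k + 1) * G k)) * (1 - G k * F k)))"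
      unfolding l(1) by (simp only: mult.assoc)
    also have "\<dots> = E * (((1 - H (k + 1) * M (k + 1)) * (1 - M (k + 1) * M k)) * ((1 - M k * G k) * (1 - G k * F k)))"
      unfolding l(2) by (simp only: mult.assoc)
    also have "\<dots> = (E * (1 - H (k + 1) * H k)) * ((1 - H k * M k) * ((1 - M k * G k) * (1 - G k * F k)))"
      unfolding l(3) by (simp only: mult.assoc)
    also have "E * (1 - H (k + 1) * H k) = (1 - F (k + 1) * F k) * E"
      by (simp add: right_diff_distrib left_diff_distrib HH)
    finally show ?thesis
      by (simp only: mult.assoc)
  qed
  have \<beta>0: "sc (\<beta> k) = 0" for k
    by (simp add: \<beta>_def)
  have P: "E * (1 - H k * M k) * (1 - M k * G k) * (1 - G k * F k)
      = (2 * sc (C k)) *\<^sub>R 1 + (2 * dot (\<beta> k) (F k)) *\<^sub>R F k" for k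
  proof -
    note [simp] = pts_D[OF gback_D(4)[OF FG, of k]] pts_D[OF gback_D(4)[OF GM, of k]] pts_D[OF gback_D(4)[OF MH, of k]]
    have FE: "F k * (E * z) = E * (H k * z)" for z
      using EH[of k] by (simp add: mult.assoc[symmetric])
    have "E * (1 - H k * M k) * (1 - M k * G k) * (1 - G k * F k) = C k - F k * C k * F k"
      by (simp add: C_def algebra_simps FE EH[symmetric])
    also have "C k = sc (C k) *\<^sub>R 1 + \<beta> k"
      by (simp add: \<beta>_def)
    also have "sc (C k) *\<^sub>R 1 + \<beta> k - F k * (sc (C k) *\<^sub>R 1 + \<beta> k) * F k
        = (2 * sc (C k)) *\<^sub>R 1 + (2 * dot (\<beta> k) (F k)) *\<^sub>R F k"
    proof -
      have "\<beta> k * F k = - (F k * \<beta> k) - (2 * dot (\<beta> k) (F k)) *\<^sub>R 1"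
        using mult_anticommute[OF \<beta>0, of "F k" k] by simp
      then have "F k * (sc (C k) *\<^sub>R 1 + \<beta> k) * F k = - (sc (C k) *\<^sub>R 1) + \<beta> k - (2 * dot (\<beta> k) (F k)) *\<^sub>R F k"
        by (simp add: distrib_left distrib_right mult.assoc right_diff_distrib)
      then show ?thesis
        by (simp add: scaleR_2[symmetric])
    qed
    finally show ?thesis
      by (simp add: \<beta>_def)
  qed
  have "dot (\<beta> (k + 1)) (F (k + 1)) = dot (\<beta> k) (F k)" for k
  proof -
    \<comment> \<open>Comparing the two sides of \<open>lax\<close> leaves \<open>u\<close> and
      \<open>v\<close> as factors of the same vector \<open>F (k + 1) + F k\<close>, which is
      nonzero since neighbours are not antipodal.\<close>
    define u v where "u = dot (\<beta> (k + 1)) (F (k + 1))" and "v = dot (\<beta> k) (F k)"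
    have "((2 * sc (C k)) *\<^sub>R 1 + (2 * u) *\<^sub>R F (k + 1)) * (1 - F (k + 1) * F k)
        = (1 - F (k + 1) * F k) * ((2 * sc (C k)) *\<^sub>R 1 + (2 * v) *\<^sub>R F k)"
      using lax[of k] unfolding P by (simp add: sC u_def v_def)
    then have "(2 * u) *\<^sub>R (F (k + 1) + F k) = (2 * v) *\<^sub>R (F (k + 1) + F k)"
      by (simp add: distrib_left distrib_right right_diff_distrib left_diff_distrib mult.assoc scaleR_add_right)
        (simp add: algebra_simps)
    moreover have "F (k + 1) + F k \<noteq> 0"
    proof
      assume "F (k + 1) + F k = 0"
      then have "dot (F (k + 1) + F k) (F k) = 0"
        by simp
      then show False
        using F.c by simp
    qed
    ultimately show ?thesis
      unfolding u_def v_def by simp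
  qed
  then have l: "dot (\<beta> k) (F k) = dot (\<beta> 0) (F 0)" for k
    by (induction k rule: int_induct[of _ 0]) (simp, metis, metis diff_add_cancel)
  interpret curve_data c F a \<beta> "dot (\<beta> 0) (F 0)"
  proof unfold_locales
    show "\<beta> (k + 1) - \<beta> k = (2 * dot a (F k)) *\<^sub>R F (k + 1) - (2 * dot a (F (k + 1))) *\<^sub>R F k" for k
      using step[of k] unfolding F.edge_commutator[OF a, symmetric] by (simp add: \<beta>_def sC)
  qed (use a \<beta>0 l in auto)
  have ne: "a \<noteq> 0 \<or> \<beta> k0 \<noteq> 0"
  proof (rule ccontr)
    assume "\<not> ?thesis"
    then have 0: "E = sc E *\<^sub>R 1" "C k0 = sc (C k0) *\<^sub>R 1"
      by (simp_all add: a_def \<beta>_def)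
    moreover have "K = C k0 - E"
      by (simp add: K C_def)
    ultimately have "K - sc K *\<^sub>R 1 = 0"
      by (metis scaleR_left_diff_distrib sc_simps(4) right_minus_eq)
    then show False
      using reg 0 by simp
  qed
  show ?thesis
  proof (cases "w 0 = 0")
    case True
    \<comment> \<open>Constant curvature solves the equation with \<xi> = 0 and a suitable
      \<delta>.\<close>
    define s where "s = F.sg 0"
    have "F.sg k = s" for k
      unfolding s_def by (rule sg_const_of_w(1)[OF True ne])
    then have "(1 + (F.sg k)\<^sup>2) * (F.sg (k + 1) + F.sg (k - 1)) = 0 * F.sg k + (1 + s\<^sup>2) * (s + s)" for k
      by simp
    then show ?thesis
      by blast
  next
    case False
    then show ?thesis
      using elastic_of_w[OF False] by metis
  qed
qed

section \<open>Matrix representation\<close>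

definition emb :: "'s::signature gq \<Rightarrow> cmat" where
  "emb x = vector [vector [gq1 x, gq2 x], vector [- (ep x * cnj (gq2 x)), cnj (gq1 x)]]"

lemma cmat_eq_iff: "A = B \<longleftrightarrow> A$1$1 = B$1$1 \<and> A$1$2 = B$1$2 \<and> A$2$1 = B$2$1 \<and> A$2$2 = B$2$2"
  for A B :: "'a^2^2"
  by (auto simp: vec_eq_iff forall_2)

lemma emb_nth [simp]:
  "emb x $1$1 = gq1 x" "emb x $1$2 = gq2 x" "emb x $2$1 = - (ep x * cnj (gq2 x))" "emb x $2$2 = cnj (gq1 x)"
  for x :: "'s::signature gq"
  by (simp_all add: emb_def)

lemma mmult_nth: "(A ** B)$i$j = A$i$1 * B$1$j + A$i$2 * B$2$j" for A B :: "'a::semiring_1^2^2"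
  by (simp add: matrix_matrix_mult_def sum_2)

lemma eps_square [simp]: "(complex_of_real (eps TYPE('s::signature)))\<^sup>2 = 1"
  "complex_of_real (eps TYPE('s::signature)) * (complex_of_real (eps TYPE('s)) * z) = z"
  using eps_cases[of "TYPE('s)"] by auto

lemma emb_simps:
  "emb 0 = 0" "emb 1 = mat 1" "emb (x + y) = emb x + emb y" "emb (x - y) = emb x - emb y" "emb (- x) = - emb x"
  "emb (r *\<^sub>R x) = r *\<^sub>R emb x" "emb (x * y) = emb x ** emb y"
  for x y :: "'s::signature gq"
  by (auto simp: cmat_eq_iff mmult_nth mat_def algebra_simps) (simp_all add: scaleR_conv_of_real)

lemma emb_inj [simp]: "emb x = emb y \<longleftrightarrow> x = y" for x y :: "'s::signature gq"
  by (auto simp: cmat_eq_iff intro: gq_eqI)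

lemma emb_eq_0 [simp]: "emb x = 0 \<longleftrightarrow> x = 0" for x :: "'s::signature gq"
  using emb_inj[of x 0] by (simp only: emb_simps)

lemma rdot_emb [simp]: "rdot (emb x) (emb y) = dot x y" for x y :: "'s::signature gq"
  by (simp add: rdot_def mdot_def adjugate_def trace_def sum_2 mmult_nth dot_def sc_def algebra_simps)

lemma trace_emb: "trace (emb x) = of_real (2 * sc x)" for x :: "'s::signature gq"
  by (simp add: trace_def sum_2 sc_def complex_eq_iff)

lemma det_emb: "det (emb x) = of_real (nrm x)" for x :: "'s::signature gq"
  by (simp add: det_2 dot_def sc_def complex_eq_iff algebra_simps)

lemma trace_free_emb: "trace_free (emb x) = emb (x - sc x *\<^sub>R 1)" for x :: "'s::signature gq"
proof -
  have "mat (trace (emb x) / 2) = (sc x *\<^sub>R mat 1 :: cmat)"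
    by (simp add: trace_emb cmat_eq_iff mat_def complex_eq_iff)
  then show ?thesis
    by (simp add: trace_free_def emb_simps)
qed

lemma matrix_inv_unique:
  fixes A B :: "'a::semiring_1^'n^'n"
  assumes "A ** B = mat 1" "B ** A = mat 1"
  shows "matrix_inv A = B"
proof -
  have "A ** matrix_inv A = mat 1 \<and> matrix_inv A ** A = mat 1"
    unfolding matrix_inv_def by (rule someI[of _ B]) (simp add: assms)
  then have "matrix_inv A ** A ** B = B"
    by simp
  then show ?thesis
    by (simp add: matrix_mul_assoc[symmetric] assms)
qed

lemma matrix_inv_emb: "nrm x \<noteq> 0 \<Longrightarrow> matrix_inv (emb x) = emb ((1 / nrm x) *\<^sub>R star x)" for x :: "'s::signature gq"
  by (rule matrix_inv_unique) (simp_all add: emb_simps(7)[symmetric] mult_star star_mult_self, simp_all add: emb_simps(2))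

lemma matrix_inv_emb_pts: "x \<in> pts \<Longrightarrow> matrix_inv (emb x) = emb (- x)" for x :: "'s::signature gq"
  by (simp add: matrix_inv_emb pts_D)

lemma invertible_emb: "invertible (emb x) \<longleftrightarrow> nrm x \<noteq> 0" for x :: "'s::signature gq"
  by (simp add: invertible_det_nz det_emb)

section \<open>Real spans of the basis matrices\<close>

lemma linear_emb: "linear emb"
  by (rule linearI) (simp_all add: emb_simps)

lemma span_emb: "span (emb ` S) = emb ` span S"
  by (rule linear_span_image[OF linear_emb])

lemma cmat_basis:
  "qk = emb (GQ (- \<i>) 0 :: 's::signature gq)" "q1 = emb (1 :: 's gq)"
  "eps TYPE('s) = 1 \<Longrightarrow> qi = emb (GQ 0 (- \<i>) :: 's gq)" "eps TYPE('s) = 1 \<Longrightarrow> qj = emb (GQ 0 (- 1) :: 's gq)"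
  "eps TYPE('s) = -1 \<Longrightarrow> sigma1 = emb (GQ 0 1 :: 's gq)" "eps TYPE('s) = -1 \<Longrightarrow> sigma2 = emb (GQ 0 (- \<i>) :: 's gq)"
  by (simp_all add: qk_def q1_def qi_def qj_def sigma1_def sigma2_def sigma3_def cmat_eq_iff mmult_nth mat_def)

lemma subspace_gq:
  "subspace {x :: 's::signature gq. sc x = 0}" "subspace {x :: 's::signature gq. gq1 x = 0}"
  "subspace {x :: 's::signature gq. gq2 x = 0}"
  by (auto simp: subspace_def)

lemma span_even: "span {1, GQ (- \<i>) 0} = {x :: 's::signature gq. gq2 x = 0}"
proof (intro equalityI)
  show "span {1, GQ (- \<i>) 0} \<subseteq> {x :: 's::signature gq. gq2 x = 0}"
    by (rule span_minimal[OF _ subspace_gq(3)]) simp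
  show "{x :: 's::signature gq. gq2 x = 0} \<subseteq> span {1, GQ (- \<i>) 0}"
  proof
    fix x :: "'s gq" assume "x \<in> {x. gq2 x = 0}"
    then have "x = Re (gq1 x) *\<^sub>R 1 + (- Im (gq1 x)) *\<^sub>R GQ (- \<i>) 0"
      by (auto intro!: gq_eqI simp: complex_eq_iff)
    moreover have "Re (gq1 x) *\<^sub>R 1 + (- Im (gq1 x)) *\<^sub>R GQ (- \<i>) 0 \<in> span {1, GQ (- \<i>) 0 :: 's gq}"
      by (intro span_add span_scale span_base) auto
    ultimately show "x \<in> span {1, GQ (- \<i>) 0}"
      by simp
  qed
qed

lemma span_odd: "span {GQ 0 (- \<i>), GQ 0 (- 1)} = {x :: 's::signature gq. gq1 x = 0}"
proof (intro equalityI)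
  show "span {GQ 0 (- \<i>), GQ 0 (- 1)} \<subseteq> {x :: 's::signature gq. gq1 x = 0}"
    by (rule span_minimal[OF _ subspace_gq(2)]) simp
  show "{x :: 's::signature gq. gq1 x = 0} \<subseteq> span {GQ 0 (- \<i>), GQ 0 (- 1)}"
  proof
    fix x :: "'s gq" assume "x \<in> {x. gq1 x = 0}"
    then have "x = (- Im (gq2 x)) *\<^sub>R GQ 0 (- \<i>) + (- Re (gq2 x)) *\<^sub>R GQ 0 (- 1)"
      by (auto intro!: gq_eqI simp: complex_eq_iff)
    moreover have "(- Im (gq2 x)) *\<^sub>R GQ 0 (- \<i>) + (- Re (gq2 x)) *\<^sub>R GQ 0 (- 1) \<in> span {GQ 0 (- \<i>), GQ 0 (- 1) :: 's gq}"
      by (intro span_add span_scale span_base) auto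
    ultimately show "x \<in> span {GQ 0 (- \<i>), GQ 0 (- 1)}"
      by simp
  qed
qed

lemma span_vec:
  fixes p q :: "'s::signature gq"
  assumes "span {p, q} = {x. gq1 x = 0}"
  shows "span {p, q, GQ (- \<i>) 0} = {x. sc x = 0}" "span {1, p, q, GQ (- \<i>) 0} = UNIV"
proof -
  have pq: "gq1 p = 0" "gq1 q = 0"
    using assms span_base[of p "{p, q}"] span_base[of q "{p, q}"] by auto
  have sub: "span {p, q} \<subseteq> span {p, q, GQ (- \<i>) 0}"
    by (rule span_mono) auto
  show *: "span {p, q, GQ (- \<i>) 0} = {x. sc x = 0}"
  proof (intro equalityI)
    show "span {p, q, GQ (- \<i>) 0} \<subseteq> {x. sc x = 0}"
      by (rule span_minimal[OF _ subspace_gq(1)]) (simp add: sc_def pq)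
    show "{x. sc x = 0} \<subseteq> span {p, q, GQ (- \<i>) 0}"
    proof
      fix x :: "'s gq" assume "x \<in> {x. sc x = 0}"
      then have "x = GQ 0 (gq2 x) + (- Im (gq1 x)) *\<^sub>R GQ (- \<i>) 0"
        by (auto intro!: gq_eqI simp: complex_eq_iff sc_def)
      moreover have "GQ 0 (gq2 x) \<in> span {p, q, GQ (- \<i>) 0}"
        using assms sub by auto
      ultimately show "x \<in> span {p, q, GQ (- \<i>) 0}"
        by (metis span_add span_scale span_base insertCI)
    qed
  qed
  show "span {1, p, q, GQ (- \<i>) 0} = UNIV"
  proof (intro equalityI subset_UNIV subsetI)
    fix x :: "'s gq"
    have "x - sc x *\<^sub>R 1 \<in> span {p, q, GQ (- \<i>) 0}"
      unfolding * by simp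
    then have "x - sc x *\<^sub>R 1 \<in> span {1, p, q, GQ (- \<i>) 0}"
      by (rule subsetD[OF span_mono[OF subset_insertI]])
    then have "x - sc x *\<^sub>R 1 + sc x *\<^sub>R 1 \<in> span {1, p, q, GQ (- \<i>) 0}"
      by (rule span_add[OF _ span_scale[OF span_base]]) simp
    then show "x \<in> span {1, p, q, GQ (- \<i>) 0}"
      by simp
  qed
qed

lemma span_odd': "span {GQ 0 1, GQ 0 (- \<i>)} = {x :: 's::signature gq. gq1 x = 0}"
proof -
  have "span {GQ 0 (- \<i>), GQ 0 (- 1) :: 's gq} = span {GQ 0 (- \<i>), - GQ 0 1}"
    by (simp add: uminus_gq_def)
  also have "\<dots> = span {GQ 0 1, GQ 0 (- \<i>)}"
  proof (rule span_eq[THEN iffD2], intro conjI)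
    show "{GQ 0 (- \<i>), - GQ 0 1} \<subseteq> span {GQ 0 1, GQ 0 (- \<i>) :: 's gq}"
      by (auto intro: span_base span_neg)
    have "- (- GQ 0 1) \<in> span {GQ 0 (- \<i>), - GQ 0 1 :: 's gq}"
      by (intro span_neg span_base) simp
    then show "{GQ 0 1, GQ 0 (- \<i>)} \<subseteq> span {GQ 0 (- \<i>), - GQ 0 1 :: 's gq}"
      by (auto intro: span_base)
  qed
  finally show ?thesis
    by (simp add: span_odd)
qed

lemma cmat_spans:
  "span {q1, qk} = emb ` {x :: 's::signature gq. gq2 x = 0}"
  "eps TYPE('s) = 1 \<Longrightarrow> span {qi, qj} = emb ` {x :: 's gq. gq1 x = 0}"
  "eps TYPE('s) = 1 \<Longrightarrow> span {qi, qj, qk} = emb ` {x :: 's gq. sc x = 0}"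
  "eps TYPE('s) = 1 \<Longrightarrow> quaternions = range (emb :: 's gq \<Rightarrow> _)"
  "eps TYPE('s) = -1 \<Longrightarrow> span {sigma1, sigma2, qk} = emb ` {x :: 's gq. sc x = 0}"
  "eps TYPE('s) = -1 \<Longrightarrow> split_quaternions = range (emb :: 's gq \<Rightarrow> _)"
proof -
  show "span {q1, qk} = emb ` {x :: 's gq. gq2 x = 0}"
    unfolding span_even[symmetric] span_emb[symmetric] by (simp add: cmat_basis[where 's = 's])
  show "span {qi, qj} = emb ` {x :: 's gq. gq1 x = 0}" if "eps TYPE('s) = 1"
    unfolding span_odd[symmetric] span_emb[symmetric] using that by (simp add: cmat_basis[where 's = 's])
  show "span {qi, qj, qk} = emb ` {x :: 's gq. sc x = 0}" if "eps TYPE('s) = 1"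
    unfolding span_vec(1)[OF span_odd, symmetric] span_emb[symmetric] using that by (simp add: cmat_basis[where 's = 's])
  show "quaternions = range (emb :: 's gq \<Rightarrow> _)" if "eps TYPE('s) = 1"
    unfolding span_vec(2)[OF span_odd, symmetric] span_emb[symmetric] quaternions_def
    using that by (simp add: cmat_basis[where 's = 's])
  show "span {sigma1, sigma2, qk} = emb ` {x :: 's gq. sc x = 0}" if "eps TYPE('s) = -1"
    unfolding span_vec(1)[OF span_odd', symmetric] span_emb[symmetric] using that by (simp add: cmat_basis[where 's = 's])
  show "split_quaternions = range (emb :: 's gq \<Rightarrow> _)" if "eps TYPE('s) = -1"
    unfolding span_vec(2)[OF span_odd', symmetric] span_emb[symmetric] split_quaternions_def
    using that by (simp add: cmat_basis[where 's = 's])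
qed

section \<open>Coefficients of the transport products\<close>

definition pcoef :: "nat \<Rightarrow> pmat \<Rightarrow> cmat" where
  "pcoef d P = map_matrix (\<lambda>p. coeff p d) P"

lemma pcoef_nth: "pcoef d P $ i $ j = coeff (P $ i $ j) d"
  by (simp add: pcoef_def map_matrix_def)

lemma pcoef_const_mult: "pcoef d (map_matrix (\<lambda>c. [:c:]) E ** P) = E ** pcoef d P"
  by (simp add: cmat_eq_iff pcoef_nth mmult_nth map_matrix_def)

lemma pcoef_linear_factor_0: "pcoef 0 (linear_factor v ** P) = pcoef 0 P"
  by (simp add: cmat_eq_iff pcoef_nth mmult_nth map_matrix_def linear_factor_def mat_def)

lemma pcoef_linear_factor_Suc: "pcoef (Suc d) (linear_factor v ** P) = pcoef (Suc d) P + v ** pcoef d P"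
  by (simp add: cmat_eq_iff pcoef_nth mmult_nth map_matrix_def linear_factor_def mat_def distrib_right)

lemma pcoef_one: "pcoef d (mat 1) = (if d = 0 then mat 1 else 0)"
  by (simp add: cmat_eq_iff pcoef_nth mat_def)

lemma regular_iff: "regular Q E n fs \<longleftrightarrow> (\<forall>k. \<exists>d. trace_free (E ** pcoef d (transport_product Q fs n k)) \<noteq> 0)"
  unfolding regular_def monodromy_def pcoef_def[symmetric] pcoef_const_mult ..

lemma mmul_0 [simp]: "A ** 0 = 0" "0 ** A = 0" for A :: "'a::semiring_1^2^2"
  by (simp_all add: cmat_eq_iff mmult_nth)

lemma pcoef_transport_product:
  fixes fs :: "nat \<Rightarrow> int \<Rightarrow> cmat" and Q :: model
  defines "v \<equiv> \<lambda>i k. transport Q (fs i k) (fs (Suc i) k)"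
  shows "pcoef d (transport_product Q fs 2 k) = (if d = 0 then mat 1 else if d = 1 then v 0 k + v 1 k
      else if d = 2 then v 1 k ** v 0 k else 0)"
    and "pcoef d (transport_product Q fs 3 k) = (if d = 0 then mat 1 else if d = 1 then v 0 k + v 1 k + v 2 k
      else if d = 2 then v 1 k ** v 0 k + v 2 k ** (v 0 k + v 1 k) else if d = 3 then v 2 k ** (v 1 k ** v 0 k) else 0)"
proof -
  have 1: "pcoef d (transport_product Q fs (Suc 0) k) = (if d = 0 then mat 1 else if d = 1 then v 0 k else 0)" for d
    by (cases d, simp_all only: transport_product.simps pcoef_linear_factor_0 pcoef_linear_factor_Suc pcoef_one)
       (auto simp: v_def)
  have 2: "pcoef d (transport_product Q fs (Suc (Suc 0)) k) = (if d = 0 then mat 1 else if d = 1 then v 0 k + v 1 k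
      else if d = 2 then v 1 k ** v 0 k else 0)" for d
    by (cases d, simp_all only: transport_product.simps(2)[of Q fs "Suc 0"] pcoef_linear_factor_0 pcoef_linear_factor_Suc 1)
       (auto simp: v_def)
  then show "pcoef d (transport_product Q fs 2 k) = (if d = 0 then mat 1 else if d = 1 then v 0 k + v 1 k
      else if d = 2 then v 1 k ** v 0 k else 0)"
    by (simp add: numeral_2_eq_2)
  have "pcoef d (transport_product Q fs (Suc (Suc (Suc 0))) k) = (if d = 0 then mat 1 else if d = 1 then v 0 k + v 1 k + v 2 k
      else if d = 2 then v 1 k ** v 0 k + v 2 k ** (v 0 k + v 1 k) else if d = 3 then v 2 k ** (v 1 k ** v 0 k) else 0)"
    by (cases d, simp_all only: transport_product.simps(2)[of Q fs "Suc (Suc 0)"] pcoef_linear_factor_0 pcoef_linear_factor_Suc 2)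
       (auto simp: v_def numeral_2_eq_2 numeral_3_eq_3)
  then show "pcoef d (transport_product Q fs 3 k) = (if d = 0 then mat 1 else if d = 1 then v 0 k + v 1 k + v 2 k
      else if d = 2 then v 1 k ** v 0 k + v 2 k ** (v 0 k + v 1 k) else if d = 3 then v 2 k ** (v 1 k ** v 0 k) else 0)"
    by (simp add: numeral_3_eq_3)
qed

section \<open>The sphere and the hyperbolic plane\<close>

lemma const_int: "(\<And>k::int. x (k + 1) = x k) \<Longrightarrow> x k = x 0"
  by (induction k rule: int_induct[of _ 0]) (simp, metis, metis diff_add_cancel)

text \<open>If \<open>a\<close> had equal products with \<open>b\<close> and \<open>d\<close>, it
  would lie on the mirror of the reflection in \<open>b - d\<close>, and \<open>c\<close> would
  equal \<open>a\<close>.\<close>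

lemma bfly_distinct:
  fixes a b c d :: "'s::signature gq"
  assumes p: "a \<in> pts" "b \<in> pts" "c \<in> pts" "d \<in> pts" "b \<noteq> d" and "bfly a b c d" "a \<noteq> c"
  shows "dot a b \<noteq> dot a d"
proof
  assume "dot a b = dot a d"
  then have "a * (b - d) = - ((b - d) * a)"
    using mult_anticommute[of a "b - d"] p by (simp add: pts_D)
  moreover have "c * (b - d) = - ((b - d) * a)"
    using assms(6) by (simp add: bfly_def algebra_simps)
  ultimately have "c * (b - d) = a * (b - d)"
    by simp
  then show False
    using nrm_cancel_right[OF pts_nrm_diff[OF p(2,4,5)]] assms(7) by blast
qed

text \<open>A normal \<open>N\<close> whose reflection interchanges \<open>b\<close> and
  \<open>d\<close> is proportional to \<open>b - d\<close>, so there is only one candidate and a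
  single equation remains. The reflections are written without inverses.\<close>

lemma bfly_iff_reflection:
  fixes a b c d :: "'s::signature gq"
  assumes p: "a \<in> pts" "b \<in> pts" "c \<in> pts" "d \<in> pts" "b \<noteq> d"
  shows "bfly a b c d \<longleftrightarrow> (\<exists>N. sc N = 0 \<and> nrm N \<noteq> 0 \<and>
    N * a = - (c * N) \<and> N * c = - (a * N) \<and> N * b = - (d * N) \<and> N * d = - (b * N))"
proof
  assume b: "bfly a b c d"
  define N where "N = b - d"
  have n: "nrm N \<noteq> 0"
    using pts_nrm_diff[OF p(2,4,5)] by (simp add: N_def)
  have Na: "N * a = - (c * N)"
    using b by (simp add: bfly_def N_def algebra_simps)
  have N0: "sc N = 0"
    using p by (simp add: N_def pts_D)
  have NN: "N * (N * z) = - (nrm N) *\<^sub>R z" for z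
    using mult_star2[of N z] by (simp add: star_vec[OF N0]) (metis minus_minus)
  have NN': "z * N * N = - (nrm N) *\<^sub>R z" for z
    using mult_star[of N] by (simp add: star_vec[OF N0] mult.assoc) (metis minus_minus mult.right_neutral mult_scaleR_right mult_minus_right)
  have "N * (N * a) * N = N * (- (c * N)) * N"
    unfolding Na by simp
  then have "- (nrm N) *\<^sub>R (a * N) = - (N * c * N * N)"
    by (simp add: NN mult.assoc)
  then have "(nrm N) *\<^sub>R (N * c) = (nrm N) *\<^sub>R (- (a * N))"
    using NN'[of "N * c"] by simp
  then have Nc: "N * c = - (a * N)"
    using n scaleR_cancel_left by blast
  have "N * b = - (d * N)" "N * d = - (b * N)"
    using pts_swap[OF p(2,4)] by (simp_all add: N_def)
  then show "\<exists>N. sc N = 0 \<and> nrm N \<noteq> 0 \<and>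
    N * a = - (c * N) \<and> N * c = - (a * N) \<and> N * b = - (d * N) \<and> N * d = - (b * N)"
    using N0 n Na Nc by blast
next
  assume "\<exists>N. sc N = 0 \<and> nrm N \<noteq> 0 \<and>
    N * a = - (c * N) \<and> N * c = - (a * N) \<and> N * b = - (d * N) \<and> N * d = - (b * N)"
  then obtain N where N: "sc N = 0" "nrm N \<noteq> 0" "N * a = - (c * N)" "N * b = - (d * N)"
    by blast
  have "b * N = - (N * b) - (2 * dot b N) *\<^sub>R 1"
    using mult_anticommute[of b N] N p by (simp add: pts_D)
  then have "(b - d) * N = - (2 * dot b N) *\<^sub>R 1"
    using N(4) by (simp add: left_diff_distrib)
  then have "(b - d) * N * N = - (2 * dot b N) *\<^sub>R N"
    by simp
  moreover have "N * N = - (nrm N) *\<^sub>R 1"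
    using mult_star[of N] by (simp add: star_vec[OF N(1)]) (metis minus_minus)
  ultimately have "(nrm N) *\<^sub>R (b - d) = (2 * dot b N) *\<^sub>R N"
    by (simp add: mult.assoc)
  then have "(1 / nrm N) *\<^sub>R ((nrm N) *\<^sub>R (b - d)) = (1 / nrm N) *\<^sub>R ((2 * dot b N) *\<^sub>R N)"
    by simp
  then obtain r where r: "b - d = r *\<^sub>R N"
    using N(2) by auto
  have "c * (b - d) = - ((b - d) * a)"
    unfolding r using N(3) by simp
  then show "bfly a b c d"
    by (simp add: bfly_def algebra_simps)
qed

locale noneuclid =
  fixes Q :: model and t :: "'s::signature itself"
  assumes Q: "(Q = S2 \<and> eps TYPE('s) = 1) \<or> (Q = H2 \<and> eps TYPE('s) = -1)"
begin

lemma QE: "Q \<noteq> E2"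
  using Q by auto

lemma curv: "curv Q = eps TYPE('s)"
  using Q by auto

lemma points: "points Q = emb ` (pts :: 's gq set)"
  using Q by (auto simp: cmat_spans[where 's = 's] det_emb pts_def)

lemma points_emb [simp]: "emb (x :: 's gq) \<in> points Q \<longleftrightarrow> x \<in> pts"
  unfolding points by (auto simp: image_iff)

lemma points_fun: "(\<forall>k. f k \<in> points Q) \<longleftrightarrow> (\<exists>F :: int \<Rightarrow> 's gq. (\<forall>k. F k \<in> pts) \<and> f = (\<lambda>k. emb (F k)))"
proof
  assume "\<forall>k. f k \<in> points Q"
  then have "\<forall>k. \<exists>F :: 's gq. F \<in> pts \<and> f k = emb F"
    unfolding points by blast
  then obtain F :: "int \<Rightarrow> 's gq" where "\<And>k. F k \<in> pts \<and> f k = emb (F k)"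
    by metis
  then show "\<exists>F :: int \<Rightarrow> 's gq. (\<forall>k. F k \<in> pts) \<and> f = (\<lambda>k. emb (F k))"
    by (intro exI[of _ F]) auto
qed auto

text \<open>The coordinate along \<open>qk\<close> outweighs the other two, so the sign of the
  product of two points is the sign of the product of these coordinates.\<close>

lemma dot_H2:
  fixes F G :: "'s gq"
  assumes e: "eps TYPE('s) = -1" and p: "F \<in> pts" "G \<in> pts"
  shows "1 \<le> \<bar>dot F G\<bar>" "dot F G > 0 \<longleftrightarrow> same_sheet (emb F) (emb G)"
proof -
  have "1 \<le> (dot F G)\<^sup>2"
    using pts_dot(1)[OF p] e by simp
  then show "1 \<le> \<bar>dot F G\<bar>"
    by (simp add: abs_le_square_iff[of 1, simplified])
  define x y where "x = Im (gq1 F)" and "y = Im (gq1 G)"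
  have n: "x\<^sup>2 = 1 + (cmod (gq2 F))\<^sup>2" "y\<^sup>2 = 1 + (cmod (gq2 G))\<^sup>2"
    using p e unfolding cmod_power2
    by (auto simp: pts_def dot_def sc_def x_def y_def power2_eq_square algebra_simps)
  have d: "dot F G = x * y - Re (gq2 F * cnj (gq2 G))"
    using p e by (auto simp: pts_def dot_def sc_def x_def y_def algebra_simps)
  have "\<bar>Re (gq2 F * cnj (gq2 G))\<bar> \<le> cmod (gq2 F) * cmod (gq2 G)"
    using abs_Re_le_cmod[of "gq2 F * cnj (gq2 G)"] by (simp add: norm_mult)
  also have "\<dots> < \<bar>x\<bar> * \<bar>y\<bar>"
  proof (rule mult_strict_mono)
    show a: "cmod (gq2 F) < \<bar>x\<bar>"
      by (rule power2_less_imp_less) (simp_all add: n)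
    show "cmod (gq2 G) < \<bar>y\<bar>"
      by (rule power2_less_imp_less) (simp_all add: n)
    show "0 < \<bar>x\<bar>"
      using a by (meson le_less_trans norm_ge_zero)
  qed simp
  finally have lt: "\<bar>Re (gq2 F * cnj (gq2 G))\<bar> < \<bar>x * y\<bar>"
    by (simp add: abs_mult)
  then have "dot F G > 0 \<longleftrightarrow> x * y > 0"
    unfolding d by linarith
  also have "\<dots> \<longleftrightarrow> sgn (- x) = sgn (- y)"
    using lt by (auto simp: sgn_if zero_less_mult_iff split: if_splits)
  also have "\<dots> \<longleftrightarrow> same_sheet (emb F) (emb G)"
    unfolding same_sheet_def cmat_basis(1)[where 's = 's] rdot_emb
    by (simp add: dot_def sc_def x_def y_def)
  finally show "dot F G > 0 \<longleftrightarrow> same_sheet (emb F) (emb G)" .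
qed

text \<open>On the possible values of the product, arccos and arcosh are injective, so constant
  distance means constant product. On the hyperboloid the common sheet makes the product positive,
  hence at least 1.\<close>

lemma curves_iff: "(\<lambda>k. emb (F k :: 's gq)) \<in> curves Q \<longleftrightarrow> (\<exists>c. gcurve c F)"
proof
  assume f: "(\<lambda>k. emb (F k)) \<in> curves Q"
  then have F: "F k \<in> pts" for k
    by (auto simp: curves_def)
  have ne: "F (k - 1) \<noteq> F (k + 1)" "F k \<noteq> F (k + 1)" for k
    using f by (auto simp: curves_def)
  have n1: "dot (F k) (F (k + 1)) \<noteq> 1" for k
    using pts_dot(2)[OF F F, of k "k + 1"] ne(2)[of k] by auto
  obtain d where d: "\<And>k. mdist Q (emb (F k)) (emb (F (k + 1))) = d"
    using f by (auto simp: curves_def)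
  have "dot (F k) (F (k + 1)) > -1 \<and> dot (F k) (F (k + 1)) = dot (F 0) (F (0 + 1))" for k
    using Q
  proof
    assume S: "Q = S2 \<and> eps TYPE('s) = 1"
    have b: "-1 \<le> dot (F k) (F (k + 1)) \<and> dot (F k) (F (k + 1)) \<le> 1" for k
      using pts_dot(1)[OF F F, of k "k + 1"] S by (simp add: abs_square_le_1 abs_le_iff)
    have "dot (F k) (F (k + 1)) \<noteq> -1"
      using pts_dot(3)[OF F F, of k "k + 1"] f S by (auto simp: curves_def emb_simps(5)[symmetric])
    moreover have "arccos (dot (F k) (F (k + 1))) = arccos (dot (F 0) (F (0 + 1)))"
      using d[of k] d[of 0] S by simp
    ultimately show ?thesis
      using b[of k] b[of 0] by (metis cos_arccos less_le)
  next
    assume H: "Q = H2 \<and> eps TYPE('s) = -1"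
    have "same_sheet (emb (F k)) (emb (F (k + 1)))" for k
      using f H by (simp add: curves_def)
    then have b: "1 \<le> dot (F k) (F (k + 1))" for k
      using dot_H2[OF _ F F, of k "k + 1"] H by fastforce
    moreover have "arcosh (dot (F k) (F (k + 1))) = arcosh (dot (F 0) (F (0 + 1)))"
      using d[of k] d[of 0] H by simp
    ultimately show ?thesis
      using b[of k] b[of 0] by (smt (verit) cosh_arcosh_real)
  qed
  then have "gcurve (dot (F 0) (F (0 + 1))) F"
    unfolding gcurve_def using F n1 ne(1) by metis
  then show "\<exists>c. gcurve c F" ..
next
  assume "\<exists>c. gcurve c F"
  then obtain c where "gcurve c F" ..
  then interpret curve c F
    by (rule curve.intro)
  have F01: "F (k + 1) \<noteq> F k" "F (k + 1) \<noteq> - F k" for k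
  proof -
    show "F (k + 1) \<noteq> F k"
      using c FF(1)[of k] by (metis F(3))
    show "F (k + 1) \<noteq> - F k"
      using c FF(1)[of k] F(3)[of k] by (metis dot_simps(8) less_irrefl)
  qed
  have "mdist Q (emb (F k)) (emb (F (k + 1))) = (if Q = S2 then arccos c else arcosh c)" for k
    using Q by auto
  moreover have "distinct [emb (F (k - 1)), emb (F k), emb (F (k + 1))]" for k
  proof -
    have "F (k + 1) \<noteq> F (k - 1)"
      using gcurve by (simp add: gcurve_def)
    then show ?thesis
      using F01(1)[of k] F01(1)[of "k - 1"] by auto
  qed
  moreover have "same_sheet (emb (F k)) (emb (F l))" if H: "Q = H2" for k l
  proof -
    have e: "eps TYPE('s) = -1"
      using H Q by auto
    have "dot (F k) (F (k + 1)) > 0" for k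
      using dot_H2(1)[OF e F(1) F(1), of k "k + 1"] c by simp
    then have "same_sheet (emb (F k)) (emb (F (k + 1)))" for k
      using dot_H2(2)[OF e F(1) F(1)] by blast
    then have "sgn (rdot (emb (F (k + 1))) qk) = sgn (rdot (emb (F k)) qk)" for k
      by (simp add: same_sheet_def)
    then have "sgn (rdot (emb (F k)) qk) = sgn (rdot (emb (F 0)) qk)" for k
      by (rule const_int)
    from this[of k] this[of l] show ?thesis
      by (simp add: same_sheet_def)
  qed
  ultimately show "(\<lambda>k. emb (F k)) \<in> curves Q"
    unfolding curves_def using F01(2) by (auto simp: emb_simps(5)[symmetric])
qed

lemma curvesD: "f \<in> curves Q \<Longrightarrow> \<exists>F :: int \<Rightarrow> 's gq. f = (\<lambda>k. emb (F k)) \<and> (\<exists>c. gcurve c F)"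
  using curves_iff points_fun[of f] by (metis (mono_tags, lifting) curves_def mem_Collect_eq)

lemma transport_emb: "F \<in> pts \<Longrightarrow> transport Q (emb F) (emb G) = emb (- (G * F :: 's gq))"
  using QE by (simp add: transport_def matrix_inv_emb_pts emb_simps(7)[symmetric])

lemma butterfly_iff:
  assumes p: "a \<in> pts" "b \<in> pts" "c \<in> pts" "d \<in> (pts :: 's gq set)"
  shows "butterfly Q (emb a) (emb b) (emb c) (emb d) \<longleftrightarrow>
    a \<noteq> c \<and> b \<noteq> d \<and> a \<noteq> - b \<and> b \<noteq> - c \<and> c \<noteq> - d \<and> d \<noteq> - a \<and> bfly a b c d"
proof -
  have "reflections Q = {\<lambda>F. - (N ** F ** matrix_inv N) | N. N \<in> emb ` {x :: 's gq. sc x = 0} \<and> det N \<noteq> 0}"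
    using Q by (elim disjE conjE) (simp_all add: cmat_spans[where 's = 's])
  also have "\<dots> = (\<lambda>N F. - (N ** F ** matrix_inv N)) ` {N \<in> emb ` {x :: 's gq. sc x = 0}. det N \<noteq> 0}"
    by blast
  also have "{N \<in> emb ` {x :: 's gq. sc x = 0}. det N \<noteq> 0} = emb ` {x :: 's gq. sc x = 0 \<and> nrm x \<noteq> 0}"
    by (auto simp: det_emb)
  finally have refl: "reflections Q = (\<lambda>N F. - (N ** F ** matrix_inv N)) ` emb ` {x :: 's gq. sc x = 0 \<and> nrm x \<noteq> 0}" .
  have eq: "- (emb N ** emb x ** matrix_inv (emb N)) = emb y \<longleftrightarrow> N * x = - (y * N)"
    if n: "nrm N \<noteq> 0" for N x y :: "'s gq"
  proof -
    have "- (emb N ** emb x ** matrix_inv (emb N)) = emb (- (N * x * ((1 / nrm N) *\<^sub>R star N)))"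
      by (simp only: matrix_inv_emb[OF n] emb_simps)
    also have "\<dots> = emb y \<longleftrightarrow> - (N * x * ((1 / nrm N) *\<^sub>R star N)) = y"
      by simp
    also have "\<dots> \<longleftrightarrow> - (N * x * ((1 / nrm N) *\<^sub>R star N)) * N = y * N"
      using nrm_cancel_right[OF n] by blast
    also have "- (N * x * ((1 / nrm N) *\<^sub>R star N)) * N = - (N * x)"
      using n by (simp add: mult.assoc star_mult_self)
    finally show ?thesis
      by (metis minus_minus)
  qed
  have "(\<exists>\<rho> \<in> reflections Q. \<rho> (emb a) = emb c \<and> \<rho> (emb c) = emb a \<and> \<rho> (emb b) = emb d \<and> \<rho> (emb d) = emb b)
     \<longleftrightarrow> (\<exists>N :: 's gq. sc N = 0 \<and> nrm N \<noteq> 0 \<and> - (emb N ** emb a ** matrix_inv (emb N)) = emb c \<and>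
       - (emb N ** emb c ** matrix_inv (emb N)) = emb a \<and> - (emb N ** emb b ** matrix_inv (emb N)) = emb d \<and>
       - (emb N ** emb d ** matrix_inv (emb N)) = emb b)"
    unfolding refl by (simp add: bex_simps image_image conj_assoc)
  also have "\<dots> \<longleftrightarrow> (\<exists>N. sc N = 0 \<and> nrm N \<noteq> 0 \<and>
    N * a = - (c * N) \<and> N * c = - (a * N) \<and> N * b = - (d * N) \<and> N * d = - (b * N))"
    by (rule ex_cong1) (use eq in \<open>auto simp del: minus_minus\<close>)
  finally show ?thesis
    using bfly_iff_reflection[OF p] QE p unfolding butterfly_def
    by (auto simp: emb_simps(5)[symmetric])
qed

text \<open>A reflection preserves products, so the distance of corresponding points is constant
  along the curves. That it differs from the edge length is the condition that opposite vertices of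
  the butterflies differ.\<close>

lemma baecklund_iff: "baecklund Q (\<lambda>k. emb (F k :: 's gq)) (\<lambda>k. emb (G k)) \<longleftrightarrow> (\<exists>c. gback c F G)"
proof
  assume b: "baecklund Q (\<lambda>k. emb (F k)) (\<lambda>k. emb (G k))"
  then obtain c c' where c: "gcurve c F" "gcurve c' G"
    by (auto simp: baecklund_def curves_iff)
  then have F: "F k \<in> pts" and G: "G k \<in> pts" for k
    by (simp_all add: gcurve_def)
  have bf: "F k \<noteq> G (k + 1) \<and> F (k + 1) \<noteq> G k \<and> G k \<noteq> - F k \<and> bfly (F k) (F (k + 1)) (G (k + 1)) (G k)" for k
    using b F G by (auto simp: baecklund_def butterfly_iff)
  have "dot (G (k + 1)) (F (k + 1)) = dot (G k) (F k)" for k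
    using bfly_dot(2)[OF F F G G, of "k + 1" k k "k + 1"] bf[of k] by simp
  then have x: "dot (G k) (F k) = dot (G 0) (F 0)" for k
    by (rule const_int)
  have "dot (F 0) (F 1) = c"
    using c(1) by (metis gcurve_def add_0)
  have "dot (G 0) (F 0) \<noteq> -1"
    using pts_dot(3)[OF F G, of 0 0] bf[of 0] by (auto simp: dot_commute)
  moreover have "dot (G 0) (F 0) \<noteq> c"
    using bfly_distinct[of "F 0" "F 1" "G 1" "G 0"] bf[of 0] \<open>dot (F 0) (F 1) = c\<close> F G
    by (auto simp: dot_commute[of "F 0" "G 0"])
  ultimately have "gback c F G"
    unfolding gback_def using c G bf x by blast
  then show "\<exists>c. gback c F G" ..
next
  assume "\<exists>c. gback c F G"
  then obtain c where FG: "gback c F G" ..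
  then obtain x where xs: "x \<noteq> c" "x \<noteq> -1" "\<And>k. dot (G k) (F k) = x"
    by (auto simp: gback_def)
  interpret F: curve c F
    by (rule gback_D[OF FG])
  interpret G: curve c G
    by (rule gback_D[OF FG])
  interpret transform c F G x
    by unfold_locales (use xs gback_D(5)[OF FG] in auto)
  have "butterfly Q (emb (F k)) (emb (F (k + 1))) (emb (G (k + 1))) (emb (G k))" for k
  proof -
    have anti: "p = - q \<Longrightarrow> q \<in> pts \<Longrightarrow> dot p q = -1" for p q :: "'s gq"
      by (simp add: pts_D)
    have "F k \<noteq> - F (k + 1)" "G (k + 1) \<noteq> - G k"
      using anti[OF _ F.F(1)[of "k + 1"], of "F k"] anti[OF _ G.F(1)[of k], of "G (k + 1)"]
      unfolding F.FF G.FF using F.c(1) by fastforce+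
    moreover have "F (k + 1) \<noteq> - G (k + 1)" "G k \<noteq> - F k"
      using anti[OF _ G.F(1)[of "k + 1"], of "F (k + 1)"] anti[OF _ F.F(1)[of k], of "G k"]
      unfolding dot_commute[of "F (k + 1)"] xs(3) using xs(2) by fastforce+
    ultimately show ?thesis
      using ne[of k] gback_D(5)[OF FG, of k] by (subst butterfly_iff) auto
  qed
  then show "baecklund Q (\<lambda>k. emb (F k)) (\<lambda>k. emb (G k))"
    unfolding baecklund_def curves_iff using F.gcurve G.gcurve by blast
qed

lemma zeta:
  assumes "gcurve c F"
  shows "zeta Q (\<lambda>k. emb (F k :: 's gq)) > 0" "(zeta Q (\<lambda>k. emb (F k)))\<^sup>2 = eps TYPE('s) * (1 - c\<^sup>2)"
proof -
  interpret curve c F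
    by (rule curve.intro[OF assms])
  have e: "eps TYPE('s) * eps TYPE('s) = 1"
    using eps_cases[of "TYPE('s)"] by auto
  have eta: "eta Q (\<lambda>k. emb (F k)) = sqrt (2 * eps TYPE('s) * (1 - c))"
    using QE FF(1)[of 0] by (simp add: eta_def curv)
  have "(eps TYPE('s) * (1 - c)) * (1 + c) > 0"
    using c(6) by (simp add: power2_eq_square algebra_simps)
  then have p: "eps TYPE('s) * (1 - c) > 0"
    using c(1) by (simp add: zero_less_mult_iff)
  have "curv Q * (eta Q (\<lambda>k. emb (F k)))\<^sup>2 / 4 = (eps TYPE('s) * eps TYPE('s)) * (1 - c) / 2"
    using p unfolding eta by (simp add: curv)
  then have z: "zeta Q (\<lambda>k. emb (F k)) = sqrt (2 * eps TYPE('s) * (1 - c)) * sqrt ((1 + c) / 2)"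
    unfolding zeta_def e by (simp add: eta field_simps)
  show "zeta Q (\<lambda>k. emb (F k)) > 0"
    unfolding z using p c(1) by simp
  show "(zeta Q (\<lambda>k. emb (F k)))\<^sup>2 = eps TYPE('s) * (1 - c\<^sup>2)"
    unfolding z using p c(1) by (simp add: power_mult_distrib) (simp add: power2_eq_square algebra_simps)
qed

lemma geodesic_curvature:
  assumes "gcurve c F"
  shows "geodesic_curvature Q (\<lambda>k. emb (F k :: 's gq)) k = 2 * curve.sg F k / zeta Q (\<lambda>k. emb (F k))"
proof -
  interpret curve c F
    by (rule curve.intro[OF assms])
  define z where "z = zeta Q (\<lambda>k. emb (F k))"
  \<comment> \<open>Minus this product is the transport matrix of the incoming edge; its frame
    expansion produces the numerator of the curvature.\<close>
  have eq: "F k * F (k - 1) = - (c *\<^sub>R 1) - (1/2) *\<^sub>R (F k * T k) - (sg k / 2) *\<^sub>R T k"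
    by (subst F_pred) (simp add: right_diff_distrib distrib_left)
  have *: "dot (- (F k * F (k - 1))) (F (k + 1) - F k) = sg k * nrm (T k) / 2"
    unfolding eq by (subst F_succ) (simp add: field_simps)
  have "edge_normal Q (\<lambda>k. emb (F k)) (k - 1) = emb ((1 / z) *\<^sub>R (- (F k * F (k - 1)) - sc (- (F k * F (k - 1))) *\<^sub>R 1))"
    using QE by (simp add: edge_normal_def transport_emb trace_free_emb emb_simps(6)[symmetric] z_def Let_def)
  moreover have "dot ((1 / z) *\<^sub>R (P - sc P *\<^sub>R 1)) D = (1 / z) * dot P D" if "sc D = 0" for P D :: "'s gq"
    using that by simp
  ultimately have "rdot (edge_normal Q (\<lambda>k. emb (F k)) (k - 1)) (emb (F (k + 1)) - emb (F k))
      = (1 / z) * dot (- (F k * F (k - 1))) (F (k + 1) - F k)"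
    unfolding emb_simps(4)[symmetric] by (metis F(2) diff_self rdot_emb sc_simps(4))
  then have "rdot (edge_normal Q (\<lambda>k. emb (F k)) (k - 1)) (emb (F (k + 1)) - emb (F k)) = (1 / z) * (sg k * nrm (T k) / 2)"
    unfolding * .
  moreover have "rdot (emb (F (k + 1)) - emb (F (k - 1))) (emb (F (k + 1)) - emb (F (k - 1))) = nrm (T k)"
    by (simp add: emb_simps(4)[symmetric] T_def del: dot_simps)
  ultimately have "geodesic_curvature Q (\<lambda>k. emb (F k)) k = 4 * ((1 / z) * (sg k * nrm (T k) / 2)) / nrm (T k)"
    by (simp add: geodesic_curvature_def)
  then show ?thesis
    using nrm_T[of k] by (simp add: z_def)
qed

text \<open>Substituting the curvature \<open>2 * sg / zeta\<close> makes the denominator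
  \<open>1 + sg^2\<close> and rescales only \<delta>.\<close>

lemma elastic_equation_iff:
  assumes "gcurve c F"
  shows "elastic_equation Q (\<lambda>k. emb (F k :: 's gq)) \<xi> \<delta> \<longleftrightarrow>
    (\<forall>k. (1 + (curve.sg F k)\<^sup>2) * (curve.sg F (k + 1) + curve.sg F (k - 1))
      = \<xi> * curve.sg F k + \<delta> * zeta Q (\<lambda>k. emb (F k)) / 2)"
proof -
  define s where "s = curve.sg F"
  define z where "z = zeta Q (\<lambda>k. emb (F k))"
  have z: "z > 0"
    using zeta(1)[OF assms] by (simp add: z_def)
  have "2 * s (k - 1) / z + 2 * s (k + 1) / z = (\<xi> * (2 * s k / z) + \<delta>) / (1 + z\<^sup>2 / 4 * (2 * s k / z)\<^sup>2)
    \<longleftrightarrow> (1 + (s k)\<^sup>2) * (s (k + 1) + s (k - 1)) = \<xi> * s k + \<delta> * z / 2" for k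
  proof -
    have n: "1 + (s k)\<^sup>2 \<noteq> 0"
      by (smt (verit) zero_le_power2)
    have "z\<^sup>2 / 4 * (2 * s k / z)\<^sup>2 = (s k)\<^sup>2"
      using z by (simp add: power_divide power_mult_distrib)
    moreover have "2 * s (k - 1) / z + 2 * s (k + 1) / z = 2 / z * (s (k + 1) + s (k - 1))"
      "\<xi> * (2 * s k / z) + \<delta> = 2 / z * (\<xi> * s k + \<delta> * z / 2)"
      using z by (simp_all add: field_simps)
    ultimately have "2 * s (k - 1) / z + 2 * s (k + 1) / z = (\<xi> * (2 * s k / z) + \<delta>) / (1 + z\<^sup>2 / 4 * (2 * s k / z)\<^sup>2)
      \<longleftrightarrow> 2 / z * (s (k + 1) + s (k - 1)) * (1 + (s k)\<^sup>2) = 2 / z * (\<xi> * s k + \<delta> * z / 2)"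
      by (simp only: nonzero_eq_divide_eq[OF n])
    also have "\<dots> \<longleftrightarrow> 2 / z * ((1 + (s k)\<^sup>2) * (s (k + 1) + s (k - 1))) = 2 / z * (\<xi> * s k + \<delta> * z / 2)"
      by (simp only: mult_ac)
    also have "\<dots> \<longleftrightarrow> (1 + (s k)\<^sup>2) * (s (k + 1) + s (k - 1)) = \<xi> * s k + \<delta> * z / 2"
      using z by (subst mult_cancel_left) simp
    finally show ?thesis .
  qed
  then show ?thesis
    unfolding elastic_equation_def geodesic_curvature[OF assms] s_def[symmetric] z_def[symmetric] by simp
qed

end

section \<open>Invariance in terms of quaternions\<close>

lemma less2: "(\<forall>i<2. P i) \<longleftrightarrow> P 0 \<and> P (Suc 0)" and less3: "(\<forall>i<3. P i) \<longleftrightarrow> P 0 \<and> P (Suc 0) \<and> P (Suc (Suc 0))"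
  for P :: "nat \<Rightarrow> bool"
  by (auto simp: less_Suc_eq numeral_2_eq_2 numeral_3_eq_3)

context noneuclid
begin

lemma represents_iff: "represents Q pres E \<phi> \<longleftrightarrow> (\<exists>e :: 's gq. E = emb e \<and> nrm e \<noteq> 0 \<and>
    \<phi> = (\<lambda>F. (if pres then 1 else -1) *\<^sub>R (matrix_inv E ** F ** E)))"
  using Q by (auto simp: cmat_spans[where 's = 's] invertible_emb)

lemma conj_emb:
  assumes "nrm (e :: 's gq) \<noteq> 0"
  shows "emb h = r *\<^sub>R (matrix_inv (emb e) ** emb f ** emb e) \<longleftrightarrow> e * h = r *\<^sub>R (f * e)"
proof -
  have "r *\<^sub>R (matrix_inv (emb e) ** emb f ** emb e) = emb (r *\<^sub>R ((1 / nrm e) *\<^sub>R star e * f * e))"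
    by (simp only: matrix_inv_emb[OF assms] emb_simps)
  then have "emb h = r *\<^sub>R (matrix_inv (emb e) ** emb f ** emb e) \<longleftrightarrow> h = r *\<^sub>R ((1 / nrm e) *\<^sub>R star e * f * e)"
    by (simp only: emb_inj)
  also have "\<dots> \<longleftrightarrow> e * h = e * (r *\<^sub>R ((1 / nrm e) *\<^sub>R star e * f * e))"
    using nrm_cancel_left[OF assms] by blast
  also have "e * (r *\<^sub>R ((1 / nrm e) *\<^sub>R star e * f * e)) = r *\<^sub>R (f * e)"
    using assms by (simp add: mult.assoc)
  finally show ?thesis .
qed

lemma trace_free_scalar: "trace_free (emb (r *\<^sub>R (1 :: 's gq))) = 0"
  by (simp only: trace_free_emb) (simp add: emb_simps(1))

text \<open>The quadratic coefficient is \<open>F * E * F\<close>, which is scalar as soon as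
  \<open>E\<close> is. The linear coefficient is trace-free, so it counts as it stands.\<close>

lemma regular_two:
  fixes E :: "'s gq" and F G H :: "int \<Rightarrow> 's gq"
  assumes p: "\<And>k. F k \<in> pts" "\<And>k. G k \<in> pts" "\<And>k. H k \<in> pts" and EH: "\<And>k. E * H k = - (F k * E)"
    and fs: "fs 0 = (\<lambda>k. emb (F k))" "fs (Suc 0) = (\<lambda>k. emb (G k))" "fs (Suc (Suc 0)) = (\<lambda>k. emb (H k))"
  shows "regular Q (emb E) 2 fs \<longleftrightarrow>
    (\<forall>k. E - sc E *\<^sub>R 1 \<noteq> 0 \<or> - (E * G k * F k) - E * H k * G k \<noteq> 0)"
proof -
  define K where "K k = - (E * G k * F k) - E * H k * G k" for k
  have K0: "sc (K k) = 0" for k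
  proof -
    have "K k = F k * (E * G k) - E * G k * F k"
      by (simp add: K_def EH mult.assoc)
    then show ?thesis
      using sc_commute[of "F k" "E * G k"] by simp
  qed
  have "(\<exists>d. trace_free (emb E ** pcoef d (transport_product Q fs 2 k)) \<noteq> 0) \<longleftrightarrow> E - sc E *\<^sub>R 1 \<noteq> 0 \<or> K k \<noteq> 0" for k
  proof -
    have v: "transport Q (fs 0 k) (fs (Suc 0) k) = emb (- (G k * F k))"
      "transport Q (fs 1 k) (fs (Suc 1) k) = emb (- (H k * G k))"
      by (simp_all add: fs transport_emb p)
    have c: "emb E ** pcoef d (transport_product Q fs 2 k) = emb (if d = 0 then E else if d = 1 then K k
        else if d = 2 then F k * E * F k else 0)" for d
    proof -
      have "E * (- (H k * G k) * - (G k * F k)) = F k * E * F k"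
        using EH[of k] pts_D[OF p(2)[of k]] by (simp add: mult.assoc) (simp add: mult.assoc[symmetric])
      then show ?thesis
        unfolding pcoef_transport_product v
        by (simp add: emb_simps(3,7)[symmetric] emb_simps(1,2) K_def algebra_simps)
    qed
    show ?thesis
    proof
      assume "\<exists>d. trace_free (emb E ** pcoef d (transport_product Q fs 2 k)) \<noteq> 0"
      then obtain d :: nat where d: "trace_free (emb (if d = 0 then E else if d = 1 then K k
        else if d = 2 then F k * E * F k else 0)) \<noteq> 0"
        unfolding c by blast
      show "E - sc E *\<^sub>R 1 \<noteq> 0 \<or> K k \<noteq> 0"
      proof (rule ccontr)
        assume "\<not> ?thesis"
        then have E: "E = sc E *\<^sub>R 1" and "K k = 0"
          by auto
        have "F k * E * F k = (- sc E) *\<^sub>R 1"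
          by (subst E) (simp add: pts_D p)
        then have "\<exists>r. F k * E * F k = r *\<^sub>R 1" ..
        moreover have "\<exists>r. E = r *\<^sub>R 1"
          using E ..
        moreover have "\<exists>r. 0 = r *\<^sub>R (1 :: 's gq)"
          by (rule exI[of _ 0]) simp
        ultimately have "\<exists>r. (if d = 0 then E else if d = 1 then K k else if d = 2 then F k * E * F k else 0) = r *\<^sub>R 1"
            (is "\<exists>r. ?x = _")
          unfolding \<open>K k = 0\<close> by simp
        then obtain r where r: "?x = r *\<^sub>R 1" ..
        from d show False
          unfolding r trace_free_scalar by simp
      qed
    next
      assume *: "E - sc E *\<^sub>R 1 \<noteq> 0 \<or> K k \<noteq> 0"
      then have "trace_free (emb E ** pcoef 0 (transport_product Q fs 2 k)) \<noteq> 0 \<or>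
         trace_free (emb E ** pcoef 1 (transport_product Q fs 2 k)) \<noteq> 0"
        unfolding c trace_free_emb by (simp add: K0)
      then show "\<exists>d. trace_free (emb E ** pcoef d (transport_product Q fs 2 k)) \<noteq> 0"
        by blast
    qed
  qed
  then show ?thesis
    by (simp add: regular_iff K_def)
qed

text \<open>The map taking \<open>z\<close> to \<open>- (F * z * F)\<close> carries the coefficients
  of degree 0 and 1 to those of degree 3 and 2 and preserves scalars. Two coefficients therefore
  decide.\<close>

lemma regular_three:
  fixes E :: "'s gq" and F G M H :: "int \<Rightarrow> 's gq"
  assumes p: "\<And>k. F k \<in> pts" "\<And>k. G k \<in> pts" "\<And>k. M k \<in> pts" "\<And>k. H k \<in> pts" and EH: "\<And>k. E * H k = F k * E"
    and fs: "fs 0 = (\<lambda>k. emb (F k))" "fs (Suc 0) = (\<lambda>k. emb (G k))" "fs (Suc (Suc 0)) = (\<lambda>k. emb (M k))"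
      "fs (Suc (Suc (Suc 0))) = (\<lambda>k. emb (H k))"
  defines "K \<equiv> \<lambda>k. - (E * G k * F k) - E * M k * G k - E * H k * M k"
  shows "regular Q (emb E) 3 fs \<longleftrightarrow> (\<forall>k. E - sc E *\<^sub>R 1 \<noteq> 0 \<or> K k - sc (K k) *\<^sub>R 1 \<noteq> 0)"
proof -
  have "(\<exists>d. trace_free (emb E ** pcoef d (transport_product Q fs 3 k)) \<noteq> 0) \<longleftrightarrow>
      E - sc E *\<^sub>R 1 \<noteq> 0 \<or> K k - sc (K k) *\<^sub>R 1 \<noteq> 0" for k
  proof -
    note [simp] = pts_D[OF p(1)[of k]] pts_D[OF p(2)[of k]] pts_D[OF p(3)[of k]] pts_D[OF p(4)[of k]]
    have v: "transport Q (fs 0 k) (fs (Suc 0) k) = emb (- (G k * F k))"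
      "transport Q (fs 1 k) (fs (Suc 1) k) = emb (- (M k * G k))"
      "transport Q (fs 2 k) (fs (Suc 2) k) = emb (- (H k * M k))"
      by (simp_all add: fs transport_emb p numeral_2_eq_2)
    have FE: "F k * (E * z) = E * (H k * z)" for z
      using EH[of k] by (simp add: mult.assoc[symmetric])
    have c: "emb E ** pcoef d (transport_product Q fs 3 k) = emb (if d = 0 then E else if d = 1 then K k
        else if d = 2 then - (F k * K k * F k) else if d = 3 then - (F k * E * F k) else 0)" for d
    proof -
      have "E * (- (M k * G k) * - (G k * F k) + - (H k * M k) * (- (G k * F k) + - (M k * G k))) = - (F k * K k * F k)"
        by (simp add: K_def FE algebra_simps)
      moreover have "E * (- (H k * M k) * (- (M k * G k) * - (G k * F k))) = - (F k * E * F k)"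
        by (simp add: FE mult.assoc)
      ultimately show ?thesis
        unfolding pcoef_transport_product v
        by (simp add: emb_simps(3,7)[symmetric] emb_simps(1,2)) (simp add: K_def algebra_simps)
    qed
    show ?thesis
    proof
      assume "\<exists>d. trace_free (emb E ** pcoef d (transport_product Q fs 3 k)) \<noteq> 0"
      then obtain d :: nat where d: "trace_free (emb (if d = 0 then E else if d = 1 then K k
        else if d = 2 then - (F k * K k * F k) else if d = 3 then - (F k * E * F k) else 0)) \<noteq> 0"
        unfolding c by blast
      show "E - sc E *\<^sub>R 1 \<noteq> 0 \<or> K k - sc (K k) *\<^sub>R 1 \<noteq> 0"
      proof (rule ccontr)
        assume "\<not> ?thesis"
        then have E: "E = sc E *\<^sub>R 1" and K: "K k = sc (K k) *\<^sub>R 1"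
          by auto
        have "- (F k * E * F k) = sc E *\<^sub>R 1" "- (F k * K k * F k) = sc (K k) *\<^sub>R 1"
          by (subst E, simp) (subst K, simp)
        then have "\<exists>r. - (F k * E * F k) = r *\<^sub>R 1" "\<exists>r. - (F k * K k * F k) = r *\<^sub>R 1"
          by blast+
        moreover have "\<exists>r. E = r *\<^sub>R 1" "\<exists>r. K k = r *\<^sub>R 1"
          using E K by blast+
        moreover have "\<exists>r. 0 = r *\<^sub>R (1 :: 's gq)"
          by (rule exI[of _ 0]) simp
        ultimately have "\<exists>r. (if d = 0 then E else if d = 1 then K k
            else if d = 2 then - (F k * K k * F k) else if d = 3 then - (F k * E * F k) else 0) = r *\<^sub>R 1"
            (is "\<exists>r. ?x = _")
          by simp
        then obtain r where r: "?x = r *\<^sub>R 1" ..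
        from d show False
          unfolding r trace_free_scalar by simp
      qed
    next
      assume *: "E - sc E *\<^sub>R 1 \<noteq> 0 \<or> K k - sc (K k) *\<^sub>R 1 \<noteq> 0"
      then have "trace_free (emb E ** pcoef 0 (transport_product Q fs 3 k)) \<noteq> 0 \<or>
         trace_free (emb E ** pcoef 1 (transport_product Q fs 3 k)) \<noteq> 0"
        unfolding c trace_free_emb by simp
      then show "\<exists>d. trace_free (emb E ** pcoef d (transport_product Q fs 3 k)) \<noteq> 0"
        by blast
    qed
  qed
  then show ?thesis
    by (simp add: regular_iff)
qed

lemma gback_same:
  assumes "gback c F G" "gback c' G H"
  shows "gback c G (H :: int \<Rightarrow> 's gq)"
proof -
  have "gcurve c G" "gcurve c' G"
    using gback_gcurve[OF assms(1)] assms(2) by (auto simp: gback_def)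
  then have "c' = c"
    unfolding gcurve_def by metis
  then show ?thesis
    using assms(2) by simp
qed

lemma two_invariant_iff:
  assumes "gcurve c (F :: int \<Rightarrow> 's gq)"
  shows "n_invariant Q 2 (\<lambda>k. emb (F k)) \<longleftrightarrow>
    (\<exists>E G H. nrm E \<noteq> 0 \<and> gback c F G \<and> gback c G H \<and> (\<forall>k. E * H k = - (F k * E)) \<and>
      (\<forall>k. E - sc E *\<^sub>R 1 \<noteq> 0 \<or> - (E * G k * F k) - E * H k * G k \<noteq> 0))"
proof
  assume "n_invariant Q 2 (\<lambda>k. emb (F k))"
  then obtain fs E \<phi> where fs: "fs 0 = (\<lambda>k. emb (F k))" "baecklund_sequence Q 2 fs" "represents Q (odd (2::nat)) E \<phi>"
      "\<forall>k. fs 2 k = \<phi> (emb (F k))" "regular Q E 2 fs"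
    by (auto simp: n_invariant_def)
  have b: "baecklund Q (fs 0) (fs (Suc 0))" "baecklund Q (fs (Suc 0)) (fs (Suc (Suc 0)))"
    using fs(2) unfolding baecklund_sequence_def less2 by auto
  then obtain G H :: "int \<Rightarrow> 's gq" where GH: "fs (Suc 0) = (\<lambda>k. emb (G k))" "fs (Suc (Suc 0)) = (\<lambda>k. emb (H k))"
    using curvesD unfolding baecklund_def by metis
  obtain e :: "'s gq" where e: "E = emb e" "nrm e \<noteq> 0" "\<phi> = (\<lambda>F. (-1) *\<^sub>R (matrix_inv E ** F ** E))"
    using fs(3) unfolding represents_iff by auto
  obtain c1 where "gback c1 F G"
    using b(1) unfolding fs(1) GH baecklund_iff by blast
  moreover have "c1 = c"
    using calculation assms unfolding gback_def gcurve_def by metis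
  ultimately have FG: "gback c F G"
    by simp
  have GHb: "gback c G H"
    using b(2) gback_same[OF FG] unfolding GH baecklund_iff by blast
  have EH: "e * H k = - (F k * e)" for k
    using fs(4) conj_emb[OF e(2), of "H k" "-1" "F k"] by (simp add: numeral_2_eq_2 GH e)
  have p: "F k \<in> pts" "G k \<in> pts" "H k \<in> pts" for k
    using gback_D(3,4)[OF FG] gback_D(4)[OF GHb] by auto
  show "\<exists>E G H. nrm E \<noteq> 0 \<and> gback c F G \<and> gback c G H \<and> (\<forall>k. E * H k = - (F k * E)) \<and>
      (\<forall>k. E - sc E *\<^sub>R 1 \<noteq> 0 \<or> - (E * G k * F k) - E * H k * G k \<noteq> 0)"
    using e(2) FG GHb EH fs(5) unfolding e(1) regular_two[OF p EH fs(1) GH] by blast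
next
  assume "\<exists>E G H. nrm E \<noteq> 0 \<and> gback c F G \<and> gback c G H \<and> (\<forall>k. E * H k = - (F k * E)) \<and>
      (\<forall>k. E - sc E *\<^sub>R 1 \<noteq> 0 \<or> - (E * G k * F k) - E * H k * G k \<noteq> 0)"
  then obtain E G H where *: "nrm E \<noteq> 0" "gback c F G" "gback c G H" "\<And>k. E * H k = - (F k * E)"
      "\<forall>k. E - sc E *\<^sub>R 1 \<noteq> 0 \<or> - (E * G k * F k) - E * H k * G k \<noteq> 0"
    by blast
  have p: "F k \<in> pts" "G k \<in> pts" "H k \<in> pts" for k
    using gback_D(3,4)[OF *(2)] gback_D(4)[OF *(3)] by auto
  define fs :: "nat \<Rightarrow> int \<Rightarrow> cmat" where
    "fs i k = emb (if i = 0 then F k else if i = 1 then G k else H k)" for i k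
  have fs: "fs 0 = (\<lambda>k. emb (F k))" "fs (Suc 0) = (\<lambda>k. emb (G k))" "fs (Suc (Suc 0)) = (\<lambda>k. emb (H k))"
    by (auto simp: fs_def)
  define \<phi> where "\<phi> = (\<lambda>F. (-1) *\<^sub>R (matrix_inv (emb E) ** F ** emb E))"
  have "baecklund_sequence Q 2 fs"
    unfolding baecklund_sequence_def less2 fs baecklund_iff using * by blast
  moreover have "represents Q (odd (2::nat)) (emb E) \<phi>"
    unfolding represents_iff using *(1) by (intro exI[of _ E]) (simp add: \<phi>_def)
  moreover have "fs 2 k = \<phi> (emb (F k))" for k
    using conj_emb[OF *(1), of "H k" "-1" "F k"] *(4)[of k] by (simp add: numeral_2_eq_2 fs \<phi>_def)
  moreover have "regular Q (emb E) 2 fs"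
    unfolding regular_two[OF p *(4) fs] by (rule *(5))
  ultimately show "n_invariant Q 2 (\<lambda>k. emb (F k))"
    unfolding n_invariant_def curves_iff using assms fs(1) by blast
qed

lemma three_invariant_iff:
  assumes "gcurve c (F :: int \<Rightarrow> 's gq)"
  shows "n_invariant Q 3 (\<lambda>k. emb (F k)) \<longleftrightarrow>
    (\<exists>E G M H. nrm E \<noteq> 0 \<and> gback c F G \<and> gback c G M \<and> gback c M H \<and> (\<forall>k. E * H k = F k * E) \<and>
      (\<forall>k. E - sc E *\<^sub>R 1 \<noteq> 0 \<or> (- (E * G k * F k) - E * M k * G k - E * H k * M k)
        - sc (- (E * G k * F k) - E * M k * G k - E * H k * M k) *\<^sub>R 1 \<noteq> 0))"
proof
  assume "n_invariant Q 3 (\<lambda>k. emb (F k))"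
  then obtain fs E \<phi> where fs: "fs 0 = (\<lambda>k. emb (F k))" "baecklund_sequence Q 3 fs" "represents Q (odd (3::nat)) E \<phi>"
      "\<forall>k. fs 3 k = \<phi> (emb (F k))" "regular Q E 3 fs"
    by (auto simp: n_invariant_def)
  have b: "baecklund Q (fs 0) (fs (Suc 0))" "baecklund Q (fs (Suc 0)) (fs (Suc (Suc 0)))"
     "baecklund Q (fs (Suc (Suc 0))) (fs (Suc (Suc (Suc 0))))"
    using fs(2) unfolding baecklund_sequence_def less3 by auto
  then obtain G M H :: "int \<Rightarrow> 's gq" where GH: "fs (Suc 0) = (\<lambda>k. emb (G k))" "fs (Suc (Suc 0)) = (\<lambda>k. emb (M k))"
     "fs (Suc (Suc (Suc 0))) = (\<lambda>k. emb (H k))"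
    using curvesD unfolding baecklund_def by metis
  obtain e :: "'s gq" where e: "E = emb e" "nrm e \<noteq> 0" "\<phi> = (\<lambda>F. 1 *\<^sub>R (matrix_inv E ** F ** E))"
    using fs(3) unfolding represents_iff by auto
  obtain c1 where "gback c1 F G"
    using b(1) unfolding fs(1) GH baecklund_iff by blast
  moreover have "c1 = c"
    using calculation assms unfolding gback_def gcurve_def by metis
  ultimately have FG: "gback c F G"
    by simp
  have GM: "gback c G M"
    using b(2) gback_same[OF FG] unfolding GH baecklund_iff by blast
  have MH: "gback c M H"
    using b(3) gback_same[OF GM] unfolding GH baecklund_iff by blast
  have EH: "e * H k = F k * e" for k
    using fs(4) conj_emb[OF e(2), of "H k" 1 "F k"] by (simp add: numeral_3_eq_3 GH e)
  have p: "F k \<in> pts" "G k \<in> pts" "M k \<in> pts" "H k \<in> pts" for k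
    using gback_D(3,4)[OF FG] gback_D(4)[OF GM] gback_D(4)[OF MH] by auto
  show "\<exists>E G M H. nrm E \<noteq> 0 \<and> gback c F G \<and> gback c G M \<and> gback c M H \<and> (\<forall>k. E * H k = F k * E) \<and>
      (\<forall>k. E - sc E *\<^sub>R 1 \<noteq> 0 \<or> (- (E * G k * F k) - E * M k * G k - E * H k * M k)
        - sc (- (E * G k * F k) - E * M k * G k - E * H k * M k) *\<^sub>R 1 \<noteq> 0)"
    using e(2) FG GM MH EH fs(5) unfolding e(1) regular_three[OF p EH fs(1) GH] by blast
next
  assume "\<exists>E G M H. nrm E \<noteq> 0 \<and> gback c F G \<and> gback c G M \<and> gback c M H \<and> (\<forall>k. E * H k = F k * E) \<and>
      (\<forall>k. E - sc E *\<^sub>R 1 \<noteq> 0 \<or> (- (E * G k * F k) - E * M k * G k - E * H k * M k)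
        - sc (- (E * G k * F k) - E * M k * G k - E * H k * M k) *\<^sub>R 1 \<noteq> 0)"
  then obtain E G M H where *: "nrm E \<noteq> 0" "gback c F G" "gback c G M" "gback c M H" "\<And>k. E * H k = F k * E"
      "\<forall>k. E - sc E *\<^sub>R 1 \<noteq> 0 \<or> (- (E * G k * F k) - E * M k * G k - E * H k * M k)
        - sc (- (E * G k * F k) - E * M k * G k - E * H k * M k) *\<^sub>R 1 \<noteq> 0"
    by blast
  have p: "F k \<in> pts" "G k \<in> pts" "M k \<in> pts" "H k \<in> pts" for k
    using gback_D(3,4)[OF *(2)] gback_D(4)[OF *(3)] gback_D(4)[OF *(4)] by auto
  define fs :: "nat \<Rightarrow> int \<Rightarrow> cmat" where
    "fs i k = emb (if i = 0 then F k else if i = 1 then G k else if i = 2 then M k else H k)" for i k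
  have fs: "fs 0 = (\<lambda>k. emb (F k))" "fs (Suc 0) = (\<lambda>k. emb (G k))" "fs (Suc (Suc 0)) = (\<lambda>k. emb (M k))"
     "fs (Suc (Suc (Suc 0))) = (\<lambda>k. emb (H k))"
    by (auto simp: fs_def)
  define \<phi> where "\<phi> = (\<lambda>F. 1 *\<^sub>R (matrix_inv (emb E) ** F ** emb E))"
  have "baecklund_sequence Q 3 fs"
    unfolding baecklund_sequence_def less3 fs baecklund_iff using * by blast
  moreover have "represents Q (odd (3::nat)) (emb E) \<phi>"
    unfolding represents_iff using *(1) by (intro exI[of _ E]) (simp add: \<phi>_def)
  moreover have "fs 3 k = \<phi> (emb (F k))" for k
    using conj_emb[OF *(1), of "H k" 1 "F k"] *(5)[of k] by (simp add: numeral_3_eq_3 fs \<phi>_def)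
  moreover have "regular Q (emb E) 3 fs"
    unfolding regular_three[OF p *(5) fs] by (rule *(6))
  ultimately show "n_invariant Q 3 (\<lambda>k. emb (F k))"
    unfolding n_invariant_def curves_iff using assms fs(1) by blast
qed

lemma discrete_circle_iff:
  assumes "gcurve c (F :: int \<Rightarrow> 's gq)"
  shows "discrete_circle Q (\<lambda>k. emb (F k)) \<longleftrightarrow> (\<exists>s. s \<noteq> 0 \<and> (\<forall>k. curve.sg F k = s))"
proof -
  define z where "z = zeta Q (\<lambda>k. emb (F k))"
  have z: "z > 0"
    using zeta(1)[OF assms] by (simp add: z_def)
  have "(\<exists>d. d \<noteq> 0 \<and> (\<forall>k. 2 * curve.sg F k / z = d)) \<longleftrightarrow> (\<exists>s. s \<noteq> 0 \<and> (\<forall>k. curve.sg F k = s))"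
  proof
    assume "\<exists>d. d \<noteq> 0 \<and> (\<forall>k. 2 * curve.sg F k / z = d)"
    then obtain d where "d \<noteq> 0" "\<And>k. 2 * curve.sg F k / z = d"
      by blast
    then have "d * z / 2 \<noteq> 0 \<and> (\<forall>k. curve.sg F k = d * z / 2)"
      using z by (auto simp: field_simps)
    then show "\<exists>s. s \<noteq> 0 \<and> (\<forall>k. curve.sg F k = s)" ..
  qed (use z in auto)
  then show ?thesis
    unfolding discrete_circle_def curves_iff geodesic_curvature[OF assms] z_def[symmetric] using assms by blast
qed

theorem two_invariant:
  assumes "gcurve c (F :: int \<Rightarrow> 's gq)"
  shows "n_invariant Q 2 (\<lambda>k. emb (F k)) \<longleftrightarrow> elastic Q (\<lambda>k. emb (F k))"
proof -
  interpret curve c F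
    by (rule curve.intro[OF assms])
  have el: "elastic Q (\<lambda>k. emb (F k)) \<longleftrightarrow>
    (\<exists>\<xi>. \<forall>k. (1 + (sg k)\<^sup>2) * (sg (k + 1) + sg (k - 1)) = \<xi> * sg k) \<and> \<not> (\<exists>s. s \<noteq> 0 \<and> (\<forall>k. sg k = s))"
    unfolding elastic_def curves_iff elastic_equation_iff[OF assms] discrete_circle_iff[OF assms] using assms by auto
  show ?thesis
    unfolding el two_invariant_iff[OF assms]
  proof
    assume "\<exists>E G H. nrm E \<noteq> 0 \<and> gback c F G \<and> gback c G H \<and> (\<forall>k. E * H k = - (F k * E)) \<and>
      (\<forall>k. E - sc E *\<^sub>R 1 \<noteq> 0 \<or> - (E * G k * F k) - E * H k * G k \<noteq> 0)"
    then obtain E G H where *: "gback c F G" "gback c G H" "nrm E \<noteq> 0" "\<And>k. E * H k = - (F k * E)"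
      "E - sc E *\<^sub>R 1 \<noteq> 0 \<or> - (E * G 0 * F 0) - E * H 0 * G 0 \<noteq> 0"
      by blast
    show "(\<exists>\<xi>. \<forall>k. (1 + (sg k)\<^sup>2) * (sg (k + 1) + sg (k - 1)) = \<xi> * sg k) \<and> \<not> (\<exists>s. s \<noteq> 0 \<and> (\<forall>k. sg k = s))"
      using two_invariant_elastic[OF *] by blast
  next
    assume *: "(\<exists>\<xi>. \<forall>k. (1 + (sg k)\<^sup>2) * (sg (k + 1) + sg (k - 1)) = \<xi> * sg k) \<and> \<not> (\<exists>s. s \<noteq> 0 \<and> (\<forall>k. sg k = s))"
    \<comment> \<open>On a geodesic every \<xi> is admissible. The value 2 would permit
      \<open>P(1) = 0\<close>, so 3 is taken.\<close>
    obtain \<xi> where \<xi>: "\<And>k. (1 + (sg k)\<^sup>2) * (sg (k + 1) + sg (k - 1)) = \<xi> * sg k + 0" "(\<forall>k. sg k = 0) \<Longrightarrow> \<xi> \<noteq> 2"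
    proof (cases "\<forall>k. sg k = 0")
      case True
      then show thesis
        by (intro that[of 3]) simp_all
    next
      case False
      then show thesis
        using * that by force
    qed
    obtain a \<beta> l where d: "curve_data c F a \<beta> l" "curve_data.w c F a \<beta> 0 \<noteq> 0" "l = 0"
      and ne: "(\<And>k. 2 *\<^sub>R a - (2 * dot a (F k)) *\<^sub>R F k + \<beta> k = 0) \<Longrightarrow> (\<forall>k. sg k = sg 0) \<and> (sg 0 = 0 \<longrightarrow> \<xi> = 2)"
      using elastic_data[OF \<xi>(1)] by metis
    have "\<exists>k. 2 *\<^sub>R a - (2 * dot a (F k)) *\<^sub>R F k + \<beta> k \<noteq> 0"
    proof (rule ccontr)
      assume "\<not> ?thesis"
      then have "(\<forall>k. sg k = sg 0) \<and> (sg 0 = 0 \<longrightarrow> \<xi> = 2)"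
        using ne by blast
      then show False
        using * \<xi>(2) by metis
    qed
    then obtain k0 where k0: "2 *\<^sub>R a - (2 * dot a (F k0)) *\<^sub>R F k0 + \<beta> k0 \<noteq> 0" ..
    interpret D: curve_data c F a \<beta> l
      by (rule d(1))
    obtain e G H where GH: "nrm (e *\<^sub>R 1 + a) \<noteq> 0" "gback c F G" "gback c G H"
      "\<And>k. (e *\<^sub>R 1 + a) * H k = - (F k * (e *\<^sub>R 1 + a))"
      and \<beta>: "\<And>k. \<beta> k = - ((e *\<^sub>R 1 + a) * G k * F k) - (e *\<^sub>R 1 + a) * H k * G k"
      by (rule D.exists_two[OF d(3) k0]) (rule that)
    define E where "E = e *\<^sub>R 1 + a"
    have "E - sc E *\<^sub>R 1 = a"
      by (simp add: E_def D.a)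
    \<comment> \<open>Regularity: otherwise \<open>X\<close> vanishes at the vertex, and with it the
      constant \<open>w\<close>.\<close>
    moreover have "a \<noteq> 0 \<or> \<beta> k \<noteq> 0" for k
    proof (rule ccontr)
      assume "\<not> ?thesis"
      then have "D.X k = 0"
        unfolding D.X_def by simp
      then show False
        using D.X_FT[of k] d(2) by simp
    qed
    ultimately show "\<exists>E G H. nrm E \<noteq> 0 \<and> gback c F G \<and> gback c G H \<and> (\<forall>k. E * H k = - (F k * E)) \<and>
      (\<forall>k. E - sc E *\<^sub>R 1 \<noteq> 0 \<or> - (E * G k * F k) - E * H k * G k \<noteq> 0)"
      using GH \<beta> unfolding E_def[symmetric] by metis
  qed
qed

theorem three_invariant:
  assumes "gcurve c (F :: int \<Rightarrow> 's gq)"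
  shows "n_invariant Q 3 (\<lambda>k. emb (F k)) \<longleftrightarrow> constrained_elastic Q (\<lambda>k. emb (F k))"
proof -
  interpret curve c F
    by (rule curve.intro[OF assms])
  define z where "z = zeta Q (\<lambda>k. emb (F k))"
  have z: "z > 0"
    using zeta(1)[OF assms] by (simp add: z_def)
  have el: "constrained_elastic Q (\<lambda>k. emb (F k)) \<longleftrightarrow>
    (\<exists>\<xi> \<delta>. \<forall>k. (1 + (sg k)\<^sup>2) * (sg (k + 1) + sg (k - 1)) = \<xi> * sg k + \<delta>)"
  proof -
    have "(\<exists>\<delta>. \<forall>k. (1 + (sg k)\<^sup>2) * (sg (k + 1) + sg (k - 1)) = \<xi> * sg k + \<delta> * z / 2) \<longleftrightarrow>
      (\<exists>\<delta>. \<forall>k. (1 + (sg k)\<^sup>2) * (sg (k + 1) + sg (k - 1)) = \<xi> * sg k + \<delta>)" for \<xi>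
    proof
      assume "\<exists>\<delta>. \<forall>k. (1 + (sg k)\<^sup>2) * (sg (k + 1) + sg (k - 1)) = \<xi> * sg k + \<delta>"
      then obtain \<delta> where "\<forall>k. (1 + (sg k)\<^sup>2) * (sg (k + 1) + sg (k - 1)) = \<xi> * sg k + (2 * \<delta> / z) * z / 2"
        using z by auto
      then show "\<exists>\<delta>. \<forall>k. (1 + (sg k)\<^sup>2) * (sg (k + 1) + sg (k - 1)) = \<xi> * sg k + \<delta> * z / 2" ..
    qed blast
    then show ?thesis
      unfolding constrained_elastic_def curves_iff elastic_equation_iff[OF assms] z_def[symmetric] using assms by blast
  qed
  show ?thesis
    unfolding el three_invariant_iff[OF assms]
  proof
    assume "\<exists>E G M H. nrm E \<noteq> 0 \<and> gback c F G \<and> gback c G M \<and> gback c M H \<and> (\<forall>k. E * H k = F k * E) \<and>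
      (\<forall>k. E - sc E *\<^sub>R 1 \<noteq> 0 \<or> (- (E * G k * F k) - E * M k * G k - E * H k * M k)
        - sc (- (E * G k * F k) - E * M k * G k - E * H k * M k) *\<^sub>R 1 \<noteq> 0)"
    then obtain E G M H where *: "gback c F G" "gback c G M" "gback c M H" "\<And>k. E * H k = F k * E"
      "E - sc E *\<^sub>R 1 \<noteq> 0 \<or> (- (E * G 0 * F 0) - E * M 0 * G 0 - E * H 0 * M 0)
        - sc (- (E * G 0 * F 0) - E * M 0 * G 0 - E * H 0 * M 0) *\<^sub>R 1 \<noteq> 0"
      by blast
    show "\<exists>\<xi> \<delta>. \<forall>k. (1 + (sg k)\<^sup>2) * (sg (k + 1) + sg (k - 1)) = \<xi> * sg k + \<delta>"
      by (rule three_invariant_elastic[OF * refl])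
  next
    assume "\<exists>\<xi> \<delta>. \<forall>k. (1 + (sg k)\<^sup>2) * (sg (k + 1) + sg (k - 1)) = \<xi> * sg k + \<delta>"
    then obtain \<xi> \<delta> where \<xi>: "\<And>k. (1 + (sg k)\<^sup>2) * (sg (k + 1) + sg (k - 1)) = \<xi> * sg k + \<delta>"
      by blast
    obtain a \<beta> l where d: "curve_data c F a \<beta> l" "curve_data.w c F a \<beta> 0 \<noteq> 0"
      using elastic_data[OF \<xi>] by metis
    interpret D: curve_data c F a \<beta> l
      by (rule d(1))
    obtain e b G M H where GH: "nrm (e *\<^sub>R 1 + a) \<noteq> 0" "gback c F G" "gback c G M" "gback c M H"
      "\<And>k. (e *\<^sub>R 1 + a) * H k = F k * (e *\<^sub>R 1 + a)"
      and K: "\<And>k. b *\<^sub>R 1 + \<beta> k - a = - ((e *\<^sub>R 1 + a) * G k * F k) - (e *\<^sub>R 1 + a) * M k * G k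
      - (e *\<^sub>R 1 + a) * H k * M k"
      by (rule D.exists_three[OF d(2)]) (rule that)
    define E where "E = e *\<^sub>R 1 + a"
    have Ea: "E - sc E *\<^sub>R 1 = a"
      by (simp add: E_def D.a)
    have "b *\<^sub>R 1 + \<beta> k - a - sc (b *\<^sub>R 1 + \<beta> k - a) *\<^sub>R 1 = \<beta> k - a" for k
      by (simp add: D.a D.sc_\<beta>)
    moreover have "a \<noteq> 0 \<or> \<beta> k - a \<noteq> 0" for k
    proof (rule ccontr)
      assume "\<not> ?thesis"
      then have "D.X k = 0"
        unfolding D.X_def by simp
      then show False
        using D.X_FT[of k] d(2) by simp
    qed
    ultimately have "\<forall>k. E - sc E *\<^sub>R 1 \<noteq> 0 \<or> b *\<^sub>R 1 + \<beta> k - a - sc (b *\<^sub>R 1 + \<beta> k - a) *\<^sub>R 1 \<noteq> 0"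
      using Ea by simp
    then show "\<exists>E G M H. nrm E \<noteq> 0 \<and> gback c F G \<and> gback c G M \<and> gback c M H \<and> (\<forall>k. E * H k = F k * E) \<and>
      (\<forall>k. E - sc E *\<^sub>R 1 \<noteq> 0 \<or> (- (E * G k * F k) - E * M k * G k - E * H k * M k)
        - sc (- (E * G k * F k) - E * M k * G k - E * H k * M k) *\<^sub>R 1 \<noteq> 0)"
      using GH unfolding K E_def[symmetric] by blast
  qed
qed

lemma noneuclidean:
  assumes "f \<in> curves Q"
  shows "(n_invariant Q 2 f \<longleftrightarrow> elastic Q f) \<and> (n_invariant Q 3 f \<longleftrightarrow> constrained_elastic Q f)"
  using curvesD[OF assms] two_invariant three_invariant by blast

end

section \<open>Elastic equations in the complex plane\<close>

definition ecurve :: "real \<Rightarrow> (int \<Rightarrow> complex) \<Rightarrow> bool" where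
  "ecurve \<eta> z \<longleftrightarrow> \<eta> > 0 \<and> (\<forall>k. cmod (z (k + 1) - z k) = \<eta>) \<and> (\<forall>k. z (k + 1) \<noteq> z (k - 1))"

lemma mult_cnj: "a * cnj a = of_real ((cmod a)\<^sup>2)" and cnj_mult_self: "cnj a * a = of_real ((cmod a)\<^sup>2)"
  by (simp_all add: complex_norm_square[symmetric] mult.commute)

declare times_complex.sel [simp del]

lemma Re_Im_mult [simp]:
  "Re (of_real r * x) = r * Re x" "Im (of_real r * x) = r * Im x"
  "Re (of_real r ^ n * x) = r ^ n * Re x" "Im (of_real r ^ n * x) = r ^ n * Im x"
  "Re (numeral m * x) = numeral m * Re x" "Im (numeral m * x) = numeral m * Im x"
  "Re (\<i> * x) = - Im x" "Im (\<i> * x) = Re x"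
  by (simp_all add: times_complex.sel flip: of_real_power)

locale ecurve_loc =
  fixes \<eta> :: real and z :: "int \<Rightarrow> complex"
  assumes ecurve: "ecurve \<eta> z"
begin

definition u :: "int \<Rightarrow> complex" where
  "u k = z (k + 1) - z k"

definition tau :: "int \<Rightarrow> complex" where
  "tau k = u k + u (k - 1)"

text \<open>The tangent of half the turning angle. Its sign is opposite to that of
  \<open>geodesic_curvature\<close>.\<close>

definition sg :: "int \<Rightarrow> real" where
  "sg k = 2 * Im (u k * cnj (u (k - 1))) / (cmod (tau k))\<^sup>2"

lemma eta: "\<eta> > 0" "\<eta> \<noteq> 0"
  using ecurve by (auto simp: ecurve_def)

lemma u [simp]: "cmod (u k) = \<eta>" "u k \<noteq> 0"
proof -
  show "cmod (u k) = \<eta>"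
    using ecurve by (simp add: ecurve_def u_def)
  then show "u k \<noteq> 0"
    using eta by auto
qed

lemma uu: "u k * cnj (u k) = of_real (\<eta>\<^sup>2)"
  by (simp add: mult_cnj)

lemma tau: "tau k \<noteq> 0"
  using ecurve by (auto simp: tau_def u_def ecurve_def)

lemma u_tau: "u k = (1 + \<i> * sg k) * tau k / 2" "u (k - 1) = (1 - \<i> * sg k) * tau k / 2"
proof -
  have "(u k - u (k - 1)) * cnj (tau k) = u k * cnj (u (k - 1)) - cnj (u k * cnj (u (k - 1)))"
    by (simp add: tau_def algebra_simps) (simp add: uu)
  also have "\<dots> = \<i> * of_real (2 * Im (u k * cnj (u (k - 1))))"
    by (simp only: complex_diff_cnj mult.commute)
  also have "\<dots> = \<i> * sg k * (tau k * cnj (tau k))"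
    using tau[of k] by (simp add: sg_def mult_cnj)
  finally have "(u k - u (k - 1) - \<i> * sg k * tau k) * cnj (tau k) = 0"
    by (simp add: algebra_simps)
  then have "u k - u (k - 1) = \<i> * sg k * tau k"
    using tau[of k] by simp
  moreover have "u k + u (k - 1) = tau k"
    by (simp add: tau_def)
  ultimately show "u k = (1 + \<i> * sg k) * tau k / 2" "u (k - 1) = (1 - \<i> * sg k) * tau k / 2"
    by (simp_all add: field_simps)
qed

lemma tau_sg: "(cmod (tau k))\<^sup>2 * (1 + (sg k)\<^sup>2) = 4 * \<eta>\<^sup>2"
proof -
  have "\<eta>\<^sup>2 = (cmod ((1 + \<i> * sg k) * tau k / 2))\<^sup>2"
    using u(1)[of k] by (simp only: u_tau(1)[of k, symmetric])
  also have "\<dots> = (cmod (1 + \<i> * sg k))\<^sup>2 * (cmod (tau k))\<^sup>2 / 4"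
    by (simp add: norm_mult power_mult_distrib norm_divide power_divide)
  also have "(cmod (1 + \<i> * sg k))\<^sup>2 = 1 + (sg k)\<^sup>2"
    by (simp add: cmod_power2)
  finally show ?thesis
    by (simp add: mult.commute)
qed

lemma inner_tau:
  "Re (tau k * cnj (u k)) = (cmod (tau k))\<^sup>2 / 2" "Re (tau k * cnj (u (k - 1))) = (cmod (tau k))\<^sup>2 / 2"
  "Im (tau k * cnj (u k)) = - sg k * (cmod (tau k))\<^sup>2 / 2"
proof -
  define N where "N = (cmod (tau k))\<^sup>2"
  have "tau k * cnj (u k) = (1 - \<i> * sg k) * (tau k * cnj (tau k)) / 2"
    "tau k * cnj (u (k - 1)) = (1 + \<i> * sg k) * (tau k * cnj (tau k)) / 2"
    by (subst u_tau, simp)+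
  then have "tau k * cnj (u k) = of_real (N / 2) - \<i> * of_real (sg k * N / 2)"
    "tau k * cnj (u (k - 1)) = of_real (N / 2) + \<i> * of_real (sg k * N / 2)"
    unfolding mult_cnj N_def[symmetric] by (simp_all add: field_simps)
  then show "Re (tau k * cnj (u k)) = (cmod (tau k))\<^sup>2 / 2" "Re (tau k * cnj (u (k - 1))) = (cmod (tau k))\<^sup>2 / 2"
    "Im (tau k * cnj (u k)) = - sg k * (cmod (tau k))\<^sup>2 / 2"
    unfolding N_def[symmetric] by simp_all
qed

end

text \<open>The imaginary parts \<open>e\<close>, \<open>\<alpha>\<close> of the even coefficients and the odd coefficients \<open>y\<close>, \<open>t\<close> of \<open>P\<close> at the powers
  \<open>0, 2\<close> and \<open>1, 3\<close> of \<open>\<lambda>\<close>. A polynomial for \<open>n = 2\<close> is multiplied by \<open>\<lambda>\<close> first, so that \<open>e = 0\<close>.\<close>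

locale edata = ecurve_loc \<eta> z for \<eta> and z :: "int \<Rightarrow> complex" +
  fixes e :: real and y :: "int \<Rightarrow> complex" and \<alpha> :: "int \<Rightarrow> real" and t :: "int \<Rightarrow> complex"
  assumes y_step: "y (k + 1) = y k - 2 * \<i> * e * u k"
    and \<alpha>_step: "\<alpha> (k + 1) - \<alpha> k = Im ((y (k + 1) + y k) * cnj (u k))"
    and t_step: "t (k + 1) = t k - \<i> * (\<alpha> k + \<alpha> (k + 1)) * u k"
    and t_refl: "t (k + 1) * cnj (u k) = u k * cnj (t k)"
begin

lemma t_const: "cmod (t (k + 1)) = cmod (t k)"
  using arg_cong[OF t_refl[of k], of cmod] eta by (simp add: norm_mult)

lemma Im_yu: "Im (y k * cnj (u k)) = (\<alpha> (k + 1) - \<alpha> k) / 2 + e * \<eta>\<^sup>2"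
proof -
  have "(y (k + 1) + y k) * cnj (u k) = 2 * (y k * cnj (u k)) - 2 * \<i> * e * (u k * cnj (u k))"
    unfolding y_step by (simp add: algebra_simps)
  then have "\<alpha> (k + 1) - \<alpha> k = 2 * Im (y k * cnj (u k)) - 2 * e * \<eta>\<^sup>2"
    unfolding \<alpha>_step by (simp add: mult.assoc uu)
  then show ?thesis
    by (simp add: field_simps)
qed

lemma Im_yu': "Im (y k * cnj (u (k - 1))) = (\<alpha> k - \<alpha> (k - 1)) / 2 - e * \<eta>\<^sup>2"
proof -
  have y: "y k = y (k - 1) - 2 * \<i> * e * u (k - 1)"
    using y_step[of "k - 1"] by simp
  have "y k * cnj (u (k - 1)) = y (k - 1) * cnj (u (k - 1)) - 2 * \<i> * e * (u (k - 1) * cnj (u (k - 1)))"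
    unfolding y by (simp add: algebra_simps)
  then have "Im (y k * cnj (u (k - 1))) = Im (y (k - 1) * cnj (u (k - 1))) - 2 * e * \<eta>\<^sup>2"
    by (simp add: mult.assoc uu)
  then show ?thesis
    using Im_yu[of "k - 1"] by simp
qed

lemma Im_tu: "Im (t k * cnj (u k)) = (\<alpha> k + \<alpha> (k + 1)) * \<eta>\<^sup>2 / 2"
proof -
  have "t k * cnj (u k) - \<i> * (\<alpha> k + \<alpha> (k + 1)) * (u k * cnj (u k)) = cnj (t k * cnj (u k))"
    using t_refl[of k] unfolding t_step by (simp add: algebra_simps)
  then have "Im (t k * cnj (u k) - \<i> * (\<alpha> k + \<alpha> (k + 1)) * (u k * cnj (u k))) = Im (cnj (t k * cnj (u k)))"
    by (rule arg_cong)
  then have "Im (t k * cnj (u k)) - (\<alpha> k + \<alpha> (k + 1)) * \<eta>\<^sup>2 = - Im (t k * cnj (u k))"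
    unfolding uu by (simp add: mult.assoc del: of_real_power of_real_add complex_cnj_mult)
  then show ?thesis
    by simp
qed

lemma Im_tu': "Im (t k * cnj (u (k - 1))) = - (\<alpha> k + \<alpha> (k - 1)) * \<eta>\<^sup>2 / 2"
proof -
  have "t k * cnj (u (k - 1)) = cnj (t (k - 1) * cnj (u (k - 1)))"
    using t_refl[of "k - 1"] by (simp add: mult.commute)
  then have "Im (t k * cnj (u (k - 1))) = Im (cnj (t (k - 1) * cnj (u (k - 1))))"
    by (rule arg_cong)
  also have "\<dots> = - (\<alpha> k + \<alpha> (k - 1)) * \<eta>\<^sup>2 / 2"
    using Im_tu[of "k - 1"] by (simp add: field_simps del: complex_cnj_mult)
  finally show ?thesis .
qed

text \<open>Since \<open>1 + \<eta>^2 \<lambda>^2\<close> is the determinant of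
  \<open>1 + \<lambda> u\<close>, the odd part of \<open>P\<close> modulo it is proportional to
  \<open>W\<close>.\<close>

definition W :: "int \<Rightarrow> complex" where
  "W k = t k - of_real (\<eta>\<^sup>2) * y k"

definition w :: "int \<Rightarrow> real" where
  "w k = 2 * Re (W k * cnj (u k))"

lemma Im_W: "Im (W k * cnj (u k)) = \<eta>\<^sup>2 * (\<alpha> k - e * \<eta>\<^sup>2)"
  "Im (W k * cnj (u (k - 1))) = - (\<eta>\<^sup>2 * (\<alpha> k - e * \<eta>\<^sup>2))"
proof -
  have lin: "Im (W k * cnj x) = Im (t k * cnj x) - \<eta>\<^sup>2 * Im (y k * cnj x)" for x
  proof -
    have "W k * cnj x = t k * cnj x - of_real (\<eta>\<^sup>2) * (y k * cnj x)"
      by (simp add: W_def algebra_simps)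
    then show ?thesis
      by (simp del: of_real_power)
  qed
  show "Im (W k * cnj (u k)) = \<eta>\<^sup>2 * (\<alpha> k - e * \<eta>\<^sup>2)"
    "Im (W k * cnj (u (k - 1))) = - (\<eta>\<^sup>2 * (\<alpha> k - e * \<eta>\<^sup>2))"
    unfolding lin Im_yu Im_yu' Im_tu Im_tu' by (simp_all add: field_simps)
qed

text \<open>By \<open>Im_W\<close> the contributions of the two adjacent edges to the component of
  \<open>W\<close> across the chord cancel, so \<open>W\<close> is a real multiple of the
  chord.\<close>

lemma W_tau: "W k = (w k / (cmod (tau k))\<^sup>2) * tau k"
proof -
  have im: "Im (W k * cnj (tau k)) = 0"
    unfolding tau_def using Im_W[of k] by (simp add: distrib_left del: of_real_power)
  define om where "om = Re (W k * cnj (tau k)) / (cmod (tau k))\<^sup>2"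
  have "W k * cnj (tau k) = of_real (Re (W k * cnj (tau k)))"
    using im by (simp add: complex_eq_iff)
  also have "\<dots> = of_real om * (tau k * cnj (tau k))"
    using tau[of k] by (simp add: om_def mult_cnj)
  finally have "(W k - of_real om * tau k) * cnj (tau k) = 0"
    by (simp add: algebra_simps)
  then have W: "W k = of_real om * tau k"
    using tau[of k] by simp
  have "w k = 2 * (om * Re (tau k * cnj (u k)))"
    unfolding w_def W by (simp add: mult.assoc)
  then have "w k = om * (cmod (tau k))\<^sup>2"
    unfolding inner_tau by simp
  then show ?thesis
    using W tau[of k] by simp
qed

lemma w_pred: "2 * Re (W k * cnj (u (k - 1))) = w k"
proof -
  have "W k * cnj (u (k - 1)) = of_real (w k / (cmod (tau k))\<^sup>2) * (tau k * cnj (u (k - 1)))"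
    by (subst W_tau) simp
  then have "Re (W k * cnj (u (k - 1))) = w k / (cmod (tau k))\<^sup>2 * Re (tau k * cnj (u (k - 1)))"
    by (simp only: Re_complex_of_real Im_complex_of_real times_complex.sel mult_zero_left diff_0_right)
  then show ?thesis
    unfolding inner_tau using tau[of k] by simp
qed

lemma w_const: "w k = w 0"
proof (rule const_int)
  fix k
  have "W (k + 1) * cnj (u k) = W k * cnj (u k)
      - \<i> * of_real (\<alpha> k + \<alpha> (k + 1) - 2 * e * \<eta>\<^sup>2) * (u k * cnj (u k))"
    unfolding W_def t_step y_step by (simp add: algebra_simps)
  then have "Re (W (k + 1) * cnj (u k)) = Re (W k * cnj (u k))"
    unfolding uu by (simp add: mult.assoc del: of_real_power of_real_add of_real_diff of_real_mult)
  then show "w (k + 1) = w k"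
    using w_pred[of "k + 1"] by (simp add: w_def)
qed

text \<open>The counterpart of the height relation on the sphere: \<alpha> is affine in the
  curvature unless \<open>w\<close> is zero.\<close>

lemma w_sg: "w 0 * sg k = - 2 * \<eta>\<^sup>2 * (\<alpha> k - e * \<eta>\<^sup>2)"
proof -
  have "W k * cnj (u k) = of_real (w 0 / (cmod (tau k))\<^sup>2) * (tau k * cnj (u k))"
    by (subst W_tau) (simp add: w_const[of k])
  then have "Im (W k * cnj (u k)) = w 0 / (cmod (tau k))\<^sup>2 * Im (tau k * cnj (u k))"
    by (simp only: Re_complex_of_real Im_complex_of_real times_complex.sel mult_zero_left add_0_right)
  then have "\<eta>\<^sup>2 * (\<alpha> k - e * \<eta>\<^sup>2) = w 0 / (cmod (tau k))\<^sup>2 * (- sg k * (cmod (tau k))\<^sup>2 / 2)"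
    unfolding inner_tau Im_W .
  then show ?thesis
    using tau[of k] by simp
qed

lemma y_tau: "Im (y k * cnj (tau k)) = (\<alpha> (k + 1) - \<alpha> (k - 1)) / 2"
  "- sg k * Re (y k * cnj (tau k)) = (\<alpha> (k + 1) + \<alpha> (k - 1) - 2 * \<alpha> k) / 2 + 2 * e * \<eta>\<^sup>2"
proof -
  have "y k * cnj (tau k) = y k * cnj (u k) + y k * cnj (u (k - 1))"
    by (simp add: tau_def algebra_simps)
  then show "Im (y k * cnj (tau k)) = (\<alpha> (k + 1) - \<alpha> (k - 1)) / 2"
    using Im_yu[of k] Im_yu'[of k] by (simp add: diff_divide_distrib)
  have "u k - u (k - 1) = \<i> * sg k * tau k"
    by (subst (1) u_tau(1), subst u_tau(2)) (simp add: field_simps)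
  then have "y k * cnj (u k) - y k * cnj (u (k - 1)) = y k * cnj (\<i> * sg k * tau k)"
    by (metis complex_cnj_diff right_diff_distrib)
  also have "\<dots> = - \<i> * sg k * (y k * cnj (tau k))"
    by simp
  finally have "Im (y k * cnj (u k)) - Im (y k * cnj (u (k - 1))) = Im (- \<i> * sg k * (y k * cnj (tau k)))"
    by (metis minus_complex.sel(2))
  also have "\<dots> = - sg k * Re (y k * cnj (tau k))"
    by (simp add: mult.assoc)
  finally show "- sg k * Re (y k * cnj (tau k)) = (\<alpha> (k + 1) + \<alpha> (k - 1) - 2 * \<alpha> k) / 2 + 2 * e * \<eta>\<^sup>2"
    unfolding Im_yu Im_yu' by (simp add: field_simps)
qed

text \<open>Together with \<open>j2_const\<close> and the modulus of \<open>t\<close> this gives, up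
  to constants, the coefficients of the determinant of \<open>P\<close>.\<close>

lemma j1_const: "(cmod (y k))\<^sup>2 + 2 * e * \<alpha> k = (cmod (y 0))\<^sup>2 + 2 * e * \<alpha> 0"
proof (rule const_int)
  fix k
  have "y (k + 1) * cnj (y (k + 1)) = y k * cnj (y k) + 2 * \<i> * e * (y k * cnj (u k)) - 2 * \<i> * e * cnj (y k * cnj (u k))
      + 4 * of_real (e\<^sup>2) * (u k * cnj (u k))"
    unfolding y_step by (simp add: algebra_simps power2_eq_square)
  then have "Re (y (k + 1) * cnj (y (k + 1))) = Re (y k * cnj (y k)) - 4 * e * Im (y k * cnj (u k)) + 4 * e\<^sup>2 * \<eta>\<^sup>2"
    unfolding uu by (simp add: mult.assoc del: complex_cnj_mult)
  then have "(cmod (y (k + 1)))\<^sup>2 = (cmod (y k))\<^sup>2 - 4 * e * Im (y k * cnj (u k)) + 4 * e\<^sup>2 * \<eta>\<^sup>2"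
    unfolding mult_cnj by (simp del: of_real_power)
  then show "(cmod (y (k + 1)))\<^sup>2 + 2 * e * \<alpha> (k + 1) = (cmod (y k))\<^sup>2 + 2 * e * \<alpha> k"
    unfolding Im_yu by (simp add: field_simps power2_eq_square)
qed

lemma j2_const: "(\<alpha> k)\<^sup>2 + 2 * Re (y k * cnj (t k)) = (\<alpha> 0)\<^sup>2 + 2 * Re (y 0 * cnj (t 0))"
proof (rule const_int)
  fix k
  define s where "s = \<alpha> k + \<alpha> (k + 1)"
  have t': "t (k + 1) = t k - \<i> * of_real s * u k"
    by (simp add: t_step s_def)
  have "y (k + 1) * cnj (t (k + 1)) = y k * cnj (t k) + \<i> * of_real s * (y k * cnj (u k))
      - 2 * \<i> * e * cnj (t k * cnj (u k)) + 2 * of_real (e * s) * (u k * cnj (u k))"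
    unfolding y_step t' by (simp add: algebra_simps)
  then have "Re (y (k + 1) * cnj (t (k + 1))) = Re (y k * cnj (t k)) - s * Im (y k * cnj (u k))
      - 2 * e * Im (t k * cnj (u k)) + 2 * (e * s) * \<eta>\<^sup>2"
    unfolding uu by (simp add: mult.assoc del: complex_cnj_mult of_real_mult)
  then show "(\<alpha> (k + 1))\<^sup>2 + 2 * Re (y (k + 1) * cnj (t (k + 1))) = (\<alpha> k)\<^sup>2 + 2 * Re (y k * cnj (t k))"
    unfolding Im_yu Im_tu by (simp add: s_def field_simps power2_eq_square)
qed

lemma elastic_of_w:
  assumes w: "w 0 \<noteq> 0"
  obtains \<xi> \<delta> where "\<And>k. (1 + (sg k)\<^sup>2) * (sg (k + 1) + sg (k - 1)) = \<xi> * sg k + \<delta>" "e = 0 \<Longrightarrow> \<delta> = 0"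
proof -
  define \<gamma> where "\<gamma> = - w 0 / (2 * \<eta>\<^sup>2)"
  \<comment> \<open>The conserved combination from which the modulus of \<open>y\<close> drops out
    after inserting \<open>t = \<eta>^2 y + (w / N) tau\<close>. What is left is the real part of
    \<open>y * cnj tau\<close>, known from the second difference of \<alpha>.\<close>
  define J where "J = (\<alpha> 0)\<^sup>2 + 2 * Re (y 0 * cnj (t 0)) - 2 * \<eta>\<^sup>2 * ((cmod (y 0))\<^sup>2 + 2 * e * \<alpha> 0)"
  define J' where "J' = J + 3 * e\<^sup>2 * (\<eta>\<^sup>2)\<^sup>2"
  have g0: "\<gamma> \<noteq> 0"
    using w eta by (simp add: \<gamma>_def)
  have w\<gamma>: "w 0 = - 2 * \<eta>\<^sup>2 * \<gamma>"
    using eta by (simp add: \<gamma>_def)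
  have \<alpha>: "\<alpha> k = e * \<eta>\<^sup>2 + \<gamma> * sg k" for k
  proof -
    have "(2 * \<eta>\<^sup>2) * (\<alpha> k - e * \<eta>\<^sup>2 - \<gamma> * sg k) = 0"
      using w_sg[of k] unfolding w\<gamma> by (simp add: algebra_simps)
    then show ?thesis
      using eta by simp
  qed
  have eq: "\<gamma>\<^sup>2 * ((1 + (sg k)\<^sup>2) * (sg (k + 1) + sg (k - 1))) = (2 * \<gamma>\<^sup>2 + 2 * J') * sg k - 4 * e * \<eta>\<^sup>2 * \<gamma>" for k
  proof -
    define R where "R = Re (y k * cnj (tau k))"
    define N where "N = (cmod (tau k))\<^sup>2"
    define g where "g = \<eta>\<^sup>2"
    have g: "g \<noteq> 0"
      using eta by (simp add: g_def)
    have N: "N \<noteq> 0" "N * (1 + (sg k)\<^sup>2) = 4 * g"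
      using tau[of k] tau_sg[of k] by (auto simp: N_def g_def)
    have t: "t k = of_real g * y k + of_real (w 0 / N) * tau k"
      using W_tau[of k] by (simp add: W_def w_const[of k] N_def g_def algebra_simps)
    have "y k * cnj (t k) = of_real g * (y k * cnj (y k)) + of_real (w 0 / N) * (y k * cnj (tau k))"
      unfolding t by (simp add: algebra_simps)
    then have "Re (y k * cnj (t k)) = g * (cmod (y k))\<^sup>2 + w 0 / N * R"
      unfolding mult_cnj R_def
      by (simp only: plus_complex.sel times_complex.sel Re_complex_of_real Im_complex_of_real mult_zero_left diff_0_right)
    then have "2 * (w 0 / N * R) = J + 4 * e * g * \<alpha> k - (\<alpha> k)\<^sup>2"
      using j1_const[of k] j2_const[of k] unfolding J_def g_def[symmetric] by (simp add: algebra_simps) algebra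
    then have "2 * w 0 * R = N * (J + 4 * e * g * \<alpha> k - (\<alpha> k)\<^sup>2)"
      using N(1) by (simp add: field_simps)
    then have "- 4 * g * \<gamma> * R = N * (J' + 2 * e * g * \<gamma> * sg k - \<gamma>\<^sup>2 * (sg k)\<^sup>2)"
      unfolding \<alpha> w\<gamma> J'_def g_def[symmetric] by (simp add: algebra_simps power2_eq_square)
    then have "sg k * (1 + (sg k)\<^sup>2) * (- 4 * g * \<gamma> * R) = sg k * (N * (1 + (sg k)\<^sup>2)) * (J' + 2 * e * g * \<gamma> * sg k - \<gamma>\<^sup>2 * (sg k)\<^sup>2)"
      by simp
    then have "4 * g * (\<gamma> * (1 + (sg k)\<^sup>2) * (- sg k * R)) = 4 * g * (sg k * (J' + 2 * e * g * \<gamma> * sg k - \<gamma>\<^sup>2 * (sg k)\<^sup>2))"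
      unfolding N(2) by (simp add: algebra_simps)
    then have "\<gamma> * (1 + (sg k)\<^sup>2) * (- sg k * R) = sg k * (J' + 2 * e * g * \<gamma> * sg k - \<gamma>\<^sup>2 * (sg k)\<^sup>2)"
      using g by (metis mult_left_cancel mult_eq_0_iff zero_neq_numeral)
    moreover have e2: "- sg k * R = \<gamma> * (sg (k + 1) + sg (k - 1) - 2 * sg k) / 2 + 2 * e * g"
      using y_tau(2)[of k] unfolding R_def[symmetric] \<alpha> g_def[symmetric] by (simp add: field_simps)
    ultimately have "\<gamma> * (1 + (sg k)\<^sup>2) * (\<gamma> * (sg (k + 1) + sg (k - 1) - 2 * sg k) / 2 + 2 * e * g)
        = sg k * (J' + 2 * e * g * \<gamma> * sg k - \<gamma>\<^sup>2 * (sg k)\<^sup>2)"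
      by (simp only:)
    then show ?thesis
      unfolding g_def[symmetric] by (simp add: field_simps power2_eq_square)
  qed
  show thesis
  proof (rule that)
    fix k
    have "(1 + (sg k)\<^sup>2) * (sg (k + 1) + sg (k - 1)) = ((2 * \<gamma>\<^sup>2 + 2 * J') * sg k - 4 * e * \<eta>\<^sup>2 * \<gamma>) / \<gamma>\<^sup>2"
      using eq[of k] g0 by (simp add: nonzero_eq_divide_eq mult.commute)
    then show "(1 + (sg k)\<^sup>2) * (sg (k + 1) + sg (k - 1)) = (2 * \<gamma>\<^sup>2 + 2 * J') / \<gamma>\<^sup>2 * sg k + - (4 * e * \<eta>\<^sup>2 * \<gamma> / \<gamma>\<^sup>2)"
      by (simp add: diff_divide_distrib)
  qed simp
qed

lemma sg_const_of_w:
  assumes w: "w 0 = 0" and ne: "e \<noteq> 0 \<or> y k0 \<noteq> 0 \<or> \<alpha> k0 \<noteq> 0 \<or> t k0 \<noteq> 0"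
  shows "sg k = sg 0" and "e = 0 \<Longrightarrow> sg k = 0"
proof -
  have \<alpha>: "\<alpha> k = e * \<eta>\<^sup>2" for k
    using w_sg[of k] w eta by simp
  have t: "t k = of_real (\<eta>\<^sup>2) * y k" for k
    using W_tau[of k] w w_const[of k] by (simp add: W_def)
  define \<rho> where "\<rho> k = Re (y k * cnj (tau k))" for k
  have yt: "y k * cnj (tau k) = of_real (\<rho> k)" for k
    using y_tau(1)[of k] unfolding \<alpha> by (simp add: complex_eq_iff \<rho>_def)
  have y: "y k = of_real (\<rho> k / (cmod (tau k))\<^sup>2) * tau k" for k
  proof -
    have "(y k - of_real (\<rho> k / (cmod (tau k))\<^sup>2) * tau k) * cnj (tau k) = of_real (\<rho> k) - of_real (\<rho> k / (cmod (tau k))\<^sup>2) * (tau k * cnj (tau k))"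
      unfolding yt[symmetric] by (simp add: algebra_simps)
    also have "\<dots> = 0"
      unfolding mult_cnj using tau[of k] by simp
    finally show ?thesis
      using tau[of k] by simp
  qed
  have yu: "Re (y k * cnj (u k)) = \<rho> k / 2" "Re (y k * cnj (u (k - 1))) = \<rho> k / 2" for k
  proof -
    have "Re (y k * cnj x) = \<rho> k / (cmod (tau k))\<^sup>2 * Re (tau k * cnj x)" for x
    proof -
      have "y k * cnj x = of_real (\<rho> k / (cmod (tau k))\<^sup>2) * (tau k * cnj x)"
        by (subst y) simp
      then show ?thesis
        by (simp only: times_complex.sel Re_complex_of_real Im_complex_of_real mult_zero_left diff_0_right)
    qed
    then show "Re (y k * cnj (u k)) = \<rho> k / 2" "Re (y k * cnj (u (k - 1))) = \<rho> k / 2"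
      using tau[of k] by (simp_all add: inner_tau)
  qed
  have \<rho>: "\<rho> k = \<rho> 0" for k
  proof (rule const_int)
    fix k
    have "y (k + 1) * cnj (u k) = y k * cnj (u k) - 2 * \<i> * e * (u k * cnj (u k))"
      unfolding y_step by (simp add: algebra_simps)
    then have "Re (y (k + 1) * cnj (u k)) = Re (y k * cnj (u k))"
      unfolding uu by (simp add: mult.assoc)
    then show "\<rho> (k + 1) = \<rho> k"
      using yu(1)[of k] yu(2)[of "k + 1"] by simp
  qed
  have s: "- sg k * \<rho> 0 = 2 * e * \<eta>\<^sup>2" for k
    using y_tau(2)[of k] \<rho>[of k] unfolding \<rho>_def[symmetric] \<alpha> by simp
  have \<rho>0: "\<rho> 0 \<noteq> 0"
  proof
    assume 0: "\<rho> 0 = 0"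
    then have "e = 0"
      using s[of 0] eta by simp
    moreover have "y k0 = 0"
      using y[of k0] \<rho>[of k0] 0 by simp
    ultimately show False
      using ne t[of k0] \<alpha>[of k0] by simp
  qed
  show "sg k = sg 0"
    using s[of k] s[of 0] \<rho>0 by (metis mult_right_cancel neg_equal_iff_equal)
  show "e = 0 \<Longrightarrow> sg k = 0"
    using s[of k] \<rho>0 by simp
qed

text \<open>With \<open>e = 0\<close> the constant \<open>y\<close> is the lowest coefficient
  \<epsilon> of a polynomial for n = 2. Its vanishing on circles contradicts \<epsilon> being
  nonzero.\<close>

lemma circle_degenerate:
  assumes e: "e = 0" and w: "w 0 \<noteq> 0" and s: "\<And>k. sg k = s" "s \<noteq> 0"
  shows "y k = 0"
proof -
  have \<alpha>: "\<alpha> k = - w 0 * s / (2 * \<eta>\<^sup>2)" for k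
    using w_sg[of k] eta by (simp add: e s field_simps)
  have "Im (y k * cnj (tau k)) = 0" "- s * Re (y k * cnj (tau k)) = 0"
    using y_tau[of k] by (simp_all only: \<alpha> e s) simp_all
  then have "y k * cnj (tau k) = 0"
    using s by (simp add: complex_eq_iff)
  then show ?thesis
    using tau[of k] by simp
qed

end

context ecurve_loc
begin

lemma elastic_data:
  assumes eq: "\<And>k. (1 + (sg k)\<^sup>2) * (sg (k + 1) + sg (k - 1)) = \<xi> * sg k + \<delta>"
  obtains e y \<alpha> t where "edata \<eta> z e y \<alpha> t" "\<And>k. edata.W \<eta> y t k \<noteq> 0" "\<delta> = 0 \<Longrightarrow> e = 0"
    "\<delta> = 0 \<Longrightarrow> \<forall>k. y k = 0 \<Longrightarrow> (\<forall>k. sg k = sg 0) \<and> (sg 0 = 0 \<longrightarrow> \<xi> = 2)"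
proof -
  define g where "g = \<eta>\<^sup>2"
  \<comment> \<open>The values of \<open>e\<close>, \<open>J\<close> and \<alpha> invert the
    formulas of \<open>elastic_of_w\<close> under the normalisation \<gamma> = 1.\<close>
  define e where "e = - \<delta> / (4 * g)"
  define J where "J = \<xi> / 2 - 1"
  define \<alpha> where "\<alpha> k = e * g + sg k" for k
  define Y where "Y k = Complex ((sg k * sg (k + 1) - J) / 2) ((sg (k + 1) - sg k) / 2 + e * g)" for k
  define Y' where "Y' k = Complex ((sg k * sg (k + 1) - J) / 2) ((sg (k + 1) - sg k) / 2 - e * g)" for k
  define y where "y k = Y k * u k / g" for k
  define t where "t k = of_real g * y k - (1 - \<i> * sg k) * u k" for k
  have g: "g \<noteq> 0"
    using eta by (simp add: g_def)
  have eg: "4 * (e * g) = - \<delta>"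
    using g by (simp add: e_def)
  have uu: "u k * cnj (u k) = of_real g" for k
    by (simp add: uu g_def)
  \<comment> \<open>The number \<open>y (k + 1)\<close> can be computed from either adjacent edge.
    That both results agree is the elastic equation.\<close>
  have YY: "Y (k + 1) * u (k + 1) = Y' k * u k" for k
  proof -
    define a b s where "a = sg k" and "b = sg (k + 1)" and "s = sg (k + 1 + 1)"
    have Y1: "Y (k + 1) = Complex ((b * s - J) / 2) ((s - b) / 2 + e * g)"
      and Y0: "Y' k = Complex ((a * b - J) / 2) ((b - a) / 2 - e * g)"
      by (simp_all add: Y_def Y'_def a_def b_def s_def)
    have "Y (k + 1) * (1 + \<i> * b) = Y' k * (1 - \<i> * b)"
    proof (rule complex_eqI)
      show "Re (Y (k + 1) * (1 + \<i> * b)) = Re (Y' k * (1 - \<i> * b))"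
        unfolding Y1 Y0 by (simp add: field_simps)
      have "(1 + b\<^sup>2) * (s + a) = \<xi> * b + \<delta>"
        using eq[of "k + 1"] by (simp add: a_def b_def s_def)
      moreover have "Im (Y (k + 1) * (1 + \<i> * b)) = (s - b) / 2 + e * g + b * (b * s - J) / 2"
        unfolding Y1 by (simp add: field_simps)
      moreover have "Im (Y' k * (1 - \<i> * b)) = (b - a) / 2 - e * g - b * (a * b - J) / 2"
        unfolding Y0 by (simp add: field_simps)
      moreover have "\<delta> = - 4 * (e * g)"
        using eg by simp
      ultimately show "Im (Y (k + 1) * (1 + \<i> * b)) = Im (Y' k * (1 - \<i> * b))"
        by (simp add: J_def power2_eq_square field_simps)
    qed
    then have "Y (k + 1) * ((1 + \<i> * b) * tau (k + 1) / 2) = Y' k * ((1 - \<i> * b) * tau (k + 1) / 2)"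
      by (simp only: mult.assoc[symmetric] times_divide_eq_right)
    then show ?thesis
      unfolding b_def u_tau[symmetric] by simp
  qed
  have y': "y (k + 1) = Y' k * u k / g" for k
    by (simp add: y_def YY)
  have yu: "y k * cnj (u k) = Y k" "y (k + 1) * cnj (u k) = Y' k" for k
    using uu[of k] g by (simp_all add: y_def[of k] y' mult.assoc)
  have t': "t (k + 1) = of_real g * y (k + 1) - (1 + \<i> * sg (k + 1)) * u k" for k
  proof -
    have "(1 - \<i> * sg (k + 1)) * u (k + 1) = (1 + \<i> * sg (k + 1)) * u (k + 1 - 1)"
      by (subst u_tau(1), subst u_tau(2)) (simp add: mult_ac)
    then show ?thesis
      by (simp add: t_def)
  qed
  have d: "edata \<eta> z e y \<alpha> t"
  proof unfold_locales
    fix k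
    have YY': "Y' k = Y k - 2 * \<i> * e * g"
      by (simp add: Y_def Y'_def complex_eq_iff mult.assoc diff_divide_distrib)
    have "y (k + 1) = (Y k - 2 * \<i> * e * g) * u k / g"
      unfolding y' YY' ..
    also have "\<dots> = y k - 2 * \<i> * e * u k"
      unfolding y_def using g by (simp add: field_simps)
    finally show ys: "y (k + 1) = y k - 2 * \<i> * e * u k" .
    show "\<alpha> (k + 1) - \<alpha> k = Im ((y (k + 1) + y k) * cnj (u k))"
      by (simp add: distrib_right yu \<alpha>_def Y_def Y'_def)
    have "t (k + 1) = of_real g * (y k - 2 * \<i> * e * u k) - (1 + \<i> * sg (k + 1)) * u k"
      unfolding t' ys ..
    also have "\<dots> = t k - \<i> * (\<alpha> k + \<alpha> (k + 1)) * u k"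
      by (simp add: t_def \<alpha>_def algebra_simps)
    finally show "t (k + 1) = t k - \<i> * (\<alpha> k + \<alpha> (k + 1)) * u k" .
    have "t (k + 1) * cnj (u k) = of_real g * (y (k + 1) * cnj (u k)) - (1 + \<i> * sg (k + 1)) * (u k * cnj (u k))"
      unfolding t' by (simp add: algebra_simps)
    also have "\<dots> = of_real g * (Y' k - (1 + \<i> * sg (k + 1)))"
      unfolding yu uu by (simp add: algebra_simps)
    also have "Y' k - (1 + \<i> * sg (k + 1)) = cnj (Y k - (1 - \<i> * sg k))"
      by (simp add: Y_def Y'_def complex_eq_iff field_simps)
    also have "of_real g * cnj (Y k - (1 - \<i> * sg k)) = cnj (of_real g * (y k * cnj (u k)) - (1 - \<i> * sg k) * (u k * cnj (u k)))"
      unfolding yu uu by (simp add: algebra_simps)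
    also have "\<dots> = u k * cnj (t k)"
      unfolding t_def by (simp add: algebra_simps)
    finally show "t (k + 1) * cnj (u k) = u k * cnj (t k)" .
  qed
  show thesis
  proof (rule that[OF d])
    show "edata.W \<eta> y t k \<noteq> 0" for k
    proof -
      have "Re (1 - \<i> * sg k) \<noteq> 0"
        by simp
      then have "1 - \<i> * sg k \<noteq> 0"
        by (metis zero_complex.sel(1))
      then show ?thesis
        unfolding edata.W_def[OF d] t_def by (simp add: g_def)
    qed
    show "\<delta> = 0 \<Longrightarrow> e = 0"
      by (simp add: e_def)
    assume "\<delta> = 0" and y0: "\<forall>k. y k = 0"
    then have "Y k = 0" for k
      using yu(1)[of k] by simp
    then have Y: "sg k * sg (k + 1) = J" "sg (k + 1) = sg k" for k
      using eg \<open>\<delta> = 0\<close> by (auto simp: Y_def complex_eq_iff dest!: spec[of _ k])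
    have "sg k = sg 0" for k
      by (rule const_int[where x = sg]) (rule Y(2))
    moreover have "sg 0 = 0 \<longrightarrow> \<xi> = 2"
    proof
      assume "sg 0 = 0"
      then show "\<xi> = 2"
        using Y(1)[of 0] by (simp add: J_def)
    qed
    ultimately show "(\<forall>k. sg k = sg 0) \<and> (sg 0 = 0 \<longrightarrow> \<xi> = 2)"
      by blast
  qed
qed

end

section \<open>Splitting off linear factors in the complex plane\<close>

text \<open>The products of the transport matrices from \<open>a\<close> to \<open>c\<close> through \<open>b\<close> and through \<open>d\<close> agree.\<close>

definition ebfly :: "complex \<Rightarrow> complex \<Rightarrow> complex \<Rightarrow> complex \<Rightarrow> bool" where
  "ebfly a b c d \<longleftrightarrow> (c - b) * cnj (b - a) = (c - d) * cnj (d - a)"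

lemma ebfly_alt:
  "ebfly a b c d \<longleftrightarrow> (c - b) * cnj (d - b) = (d - b) * cnj (d - a)"
  "ebfly a b c d \<Longrightarrow> (c - d) * cnj (d - b) = (d - b) * cnj (b - a)"
  "ebfly a b c d \<longleftrightarrow> (c - a) * cnj (d - b) = (d - a) * cnj (d - a) - (b - a) * cnj (b - a)"
  by (auto simp: ebfly_def algebra_simps)

lemma ebfly_norm:
  assumes "ebfly a b c d" "b \<noteq> d"
  shows "cmod (c - b) = cmod (d - a)" "cmod (c - d) = cmod (b - a)"
proof -
  have n: "cmod (d - b) \<noteq> 0"
    using assms(2) by simp
  have "cmod ((c - b) * cnj (d - b)) = cmod ((d - b) * cnj (d - a))"
    using assms(1) ebfly_alt(1) by metis
  then show "cmod (c - b) = cmod (d - a)"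
    using n unfolding norm_mult complex_mod_cnj by simp
  have "cmod ((c - d) * cnj (d - b)) = cmod ((d - b) * cnj (b - a))"
    using assms(1) ebfly_alt(2) by metis
  then show "cmod (c - d) = cmod (b - a)"
    using n unfolding norm_mult complex_mod_cnj by simp
qed

lemma ebfly_distinct:
  assumes "ebfly a b c d" "b \<noteq> d"
  shows "c \<noteq> a \<longleftrightarrow> cmod (d - a) \<noteq> cmod (b - a)"
proof -
  have "(c - a) * cnj (d - b) = of_real ((cmod (d - a))\<^sup>2 - (cmod (b - a))\<^sup>2)"
    using assms(1) unfolding ebfly_alt(3) mult_cnj by (simp only: of_real_diff)
  moreover have "cnj (d - b) \<noteq> 0"
    using assms(2) by simp
  ultimately have "c = a \<longleftrightarrow> (cmod (d - a))\<^sup>2 - (cmod (b - a))\<^sup>2 = 0"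
    by (metis mult_eq_0_iff of_real_eq_0_iff right_minus_eq)
  then show ?thesis
    by simp
qed

section \<open>Transformed curves in the complex plane\<close>

definition eback :: "real \<Rightarrow> (int \<Rightarrow> complex) \<Rightarrow> (int \<Rightarrow> complex) \<Rightarrow> bool" where
  "eback \<eta> z y \<longleftrightarrow> ecurve \<eta> z \<and> (\<forall>k. ebfly (z k) (z (k + 1)) (y (k + 1)) (y k))
     \<and> (\<exists>\<rho>. \<rho> \<noteq> \<eta> \<and> (\<forall>k. cmod (y k - z k) = \<rho>))"

lemma eback_D:
  assumes "eback \<eta> z y"
  shows "ecurve \<eta> z" "ebfly (z k) (z (k + 1)) (y (k + 1)) (y k)" "z (k + 1) \<noteq> y k" "y (k + 1) \<noteq> z k"
proof -
  show c: "ecurve \<eta> z" and b: "ebfly (z k) (z (k + 1)) (y (k + 1)) (y k)"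
    using assms by (auto simp: eback_def)
  have n: "cmod (y k - z k) \<noteq> \<eta>" "cmod (z (k + 1) - z k) = \<eta>"
    using assms by (auto simp: eback_def ecurve_def)
  then show ne: "z (k + 1) \<noteq> y k"
    by auto
  show "y (k + 1) \<noteq> z k"
    using ebfly_distinct[OF b ne] n by metis
qed

lemma eback_ecurve:
  assumes "eback \<eta> z y"
  shows "ecurve \<eta> y"
  unfolding ecurve_def
proof (intro conjI allI)
  note zc = eback_D(1)[OF assms]
  obtain \<rho> where \<rho>: "\<rho> \<noteq> \<eta>" "\<And>k. cmod (y k - z k) = \<rho>"
    using assms by (auto simp: eback_def)
  show "\<eta> > 0"
    using zc by (simp add: ecurve_def)
  show "cmod (y (k + 1) - y k) = \<eta>" for k
    using ebfly_norm(2)[OF eback_D(2,3)[OF assms]] zc by (simp add: ecurve_def)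
  show "y (k + 1) \<noteq> y (k - 1)" for k
  proof
    assume eq: "y (k + 1) = y (k - 1)"
    have z: "cmod (z (k + 1) - z k) = \<eta>" for k
      using zc by (simp add: ecurve_def)
    \<comment> \<open>The product of one diagonal with the conjugate of the other is the same real
      number in all butterflies. Equal points of \<open>y\<close> hence give equal diagonals, and
      equal points of \<open>z\<close>.\<close>
    have *: "(y (k + 1) - z k) * cnj (y k - z (k + 1)) = of_real (\<rho>\<^sup>2) - of_real (\<eta>\<^sup>2)" for k
      using eback_D(2)[OF assms, of k] unfolding ebfly_alt(3) mult_cnj z \<rho> .
    have "cnj ((y k - z (k - 1)) * cnj (y (k - 1) - z k)) = cnj (of_real (\<rho>\<^sup>2) - of_real (\<eta>\<^sup>2))"
      using *[of "k - 1"] by simp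
    then have "(y (k + 1) - z k) * cnj (y k - z (k - 1)) = of_real (\<rho>\<^sup>2) - of_real (\<eta>\<^sup>2)"
      unfolding eq by (simp add: mult.commute)
    then have "(y (k + 1) - z k) * cnj (y k - z (k + 1)) = (y (k + 1) - z k) * cnj (y k - z (k - 1))"
      using *[of k] by simp
    then have "z (k + 1) = z (k - 1)"
      using eback_D(4)[OF assms, of k] by (metis complex_cnj_cancel_iff diff_left_imp_eq mult_left_cancel right_minus_eq)
    then show False
      using zc by (simp add: ecurve_def)
  qed
qed

text \<open>The counterpart of \<open>factor_step\<close> modulo \<open>1 + d \<lambda>^2\<close>,
  with even part \<open>p\<close> and odd part \<open>r\<close> of the remainder. The conjugates
  come from the product of antidiagonal matrices.\<close>

lemma e_factor:
  fixes p p' r r' u v v' w :: complex and d :: real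
  assumes d: "d \<noteq> 0" and v: "v * cnj v = of_real d" and R: "r = p * v" "r' = p' * v'" "p' \<noteq> 0"
    and e1: "p' + r' * cnj u / d = p + w * cnj r / d" and e2: "r' + p' * u = r + w * cnj p"
  shows "v' * cnj (v - u) = (v - u) * cnj v"
proof -
  have v2: "cnj v * v = of_real d"
    using v by (simp add: mult.commute)
  have "p' * (v + v' * cnj u * v / d) = (p' + r' * cnj u / d) * v"
    by (simp add: R algebra_simps)
  also have "\<dots> = (p + w * cnj r / d) * v"
    by (simp only: e1)
  also have "\<dots> = p * v + w * cnj p * (cnj v * v) / d"
    unfolding R(1) by (simp add: algebra_simps)
  also have "\<dots> = p' * (v' + u)"
    using e2 d unfolding v2 R by (simp add: algebra_simps)
  finally have "v + v' * cnj u * v / d = v' + u"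
    using R(3) by simp
  then have "(v + v' * cnj u * v / d) * cnj v = (v' + u) * cnj v"
    by simp
  then have "v * cnj v + v' * cnj u * (v * cnj v) / d = v' * cnj v + u * cnj v"
    by (simp add: algebra_simps)
  then have "v * cnj v + v' * cnj u = v' * cnj v + u * cnj v"
    using d unfolding v by simp
  then show ?thesis
    by (simp add: algebra_simps)
qed

text \<open>Conjugation by the polynomial with coefficients \<open>E\<close>, \<open>Y\<close>, \<open>a\<close>, possibly followed by a cubic one, carries the
  transport matrices of \<open>z\<close> to those with entries \<open>w\<close>.\<close>

locale intertwiner = ecurve_loc \<eta> z for \<eta> and z :: "int \<Rightarrow> complex" +
  fixes E :: complex and Y a w :: "int \<Rightarrow> complex"
  assumes E: "E \<noteq> 0"
    and L1: "Y (k + 1) + E * u k = Y k + w k * cnj E"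
    and L2: "a (k + 1) - Y (k + 1) * cnj (u k) = a k - w k * cnj (Y k)"
begin

text \<open>The coefficients are \<open>E\<close>, \<open>Y\<close>, \<open>a\<close>, and
  \<open>root\<close> says that \<open>1 + d \<lambda>^2\<close> divides the determinant. The
  remainder has even part \<open>p = E - a / d\<close> and odd part \<open>Y\<close>; their quotient
  is the first displacement. The other root \<open>d'\<close> may be zero and then yields the
  identity transformation.\<close>

lemma quadratic_step:
  assumes L3: "\<And>k. a (k + 1) * u k = w k * cnj (a k)"
    and d: "d > 0" "d \<noteq> \<eta>\<^sup>2" and d': "d' \<ge> 0" "d' \<noteq> \<eta>\<^sup>2"
    and root: "\<And>k. d * (cmod (Y k))\<^sup>2 = (cmod (d * E - a k))\<^sup>2" and Y: "\<And>k. Y k \<noteq> 0"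
    and a2: "\<And>k. (cmod (a k))\<^sup>2 = (cmod E)\<^sup>2 * (d * d')"
  obtains g h where "eback \<eta> z g" "eback \<eta> g h" "\<And>k. (h (k + 1) - h k) * E = w k * cnj E"
    "\<And>k. E * (h k - z k) = Y k" "\<And>k. a k = - (E * (h k - g k) * cnj (g k - z k))"
proof -
  define p where "p k = E - a k / d" for k
  have dp: "d * p k = d * E - a k" for k
    using d by (simp add: p_def field_simps)
  have np: "d * (cmod (p k))\<^sup>2 = (cmod (Y k))\<^sup>2" for k
  proof -
    have "d * (d * (cmod (p k))\<^sup>2) = (cmod (d * p k))\<^sup>2"
      using d by (simp add: norm_mult power_mult_distrib power2_eq_square)
    also have "\<dots> = d * (cmod (Y k))\<^sup>2"
      unfolding dp root ..
    finally show ?thesis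
      using d by (metis less_irrefl mult_left_cancel)
  qed
  then have p0: "p k \<noteq> 0" for k
    using Y[of k] d by (metis mult_zero_right norm_zero power_eq_0_iff zero_less_numeral norm_eq_zero power_zero_numeral)
  define v where "v k = Y k / p k" for k
  have Yv: "Y k = p k * v k" for k
    using p0 by (simp add: v_def)
  have nv: "(cmod (v k))\<^sup>2 = d" for k
    using np[of k] p0[of k] by (simp add: v_def norm_divide power_divide field_simps)
  have vv: "v k * cnj (v k) = of_real d" for k
    by (simp add: mult_cnj nv)
  define v' where "v' k = Y k / E - v k" for k
  have Ev': "E * v' k = Y k - E * v k" for k
    using E by (simp add: v'_def algebra_simps)
  have av: "a k = - (E * v' k * cnj (v k))" for k
  proof -
    have "a k * v k = d * (E * v k) - d * (p k * v k)"
      using arg_cong[OF dp[of k], of "\<lambda>x. (d * E - x) * v k"] by (simp add: left_diff_distrib mult.assoc)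
    also have "\<dots> = - (d * (E * v' k))"
      unfolding Yv[symmetric] Ev' by (simp add: algebra_simps)
    also have "\<dots> = - (E * v' k * cnj (v k)) * v k"
      using vv[of k] by (simp add: mult_ac)
    finally show ?thesis
      using vv[of k] d by (metis mult_right_cancel mult_zero_left of_real_eq_0_iff less_irrefl)
  qed
  define g where "g k = z k + v k" for k
  define h where "h k = g k + v' k" for k
  have gz: "g k - z k = v k" and hg: "h k - g k = v' k" for k
    by (simp_all add: g_def h_def)
  have bf: "v (k + 1) * cnj (v k - u k) = (v k - u k) * cnj (v k)" for k
  proof (rule e_factor[OF _ vv Yv Yv p0])
    show "d \<noteq> 0"
      using d by simp
    show "p (k + 1) + Y (k + 1) * cnj (u k) / d = p k + w k * cnj (Y k) / d"
      using arg_cong[OF L2[of k], of "\<lambda>x. E - x / d"] by (simp add: p_def diff_divide_distrib)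
    have "Y (k + 1) + p (k + 1) * u k = Y (k + 1) + E * u k - a (k + 1) * u k / d"
      by (simp add: p_def algebra_simps)
    then show "Y (k + 1) + p (k + 1) * u k = Y k + w k * cnj (p k)"
      unfolding L1 L3 by (simp add: p_def algebra_simps)
  qed
  have u: "z (k + 1) - z k = u k" for k
    by (simp add: u_def)
  have b1: "ebfly (z k) (z (k + 1)) (g (k + 1)) (g k)" for k
  proof -
    have "g k - z (k + 1) = v k - u k"
      by (simp add: g_def u_def)
    then show ?thesis
      unfolding ebfly_alt(1) gz by (simp only: bf)
  qed
  have zg: "eback \<eta> z g"
    unfolding eback_def
  proof (intro conjI exI[of _ "sqrt d"] allI)
    show "sqrt d \<noteq> \<eta>"
      using d by auto
    show "cmod (g k - z k) = sqrt d" for k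
      unfolding gz using nv[of k] by (metis norm_ge_zero real_sqrt_unique)
  qed (use ecurve b1 in auto)
  have sum: "(h (k + 1) - h k) * E = w k * cnj E" for k
  proof -
    have "(h (k + 1) - h k) * E = E * (z (k + 1) - z k) + (E * v (k + 1) + E * v' (k + 1)) - (E * v k + E * v' k)"
      by (simp add: h_def g_def algebra_simps)
    then show ?thesis
      unfolding u Ev' using L1[of k] by (simp add: algebra_simps)
  qed
  have b2: "ebfly (g k) (g (k + 1)) (h (k + 1)) (h k)" for k
  proof -
    define U where "U = g (k + 1) - g k"
    define H where "H = h (k + 1) - h k"
    have U: "U = u k + v (k + 1) - v k"
      by (simp add: U_def g_def u_def)
    have H: "H = U + v' (k + 1) - v' k"
      by (simp add: U_def H_def h_def)
    have b: "v (k + 1) * cnj (u k) = U * cnj (v k)"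
      using b1[of k] unfolding ebfly_def gz u U_def .
    have wE: "w k * cnj (Y k) = E * (H * (cnj (v k) + cnj (v' k)))"
    proof -
      have "cnj (Y k) = cnj E * (cnj (v k) + cnj (v' k))"
        using arg_cong[OF Ev'[of k], of cnj] by (simp add: algebra_simps)
      then have "w k * cnj (Y k) = (w k * cnj E) * (cnj (v k) + cnj (v' k))"
        by simp
      then show ?thesis
        unfolding sum[symmetric] H_def by (simp add: mult_ac)
    qed
    have Y': "Y k = E * (v k + v' k)" for k
      using Ev'[of k] by (simp add: algebra_simps)
    have "E * (v' (k + 1) * cnj (v (k + 1)) + (v (k + 1) + v' (k + 1)) * cnj (u k))
      = E * (v' k * cnj (v k) + H * (cnj (v k) + cnj (v' k)))"
      using L2[of k] unfolding wE av Y'[of "k + 1"] by (simp add: algebra_simps)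
    then have "v' (k + 1) * cnj (v (k + 1)) + (v (k + 1) + v' (k + 1)) * cnj (u k)
      = v' k * cnj (v k) + H * (cnj (v k) + cnj (v' k))"
      using E by (metis mult_left_cancel)
    then have "v' (k + 1) * (cnj (v (k + 1)) + cnj (u k)) + U * cnj (v k)
      = v' k * cnj (v k) + H * (cnj (v k) + cnj (v' k))"
      using b by (simp add: algebra_simps)
    moreover have "cnj (v (k + 1)) + cnj (u k) = cnj U + cnj (v k)"
      by (simp add: U)
    ultimately have "v' (k + 1) * (cnj U + cnj (v k)) + U * cnj (v k)
      = v' k * cnj (v k) + H * (cnj (v k) + cnj (v' k))"
      by simp
    then have "v' (k + 1) * cnj U = H * cnj (v' k)"
      unfolding H by (simp add: algebra_simps)
    then show ?thesis
      unfolding ebfly_def hg U_def[symmetric] H_def[symmetric] .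
  qed
  have gh: "eback \<eta> g h"
    unfolding eback_def
  proof (intro conjI exI[of _ "sqrt d'"] allI)
    show "sqrt d' \<noteq> \<eta>"
      using d' by auto
    show "cmod (h k - g k) = sqrt d'" for k
    proof -
      have "(cmod (a k))\<^sup>2 = (cmod E)\<^sup>2 * (cmod (v' k))\<^sup>2 * d"
        unfolding av using nv[of k] by (simp add: norm_mult power_mult_distrib)
      then have "(cmod (v' k))\<^sup>2 = d'"
        using a2[of k] E d by simp
      then show ?thesis
        unfolding hg by (metis norm_ge_zero real_sqrt_unique)
    qed
  qed (use eback_ecurve[OF zg] b2 in auto)
  show thesis
  proof (rule that[OF zg gh sum])
    show "E * (h k - z k) = Y k" for k
      using Ev'[of k] by (simp add: h_def g_def algebra_simps)
    show "a k = - (E * (h k - g k) * cnj (g k - z k))" for k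
      unfolding hg gz by (rule av)
  qed
qed

text \<open>The quotient by \<open>1 + \<lambda> v\<close> has the coefficients \<open>E\<close>,
  \<open>Y - E v\<close> and \<open>a + (Y - E v) cnj v\<close>. It intertwines the transformed
  curve with the same matrices \<open>w\<close>, so \<open>quadratic_step\<close> can
  follow.\<close>

lemma cubic_step:
  assumes L3: "\<And>k. t (k + 1) + a (k + 1) * u k = t k + w k * cnj (a k)"
    and L4: "\<And>k. t (k + 1) * cnj (u k) = w k * cnj (t k)"
    and d: "d > 0" "d \<noteq> \<eta>\<^sup>2"
    and root: "\<And>k. d * (cmod (d * E - a k))\<^sup>2 = (cmod (d * Y k - t k))\<^sup>2" and p: "\<And>k. d * E - a k \<noteq> 0"
  obtains g where "eback \<eta> z g" "\<And>k. (cmod (g k - z k))\<^sup>2 = d"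
    "intertwiner \<eta> g E (\<lambda>k. Y k - E * (g k - z k)) (\<lambda>k. a k + (Y k - E * (g k - z k)) * cnj (g k - z k)) w"
    "\<And>k. (a (k + 1) + (Y (k + 1) - E * (g (k + 1) - z (k + 1))) * cnj (g (k + 1) - z (k + 1))) * (g (k + 1) - g k)
      = w k * cnj (a k + (Y k - E * (g k - z k)) * cnj (g k - z k))"
    "\<And>k. t k = (a k + (Y k - E * (g k - z k)) * cnj (g k - z k)) * (g k - z k)"
proof -
  define p where "p k = E - a k / d" for k
  define r where "r k = Y k - t k / d" for k
  have dp: "d * p k = d * E - a k" and dr: "d * r k = d * Y k - t k" for k
    using d by (simp_all add: p_def r_def field_simps)
  have p0: "p k \<noteq> 0" for k
    using p[of k] dp[of k] by auto
  have np: "d * (cmod (p k))\<^sup>2 = (cmod (r k))\<^sup>2" for k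
  proof -
    have "d\<^sup>2 * (d * (cmod (p k))\<^sup>2) = d * (cmod (d * p k))\<^sup>2" "d\<^sup>2 * (cmod (r k))\<^sup>2 = (cmod (d * r k))\<^sup>2"
      using d by (simp_all add: norm_mult power_mult_distrib)
    then have "d\<^sup>2 * (d * (cmod (p k))\<^sup>2) = d\<^sup>2 * (cmod (r k))\<^sup>2"
      using root[of k] unfolding dp dr by simp
    then show ?thesis
      using d by simp
  qed
  define v where "v k = r k / p k" for k
  have rv: "r k = p k * v k" for k
    using p0 by (simp add: v_def)
  have nv: "(cmod (v k))\<^sup>2 = d" for k
    using np[of k] p0[of k] by (simp add: v_def norm_divide power_divide field_simps)
  have vv: "v k * cnj (v k) = of_real d" for k
    by (simp add: mult_cnj nv)
  define g where "g k = z k + v k" for k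
  have gz: "g k - z k = v k" for k
    by (simp add: g_def)
  have bf: "v (k + 1) * cnj (v k - u k) = (v k - u k) * cnj (v k)" for k
  proof (rule e_factor[OF _ vv rv rv p0])
    show "d \<noteq> 0"
      using d by simp
    have "p (k + 1) + r (k + 1) * cnj (u k) / d
        = E - (a (k + 1) - Y (k + 1) * cnj (u k)) / d - t (k + 1) * cnj (u k) / d / d"
      by (simp add: p_def r_def diff_divide_distrib left_diff_distrib)
    also have "\<dots> = p k + w k * cnj (r k) / d"
      unfolding L2 L4 by (simp add: p_def r_def diff_divide_distrib right_diff_distrib)
    finally show "p (k + 1) + r (k + 1) * cnj (u k) / d = p k + w k * cnj (r k) / d" .
    have "r (k + 1) + p (k + 1) * u k = Y (k + 1) + E * u k - (t (k + 1) + a (k + 1) * u k) / d"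
      by (simp add: p_def r_def add_divide_distrib algebra_simps)
    then show "r (k + 1) + p (k + 1) * u k = r k + w k * cnj (p k)"
      unfolding L1 L3 by (simp add: p_def r_def add_divide_distrib algebra_simps)
  qed
  have u: "z (k + 1) - z k = u k" for k
    by (simp add: u_def)
  have b1: "ebfly (z k) (z (k + 1)) (g (k + 1)) (g k)" for k
  proof -
    have "g k - z (k + 1) = v k - u k"
      by (simp add: g_def u_def)
    then show ?thesis
      unfolding ebfly_alt(1) gz by (simp only: bf)
  qed
  have zg: "eback \<eta> z g"
    unfolding eback_def
  proof (intro conjI exI[of _ "sqrt d"] allI)
    show "sqrt d \<noteq> \<eta>"
      using d by auto
    show "cmod (g k - z k) = sqrt d" for k
      unfolding gz using nv[of k] by (metis norm_ge_zero real_sqrt_unique)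
  qed (use ecurve b1 in auto)
  define y where "y k = Y k - E * v k" for k
  define b where "b k = a k + y k * cnj (v k)" for k
  define U where "U k = g (k + 1) - g k" for k
  have U: "U k = u k + v (k + 1) - v k" for k
    by (simp add: U_def g_def u_def)
  have bu: "v (k + 1) * cnj (u k) = U k * cnj (v k)" for k
    using b1[of k] unfolding ebfly_def gz u U_def .
  have l1: "y (k + 1) + E * U k = y k + w k * cnj E" for k
    using L1[of k] by (simp add: y_def U algebra_simps)
  have l2: "b (k + 1) - y (k + 1) * cnj (U k) = b k - w k * cnj (y k)" for k
  proof -
    have "b (k + 1) - y (k + 1) * cnj (U k) = a (k + 1) - y (k + 1) * cnj (u k) + y (k + 1) * cnj (v k)"
      by (simp add: b_def U algebra_simps)
    also have "\<dots> = (a (k + 1) - Y (k + 1) * cnj (u k)) + E * (v (k + 1) * cnj (u k)) + y (k + 1) * cnj (v k)"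
      by (simp add: y_def algebra_simps)
    also have "\<dots> = a k - w k * cnj (Y k) + (y (k + 1) + E * U k) * cnj (v k)"
      unfolding L2 bu by (simp add: algebra_simps)
    also have "\<dots> = b k - w k * cnj (y k)"
      unfolding l1 by (simp add: b_def y_def algebra_simps)
    finally show ?thesis .
  qed
  have t: "t k = b k * v k" for k
  proof -
    have "b k * v k = a k * v k + y k * of_real d"
      unfolding vv[of k, symmetric] by (simp add: b_def algebra_simps)
    also have "a k * v k = d * (E * v k) - d * (p k * v k)"
      using arg_cong[OF dp[of k], of "\<lambda>x. (d * E - x) * v k"] by (simp add: left_diff_distrib mult.assoc)
    also have "d * (p k * v k) = d * Y k - t k"
      unfolding rv[symmetric] by (rule dr)
    finally show ?thesis
      by (simp add: y_def algebra_simps)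
  qed
  have l3: "b (k + 1) * U k = w k * cnj (b k)" for k
  proof -
    have cb: "cnj (v (k + 1)) * u k = cnj (U k) * v k"
      using arg_cong[OF bu[of k], of cnj] by simp
    have "b (k + 1) * v (k + 1) + a (k + 1) * u k = b k * v k + w k * cnj (a k)"
      using L3[of k] unfolding t .
    moreover have "a (k + 1) = b (k + 1) - y (k + 1) * cnj (v (k + 1))" "cnj (a k) = cnj (b k) - cnj (y k) * v k"
      by (simp_all add: b_def)
    ultimately have "b (k + 1) * v (k + 1) + (b (k + 1) - y (k + 1) * cnj (v (k + 1))) * u k
        = b k * v k + w k * (cnj (b k) - cnj (y k) * v k)"
      by (simp only:)
    then have "b (k + 1) * v (k + 1) + b (k + 1) * u k - y (k + 1) * (cnj (v (k + 1)) * u k)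
        = b k * v k + w k * (cnj (b k) - cnj (y k) * v k)"
      by (simp add: algebra_simps)
    then have "b (k + 1) * U k + (b (k + 1) - y (k + 1) * cnj (U k)) * v k
        = b k * v k + w k * (cnj (b k) - cnj (y k) * v k)"
      unfolding cb by (simp add: U algebra_simps)
    then show ?thesis
      unfolding l2 by (simp add: algebra_simps)
  qed
  have g: "ecurve_loc \<eta> g"
    by (rule ecurve_loc.intro[OF eback_ecurve[OF zg]])
  have "intertwiner \<eta> g E y b w"
    by (intro intertwiner.intro g intertwiner_axioms.intro)
       (use E l1 l2 in \<open>auto simp: ecurve_loc.u_def[OF g] U_def\<close>)
  moreover have "y = (\<lambda>k. Y k - E * (g k - z k))" "b = (\<lambda>k. a k + (Y k - E * (g k - z k)) * cnj (g k - z k))"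
    by (simp_all add: fun_eq_iff y_def b_def gz)
  ultimately have "intertwiner \<eta> g E (\<lambda>k. Y k - E * (g k - z k)) (\<lambda>k. a k + (Y k - E * (g k - z k)) * cnj (g k - z k)) w"
    by simp
  note I = this
  show thesis
  proof (rule that[OF zg _ I])
    show "(cmod (g k - z k))\<^sup>2 = d" for k
      unfolding gz by (rule nv)
    show "(a (k + 1) + (Y (k + 1) - E * (g (k + 1) - z (k + 1))) * cnj (g (k + 1) - z (k + 1))) * (g (k + 1) - g k)
      = w k * cnj (a k + (Y k - E * (g k - z k)) * cnj (g k - z k))" for k
      unfolding gz using l3[of k] unfolding U_def b_def y_def .
    show "t k = (a k + (Y k - E * (g k - z k)) * cnj (g k - z k)) * (g k - z k)" for k
      unfolding gz using t[of k] unfolding b_def y_def .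
  qed
qed

end

context edata
begin

lemma Y_refl: "y (k + 1) * cnj (u k) - u k * cnj (y k) = \<i> * of_real (\<alpha> (k + 1) - \<alpha> k)"
proof (rule complex_eqI)
  have "y (k + 1) * cnj (u k) = y k * cnj (u k) - 2 * \<i> * e * (u k * cnj (u k))"
    unfolding y_step by (simp add: algebra_simps)
  then have "Re (y (k + 1) * cnj (u k)) = Re (y k * cnj (u k))"
    unfolding uu by (simp add: mult.assoc)
  moreover have "u k * cnj (y k) = cnj (y k * cnj (u k))"
    by simp
  ultimately show "Re (y (k + 1) * cnj (u k) - u k * cnj (y k)) = Re (\<i> * of_real (\<alpha> (k + 1) - \<alpha> k))"
    by (simp del: complex_cnj_mult)
  have "Im (u k * cnj (y k)) = Im (cnj (y k * cnj (u k)))"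
    by (simp add: mult.commute)
  also have "\<dots> = - Im (y k * cnj (u k))"
    by (rule cnj.sel(2))
  finally show "Im (y (k + 1) * cnj (u k) - u k * cnj (y k)) = Im (\<i> * of_real (\<alpha> (k + 1) - \<alpha> k))"
    by (simp add: \<alpha>_step distrib_right)
qed

text \<open>For n = 2 the matrix \<open>E\<close> is antidiagonal. Multiplying by a fixed
  antidiagonal matrix from the left makes it diagonal and replaces \<open>u\<close> by its
  conjugate, which brings the polynomial into the form of \<open>intertwiner\<close>.\<close>

lemma exists_two:
  assumes e: "e = 0" and y0: "y 0 \<noteq> 0"
  obtains g h where "eback \<eta> z g" "eback \<eta> g h" "\<And>k. y 0 * cnj (h (k + 1) - h k) = u k * cnj (y 0)"
proof -
  have y: "y k = y 0" for k
    by (rule const_int[where x = y]) (simp add: y_step e)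
  define N j2 j3 where "N = (cmod (y 0))\<^sup>2" and "j2 = (\<alpha> 0)\<^sup>2 + 2 * Re (y 0 * cnj (t 0))" and "j3 = (cmod (t 0))\<^sup>2"
  have N: "N > 0"
    using y0 by (simp add: N_def)
  have j3: "(cmod (t k))\<^sup>2 = j3" for k
    unfolding j3_def using const_int[where x = "\<lambda>k. cmod (t k)", OF t_const, of k] by simp
  have j2: "(\<alpha> k)\<^sup>2 + 2 * Re (y 0 * cnj (t k)) = j2" for k
    using j2_const[of k] y[of k] by (simp add: j2_def)
  \<comment> \<open>The free parameter \<open>b\<close> is the real part of the even coefficient;
    when it is large, the quadratic equation for \<open>d\<close> has real roots.\<close>
  have "\<forall>\<^sub>F b in at_top. b > 0 \<and> 1 * b\<^sup>2 + (j2 - (4 * N * j3 + 1)) > 0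
      \<and> (- \<eta>\<^sup>2) * b\<^sup>2 + (N * \<eta>^4 - j2 * \<eta>\<^sup>2 + j3) \<noteq> 0"
    using eta by (intro eventually_conj eventually_quadratic_pos eventually_quadratic_nonzero eventually_gt_at_top) auto
  then obtain b where b: "b > 0" "b\<^sup>2 + j2 > 4 * N * j3 + 1" "- \<eta>\<^sup>2 * b\<^sup>2 + (N * \<eta>^4 - j2 * \<eta>\<^sup>2 + j3) \<noteq> 0"
    using eventually_happens by force
  define S where "S = b\<^sup>2 + j2"
  have Nj: "4 * N * j3 \<ge> 0"
    using N by (simp add: j3_def)
  then have S: "S > 1" "S > 4 * N * j3"
    using b(2) by (simp_all add: S_def)
  then have "S\<^sup>2 \<ge> 4 * N * j3"
    using mult_mono[of 1 S S S] unfolding power2_eq_square by linarith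
  define R where "R = sqrt (S\<^sup>2 - 4 * N * j3)"
  have R: "R\<^sup>2 = S\<^sup>2 - 4 * N * j3" "R \<ge> 0"
    using \<open>S\<^sup>2 \<ge> 4 * N * j3\<close> by (simp_all add: R_def)
  define d d' where "d = (S + R) / (2 * N)" and "d' = (S - R) / (2 * N)"
  have dd: "S = N * (d + d')" "j3 = N * (d * d')"
  proof -
    show "S = N * (d + d')"
      using N by (simp add: d_def d'_def field_simps)
    have "4 * N * (N * (d * d')) = S\<^sup>2 - R\<^sup>2"
      using N by (simp add: d_def d'_def field_simps power2_eq_square)
    then show "j3 = N * (d * d')"
      using N unfolding R(1) by simp
  qed
  have d: "d > 0"
    using S R N by (simp add: d_def add_pos_nonneg)
  have "j3 \<ge> 0"
    by (simp add: j3_def)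
  then have d': "d' \<ge> 0"
    using N d unfolding dd(2) by (simp add: zero_le_mult_iff)
  have "- \<eta>\<^sup>2 * b\<^sup>2 + (N * \<eta>^4 - j2 * \<eta>\<^sup>2 + j3) = N * \<eta>^4 - S * \<eta>\<^sup>2 + j3"
    by (simp add: S_def algebra_simps)
  also have "\<dots> = N * ((\<eta>\<^sup>2 - d) * (\<eta>\<^sup>2 - d'))"
    unfolding dd by (simp add: algebra_simps power2_eq_square power4_eq_xxxx)
  finally have ne: "d \<noteq> \<eta>\<^sup>2" "d' \<noteq> \<eta>\<^sup>2"
    using b(3) by auto
  define A where "A k = Complex b (- \<alpha> k)" for k
  have A: "A k = of_real b - \<i> * of_real (\<alpha> k)" for k
    by (simp add: A_def complex_eq_iff)
  interpret I: intertwiner \<eta> z "- cnj (y 0)" A "\<lambda>k. - cnj (t k)" "\<lambda>k. cnj (u k)"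
  proof unfold_locales
    show "- cnj (y 0) \<noteq> 0"
      using y0 by simp
    have *: "cnj (y 0 * cnj (u k) - u k * cnj (y 0)) = cnj (\<i> * of_real (\<alpha> (k + 1) - \<alpha> k))" for k
      using Y_refl[of k] y[of k] y[of "k + 1"] by metis
    show "A (k + 1) + - cnj (y 0) * u k = A k + cnj (u k) * cnj (- cnj (y 0))" for k
      using *[of k] unfolding A by (simp add: algebra_simps)
    have **: "cnj (t (k + 1)) = cnj (t k - \<i> * (\<alpha> k + \<alpha> (k + 1)) * u k)" for k
      by (simp only: t_step)
    show "- cnj (t (k + 1)) - A (k + 1) * cnj (u k) = - cnj (t k) - cnj (u k) * cnj (A k)" for k
      using **[of k] unfolding A by (simp add: algebra_simps)
  qed
  obtain g h where "eback \<eta> z g" "eback \<eta> g h"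
    and H: "\<And>k. (h (k + 1) - h k) * (- cnj (y 0)) = cnj (u k) * cnj (- cnj (y 0))"
  proof (rule I.quadratic_step[OF _ d ne(1) d' ne(2)])
    fix k
    have "cnj (t (k + 1) * cnj (u k)) = cnj (u k * cnj (t k))"
      by (simp only: t_refl)
    then show "- cnj (t (k + 1)) * u k = cnj (u k) * cnj (- cnj (t k))"
      by simp
    have "(cmod (A k))\<^sup>2 = b\<^sup>2 + (\<alpha> k)\<^sup>2"
      by (simp add: A_def cmod_power2)
    moreover have "(cmod (of_real d * - cnj (y 0) - - cnj (t k)))\<^sup>2 = d\<^sup>2 * N - 2 * d * Re (y 0 * cnj (t k)) + j3"
    proof -
      have "of_real d * - cnj (y 0) - - cnj (t k) = cnj (t k - of_real d * y 0)"
        by simp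
      then have "(cmod (of_real d * - cnj (y 0) - - cnj (t k)))\<^sup>2 = (cmod (t k - of_real d * y 0))\<^sup>2"
        by (metis complex_mod_cnj)
      also have "\<dots> = (cmod (t k))\<^sup>2 + d\<^sup>2 * N - 2 * d * Re (y 0 * cnj (t k))"
        unfolding N_def cmod_power2 by (simp add: times_complex.sel power2_eq_square algebra_simps)
      finally show ?thesis
        by (simp add: j3)
    qed
    moreover have "d * S = N * d\<^sup>2 + j3"
      unfolding dd by (simp add: algebra_simps power2_eq_square)
    ultimately show "d * (cmod (A k))\<^sup>2 = (cmod (of_real d * - cnj (y 0) - - cnj (t k)))\<^sup>2"
      by (simp add: S_def j2[of k, symmetric]) (simp add: algebra_simps)
    show "A k \<noteq> 0"
      using b(1) by (simp add: A_def complex_eq_iff)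
    show "(cmod (- cnj (t k)))\<^sup>2 = (cmod (- cnj (y 0)))\<^sup>2 * (d * d')"
      using dd(2) by (simp add: j3 N_def)
  qed (rule that)
  moreover have "y 0 * cnj (h (k + 1) - h k) = u k * cnj (y 0)" for k
    using arg_cong[OF H[of k], of cnj] by (simp add: algebra_simps)
  ultimately show thesis
    using that by blast
qed

text \<open>If \<open>t\<close> is nonzero, the cubic is negative at 0 and a small positive
  \<open>z0\<close> works. If \<open>t\<close> vanishes, then \<alpha> changes sign from vertex to
  vertex and \<open>y\<close> is nowhere zero; the cubic loses a factor \<open>z\<close>, and at one
  of two neighbouring vertices the discriminant of the rest is seen to be positive.\<close>

lemma neg_value:
  assumes W: "\<And>k. W k \<noteq> 0"
  defines "j1 \<equiv> (cmod (y 0))\<^sup>2 + 2 * e * \<alpha> 0" and "j2 \<equiv> (\<alpha> 0)\<^sup>2 + 2 * Re (y 0 * cnj (t 0))" and "j3 \<equiv> (cmod (t 0))\<^sup>2"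
  obtains z0 where "z0 * (e\<^sup>2 * z0^3 + (- j1) * z0\<^sup>2 + j2 * z0 + (- j3)) < 0"
proof (cases "t 0 = 0")
  case False
  define q where "q z = e\<^sup>2 * z^3 + (- j1) * z\<^sup>2 + j2 * z + (- j3)" for z
  have "(q \<longlongrightarrow> q 0) (at_right 0)"
    unfolding q_def by (intro tendsto_intros)
  moreover have "q 0 < 0"
    using False by (simp add: q_def j3_def)
  ultimately have "\<forall>\<^sub>F z in at_right 0. q z < 0"
    by (rule order_tendstoD)
  moreover have "\<forall>\<^sub>F z in at_right 0. (z::real) > 0"
    by (rule eventually_at_right_less)
  ultimately have "\<forall>\<^sub>F z in at_right 0. q z < 0 \<and> z > 0"
    by (rule eventually_conj)
  then obtain z0 where "q z0 < 0" "z0 > 0"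
    using eventually_happens'[OF trivial_limit_at_right_real] by blast
  then have "z0 * q z0 < 0"
    by (simp add: mult_pos_neg)
  then show thesis
    unfolding q_def by (rule that)
next
  case True
  have t: "t k = 0" for k
    using const_int[where x = "\<lambda>k. cmod (t k)", OF t_const, of k] True by simp
  have y: "y k \<noteq> 0" for k
    using W[of k] by (auto simp: W_def t)
  have \<alpha>1: "\<alpha> (0 + 1) = - \<alpha> 0"
  proof -
    have "of_real (\<alpha> 0 + \<alpha> (0 + 1)) * u 0 = 0"
      using t_step[of 0] unfolding t by simp
    then have "\<alpha> 0 + \<alpha> (0 + 1) = 0"
      by (metis mult_eq_0_iff of_real_eq_0_iff u(2))
    then show ?thesis
      by simp
  qed
  obtain A B where AB: "A > 0" "B \<ge> 0" "j1 = A + 2 * B" "B\<^sup>2 = e\<^sup>2 * (\<alpha> 0)\<^sup>2"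
  proof (cases "e * \<alpha> 0 \<ge> 0")
    case True
    then show thesis
      using y[of 0] by (intro that[of "(cmod (y 0))\<^sup>2" "e * \<alpha> 0"]) (simp_all add: j1_def power_mult_distrib)
  next
    case False
    have "j1 = (cmod (y (0 + 1)))\<^sup>2 + 2 * (e * - \<alpha> 0)"
      using j1_const[of "0 + 1"] unfolding \<alpha>1 j1_def by simp
    with False show thesis
      using y[of "0 + 1"] by (intro that[of "(cmod (y (0 + 1)))\<^sup>2" "e * - \<alpha> 0"]) (simp_all add: power_mult_distrib)
  qed
  have "(- j1)\<^sup>2 - 4 * e\<^sup>2 * (\<alpha> 0)\<^sup>2 = A\<^sup>2 + 4 * (A * B)"
    using AB(4) unfolding AB(3) by (simp add: power2_eq_square algebra_simps)
  also have "\<dots> > 0"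
    using AB(1,2) by (intro add_pos_nonneg) auto
  finally obtain z0 where z0: "e\<^sup>2 * z0\<^sup>2 + (- j1) * z0 + (\<alpha> 0)\<^sup>2 < 0"
    by (rule quadratic_neg_value)
  then have "z0 \<noteq> 0"
    by (metis add.left_neutral mult_zero_right not_less zero_le_power2 power_zero_numeral)
  then have "z0\<^sup>2 * (e\<^sup>2 * z0\<^sup>2 + (- j1) * z0 + (\<alpha> 0)\<^sup>2) < 0"
    using z0 by (intro mult_pos_neg) auto
  then show thesis
    by (intro that[of z0]) (simp add: j2_def j3_def t algebra_simps power2_eq_square power3_eq_cube)
qed

lemma exists_three:
  assumes W: "\<And>k. W k \<noteq> 0"
  obtains E g m h where "E \<noteq> 0" "Im E = e" "eback \<eta> z g" "eback \<eta> g m" "eback \<eta> m h"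
    "\<And>k. (h (k + 1) - h k) * E = u k * cnj E" "\<And>k. E * (h k - z k) = y k"
    "\<And>k. t k = - (E * (h k - m k) * cnj (m k - g k) * (g k - z k))"
proof -
  define j1 j2 j3 where "j1 = (cmod (y 0))\<^sup>2 + 2 * e * \<alpha> 0" and "j2 = (\<alpha> 0)\<^sup>2 + 2 * Re (y 0 * cnj (t 0))" and "j3 = (cmod (t 0))\<^sup>2"
  have j: "(cmod (y k))\<^sup>2 + 2 * e * \<alpha> k = j1" "(\<alpha> k)\<^sup>2 + 2 * Re (y k * cnj (t k)) = j2" "(cmod (t k))\<^sup>2 = j3" for k
    using j1_const[of k] j2_const[of k] const_int[where x = "\<lambda>k. cmod (t k)", OF t_const, of k]
    by (simp_all add: j1_def j2_def j3_def)
  obtain z0 where z0: "z0 * (e\<^sup>2 * z0^3 + (- j1) * z0\<^sup>2 + j2 * z0 + (- j3)) < 0"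
    unfolding j1_def j2_def j3_def by (rule neg_value[OF W])
  obtain x r1 r2 r3 where x: "x > 0" "x\<^sup>2 + e\<^sup>2 > 0" and r: "r1 < r2" "r2 < r3"
    and F: "\<And>d. x\<^sup>2 * (d - 0) * (d - z0)\<^sup>2 + (e\<^sup>2 * d^3 + (- j1) * d\<^sup>2 + j2 * d + (- j3)) = (x\<^sup>2 + e\<^sup>2) * (d - r1) * (d - r2) * (d - r3)"
    and Fn: "x\<^sup>2 * (\<eta>\<^sup>2 - 0) * (\<eta>\<^sup>2 - z0)\<^sup>2 + (e\<^sup>2 * (\<eta>\<^sup>2)^3 + (- j1) * (\<eta>\<^sup>2)\<^sup>2 + j2 * \<eta>\<^sup>2 + (- j3)) \<noteq> 0"
  proof (rule perturbed_cubic_roots[of z0 0 "e\<^sup>2" "- j1" j2 "- j3" "\<eta>\<^sup>2"])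
    show "(z0 - 0) * (e\<^sup>2 * z0^3 + (- j1) * z0\<^sup>2 + j2 * z0 + (- j3)) < 0"
      using z0 by (simp only: diff_0_right)
    show "\<eta>\<^sup>2 \<noteq> 0"
      using eta(2) by simp
  qed (rule that)
  have rn: "r1 \<noteq> \<eta>\<^sup>2" "r2 \<noteq> \<eta>\<^sup>2" "r3 \<noteq> \<eta>\<^sup>2"
    using Fn unfolding F by auto
  \<comment> \<open>The real parts \<open>x\<close> and \<open>x * z0\<close> of the even
    coefficients are the freely chosen traces; the imaginary parts are the given data.\<close>
  define E where "E = Complex x e"
  define a where "a k = Complex (x * z0) (\<alpha> k)" for k
  have E: "E = of_real x + \<i> * of_real e" "E \<noteq> 0" and cE: "(cmod E)\<^sup>2 = x\<^sup>2 + e\<^sup>2"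
    using x by (simp_all add: E_def complex_eq_iff cmod_power2)
  have a: "a k = of_real (x * z0) + \<i> * of_real (\<alpha> k)" for k
    by (simp add: a_def complex_eq_iff)
  have D: "d * (cmod (of_real d * E - a k))\<^sup>2 - (cmod (of_real d * y k - t k))\<^sup>2
      = (x\<^sup>2 + e\<^sup>2) * (d - r1) * (d - r2) * (d - r3)" for d k
  proof -
    have n1: "(cmod (of_real d * E - a k))\<^sup>2 = (d * x - x * z0)\<^sup>2 + (d * e - \<alpha> k)\<^sup>2"
      by (simp add: cmod_power2 E_def a_def)
    have n2: "(cmod (of_real d * y k - t k))\<^sup>2 = d\<^sup>2 * (cmod (y k))\<^sup>2 - 2 * d * Re (y k * cnj (t k)) + (cmod (t k))\<^sup>2"
      unfolding cmod_power2 by (simp add: times_complex.sel power2_eq_square algebra_simps)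
    show ?thesis
      unfolding n1 n2 F[symmetric] j(1)[of k, symmetric] j(2)[of k, symmetric] j(3)[of k, symmetric]
      by (simp add: power2_eq_square power3_eq_cube algebra_simps)
  qed
  have rt: "d * (cmod (of_real d * E - a k))\<^sup>2 = (cmod (of_real d * y k - t k))\<^sup>2" if "d \<in> {r1, r2, r3}" for d k
    using D[of d k] that by auto
  have p: "of_real d * E - a k \<noteq> 0" if "d \<in> {r1, r2, r3}" for d k
  proof
    assume "of_real d * E - a k = 0"
    then have "Re (of_real d * E - a k) = 0"
      by simp
    then have "d = z0"
      using x by (simp add: E_def a_def)
    moreover have "x\<^sup>2 * (d - 0) * (d - z0)\<^sup>2 + (e\<^sup>2 * d^3 + (- j1) * d\<^sup>2 + j2 * d + (- j3)) = 0"
      unfolding F using that by auto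
    ultimately show False
      using z0 by simp
  qed
  \<comment> \<open>A root satisfies an equation of the form d times a positive square equals a
    square.\<close>
  have "d \<ge> 0" if "d \<in> {r1, r2, r3}" for d
  proof -
    have "0 \<le> d * (cmod (of_real d * E - a 0))\<^sup>2"
      unfolding rt[OF that] by simp
    moreover have "(cmod (of_real d * E - a 0))\<^sup>2 > 0"
      using p[OF that] by simp
    ultimately show ?thesis
      by (simp add: zero_le_mult_iff)
  qed
  then have r0: "r1 \<ge> 0" "r2 > 0" "r3 > 0"
    using r by force+
  interpret I: intertwiner \<eta> z E y a u
  proof unfold_locales
    show "E \<noteq> 0"
      by (rule E)
    show "y (k + 1) + E * u k = y k + u k * cnj E" for k
      unfolding y_step E by (simp add: algebra_simps)
    show "a (k + 1) - y (k + 1) * cnj (u k) = a k - u k * cnj (y k)" for k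
      using Y_refl[of k] unfolding a by (simp add: algebra_simps)
  qed
  obtain g where zg: "eback \<eta> z g" and ng: "\<And>k. (cmod (g k - z k))\<^sup>2 = r3"
    and I2: "intertwiner \<eta> g E (\<lambda>k. y k - E * (g k - z k)) (\<lambda>k. a k + (y k - E * (g k - z k)) * cnj (g k - z k)) u"
    and l3: "\<And>k. (a (k + 1) + (y (k + 1) - E * (g (k + 1) - z (k + 1))) * cnj (g (k + 1) - z (k + 1))) * (g (k + 1) - g k)
      = u k * cnj (a k + (y k - E * (g k - z k)) * cnj (g k - z k))"
    and t: "\<And>k. t k = (a k + (y k - E * (g k - z k)) * cnj (g k - z k)) * (g k - z k)"
  proof (rule I.cubic_step[OF _ t_refl r0(3) rn(3)])
    show "t (k + 1) + a (k + 1) * u k = t k + u k * cnj (a k)" for k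
      unfolding t_step a by (simp add: algebra_simps)
    show "r3 * (cmod (of_real r3 * E - a k))\<^sup>2 = (cmod (of_real r3 * y k - t k))\<^sup>2" "of_real r3 * E - a k \<noteq> 0" for k
      using rt p by simp_all
  qed (rule that)
  define v where "v k = g k - z k" for k
  define Y where "Y k = y k - E * v k" for k
  define b where "b k = a k + Y k * cnj (v k)" for k
  note fold = v_def[symmetric] Y_def[symmetric] b_def[symmetric]
  interpret I2: intertwiner \<eta> g E Y b u
    using I2 unfolding fold .
  have t: "t k = b k * v k" for k
    using t[of k] unfolding fold .
  have vv: "v k * cnj (v k) = of_real r3" for k
    using ng[of k] unfolding fold mult_cnj by simp
  \<comment> \<open>Splitting off the first factor divides the determinant by \<open>d - r3\<close>,
    so the other two roots are roots of the quotient.\<close>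
  have root2: "d * (cmod (Y k))\<^sup>2 = (cmod (of_real d * E - b k))\<^sup>2" if "d \<in> {r1, r2}" for d k
  proof -
    define A where "A = of_real d * E - b k"
    have A: "of_real d * E - a k = A + Y k * cnj (v k)" "of_real d * y k - t k = of_real d * Y k + A * v k"
      by (simp_all add: A_def b_def Y_def t algebra_simps)
    have "of_real d * ((A + Y k * cnj (v k)) * cnj (A + Y k * cnj (v k))) - (of_real d * Y k + A * v k) * cnj (of_real d * Y k + A * v k)
        = of_real d * (A * cnj A) + of_real d * (Y k * cnj (Y k)) * (v k * cnj (v k)) - of_real d ^ 2 * (Y k * cnj (Y k)) - A * cnj A * (v k * cnj (v k))"
      by (simp add: algebra_simps power2_eq_square)
    also have "\<dots> = of_real ((d - r3) * ((cmod A)\<^sup>2 - d * (cmod (Y k))\<^sup>2))"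
      unfolding vv unfolding mult_cnj by (simp add: algebra_simps power2_eq_square)
    finally have "of_real (d * (cmod (of_real d * E - a k))\<^sup>2 - (cmod (of_real d * y k - t k))\<^sup>2)
        = (of_real ((d - r3) * ((cmod A)\<^sup>2 - d * (cmod (Y k))\<^sup>2)) :: complex)"
      unfolding A mult_cnj by simp
    then have "d * (cmod (of_real d * E - a k))\<^sup>2 - (cmod (of_real d * y k - t k))\<^sup>2 = (d - r3) * ((cmod A)\<^sup>2 - d * (cmod (Y k))\<^sup>2)"
      by (simp only: of_real_eq_iff)
    moreover have "d * (cmod (of_real d * E - a k))\<^sup>2 - (cmod (of_real d * y k - t k))\<^sup>2 = 0"
      unfolding D using that by auto
    ultimately show ?thesis
      using that r by (auto simp: A_def)
  qed
  obtain m h where gm: "eback \<eta> g m" and mh: "eback \<eta> m h" and H: "\<And>k. (h (k + 1) - h k) * E = u k * cnj E"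
    and Yh: "\<And>k. E * (h k - g k) = Y k" and bh: "\<And>k. b k = - (E * (h k - m k) * cnj (m k - g k))"
  proof (rule I2.quadratic_step[OF _ r0(2) rn(2) r0(1) rn(1)])
    fix k
    show "b (k + 1) * I2.u k = u k * cnj (b k)"
      using l3[of k] unfolding fold I2.u_def .
    show "r2 * (cmod (Y k))\<^sup>2 = (cmod (of_real r2 * E - b k))\<^sup>2"
      by (rule root2) simp
    show "Y k \<noteq> 0"
    proof
      assume "Y k = 0"
      then have "of_real r1 * E = b k" "of_real r2 * E = b k"
        using root2[of r1 k] root2[of r2 k] by simp_all
      then have "of_real r1 * E = of_real r2 * E"
        by simp
      then show False
        using E(2) r(1) by simp
    qed
    have "(cmod (b k))\<^sup>2 * r3 = j3"
      using j(3)[of k] ng[of k] unfolding t fold by (simp add: norm_mult power_mult_distrib)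
    also have "j3 = (cmod E)\<^sup>2 * (r2 * r1) * r3"
      using F[of 0] by (simp add: cE)
    finally show "(cmod (b k))\<^sup>2 = (cmod E)\<^sup>2 * (r2 * r1)"
      using r0 by simp
  qed (rule that)
  show thesis
  proof (rule that[OF E(2) _ zg gm mh H])
    show "Im E = e"
      by (simp add: E_def)
    show "E * (h k - z k) = y k" for k
      using Yh[of k] unfolding Y_def v_def by (simp add: algebra_simps)
    show "t k = - (E * (h k - m k) * cnj (m k - g k) * (g k - z k))" for k
      unfolding t bh v_def by simp
  qed
qed

end

lemma eback_steps:
  assumes "eback \<eta> z g"
  shows "(g (k + 1) - z (k + 1)) * cnj (z (k + 1) - z k) = (g (k + 1) - g k) * cnj (g k - z k)"
    and "g (k + 1) - z (k + 1) = (g (k + 1) - g k) + (g k - z k) - (z (k + 1) - z k)"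
  using eback_D(2)[OF assms, of k] by (simp_all add: ebfly_def)

section \<open>Invariant curves in the complex plane\<close>

lemma two_step_identity:
  fixes u u1 u2 v0 v1 v0' v1' :: complex
  assumes s: "v0' = u1 + v0 - u" "v1' = u2 + v1 - u1"
    and b: "v0' * cnj u = u1 * cnj v0" "v1' * cnj u1 = u2 * cnj v1"
  shows "cnj v0' * u + cnj v1' * u - cnj u2 * (v0 + v1) = v0 * cnj v1 - cnj v1' * v0'"
proof -
  have "(cnj v0' * u + cnj v1' * u - cnj u2 * (v0 + v1)) - (v0 * cnj v1 - cnj v1' * v0')
      = (cnj v0' * u - cnj u1 * v0) + (cnj v1' * u1 - cnj u2 * v1)"
    unfolding s by (simp add: algebra_simps)
  moreover have "cnj v0' * u = cnj u1 * v0" "cnj v1' * u1 = cnj u2 * v1"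
    using b[THEN arg_cong, of cnj] by simp_all
  ultimately show ?thesis
    by simp
qed

text \<open>Coefficients of the exchange relation between the transport products along the two sides of a
  strip of three butterflies.\<close>

lemma three_step_identities:
  fixes u u1 u2 u3 v0 v1 v2 v0' v1' v2' :: complex
  assumes s: "v0' = u1 + v0 - u" "v1' = u2 + v1 - u1" "v2' = u3 + v2 - u2"
    and b: "v0' * cnj u = u1 * cnj v0" "v1' * cnj u1 = u2 * cnj v1" "v2' * cnj u2 = u3 * cnj v2"
  shows "v1' * cnj v0' + v2' * (cnj v0' + cnj v1') + (v0' + v1' + v2') * cnj u
      = v1 * cnj v0 + v2 * (cnj v0 + cnj v1) + u3 * (cnj v0 + cnj v1 + cnj v2)"
    and "v2' * cnj v1' * v0' + (v1' * cnj v0' + v2' * (cnj v0' + cnj v1')) * u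
      = v2 * cnj v1 * v0 + u3 * (cnj v1 * v0 + cnj v2 * (v0 + v1))"
    and "v2' * cnj v1' * v0' * cnj u = u3 * cnj v2 * v1 * cnj v0"
proof -
  have c: "cnj v0' * u = cnj u1 * v0" "cnj v1' * u1 = cnj u2 * v1"
    using b[THEN arg_cong, of cnj] by simp_all
  have "(v1' * cnj v0' + v2' * (cnj v0' + cnj v1') + (v0' + v1' + v2') * cnj u)
      - (v1 * cnj v0 + v2 * (cnj v0 + cnj v1) + u3 * (cnj v0 + cnj v1 + cnj v2))
      = (v0' * cnj u - u1 * cnj v0) + (v1' * cnj u1 - u2 * cnj v1) + (v2' * cnj u2 - u3 * cnj v2)"
    unfolding s by (simp add: algebra_simps)
  then show "v1' * cnj v0' + v2' * (cnj v0' + cnj v1') + (v0' + v1' + v2') * cnj u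
      = v1 * cnj v0 + v2 * (cnj v0 + cnj v1) + u3 * (cnj v0 + cnj v1 + cnj v2)"
    unfolding b by simp
  have "(v2' * cnj v1' * v0' + (v1' * cnj v0' + v2' * (cnj v0' + cnj v1')) * u)
      - (v2 * cnj v1 * v0 + u3 * (cnj v1 * v0 + cnj v2 * (v0 + v1)))
      = (cnj v0' * u - cnj u1 * v0) * (v1' + v2') + (v1' * cnj u1 - u2 * cnj v1) * v0
        + v2' * (cnj v1' * u1 - cnj u2 * v1) + (v2' * cnj u2 - u3 * cnj v2) * (v0 + v1)"
    unfolding s by (simp add: algebra_simps)
  then show "v2' * cnj v1' * v0' + (v1' * cnj v0' + v2' * (cnj v0' + cnj v1')) * u
      = v2 * cnj v1 * v0 + u3 * (cnj v1 * v0 + cnj v2 * (v0 + v1))"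
    unfolding b c by simp
  have "v2' * cnj v1' * v0' * cnj u - u3 * cnj v2 * v1 * cnj v0
      = v2' * cnj v1' * (v0' * cnj u - u1 * cnj v0) + v2' * cnj v0 * (cnj v1' * u1 - cnj u2 * v1)
        + v1 * cnj v0 * (v2' * cnj u2 - u3 * cnj v2)"
    by (simp add: algebra_simps)
  then show "v2' * cnj v1' * v0' * cnj u = u3 * cnj v2 * v1 * cnj v0"
    unfolding b c by simp
qed

context ecurve_loc
begin

lemma edata_two:
  assumes bt: "eback \<eta> z g" "eback \<eta> g h" and \<epsilon>: "\<And>k. \<epsilon> * cnj (h (k + 1) - h k) = u k * cnj \<epsilon>"
  defines "a \<equiv> \<lambda>k. - (\<epsilon> * cnj (h k - z k))"
  shows "edata \<eta> z 0 (\<lambda>_. \<epsilon>) (\<lambda>k. Im (a k)) (\<lambda>k. - (\<epsilon> * cnj (h k - g k) * (g k - z k)))"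
proof unfold_locales
  fix k
  define u1 u2 v0 v1 v0' v1' where "u1 = g (k + 1) - g k" and "u2 = h (k + 1) - h k" and "v0 = g k - z k"
    and "v1 = h k - g k" and "v0' = g (k + 1) - z (k + 1)" and "v1' = h (k + 1) - g (k + 1)"
  note fold = u_def[symmetric] u1_def[symmetric] u2_def[symmetric] v0_def[symmetric] v1_def[symmetric] v0'_def[symmetric] v1'_def[symmetric]
  have s: "v0' = u1 + v0 - u k" "v1' = u2 + v1 - u1" and b: "v0' * cnj (u k) = u1 * cnj v0" "v1' * cnj u1 = u2 * cnj v1"
    using eback_steps[OF bt(1), of k] eback_steps[OF bt(2), of k] unfolding fold by auto
  have e2: "\<epsilon> * cnj u2 = u k * cnj \<epsilon>"
    using \<epsilon>[of k] unfolding fold .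
  have e2': "cnj \<epsilon> * u k = \<epsilon> * cnj u2"
    using e2 by (simp add: mult.commute)
  have a: "a k = - (\<epsilon> * (cnj v0 + cnj v1))" "a (k + 1) = - (\<epsilon> * (cnj v0' + cnj v1'))"
    by (simp_all add: a_def v0_def v1_def v0'_def v1'_def algebra_simps)
  have da: "a (k + 1) - a k = \<epsilon> * cnj (u k) - cnj (\<epsilon> * cnj (u k))"
  proof -
    have "a (k + 1) - a k = \<epsilon> * cnj (u k) - \<epsilon> * cnj u2"
      unfolding a s by (simp add: algebra_simps)
    then show ?thesis
      unfolding e2 by (simp add: mult.commute)
  qed
  have re: "Re (a (k + 1)) = Re (a k)"
    using arg_cong[OF da, of Re] by (simp del: complex_cnj_mult)
  show "\<epsilon> = \<epsilon> - 2 * \<i> * complex_of_real 0 * u k"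
    by simp
  have "Im (a (k + 1)) - Im (a k) = 2 * Im (\<epsilon> * cnj (u k))"
    using arg_cong[OF da, of Im] by (simp del: complex_cnj_mult)
  then show "Im (a (k + 1)) - Im (a k) = Im ((\<epsilon> + \<epsilon>) * cnj (u k))"
    unfolding distrib_right plus_complex.sel by simp
  \<comment> \<open>The real part of \<open>a\<close> is constant, so the sum of imaginary parts in
    \<open>t_step\<close> can be replaced by this difference.\<close>
  have ia: "\<i> * (Im (a k) + Im (a (k + 1))) = a (k + 1) - cnj (a k)"
    using re by (simp add: complex_eq_iff)
  have "(a (k + 1) - cnj (a k)) * u k = - (\<epsilon> * (cnj v0' * u k + cnj v1' * u k)) + (cnj \<epsilon> * u k) * (v0 + v1)"
    unfolding a by (simp add: algebra_simps)
  also have "\<dots> = - (\<epsilon> * (cnj v0' * u k + cnj v1' * u k - cnj u2 * (v0 + v1)))"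
    unfolding e2' by (simp add: algebra_simps)
  also have "\<dots> = - (\<epsilon> * (v0 * cnj v1 - cnj v1' * v0'))"
    unfolding two_step_identity[OF s b] ..
  finally have "- (\<epsilon> * cnj v1' * v0') = - (\<epsilon> * cnj v1 * v0) - (a (k + 1) - cnj (a k)) * u k"
    by (simp add: algebra_simps)
  then show "- (\<epsilon> * cnj (h (k + 1) - g (k + 1)) * (g (k + 1) - z (k + 1)))
      = - (\<epsilon> * cnj (h k - g k) * (g k - z k)) - \<i> * complex_of_real (Im (a k) + Im (a (k + 1))) * u k"
    unfolding fold ia .
  have "cnj v1' * u1 = cnj u2 * v1"
    using arg_cong[OF b(2), of cnj] by simp
  then have "cnj v1' * (v0' * cnj (u k)) = cnj u2 * v1 * cnj v0"
    unfolding b(1) by (simp add: mult.assoc[symmetric])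
  then have "\<epsilon> * (cnj v1' * (v0' * cnj (u k))) = (u k * cnj \<epsilon>) * v1 * cnj v0"
    unfolding e2[symmetric] by simp
  then show "- (\<epsilon> * cnj (h (k + 1) - g (k + 1)) * (g (k + 1) - z (k + 1))) * cnj (u k)
      = u k * cnj (- (\<epsilon> * cnj (h k - g k) * (g k - z k)))"
    unfolding fold by (simp add: mult_ac)
qed

lemma edata_three:
  assumes bt: "eback \<eta> z g" "eback \<eta> g m" "eback \<eta> m h" and E: "\<And>k. (h (k + 1) - h k) * E = u k * cnj E"
  defines "a \<equiv> \<lambda>k. - (E * ((m k - g k) * cnj (g k - z k) + (h k - m k) * cnj (m k - z k)))"
  shows "edata \<eta> z (Im E) (\<lambda>k. E * (h k - z k)) (\<lambda>k. Im (a k)) (\<lambda>k. - (E * (h k - m k) * cnj (m k - g k) * (g k - z k)))"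
proof unfold_locales
  fix k
  define u1 u2 u3 v0 v1 v2 v0' v1' v2' where "u1 = g (k + 1) - g k" and "u2 = m (k + 1) - m k" and "u3 = h (k + 1) - h k"
    and "v0 = g k - z k" and "v1 = m k - g k" and "v2 = h k - m k"
    and "v0' = g (k + 1) - z (k + 1)" and "v1' = m (k + 1) - g (k + 1)" and "v2' = h (k + 1) - m (k + 1)"
  note fold = u_def[symmetric] u1_def[symmetric] u2_def[symmetric] u3_def[symmetric] v0_def[symmetric] v1_def[symmetric]
    v2_def[symmetric] v0'_def[symmetric] v1'_def[symmetric] v2'_def[symmetric]
  have s: "v0' = u1 + v0 - u k" "v1' = u2 + v1 - u1" "v2' = u3 + v2 - u2"
    and b: "v0' * cnj (u k) = u1 * cnj v0" "v1' * cnj u1 = u2 * cnj v1" "v2' * cnj u2 = u3 * cnj v2"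
    using eback_steps[OF bt(1), of k] eback_steps[OF bt(2), of k] eback_steps[OF bt(3), of k] unfolding fold by auto
  note id = three_step_identities[OF s b]
  have e3: "u k * cnj E = E * u3"
    using E[of k] unfolding fold by (simp add: mult.commute)
  define X X' where "X = v1 * cnj v0 + v2 * (cnj v0 + cnj v1)" and "X' = v1' * cnj v0' + v2' * (cnj v0' + cnj v1')"
  have a: "a k = - (E * X)" "a (k + 1) = - (E * X')"
    by (simp_all add: a_def X_def X'_def v0_def v1_def v2_def v0'_def v1'_def v2'_def)
  have y: "E * (h k - z k) = E * (v0 + v1 + v2)" "E * (h (k + 1) - z (k + 1)) = E * (v0' + v1' + v2')"
    by (simp_all add: v0_def v1_def v2_def v0'_def v1'_def v2'_def)
  define y0 y1 where "y0 = E * (v0 + v1 + v2)" and "y1 = E * (v0' + v1' + v2')"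
  have yd: "y1 = y0 - 2 * \<i> * Im E * u k"
  proof -
    have "y1 = y0 + E * u3 - E * u k"
      unfolding y0_def y1_def s by (simp add: algebra_simps)
    also have "\<dots> = y0 - (E - cnj E) * u k"
      unfolding e3[symmetric] by (simp add: algebra_simps)
    also have "E - cnj E = 2 * \<i> * Im E"
      by (simp add: complex_eq_iff mult.assoc)
    finally show ?thesis .
  qed
  then show "E * (h (k + 1) - z (k + 1)) = E * (h k - z k) - 2 * \<i> * complex_of_real (Im E) * u k"
    unfolding y y0_def y1_def .
  have da: "a (k + 1) - a k = y1 * cnj (u k) - cnj (y0 * cnj (u k))"
  proof -
    have "E * (X' + (v0' + v1' + v2') * cnj (u k)) = E * (X + u3 * (cnj v0 + cnj v1 + cnj v2))"
      unfolding X_def X'_def id(1) ..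
    then have "E * X' + y1 * cnj (u k) = E * X + (u k * cnj E) * (cnj v0 + cnj v1 + cnj v2)"
      unfolding e3 y1_def by (simp add: algebra_simps)
    moreover have "(u k * cnj E) * (cnj v0 + cnj v1 + cnj v2) = cnj (y0 * cnj (u k))"
      by (simp add: y0_def mult_ac)
    ultimately show ?thesis
      unfolding a by (simp add: algebra_simps)
  qed
  have "y1 * cnj (u k) = y0 * cnj (u k) - 2 * \<i> * Im E * (u k * cnj (u k))"
    unfolding yd by (simp add: algebra_simps)
  then have ry: "Re (y1 * cnj (u k)) = Re (y0 * cnj (u k))"
    unfolding uu by (simp add: mult.assoc)
  have re: "Re (a (k + 1)) = Re (a k)"
    using arg_cong[OF da, of Re] ry by (simp del: complex_cnj_mult)
  have "Im (a (k + 1)) - Im (a k) = Im (y1 * cnj (u k)) + Im (y0 * cnj (u k))"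
    using arg_cong[OF da, of Im] by (simp del: complex_cnj_mult)
  then show "Im (a (k + 1)) - Im (a k) = Im ((E * (h (k + 1) - z (k + 1)) + E * (h k - z k)) * cnj (u k))"
    unfolding y y0_def y1_def by (simp only: distrib_right[of _ _ "cnj (u k)"] plus_complex.sel)
  have ia: "\<i> * (Im (a k) + Im (a (k + 1))) = a (k + 1) - cnj (a k)"
    using re by (simp add: complex_eq_iff)
  have "E * (v2' * cnj v1' * v0' + X' * u k) = E * (v2 * cnj v1 * v0 + u3 * (cnj v1 * v0 + cnj v2 * (v0 + v1)))"
    unfolding X'_def id(2) ..
  then have "E * v2' * cnj v1' * v0' + E * X' * u k = E * v2 * cnj v1 * v0 + E * u3 * (cnj v1 * v0 + cnj v2 * (v0 + v1))"
    by (simp only: distrib_left[of E] mult.assoc)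
  moreover have "cnj (a k) * u k = - (E * u3 * (cnj v1 * v0 + cnj v2 * (v0 + v1)))"
    unfolding a e3[symmetric] X_def by (simp add: algebra_simps)
  moreover have "- p = - q - (- d - c)" if "p + d = q + r" "c = - r" for p q r d c :: complex
    using that by algebra
  ultimately have "- (E * v2' * cnj v1' * v0') = - (E * v2 * cnj v1 * v0) - (- (E * X' * u k) - cnj (a k) * u k)"
    by blast
  then have "- (E * v2' * cnj v1' * v0') = - (E * v2 * cnj v1 * v0) - (a (k + 1) - cnj (a k)) * u k"
    unfolding a(2) by (simp only: left_diff_distrib mult_minus_left)
  then show "- (E * (h (k + 1) - m (k + 1)) * cnj (m (k + 1) - g (k + 1)) * (g (k + 1) - z (k + 1)))
      = - (E * (h k - m k) * cnj (m k - g k) * (g k - z k))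
        - \<i> * complex_of_real (Im (a k) + Im (a (k + 1))) * u k"
    unfolding fold ia .
  have "E * (v2' * cnj v1' * v0' * cnj (u k)) = (u k * cnj E) * cnj v2 * v1 * cnj v0"
    unfolding id(3) e3 by (simp add: mult_ac)
  then show "- (E * (h (k + 1) - m (k + 1)) * cnj (m (k + 1) - g (k + 1)) * (g (k + 1) - z (k + 1))) * cnj (u k)
      = u k * cnj (- (E * (h k - m k) * cnj (m k - g k) * (g k - z k)))"
    unfolding fold by (simp add: mult_ac)
qed

lemma two_iff:
  "(\<exists>\<epsilon> g h. \<epsilon> \<noteq> 0 \<and> eback \<eta> z g \<and> eback \<eta> g h \<and> (\<forall>k. \<epsilon> * cnj (h (k + 1) - h k) = u k * cnj \<epsilon>))
    \<longleftrightarrow> (\<exists>\<xi>. \<forall>k. (1 + (sg k)\<^sup>2) * (sg (k + 1) + sg (k - 1)) = \<xi> * sg k) \<and> \<not> (\<exists>s. s \<noteq> 0 \<and> (\<forall>k. sg k = s))"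
    (is "?L \<longleftrightarrow> ?R")
proof
  assume ?L
  then obtain \<epsilon> g h where "\<epsilon> \<noteq> 0" "eback \<eta> z g" "eback \<eta> g h" "\<And>k. \<epsilon> * cnj (h (k + 1) - h k) = u k * cnj \<epsilon>"
    by blast
  then obtain \<alpha> t where "edata \<eta> z 0 (\<lambda>_. \<epsilon>) \<alpha> t"
    using edata_two by blast
  then interpret edata \<eta> z 0 "\<lambda>_. \<epsilon>" \<alpha> t .
  show ?R
  proof (cases "w 0 = 0")
    case True
    then have "sg k = 0" for k
      using sg_const_of_w(2)[OF True] \<open>\<epsilon> \<noteq> 0\<close> by blast
    then show ?thesis
      by simp
  next
    case False
    obtain \<xi> \<delta> where "\<And>k. (1 + (sg k)\<^sup>2) * (sg (k + 1) + sg (k - 1)) = \<xi> * sg k + \<delta>" "\<delta> = 0"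
      using elastic_of_w[OF False] by metis
    moreover have "\<not> (\<exists>s. s \<noteq> 0 \<and> (\<forall>k. sg k = s))"
      using circle_degenerate[OF _ False] \<open>\<epsilon> \<noteq> 0\<close> by blast
    ultimately show ?thesis
      by auto
  qed
next
  assume R: ?R
  then obtain \<xi>' where \<xi>': "\<And>k. (1 + (sg k)\<^sup>2) * (sg (k + 1) + sg (k - 1)) = \<xi>' * sg k"
    by blast
  \<comment> \<open>On a straight line any \<xi> is allowed, and a value different from 2 keeps
    \<open>y\<close> from vanishing.\<close>
  define \<xi> where "\<xi> = (if \<forall>k. sg k = 0 then 3 else \<xi>')"
  have \<xi>: "(1 + (sg k)\<^sup>2) * (sg (k + 1) + sg (k - 1)) = \<xi> * sg k + 0" for k
    using \<xi>'[of k] by (auto simp: \<xi>_def)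
  obtain e y \<alpha> t where d: "edata \<eta> z e y \<alpha> t" and "e = 0"
    and y: "\<forall>k. y k = 0 \<Longrightarrow> (\<forall>k. sg k = sg 0) \<and> (sg 0 = 0 \<longrightarrow> \<xi> = 2)"
    using elastic_data[OF \<xi>] by metis
  interpret edata \<eta> z e y \<alpha> t
    by (rule d)
  have "y k = y 0" for k
    by (rule const_int[where x = y]) (simp add: y_step \<open>e = 0\<close>)
  moreover have "\<not> (\<forall>k. y k = 0)"
  proof
    assume "\<forall>k. y k = 0"
    then have *: "\<forall>k. sg k = sg 0" "sg 0 = 0 \<longrightarrow> \<xi> = 2"
      using y by blast+
    then have "sg 0 = 0"
      using R by blast
    then show False
      using * by (auto simp: \<xi>_def)
  qed
  ultimately have "y 0 \<noteq> 0"
    by metis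
  then show ?L
    using exists_two[OF \<open>e = 0\<close>] by metis
qed

lemma three_iff:
  "(\<exists>E g m h. E \<noteq> 0 \<and> eback \<eta> z g \<and> eback \<eta> g m \<and> eback \<eta> m h \<and> (\<forall>k. (h (k + 1) - h k) * E = u k * cnj E)
      \<and> (\<forall>k. Im E \<noteq> 0 \<or> E * (h k - z k) \<noteq> 0
        \<or> Im (- (E * ((m k - g k) * cnj (g k - z k) + (h k - m k) * cnj (m k - z k)))) \<noteq> 0
        \<or> - (E * (h k - m k) * cnj (m k - g k) * (g k - z k)) \<noteq> 0))
    \<longleftrightarrow> (\<exists>\<xi> \<delta>. \<forall>k. (1 + (sg k)\<^sup>2) * (sg (k + 1) + sg (k - 1)) = \<xi> * sg k + \<delta>)"
    (is "?L \<longleftrightarrow> ?R")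
proof
  assume ?L
  then obtain E g m h where bt: "eback \<eta> z g" "eback \<eta> g m" "eback \<eta> m h" and E: "\<And>k. (h (k + 1) - h k) * E = u k * cnj E"
    and ne: "Im E \<noteq> 0 \<or> E * (h 0 - z 0) \<noteq> 0 \<or> Im (- (E * ((m 0 - g 0) * cnj (g 0 - z 0) + (h 0 - m 0) * cnj (m 0 - z 0)))) \<noteq> 0
        \<or> - (E * (h 0 - m 0) * cnj (m 0 - g 0) * (g 0 - z 0)) \<noteq> 0"
    by blast
  interpret edata \<eta> z "Im E" "\<lambda>k. E * (h k - z k)" "\<lambda>k. Im (- (E * ((m k - g k) * cnj (g k - z k) + (h k - m k) * cnj (m k - z k))))"
    "\<lambda>k. - (E * (h k - m k) * cnj (m k - g k) * (g k - z k))"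
    by (rule edata_three[OF bt E])
  show ?R
  proof (cases "w 0 = 0")
    case True
    then have "sg k = sg 0" for k
      by (rule sg_const_of_w(1)) (rule ne)
    then have "(1 + (sg k)\<^sup>2) * (sg (k + 1) + sg (k - 1)) = (2 * (1 + (sg 0)\<^sup>2)) * sg k + 0" for k
      by (metis (no_types, opaque_lifting) add.right_neutral distrib_left mult.assoc mult.commute mult_2)
    then show ?thesis
      by blast
  next
    case False
    then show ?thesis
      using elastic_of_w by metis
  qed
next
  assume ?R
  then obtain \<xi> \<delta> where "\<And>k. (1 + (sg k)\<^sup>2) * (sg (k + 1) + sg (k - 1)) = \<xi> * sg k + \<delta>"
    by blast
  then obtain e y \<alpha> t where d: "edata \<eta> z e y \<alpha> t" and W: "\<And>k. edata.W \<eta> y t k \<noteq> 0"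
    using elastic_data by metis
  interpret edata \<eta> z e y \<alpha> t
    by (rule d)
  obtain E g m h where E: "E \<noteq> 0" "Im E = e" "eback \<eta> z g" "eback \<eta> g m" "eback \<eta> m h"
    "\<And>k. (h (k + 1) - h k) * E = u k * cnj E" "\<And>k. E * (h k - z k) = y k"
    "\<And>k. t k = - (E * (h k - m k) * cnj (m k - g k) * (g k - z k))"
  proof (rule exists_three[OF W])
  qed (rule that)
  have "E * (h k - z k) \<noteq> 0 \<or> - (E * (h k - m k) * cnj (m k - g k) * (g k - z k)) \<noteq> 0" for k
    using W[of k] unfolding W_def E(7) E(8)[symmetric] by auto
  then show ?L
    using E(1,3-6) by blast
qed

end

section \<open>The Euclidean plane\<close>

text \<open>Antidiagonal matrices, which contain the points and transports of the plane;
  \<open>ev\<close> gives the diagonal ones, which induce the rotations.\<close>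

definition od :: "complex \<Rightarrow> plus gq" where
  "od z = GQ 0 z"

definition ev :: "complex \<Rightarrow> plus gq" where
  "ev z = GQ z 0"

lemma eps_plus [simp]: "eps TYPE(plus) = 1" "eps (x :: plus itself) = 1"
  by (simp_all add: eps_plus_def)

lemma od_ev_simps:
  "od z * od w = ev (- (z * cnj w))" "ev a * od z = od (a * z)" "od z * ev a = od (z * cnj a)" "ev a * ev b = ev (a * b)"
  "od z + od w = od (z + w)" "od z - od w = od (z - w)" "- od z = od (- z)" "r *\<^sub>R od z = od (of_real r * z)"
  "ev a + ev b = ev (a + b)" "- ev a = ev (- a)" "r *\<^sub>R ev a = ev (of_real r * a)" "star (od z) = - od z" "star (ev a) = ev (cnj a)"
  by (auto intro!: gq_eqI simp: od_def ev_def)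

lemma od_ev_inj [simp]: "od z = od w \<longleftrightarrow> z = w" "ev z = ev w \<longleftrightarrow> z = w" "od z = 0 \<longleftrightarrow> z = 0" "ev z = 0 \<longleftrightarrow> z = 0"
  by (simp_all add: od_def ev_def zero_gq_def)

lemma sc_od_ev [simp]: "sc (od z) = 0" "sc (ev z) = Re z"
  by (simp_all add: sc_def od_def ev_def)

lemma dot_od [simp]: "dot (od z) (od w) = Re (z * cnj w)" "nrm (ev z) = (cmod z)\<^sup>2"
  by (simp_all add: dot_def sc_def od_def ev_def times_complex.sel cmod_power2) (simp add: power2_eq_square)

definition ept :: "complex \<Rightarrow> cmat" where
  "ept z = emb (od z)"

lemma ept_simps:
  "ept z + ept w = ept (z + w)" "ept z - ept w = ept (z - w)" "r *\<^sub>R ept z = ept (of_real r * z)"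
  by (simp_all add: ept_def emb_simps(3,4,6)[symmetric] od_ev_simps)

lemma ept_inj [simp]: "ept z = ept w \<longleftrightarrow> z = w" "ept z = 0 \<longleftrightarrow> z = 0"
  by (simp_all add: ept_def)

lemma rdot_ept [simp]: "rdot (ept z) (ept w) = Re (z * cnj w)"
  by (simp add: ept_def)

lemma rdot_ept_self: "rdot (ept z) (ept z) = (cmod z)\<^sup>2"
  by (simp add: mult_cnj del: of_real_power)

lemma span_ij: "span {qi, qj} = range ept"
proof -
  have "{x :: plus gq. gq1 x = 0} = range od"
  proof (intro equalityI subsetI)
    fix x :: "plus gq" assume "x \<in> {x. gq1 x = 0}"
    then have "x = od (gq2 x)"
      by (auto intro: gq_eqI simp: od_def)
    then show "x \<in> range od"
      by blast
  qed (auto simp: od_def)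
  then show ?thesis
    using cmat_spans(2)[where 's = plus] by (simp add: image_image ept_def)
qed

lemma span_1k: "span {q1, qk} = range (\<lambda>c. emb (ev c))"
proof -
  have "{x :: plus gq. gq2 x = 0} = range ev"
  proof (intro equalityI subsetI)
    fix x :: "plus gq" assume "x \<in> {x. gq2 x = 0}"
    then have "x = ev (gq1 x)"
      by (auto intro: gq_eqI simp: ev_def)
    then show "x \<in> range ev"
      by blast
  qed (auto simp: ev_def)
  then show ?thesis
    using cmat_spans(1)[where 's = plus] by (simp add: image_image)
qed

lemma transport_E2 [simp]: "transport E2 F G = G - F"
  by (simp add: transport_def)

lemma curves_E2: "(\<lambda>k. ept (z k)) \<in> curves E2 \<longleftrightarrow> (\<exists>\<eta>. ecurve \<eta> z)"
proof
  assume f: "(\<lambda>k. ept (z k)) \<in> curves E2"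
  then obtain \<eta> where "\<And>k. mdist E2 (ept (z k)) (ept (z (k + 1))) = \<eta>"
    by (auto simp: curves_def)
  then have \<eta>: "cmod (z (k + 1) - z k) = \<eta>" for k
    by (simp add: ept_simps rdot_ept_self del: rdot_ept)
  have d: "distinct [z (k - 1), z k, z (k + 1)]" for k
    using f by (auto simp: curves_def)
  then have "\<eta> > 0"
    using \<eta>[of 0] d[of 0] by auto
  moreover have "z (k + 1) \<noteq> z (k - 1)" for k
    using d[of k] by auto
  ultimately have "ecurve \<eta> z"
    using \<eta> by (simp add: ecurve_def)
  then show "\<exists>\<eta>. ecurve \<eta> z" ..
next
  assume "\<exists>\<eta>. ecurve \<eta> z"
  then obtain \<eta> where c: "\<eta> > 0" "\<And>k. cmod (z (k + 1) - z k) = \<eta>" "\<And>k. z (k + 1) \<noteq> z (k - 1)"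
    by (auto simp: ecurve_def)
  then have "z (k + 1) \<noteq> z k" for k
    by (metis less_irrefl norm_zero right_minus_eq)
  from this this[of "k - 1" for k] have "distinct [z (k - 1), z k, z (k + 1)]" for k
    using c(3)[of k] by (auto dest: sym)
  then show "(\<lambda>k. ept (z k)) \<in> curves E2"
    using c(2) by (auto simp: curves_def ept_simps rdot_ept_self span_ij simp del: rdot_ept)
qed

lemma curves_E2D: "f \<in> curves E2 \<Longrightarrow> \<exists>z. f = (\<lambda>k. ept (z k)) \<and> (\<exists>\<eta>. ecurve \<eta> z)"
proof -
  assume f: "f \<in> curves E2"
  then have "\<forall>k. \<exists>z. f k = ept z"
    by (auto simp: curves_def span_ij)
  then obtain z where "f = (\<lambda>k. ept (z k))"
    by metis
  then show ?thesis
    using f curves_E2 by blast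
qed

text \<open>The reflection in the line through \<open>p\<close> with normal \<open>n\<close>, in
  complex form and freed of its denominator.\<close>

lemma reflection_ept:
  assumes "n \<noteq> 0"
  shows "ept x - (2 * rdot (ept x - ept p) (ept n) / rdot (ept n) (ept n)) *\<^sub>R ept n = ept y
    \<longleftrightarrow> (y - p) * cnj n = - (cnj (x - p) * n)"
proof -
  define r where "r = 2 * Re ((x - p) * cnj n) / (cmod n)\<^sup>2"
  have "of_real (2 * Re ((x - p) * cnj n)) = (x - p) * cnj n + cnj ((x - p) * cnj n)"
    by (rule complex_add_cnj[symmetric])
  then have r: "of_real r * (n * cnj n) = (x - p) * cnj n + cnj (x - p) * n"
    using assms unfolding mult_cnj of_real_mult[symmetric] r_def by simp
  have "ept x - (2 * rdot (ept x - ept p) (ept n) / rdot (ept n) (ept n)) *\<^sub>R ept n = ept (x - of_real r * n)"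
    unfolding rdot_ept_self ept_simps rdot_ept r_def ..
  also have "\<dots> = ept y \<longleftrightarrow> (x - of_real r * n) * cnj n = y * cnj n"
    using assms by simp
  also have "(x - of_real r * n) * cnj n = p * cnj n - cnj (x - p) * n"
    using r by (simp add: algebra_simps)
  finally show ?thesis
    by (auto simp: algebra_simps)
qed

lemma butterfly_E2: "butterfly E2 (ept a) (ept b) (ept c) (ept d) \<longleftrightarrow> a \<noteq> c \<and> b \<noteq> d \<and> ebfly a b c d"
proof -
  have "reflections E2 = {\<lambda>F. F - (2 * rdot (F - ept p) (ept n) / rdot (ept n) (ept n)) *\<^sub>R ept n | p n. n \<noteq> 0}"
  proof (intro equalityI subsetI)
    fix \<rho> assume "\<rho> \<in> reflections E2"
    then obtain P N where PN: "\<rho> = (\<lambda>F. F - (2 * rdot (F - P) N / rdot N N) *\<^sub>R N)" "P \<in> range ept" "N \<in> range ept" "N \<noteq> 0"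
      unfolding reflections.simps span_ij by blast
    then obtain p n where pn: "P = ept p" "N = ept n"
      by blast
    then have "n \<noteq> 0"
      using PN(4) by simp
    then show "\<rho> \<in> {\<lambda>F. F - (2 * rdot (F - ept p) (ept n) / rdot (ept n) (ept n)) *\<^sub>R ept n | p n. n \<noteq> 0}"
      unfolding PN(1) pn by blast
  next
    fix \<rho> assume "\<rho> \<in> {\<lambda>F. F - (2 * rdot (F - ept p) (ept n) / rdot (ept n) (ept n)) *\<^sub>R ept n | p n. n \<noteq> 0}"
    then obtain p n where pn: "\<rho> = (\<lambda>F. F - (2 * rdot (F - ept p) (ept n) / rdot (ept n) (ept n)) *\<^sub>R ept n)" "n \<noteq> 0"
      by blast
    then have "ept n \<noteq> 0"
      by simp
    then show "\<rho> \<in> reflections E2"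
      unfolding reflections.simps span_ij pn(1) by blast
  qed
  then have "(\<exists>\<rho> \<in> reflections E2. \<rho> (ept a) = ept c \<and> \<rho> (ept c) = ept a \<and> \<rho> (ept b) = ept d \<and> \<rho> (ept d) = ept b)
    \<longleftrightarrow> (\<exists>p n. n \<noteq> 0 \<and> ept a - (2 * rdot (ept a - ept p) (ept n) / rdot (ept n) (ept n)) *\<^sub>R ept n = ept c
      \<and> ept c - (2 * rdot (ept c - ept p) (ept n) / rdot (ept n) (ept n)) *\<^sub>R ept n = ept a
      \<and> ept b - (2 * rdot (ept b - ept p) (ept n) / rdot (ept n) (ept n)) *\<^sub>R ept n = ept d
      \<and> ept d - (2 * rdot (ept d - ept p) (ept n) / rdot (ept n) (ept n)) *\<^sub>R ept n = ept b)"
    by (simp only: bex_simps mem_Collect_eq) blast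
  also have "\<dots> \<longleftrightarrow> (\<exists>p n. n \<noteq> 0 \<and> (c - p) * cnj n = - (cnj (a - p) * n) \<and> (a - p) * cnj n = - (cnj (c - p) * n)
      \<and> (d - p) * cnj n = - (cnj (b - p) * n) \<and> (b - p) * cnj n = - (cnj (d - p) * n))"
    by (intro ex_cong1 conj_cong reflection_ept refl)
  finally have refl: "(\<exists>\<rho> \<in> reflections E2. \<rho> (ept a) = ept c \<and> \<rho> (ept c) = ept a \<and> \<rho> (ept b) = ept d \<and> \<rho> (ept d) = ept b)
    \<longleftrightarrow> (\<exists>p n. n \<noteq> 0 \<and> (c - p) * cnj n = - (cnj (a - p) * n) \<and> (a - p) * cnj n = - (cnj (c - p) * n)
      \<and> (d - p) * cnj n = - (cnj (b - p) * n) \<and> (b - p) * cnj n = - (cnj (d - p) * n))" .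
  show ?thesis
  proof (cases "a \<noteq> c \<and> b \<noteq> d")
    case True
    have "(\<exists>p n. n \<noteq> 0 \<and> (c - p) * cnj n = - (cnj (a - p) * n) \<and> (a - p) * cnj n = - (cnj (c - p) * n)
      \<and> (d - p) * cnj n = - (cnj (b - p) * n) \<and> (b - p) * cnj n = - (cnj (d - p) * n)) \<longleftrightarrow> ebfly a b c d"
    proof
      assume "\<exists>p n. n \<noteq> 0 \<and> (c - p) * cnj n = - (cnj (a - p) * n) \<and> (a - p) * cnj n = - (cnj (c - p) * n)
        \<and> (d - p) * cnj n = - (cnj (b - p) * n) \<and> (b - p) * cnj n = - (cnj (d - p) * n)"
      then obtain p n where n: "n \<noteq> 0" and r: "(c - p) * cnj n = - (cnj (a - p) * n)" "(d - p) * cnj n = - (cnj (b - p) * n)"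
        "(b - p) * cnj n = - (cnj (d - p) * n)"
        by blast
      have "(c - p) * cnj n - (d - p) * cnj n = cnj (b - a) * n" "(c - p) * cnj n - (b - p) * cnj n = cnj (d - a) * n"
        unfolding r by (simp_all add: algebra_simps)
      then have 1: "(c - d) * cnj n = cnj (b - a) * n" "(c - b) * cnj n = cnj (d - a) * n"
        by (simp_all add: left_diff_distrib)
      have "((c - b) * cnj (b - a)) * (n * cnj n) = ((c - b) * cnj n) * (cnj (b - a) * n)"
        by (simp only: mult_ac)
      also have "\<dots> = ((c - d) * cnj (d - a)) * (n * cnj n)"
        unfolding 1[symmetric] unfolding 1(2) by (simp only: mult_ac)
      finally show "ebfly a b c d"
        using n by (simp add: ebfly_def)
    next
      assume e: "ebfly a b c d"
      \<comment> \<open>The axis has to be the perpendicular bisector of \<open>b\<close> and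
        \<open>d\<close>.\<close>
      define n p where "n = b - d" and "p = d + n / 2"
      have n: "n \<noteq> 0"
        using True by (simp add: n_def)
      have b: "b = d + n"
        by (simp add: n_def)
      have "(c - b) * cnj (d - b) = (d - b) * cnj (d - a)"
        using e by (simp only: ebfly_alt(1))
      then have cn: "c * cnj n = d * cnj n + n * cnj n + n * cnj d - n * cnj a"
        unfolding b by (simp add: algebra_simps)
      have 1: "(c - p) * cnj n = - (cnj (a - p) * n)"
        using cn by (simp add: p_def algebra_simps)
      have "(a - p) * cnj n = - (cnj (c - p) * n)"
        using arg_cong[OF 1, of cnj] by (simp add: algebra_simps)
      moreover have "(d - p) * cnj n = - (cnj (b - p) * n)" "(b - p) * cnj n = - (cnj (d - p) * n)"
        unfolding b p_def by (simp_all add: algebra_simps)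
      ultimately show "\<exists>p n. n \<noteq> 0 \<and> (c - p) * cnj n = - (cnj (a - p) * n) \<and> (a - p) * cnj n = - (cnj (c - p) * n)
        \<and> (d - p) * cnj n = - (cnj (b - p) * n) \<and> (b - p) * cnj n = - (cnj (d - p) * n)"
        using n 1 by blast
    qed
    then show ?thesis
      using True unfolding butterfly_def refl by (simp add: span_ij)
  qed (auto simp: butterfly_def)
qed

lemma baecklund_E2: "baecklund E2 (\<lambda>k. ept (z k)) (\<lambda>k. ept (y k)) \<longleftrightarrow> (\<exists>\<eta>. eback \<eta> z y)"
proof
  assume b: "baecklund E2 (\<lambda>k. ept (z k)) (\<lambda>k. ept (y k))"
  then obtain \<eta> where c: "ecurve \<eta> z"
    by (auto simp: baecklund_def curves_E2)
  have bf: "z k \<noteq> y (k + 1)" "z (k + 1) \<noteq> y k" "ebfly (z k) (z (k + 1)) (y (k + 1)) (y k)" for k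
    using b by (auto simp: baecklund_def butterfly_E2)
  have \<rho>: "cmod (y k - z k) = cmod (y 0 - z 0)" for k
    by (rule const_int[where x = "\<lambda>k. cmod (y k - z k)"]) (rule ebfly_norm(1)[OF bf(3,2)])
  have "cmod (y 0 - z 0) \<noteq> \<eta>"
    using ebfly_distinct[OF bf(3,2), of 0] bf(1)[of 0] c by (metis ecurve_def)
  then have "eback \<eta> z y"
    unfolding eback_def using c bf(3) \<rho> by blast
  then show "\<exists>\<eta>. eback \<eta> z y" ..
next
  assume "\<exists>\<eta>. eback \<eta> z y"
  then obtain \<eta> where b: "eback \<eta> z y" ..
  show "baecklund E2 (\<lambda>k. ept (z k)) (\<lambda>k. ept (y k))"
    unfolding baecklund_def curves_E2 butterfly_E2
    using eback_D[OF b] eback_ecurve[OF b] by metis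
qed

text \<open>Conjugation by an antidiagonal matrix acts on points as complex conjugation followed by
  a rotation. The translation is invisible in the edges and is recovered as the constant difference
  \<open>T 0\<close>.\<close>

lemma represents_E2_two:
  fixes h z :: "int \<Rightarrow> complex"
  shows "(\<exists>\<phi>. represents E2 False E \<phi> \<and> (\<forall>k. ept (h k) = \<phi> (ept (z k))))
    \<longleftrightarrow> (\<exists>\<epsilon>. E = ept \<epsilon> \<and> \<epsilon> \<noteq> 0 \<and> (\<forall>k. \<epsilon> * cnj (h (k + 1) - h k) = (z (k + 1) - z k) * cnj \<epsilon>))"
    (is "?L \<longleftrightarrow> ?R")
proof -
  have conj: "matrix_inv (ept \<epsilon>) ** ept x ** ept \<epsilon> + ept T = ept (\<epsilon> * cnj x / cnj \<epsilon> + T)" if "\<epsilon> \<noteq> 0" for \<epsilon> x T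
  proof -
    have n: "Re (\<epsilon> * cnj \<epsilon>) \<noteq> 0" "of_real (Re (\<epsilon> * cnj \<epsilon>)) = \<epsilon> * cnj \<epsilon>"
      using that by (simp_all add: mult_cnj del: of_real_power)
    have "matrix_inv (ept \<epsilon>) ** ept x ** ept \<epsilon> = emb ((1 / Re (\<epsilon> * cnj \<epsilon>)) *\<^sub>R star (od \<epsilon>) * od x * od \<epsilon>)"
      unfolding ept_def using n(1) by (simp only: matrix_inv_emb dot_od emb_simps(7) not_False_eq_True)
    also have "(1 / Re (\<epsilon> * cnj \<epsilon>)) *\<^sub>R star (od \<epsilon>) * od x * od \<epsilon> = od (\<epsilon> * cnj x / cnj \<epsilon>)"
      using that by (simp only: od_ev_simps od_ev_inj) (simp add: n(2))
    finally show ?thesis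
      by (simp add: ept_simps flip: ept_def)
  qed
  show ?thesis
  proof
    assume ?L
    then obtain \<epsilon> T where E: "E = ept \<epsilon>" "\<epsilon> \<noteq> 0" and h: "\<And>k. ept (h k) = matrix_inv (ept \<epsilon>) ** ept (z k) ** ept \<epsilon> + ept T"
      by (auto simp: span_ij)
    then have h: "h k = \<epsilon> * cnj (z k) / cnj \<epsilon> + T" for k
      by (simp add: conj)
    have "\<epsilon> * cnj (h (k + 1) - h k) = (z (k + 1) - z k) * cnj \<epsilon>" for k
      using E(2) unfolding h by (simp add: field_simps)
    then show ?R
      using E by blast
  next
    assume ?R
    then obtain \<epsilon> where E: "E = ept \<epsilon>" "\<epsilon> \<noteq> 0" and h: "\<And>k. \<epsilon> * cnj (h (k + 1) - h k) = (z (k + 1) - z k) * cnj \<epsilon>"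
      by blast
    define T where "T k = h k - \<epsilon> * cnj (z k) / cnj \<epsilon>" for k
    have "T (k + 1) = T k" for k
    proof -
      have "cnj \<epsilon> * (h (k + 1) - h k) = cnj (z (k + 1) - z k) * \<epsilon>"
        using arg_cong[OF h[of k], of cnj] by simp
      then show ?thesis
        using E(2) by (simp add: T_def field_simps)
    qed
    then have T: "T k = T 0" for k
      by (rule const_int)
    have "h k = \<epsilon> * cnj (z k) / cnj \<epsilon> + T 0" for k
    proof -
      have "h k = \<epsilon> * cnj (z k) / cnj \<epsilon> + T k"
        by (simp add: T_def)
      then show ?thesis
        by (simp only: T[of k])
    qed
    then have "ept (h k) = matrix_inv (ept \<epsilon>) ** ept (z k) ** ept \<epsilon> + ept (T 0)" for k
      unfolding conj[OF E(2)] by simp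
    moreover have "represents E2 False E (\<lambda>F. matrix_inv (ept \<epsilon>) ** F ** ept \<epsilon> + ept (T 0))"
      unfolding represents.simps if_False span_ij E(1)
      by (intro conjI bexI[of _ "ept (T 0)"] rangeI refl) (simp add: E(2))
    ultimately show ?L
      by (intro exI[of _ "\<lambda>F. matrix_inv (ept \<epsilon>) ** F ** ept \<epsilon> + ept (T 0)"] conjI allI)
  qed
qed

lemma represents_E2_three:
  fixes h z :: "int \<Rightarrow> complex"
  shows "(\<exists>\<phi>. represents E2 True E \<phi> \<and> (\<forall>k. ept (h k) = \<phi> (ept (z k))))
    \<longleftrightarrow> (\<exists>c. E = emb (ev c) \<and> c \<noteq> 0 \<and> (\<forall>k. (h (k + 1) - h k) * c = (z (k + 1) - z k) * cnj c))"
    (is "?L \<longleftrightarrow> ?R")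
proof -
  have conj: "matrix_inv (emb (ev c)) ** ept x ** emb (ev c) + ept T = ept (x * cnj c / c + T)" if "c \<noteq> 0" for c x T
  proof -
    have n: "(cmod c)\<^sup>2 \<noteq> 0" "of_real ((cmod c)\<^sup>2) = c * cnj c"
      using that by (simp_all add: mult_cnj)
    have "matrix_inv (emb (ev c)) ** ept x ** emb (ev c) = emb ((1 / (cmod c)\<^sup>2) *\<^sub>R star (ev c) * od x * ev c)"
      unfolding ept_def using n(1) by (simp only: matrix_inv_emb dot_od emb_simps(7) not_False_eq_True)
    also have "(1 / (cmod c)\<^sup>2) *\<^sub>R star (ev c) * od x * ev c = od (x * cnj c / c)"
      using that by (simp only: od_ev_simps od_ev_inj of_real_divide n(2)) simp
    finally show ?thesis
      by (simp add: ept_simps flip: ept_def)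
  qed
  show ?thesis
  proof
    assume ?L
    then obtain c T where E: "E = emb (ev c)" "c \<noteq> 0" and h: "\<And>k. ept (h k) = matrix_inv (emb (ev c)) ** ept (z k) ** emb (ev c) + ept T"
      by (auto simp: span_ij span_1k)
    then have h: "h k = z k * cnj c / c + T" for k
      by (simp add: conj)
    have "(h (k + 1) - h k) * c = (z (k + 1) - z k) * cnj c" for k
      using E(2) unfolding h by (simp add: field_simps)
    then show ?R
      using E by blast
  next
    assume ?R
    then obtain c where E: "E = emb (ev c)" "c \<noteq> 0" and h: "\<And>k. (h (k + 1) - h k) * c = (z (k + 1) - z k) * cnj c"
      by blast
    define T where "T k = h k - z k * cnj c / c" for k
    have "T (k + 1) = T k" for k
      using h[of k] E(2) by (simp add: T_def field_simps)
    then have T: "T k = T 0" for k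
      by (rule const_int)
    have "h k = z k * cnj c / c + T 0" for k
    proof -
      have "h k = z k * cnj c / c + T k"
        by (simp add: T_def)
      then show ?thesis
        by (simp only: T[of k])
    qed
    then have "ept (h k) = matrix_inv (emb (ev c)) ** ept (z k) ** emb (ev c) + ept (T 0)" for k
      unfolding conj[OF E(2)] by simp
    moreover have "represents E2 True E (\<lambda>F. matrix_inv (emb (ev c)) ** F ** emb (ev c) + ept (T 0))"
      unfolding represents.simps if_True span_ij span_1k E(1)
      by (intro conjI bexI[of _ "ept (T 0)"] rangeI refl) (simp add: E(2))
    ultimately show ?L
      by (intro exI[of _ "\<lambda>F. matrix_inv (emb (ev c)) ** F ** emb (ev c) + ept (T 0)"] conjI allI)
  qed
qed

section \<open>Regularity in the Euclidean plane\<close>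

lemma trace_free_od_ev: "trace_free (emb (od y)) = emb (od y)" "trace_free (emb (ev a)) = 0 \<longleftrightarrow> Im a = 0"
  by (simp_all add: trace_free_emb) (auto simp: ev_def complex_eq_iff zero_gq_def one_gq_def scaleR_gq_def minus_gq_def)

text \<open>The matrix \<open>E\<close> itself is trace-free and nonzero, so the constant
  coefficient already suffices.\<close>

lemma regular_E2_two: "\<epsilon> \<noteq> 0 \<Longrightarrow> regular E2 (ept \<epsilon>) 2 fs"
  unfolding regular_iff pcoef_transport_product
  by (intro allI exI[of _ 0]) (simp add: trace_free_od_ev ept_def)

text \<open>Odd coefficients are trace-free matrices and count fully; of the even ones only the
  imaginary part does.\<close>

lemma regular_E2_three:
  assumes fs: "fs 0 = (\<lambda>k. ept (z k))" "fs (Suc 0) = (\<lambda>k. ept (g k))" "fs (Suc (Suc 0)) = (\<lambda>k. ept (m k))"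
      "fs (Suc (Suc (Suc 0))) = (\<lambda>k. ept (h k))"
  shows "regular E2 (emb (ev c)) 3 fs \<longleftrightarrow> (\<forall>k. Im c \<noteq> 0 \<or> c * (h k - z k) \<noteq> 0
        \<or> Im (- (c * ((m k - g k) * cnj (g k - z k) + (h k - m k) * cnj (m k - z k)))) \<noteq> 0
        \<or> - (c * (h k - m k) * cnj (m k - g k) * (g k - z k)) \<noteq> 0)"
proof -
  have "(\<exists>d. trace_free (emb (ev c) ** pcoef d (transport_product E2 fs 3 k)) \<noteq> 0) \<longleftrightarrow> (Im c \<noteq> 0 \<or> c * (h k - z k) \<noteq> 0
        \<or> Im (- (c * ((m k - g k) * cnj (g k - z k) + (h k - m k) * cnj (m k - z k)))) \<noteq> 0
        \<or> - (c * (h k - m k) * cnj (m k - g k) * (g k - z k)) \<noteq> 0)" (is "(\<exists>d. ?P d) \<longleftrightarrow> _") for k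
  proof -
    have v: "fs (Suc 0) k - fs 0 k = emb (od (g k - z k))" "fs (Suc (Suc 0)) k - fs (Suc 0) k = emb (od (m k - g k))"
        "fs (Suc (Suc (Suc 0))) k - fs (Suc (Suc 0)) k = emb (od (h k - m k))"
      by (simp_all add: fs ept_simps flip: ept_def)
    have c: "pcoef d (transport_product E2 fs 3 k) = (if d = 0 then emb (1 :: plus gq) else if d = 1 then emb (od (h k - z k))
      else if d = 2 then emb (ev (- ((m k - g k) * cnj (g k - z k) + (h k - m k) * cnj (m k - z k))))
      else if d = 3 then emb (od (- ((h k - m k) * cnj (m k - g k) * (g k - z k)))) else 0)" for d
      unfolding pcoef_transport_product transport_E2 numeral_2_eq_2[symmetric]
      by (simp only: v One_nat_def numeral_2_eq_2 emb_simps(2,3,7)[symmetric] od_ev_simps)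
         (simp add: algebra_simps emb_simps(2))
    have "?P d \<longleftrightarrow> (if d = 0 then Im c \<noteq> 0 else if d = 1 then c * (h k - z k) \<noteq> 0
      else if d = 2 then Im (- (c * ((m k - g k) * cnj (g k - z k) + (h k - m k) * cnj (m k - z k)))) \<noteq> 0
      else if d = 3 then - (c * (h k - m k) * cnj (m k - g k) * (g k - z k)) \<noteq> 0 else False)" for d
    proof -
      define X where "X = (m k - g k) * cnj (g k - z k) + (h k - m k) * cnj (m k - z k)"
      have "trace_free (0 :: cmat) = 0"
        using trace_free_od_ev(1)[of 0] by (metis emb_eq_0 od_ev_inj(3))
      then show ?thesis
        unfolding c X_def[symmetric] by (auto simp: emb_simps(7)[symmetric] od_ev_simps trace_free_od_ev mult.assoc)
    qed
    moreover have "(\<exists>d::nat. if d = 0 then A else if d = 1 then B else if d = 2 then C else if d = 3 then D else False)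
        \<longleftrightarrow> A \<or> B \<or> C \<or> D" for A B C D
    proof
      assume "A \<or> B \<or> C \<or> D"
      then show "\<exists>d::nat. if d = 0 then A else if d = 1 then B else if d = 2 then C else if d = 3 then D else False"
        by (elim disjE) (rule exI[of _ 0], simp, rule exI[of _ 1], simp, rule exI[of _ 2], simp, rule exI[of _ 3], simp)
    qed (auto split: if_splits)
    ultimately show ?thesis
      by (simp only:)
  qed
  then show ?thesis
    unfolding regular_iff by blast
qed

lemma baecklund_sequence_E2:
  assumes "baecklund_sequence E2 n fs" "fs 0 = (\<lambda>k. ept (z k))" "ecurve \<eta> z" "n > 0"
  obtains g where "fs (Suc 0) = (\<lambda>k. ept (g k))" "eback \<eta> z g" "baecklund_sequence E2 (n - 1) (\<lambda>i. fs (Suc i))"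
proof -
  have b: "baecklund E2 (fs 0) (fs (Suc 0))"
    using assms(1,4) by (simp add: baecklund_sequence_def)
  then obtain g where g: "fs (Suc 0) = (\<lambda>k. ept (g k))"
    using curves_E2D unfolding baecklund_def by blast
  then obtain \<eta>' where "eback \<eta>' z g"
    using b unfolding assms(2) g baecklund_E2 by blast
  moreover from this have "\<eta>' = \<eta>"
    using assms(3) eback_D(1) unfolding ecurve_def by metis
  moreover have "baecklund_sequence E2 (n - 1) (\<lambda>i. fs (Suc i))"
    using assms(1) by (simp add: baecklund_sequence_def)
  ultimately show thesis
    using that g by simp
qed

context ecurve_loc
begin

lemma two_invariant_E2:
  "n_invariant E2 2 (\<lambda>k. ept (z k)) \<longleftrightarrow>
    (\<exists>\<epsilon> g h. \<epsilon> \<noteq> 0 \<and> eback \<eta> z g \<and> eback \<eta> g h \<and> (\<forall>k. \<epsilon> * cnj (h (k + 1) - h k) = u k * cnj \<epsilon>))"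
proof
  assume "n_invariant E2 2 (\<lambda>k. ept (z k))"
  then obtain fs E \<phi> where fs: "fs 0 = (\<lambda>k. ept (z k))" "baecklund_sequence E2 2 fs" "represents E2 (odd (2::nat)) E \<phi>"
      "\<forall>k. fs 2 k = \<phi> (ept (z k))"
    unfolding n_invariant_def by blast
  obtain g where g: "fs (Suc 0) = (\<lambda>k. ept (g k))" "eback \<eta> z g" "baecklund_sequence E2 (2 - 1) (\<lambda>i. fs (Suc i))"
    using baecklund_sequence_E2[OF fs(2,1) ecurve] by auto
  obtain h where h: "fs (Suc (Suc 0)) = (\<lambda>k. ept (h k))" "eback \<eta> g h"
    using baecklund_sequence_E2[OF g(3,1) eback_ecurve[OF g(2)]] by auto
  have "\<exists>\<phi>. represents E2 False E \<phi> \<and> (\<forall>k. ept (h k) = \<phi> (ept (z k)))"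
    using fs(3,4) unfolding numeral_2_eq_2 h by auto
  then show "\<exists>\<epsilon> g h. \<epsilon> \<noteq> 0 \<and> eback \<eta> z g \<and> eback \<eta> g h \<and> (\<forall>k. \<epsilon> * cnj (h (k + 1) - h k) = u k * cnj \<epsilon>)"
    unfolding represents_E2_two u_def using g(2) h(2) by blast
next
  assume "\<exists>\<epsilon> g h. \<epsilon> \<noteq> 0 \<and> eback \<eta> z g \<and> eback \<eta> g h \<and> (\<forall>k. \<epsilon> * cnj (h (k + 1) - h k) = u k * cnj \<epsilon>)"
  then obtain \<epsilon> g h where *: "\<epsilon> \<noteq> 0" "eback \<eta> z g" "eback \<eta> g h" "\<forall>k. \<epsilon> * cnj (h (k + 1) - h k) = (z (k + 1) - z k) * cnj \<epsilon>"
    unfolding u_def by blast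
  obtain \<phi> where \<phi>: "represents E2 False (ept \<epsilon>) \<phi>" "\<forall>k. ept (h k) = \<phi> (ept (z k))"
    using represents_E2_two[of "ept \<epsilon>" h z] *(1,4) by blast
  define fs where "fs i k = ept (if i = 0 then z k else if i = 1 then g k else h k)" for i :: nat and k
  have fs: "fs 0 = (\<lambda>k. ept (z k))" "fs (Suc 0) = (\<lambda>k. ept (g k))" "fs (Suc (Suc 0)) = (\<lambda>k. ept (h k))"
    by (auto simp: fs_def)
  have "baecklund_sequence E2 2 fs"
    unfolding baecklund_sequence_def less2 fs baecklund_E2 using * by blast
  moreover have "represents E2 (odd (2::nat)) (ept \<epsilon>) \<phi>" "\<forall>k. fs 2 k = \<phi> (ept (z k))"
    using \<phi> by (simp_all add: numeral_2_eq_2 fs)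
  ultimately show "n_invariant E2 2 (\<lambda>k. ept (z k))"
    unfolding n_invariant_def curves_E2 using ecurve fs(1) regular_E2_two[OF *(1)] by blast
qed

lemma three_invariant_E2:
  "n_invariant E2 3 (\<lambda>k. ept (z k)) \<longleftrightarrow>
    (\<exists>E g m h. E \<noteq> 0 \<and> eback \<eta> z g \<and> eback \<eta> g m \<and> eback \<eta> m h \<and> (\<forall>k. (h (k + 1) - h k) * E = u k * cnj E)
      \<and> (\<forall>k. Im E \<noteq> 0 \<or> E * (h k - z k) \<noteq> 0
        \<or> Im (- (E * ((m k - g k) * cnj (g k - z k) + (h k - m k) * cnj (m k - z k)))) \<noteq> 0
        \<or> - (E * (h k - m k) * cnj (m k - g k) * (g k - z k)) \<noteq> 0))" (is "_ \<longleftrightarrow> ?R")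
proof
  assume "n_invariant E2 3 (\<lambda>k. ept (z k))"
  then obtain fs E \<phi> where fs: "fs 0 = (\<lambda>k. ept (z k))" "baecklund_sequence E2 3 fs" "represents E2 (odd (3::nat)) E \<phi>"
      "\<forall>k. fs 3 k = \<phi> (ept (z k))" "regular E2 E 3 fs"
    unfolding n_invariant_def by blast
  obtain g where g: "fs (Suc 0) = (\<lambda>k. ept (g k))" "eback \<eta> z g" "baecklund_sequence E2 (3 - 1) (\<lambda>i. fs (Suc i))"
    using baecklund_sequence_E2[OF fs(2,1) ecurve] by auto
  obtain m where m: "fs (Suc (Suc 0)) = (\<lambda>k. ept (m k))" "eback \<eta> g m" "baecklund_sequence E2 (3 - 1 - 1) (\<lambda>i. fs (Suc (Suc i)))"
    using baecklund_sequence_E2[OF g(3,1) eback_ecurve[OF g(2)]] by auto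
  obtain h where h: "fs (Suc (Suc (Suc 0))) = (\<lambda>k. ept (h k))" "eback \<eta> m h"
    using baecklund_sequence_E2[OF m(3,1) eback_ecurve[OF m(2)]] by auto
  have "\<exists>\<phi>. represents E2 True E \<phi> \<and> (\<forall>k. ept (h k) = \<phi> (ept (z k)))"
    using fs(3,4) unfolding numeral_3_eq_3 h by auto
  then obtain c where c: "E = emb (ev c)" "c \<noteq> 0" "\<forall>k. (h (k + 1) - h k) * c = (z (k + 1) - z k) * cnj c"
    unfolding represents_E2_three by blast
  show ?R
    using c(2,3) g(2) m(2) h(2) fs(5) unfolding c(1) regular_E2_three[OF fs(1) g(1) m(1) h(1)] u_def by blast
next
  assume ?R
  then obtain c g m h where *: "c \<noteq> 0" "eback \<eta> z g" "eback \<eta> g m" "eback \<eta> m h"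
      "\<forall>k. (h (k + 1) - h k) * c = (z (k + 1) - z k) * cnj c"
    and r: "\<forall>k. Im c \<noteq> 0 \<or> c * (h k - z k) \<noteq> 0
        \<or> Im (- (c * ((m k - g k) * cnj (g k - z k) + (h k - m k) * cnj (m k - z k)))) \<noteq> 0
        \<or> - (c * (h k - m k) * cnj (m k - g k) * (g k - z k)) \<noteq> 0"
    unfolding u_def by blast
  obtain \<phi> where \<phi>: "represents E2 True (emb (ev c)) \<phi>" "\<forall>k. ept (h k) = \<phi> (ept (z k))"
    using represents_E2_three[of "emb (ev c)" h z] *(1,5) by blast
  define fs where "fs i k = ept (if i = 0 then z k else if i = 1 then g k else if i = 2 then m k else h k)" for i :: nat and k
  have fs: "fs 0 = (\<lambda>k. ept (z k))" "fs (Suc 0) = (\<lambda>k. ept (g k))" "fs (Suc (Suc 0)) = (\<lambda>k. ept (m k))"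
      "fs (Suc (Suc (Suc 0))) = (\<lambda>k. ept (h k))"
    by (auto simp: fs_def)
  have "baecklund_sequence E2 3 fs"
    unfolding baecklund_sequence_def less3 fs baecklund_E2 using * by blast
  moreover have "represents E2 (odd (3::nat)) (emb (ev c)) \<phi>" "\<forall>k. fs 3 k = \<phi> (ept (z k))"
    using \<phi> by (simp_all add: numeral_3_eq_3 fs)
  moreover have "regular E2 (emb (ev c)) 3 fs"
    unfolding regular_E2_three[OF fs] by (rule r)
  ultimately show "n_invariant E2 3 (\<lambda>k. ept (z k))"
    unfolding n_invariant_def curves_E2 using ecurve fs(1) by blast
qed

lemma eta_E2: "eta E2 (\<lambda>k. ept (z k)) = \<eta>"
proof -
  have "cmod (z 1 - z 0) = \<eta>"
    using u(1)[of 0] by (simp add: u_def)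
  then show ?thesis
    using eta by (simp add: eta_def ept_simps rdot_ept_self del: rdot_ept)
qed

text \<open>The matrix \<open>qk\<close> multiplies a point by \<open>- \<i>\<close>, so the edge
  normals point to the right of the curve and the sign is reversed.\<close>

lemma geodesic_curvature_E2: "geodesic_curvature E2 (\<lambda>k. ept (z k)) k = - 2 * sg k / \<eta>"
proof -
  have k: "qk ** ept x = ept (- (\<i> * x))" for x
  proof -
    have "qk ** ept x = emb (ev (- \<i>) * od x)"
      by (simp add: cmat_basis(1)[where 's = plus] ept_def emb_simps(7) ev_def)
    then show ?thesis
      by (simp add: od_ev_simps ept_def)
  qed
  have "edge_normal E2 (\<lambda>k. ept (z k)) (k - 1) = ept (of_real (1 / \<eta>) * - (\<i> * u (k - 1)))"
    by (simp add: edge_normal_def eta_E2 Let_def ept_simps k u_def)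
  then have "rdot (edge_normal E2 (\<lambda>k. ept (z k)) (k - 1)) (ept (z (k + 1)) - ept (z k))
      = Re (of_real (1 / \<eta>) * - (\<i> * u (k - 1)) * cnj (u k))"
    unfolding ept_simps u_def[of k, symmetric] by (simp only: rdot_ept)
  also have "of_real (1 / \<eta>) * - (\<i> * u (k - 1)) * cnj (u k) = of_real (1 / \<eta>) * - (\<i> * cnj (u k * cnj (u (k - 1))))"
    by (simp add: mult_ac)
  also have "Re \<dots> = - Im (u k * cnj (u (k - 1))) / \<eta>"
    by (simp only: Re_Im_mult uminus_complex.sel cnj.sel) simp
  finally have 1: "rdot (edge_normal E2 (\<lambda>k. ept (z k)) (k - 1)) (ept (z (k + 1)) - ept (z k)) = - Im (u k * cnj (u (k - 1))) / \<eta>" .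
  have "z (k + 1) - z (k - 1) = tau k"
    by (simp add: tau_def u_def)
  then have 2: "rdot (ept (z (k + 1)) - ept (z (k - 1))) (ept (z (k + 1)) - ept (z (k - 1))) = (cmod (tau k))\<^sup>2"
    unfolding ept_simps rdot_ept_self by simp
  show ?thesis
    unfolding geodesic_curvature_def 1 2 sg_def by simp
qed

lemma elastic_equation_E2:
  "elastic_equation E2 (\<lambda>k. ept (z k)) \<xi> \<delta> \<longleftrightarrow>
    (\<forall>k. (1 + (sg k)\<^sup>2) * (sg (k + 1) + sg (k - 1)) = \<xi> * sg k + - \<delta> * \<eta> / 2)"
proof -
  have z: "zeta E2 (\<lambda>k. ept (z k)) = \<eta>"
    by (simp add: zeta_def eta_E2)
  have "- 2 * sg (k - 1) / \<eta> + - 2 * sg (k + 1) / \<eta> = (\<xi> * (- 2 * sg k / \<eta>) + \<delta>) / (1 + \<eta>\<^sup>2 / 4 * (- 2 * sg k / \<eta>)\<^sup>2)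
    \<longleftrightarrow> (1 + (sg k)\<^sup>2) * (sg (k + 1) + sg (k - 1)) = \<xi> * sg k + - \<delta> * \<eta> / 2" for k
  proof -
    have n: "1 + (sg k)\<^sup>2 \<noteq> 0"
      by (smt (verit) zero_le_power2)
    have "\<eta>\<^sup>2 / 4 * (- 2 * sg k / \<eta>)\<^sup>2 = (sg k)\<^sup>2"
      using eta by (simp add: power_divide power_mult_distrib)
    moreover have "- 2 * sg (k - 1) / \<eta> + - 2 * sg (k + 1) / \<eta> = - 2 / \<eta> * (sg (k + 1) + sg (k - 1))"
      "\<xi> * (- 2 * sg k / \<eta>) + \<delta> = - 2 / \<eta> * (\<xi> * sg k + - \<delta> * \<eta> / 2)"
      using eta by (simp_all add: field_simps)
    ultimately have "- 2 * sg (k - 1) / \<eta> + - 2 * sg (k + 1) / \<eta> = (\<xi> * (- 2 * sg k / \<eta>) + \<delta>) / (1 + \<eta>\<^sup>2 / 4 * (- 2 * sg k / \<eta>)\<^sup>2)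
      \<longleftrightarrow> - 2 / \<eta> * (sg (k + 1) + sg (k - 1)) * (1 + (sg k)\<^sup>2) = - 2 / \<eta> * (\<xi> * sg k + - \<delta> * \<eta> / 2)"
      by (simp only: nonzero_eq_divide_eq[OF n])
    also have "\<dots> \<longleftrightarrow> - 2 / \<eta> * ((1 + (sg k)\<^sup>2) * (sg (k + 1) + sg (k - 1))) = - 2 / \<eta> * (\<xi> * sg k + - \<delta> * \<eta> / 2)"
      by (simp only: mult_ac)
    also have "\<dots> \<longleftrightarrow> (1 + (sg k)\<^sup>2) * (sg (k + 1) + sg (k - 1)) = \<xi> * sg k + - \<delta> * \<eta> / 2"
      using eta by (subst mult_cancel_left) simp
    finally show ?thesis .
  qed
  then show ?thesis
    unfolding elastic_equation_def geodesic_curvature_E2 z by simp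
qed

lemma discrete_circle_E2: "discrete_circle E2 (\<lambda>k. ept (z k)) \<longleftrightarrow> (\<exists>s. s \<noteq> 0 \<and> (\<forall>k. sg k = s))"
proof -
  have "(\<exists>c. c \<noteq> 0 \<and> (\<forall>k. - 2 * sg k / \<eta> = c)) \<longleftrightarrow> (\<exists>s. s \<noteq> 0 \<and> (\<forall>k. sg k = s))"
  proof
    assume "\<exists>c. c \<noteq> 0 \<and> (\<forall>k. - 2 * sg k / \<eta> = c)"
    then obtain c where "c \<noteq> 0" "\<And>k. - 2 * sg k / \<eta> = c"
      by blast
    then have "- 2 * sg k = c * \<eta>" for k
      using eta by (simp add: field_simps)
    then have "sg k = - c * \<eta> / 2" for k
      by (simp add: field_simps) (metis minus_minus)
    then have "- c * \<eta> / 2 \<noteq> 0 \<and> (\<forall>k. sg k = - c * \<eta> / 2)"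
      using eta \<open>c \<noteq> 0\<close> by simp
    then show "\<exists>s. s \<noteq> 0 \<and> (\<forall>k. sg k = s)" ..
  qed (use eta in auto)
  then show ?thesis
    unfolding discrete_circle_def geodesic_curvature_E2 curves_E2 using ecurve by blast
qed

lemma euclidean_iff:
  "(n_invariant E2 2 (\<lambda>k. ept (z k)) \<longleftrightarrow> elastic E2 (\<lambda>k. ept (z k)))
    \<and> (n_invariant E2 3 (\<lambda>k. ept (z k)) \<longleftrightarrow> constrained_elastic E2 (\<lambda>k. ept (z k)))"
proof -
  have c: "(\<lambda>k. ept (z k)) \<in> curves E2"
    using ecurve curves_E2 by blast
  have "(\<exists>\<xi> \<delta>. elastic_equation E2 (\<lambda>k. ept (z k)) \<xi> \<delta>)
      \<longleftrightarrow> (\<exists>\<xi> \<delta>. \<forall>k. (1 + (sg k)\<^sup>2) * (sg (k + 1) + sg (k - 1)) = \<xi> * sg k + \<delta>)"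
  proof
    assume "\<exists>\<xi> \<delta>. \<forall>k. (1 + (sg k)\<^sup>2) * (sg (k + 1) + sg (k - 1)) = \<xi> * sg k + \<delta>"
    then obtain \<xi> \<delta> where e: "\<And>k. (1 + (sg k)\<^sup>2) * (sg (k + 1) + sg (k - 1)) = \<xi> * sg k + \<delta>"
      by blast
    have "elastic_equation E2 (\<lambda>k. ept (z k)) \<xi> (- 2 * \<delta> / \<eta>)"
      unfolding elastic_equation_E2 e using eta by simp
    then show "\<exists>\<xi> \<delta>. elastic_equation E2 (\<lambda>k. ept (z k)) \<xi> \<delta>"
      by blast
  qed (unfold elastic_equation_E2, blast)
  then have "n_invariant E2 3 (\<lambda>k. ept (z k)) \<longleftrightarrow> constrained_elastic E2 (\<lambda>k. ept (z k))"
    unfolding three_invariant_E2 three_iff constrained_elastic_def using c by simp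
  moreover have "n_invariant E2 2 (\<lambda>k. ept (z k)) \<longleftrightarrow> elastic E2 (\<lambda>k. ept (z k))"
    unfolding two_invariant_E2 two_iff elastic_def discrete_circle_E2 elastic_equation_E2 using c by simp
  ultimately show ?thesis
    by blast
qed

end

lemma euclidean:
  assumes "f \<in> curves E2"
  shows "(n_invariant E2 2 f \<longleftrightarrow> elastic E2 f) \<and> (n_invariant E2 3 f \<longleftrightarrow> constrained_elastic E2 f)"
  using curves_E2D[OF assms] ecurve_loc.euclidean_iff[OF ecurve_loc.intro] by blast

theorem theorem30:
  fixes Q :: model and f :: "int \<Rightarrow> cmat"
  assumes "f \<in> curves Q"
  shows "(n_invariant Q 2 f \<longleftrightarrow> elastic Q f) \<and>
         (n_invariant Q 3 f \<longleftrightarrow> constrained_elastic Q f)"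
proof (cases Q)
  case E2
  then show ?thesis
    using euclidean assms by simp
next
  case S2
  interpret noneuclid Q "TYPE(plus)"
    by unfold_locales (simp add: S2)
  show ?thesis
    by (rule noneuclidean[OF assms])
next
  case H2
  interpret noneuclid Q "TYPE(minus)"
    by unfold_locales (simp add: H2 eps_minus_def)
  show ?thesis
    by (rule noneuclidean[OF assms])
qed

end
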